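(* There is a one-to-one correspondence between: (1) semigroups $\{\mathcal P_t\}_{t\ge0}$ of quantum operations on $\mathscr G_{\mathcal H_1}$ such that for each $t\ge0$, $\mathcal P_t$ maps $\mathfrak S_{GIG}$ into itself; and (2) pairs $(G,A)$ consisting of a contraction semigroup generator $G$ on $\mathcal H_1$ together with an operator $A$ on $\mathcal H_1$ satisfying $0\le A\le -G-G^*$. More specifically: let $\{\mathcal P_t\}_{t\ge0}$ be as in (1). Then there is a pair $(G,A)$ as in (2) such that with $R_t=\int_0^te^{sG}Ae^{sG^*}\,ds$, $$\mathcal P_t=\Phi_{e^{tG},R_t}\big|_{\mathscr G_{\mathcal H_1}}\qquad( * )$$ for all $t\ge0$, where $\Phi_{S,R}$ is the GIG quantum operation produced by the Evans-Hugenholtz-Kadison construction. Conversely, let $(G,A)$ be as in (2) and define $R_t=\int_0^te^{sG}Ae^{sG^*}\,ds$. Then for each $t$, $(e^{tG},R_t)$ is a compatible pair, so that the Evans-Hugenholtz-Kadison construction yields a GIG quantum operation $\Phi_{e^{tG},R_t}$ on $\mathscr A_{\mathcal H_1}$, and with $\mathcal P_t$ defined by $( * )$, $\{\mathcal P_t\}_{t\ge0}$ is a semigroup of quantum operations on $\mathscr G_{\mathcal H_1}$ such that each $\mathcal P_t$ maps $\mathfrak S_{GIG}$ into itself.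
   Context: Let $\mathcal H_1$ be a complex Hilbert space of finite dimension $N$ (inner product conjugate linear in the first variable). A CAR field over $\mathcal H_1$ is a conjugate linear map $\psi\mapsto Z(\psi)$ into bounded operators on a Hilbert space $\mathscr K$ with, writing $Z^*(\psi)=Z(\psi)^*$, $Z(\psi)Z^*(\phi)+Z^*(\phi)Z(\psi)=\langle\psi,\phi\rangle1$ and $Z(\psi)Z(\phi)+Z(\phi)Z(\psi)=0$. Fix one acting irreducibly; then $\dim\mathscr K=2^N$ and the generated $*$-algebra is $\mathscr A_{\mathcal H_1}=\mathcal B(\mathscr K)$. Let $\tau=2^{-N}\mathrm{Tr}$; density matrices are operators $\rho\ge0$ with $\tau(\rho)=1$. The number operator is $\mathcal N=\sum_jZ^*(\psi_j)Z(\psi_j)$ (any orthonormal basis), and $\mathscr G_{\mathcal H_1}$ is the commutant of $\mathcal N$ in $\mathscr A_{\mathcal H_1}$. $\mathscr Q=\{Q\in\mathcal B(\mathcal H_1):0\le Q\le1\}$; for $Q=\sum_j\mu_j|\psi_j\rangle\langle\psi_j|\in\mathscr Q$ (spectral decomposition) $\rho_Q=\prod_{j=1}^N\big((1-\mu_j)2Z(\psi_j)Z^*(\psi_j)+\mu_j2Z^*(\psi_j)Z(\psi_j)\big)$ is the density matrix of the gauge invariant Gaussian (GIG) state with symbol $Q$. $\mathfrak S_{GIG}=\{\rho_Q:Q\in\mathscr Q\}\subset\mathscr G_{\mathcal H_1}$. A quantum operation is a completely positive trace preserving linear map. A GIG quantum operation on $\mathscr A_{\mathcal H_1}$ is a quantum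 operation that maps $\mathfrak S_{GIG}$ into itself and is gauge covariant, i.e. $\Phi(e^{-it\mathcal N}Xe^{it\mathcal N})=e^{-it\mathcal N}\Phi(X)e^{it\mathcal N}$ for all $t\in\mathbb R$. A semigroup of quantum operations means a continuous one: $\mathcal P_0=1$, $\mathcal P_s\mathcal P_t=\mathcal P_{s+t}$, $t\mapsto\mathcal P_t$ continuous on $[0,\infty)$. $G$ is a contraction semigroup generator iff $\|e^{tG}\|\le1$ for all $t\ge0$, equivalently $G+G^*\le0$. Evans-Hugenholtz-Kadison (EHK) construction. A pair $(S,R)$ of operators on $\mathcal H_1$ is compatible if $S$ is a contraction and $0\le R\le1-SS^*$. For such a pair there is a unique $T\in\mathscr Q$ with $\ker(1-SS^* )\subseteq\ker T$ and $R=(1-SS^* )^{1/2}T(1-SS^* )^{1/2}$. On $\mathscr K\otimes\mathscr K$ consider the CAR field over $\mathcal H_1\oplus\mathcal H_1$, $Z(\psi\oplus\eta)=Z(\psi)\otimes W+1\otimes Z(\eta)$ with $W=e^{i\pi\mathcal N}$; let $\mathscr A$, $\mathscr B$ be the $*$-algebras generated by $\{Z(\psi\oplus0)\}$, $\{Z(0\oplus\psi)\}$, each identified with $\mathscr A_{\mathcal H_1}$ via $Z(\psi\oplus0)\leftrightarrow Z(\psi)$, $Z(0\oplus\psi)\leftrightarrow Z(\psi)$. Let $U_S=\begin{pmatrix}-(1-SS^* )^{1/2}&S\\S^*&(1-S^*S)^{1/2}\end{pmatrix}$, a self-adjoint unitary on $\mathcal H_1\oplus\mathcal H_1$, and $\alpha_{U_S}$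 the (involutive) $*$-automorphism with $\alpha_{U_S}(Z(\xi))=Z(U_S\xi)$ for $\xi\in\mathcal H_1\oplus\mathcal H_1$. Let $\rho_T\in\mathscr A$ be the GIG density matrix with symbol $T$, and $\mathbb E_{\mathscr A}$ the orthogonal projection of $\mathscr A_{\mathcal H_1\oplus\mathcal H_1}$ onto $\mathscr A$ for the inner product given by the normalized trace. Then $\Phi_{S,R}(\rho)=\mathbb E_{\mathscr A}(\alpha_{U_S}(\rho_T\rho))$ for $\rho\in\mathscr B\cong\mathscr A_{\mathcal H_1}$, extended linearly, regarded as a map on $\mathscr A_{\mathcal H_1}$.
   Formalization: The correspondence given by ( * ) is not one-to-one, since (G+iθ1, A) with θ real yields the same semigroup as (G, A); it is proved that ( * ) is onto and that two pairs give the same semigroup exactly when A=A' and G'-G=iθ1, together with the existence of some bijection between (1) and (2). *)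

theory Defs
  imports "HOL-Analysis.Analysis"
begin

section \<open>Operators on finite-dimensional Hilbert spaces\<close>

text \<open>
  The Hilbert space is \<open>complex ^ 'n\<close>, operators are square matrices. The library norm on
  \<open>complex ^ 'n\<close> is the Euclidean one, but its inner product is real-valued (the real part of
  the Hermitian one) and its multiplication \<open>*\<close> on \<open>complex ^ 'n ^ 'n\<close> is componentwise, so the
  Hermitian inner product and the operator exponential are introduced here.
\<close>

type_synonym 'n cop = "complex ^ 'n ^ 'n"

definition cinner :: "complex ^ 'n \<Rightarrow> complex ^ 'n \<Rightarrow> complex" where
  "cinner x y = (\<Sum>i\<in>UNIV. cnj (x $ i) * y $ i)"

definition orthonormal_basis :: "('n \<Rightarrow> complex ^ 'n) \<Rightarrow> bool" where
  "orthonormal_basis \<psi> \<longleftrightarrow> (\<forall>i j. cinner (\<psi> i) (\<psi> j) = (if i = j then 1 else 0))"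

definition ketbra :: "complex ^ 'n \<Rightarrow> complex ^ 'n \<Rightarrow> 'n cop" where
  "ketbra x y = (\<chi> i j. x $ i * cnj (y $ j))"

definition cscale :: "complex \<Rightarrow> 'n::finite cop \<Rightarrow> 'n cop" (infixr \<open>*\<^sub>M\<close> 75) where
  "c *\<^sub>M A = (\<chi> i j. c * A $ i $ j)"

definition dagger :: "'n::finite cop \<Rightarrow> 'n cop" where
  "dagger A = (\<chi> i j. cnj (A $ j $ i))"

definition psd :: "'n::finite cop \<Rightarrow> bool" where
  "psd A \<longleftrightarrow> (\<forall>v. cinner v (A *v v) \<in> \<real>\<^sub>\<ge>\<^sub>0)"

definition op_le :: "'n::finite cop \<Rightarrow> 'n cop \<Rightarrow> bool" where
  "op_le A B \<longleftrightarrow> psd (B - A)"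

definition contraction :: "'n::finite cop \<Rightarrow> bool" where
  "contraction S \<longleftrightarrow> onorm ((*v) S) \<le> 1"

definition op_sqrt :: "'n::finite cop \<Rightarrow> 'n cop" where
  "op_sqrt A = (THE B. psd B \<and> B ** B = A)"

definition op_power :: "'n::finite cop \<Rightarrow> nat \<Rightarrow> 'n cop" where
  "op_power A k = (((**) A) ^^ k) (mat 1)"

definition op_exp :: "'n::finite cop \<Rightarrow> 'n cop" where
  "op_exp A = (\<Sum>k. op_power A k /\<^sub>R fact k)"

definition normalized_trace :: "'n::finite cop \<Rightarrow> complex" where
  "normalized_trace A = trace A / of_nat CARD('n)"

definition kron :: "'k::finite cop \<Rightarrow> 'l::finite cop \<Rightarrow> ('k \<times> 'l) cop" where
  "kron A B = (\<chi> p q. A $ fst p $ fst q * B $ snd p $ snd q)"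

definition direct_sum :: "complex ^ 'n \<Rightarrow> complex ^ 'm \<Rightarrow> complex ^ ('n + 'm)" where
  "direct_sum \<psi> \<eta> = (\<chi> s. case s of Inl i \<Rightarrow> \<psi> $ i | Inr j \<Rightarrow> \<eta> $ j)"

definition block_op :: "'n::finite cop \<Rightarrow> 'n cop \<Rightarrow> 'n cop \<Rightarrow> 'n cop \<Rightarrow> ('n + 'n) cop" where
  "block_op A B C D = (\<chi> r c. case (r, c) of
      (Inl i, Inl j) \<Rightarrow> A $ i $ j
    | (Inl i, Inr j) \<Rightarrow> B $ i $ j
    | (Inr i, Inl j) \<Rightarrow> C $ i $ j
    | (Inr i, Inr j) \<Rightarrow> D $ i $ j)"

definition star_subalgebra :: "'n::finite cop set \<Rightarrow> bool" where
  "star_subalgebra \<A> \<longleftrightarrow> 0 \<in> \<A> \<and>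
     (\<forall>X\<in>\<A>. \<forall>Y\<in>\<A>. X + Y \<in> \<A> \<and> X ** Y \<in> \<A>) \<and>
     (\<forall>c. \<forall>X\<in>\<A>. c *\<^sub>M X \<in> \<A>) \<and> (\<forall>X\<in>\<A>. dagger X \<in> \<A>)"

definition star_hom :: "('k::finite cop \<Rightarrow> 'l::finite cop) \<Rightarrow> bool" where
  "star_hom f \<longleftrightarrow> (\<forall>X Y. f (X + Y) = f X + f Y) \<and> (\<forall>c X. f (c *\<^sub>M X) = c *\<^sub>M f X) \<and>
     (\<forall>X Y. f (X ** Y) = f X ** f Y) \<and> (\<forall>X. f (dagger X) = dagger (f X)) \<and> f (mat 1) = mat 1"

text \<open>Orthogonal projection onto \<open>\<A>\<close> for the inner product \<open>\<tau> (V\<^sup>* X)\<close>.\<close>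

definition trace_proj :: "'n::finite cop set \<Rightarrow> 'n cop \<Rightarrow> 'n cop" where
  "trace_proj \<A> X = (THE Y. Y \<in> \<A> \<and> (\<forall>V\<in>\<A>. normalized_trace (dagger V ** (X - Y)) = 0))"


section \<open>Quantum operations\<close>

text \<open>Positivity of the operator on the \<open>m\<close>-fold direct sum with the blocks \<open>X i j\<close>, \<open>i, j < m\<close>.\<close>

definition block_psd :: "nat \<Rightarrow> (nat \<Rightarrow> nat \<Rightarrow> 'k::finite cop) \<Rightarrow> bool" where
  "block_psd m X \<longleftrightarrow> (\<forall>v. (\<Sum>i<m. \<Sum>j<m. cinner (v i) (X i j *v v j)) \<in> \<real>\<^sub>\<ge>\<^sub>0)"

definition completely_positive_on :: "'k::finite cop set \<Rightarrow> ('k cop \<Rightarrow> 'k cop) \<Rightarrow> bool" where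
  "completely_positive_on \<A> \<Phi> \<longleftrightarrow> (\<forall>m X. (\<forall>i<m. \<forall>j<m. X i j \<in> \<A>) \<longrightarrow>
     block_psd m X \<longrightarrow> block_psd m (\<lambda>i j. \<Phi> (X i j)))"

text \<open>
  Here \<open>\<A>\<close> is meant to be a unital *-subalgebra; only the values of \<open>\<Phi>\<close> on \<open>\<A>\<close> matter.
\<close>

definition quantum_operation_on :: "'k::finite cop set \<Rightarrow> ('k cop \<Rightarrow> 'k cop) \<Rightarrow> bool" where
  "quantum_operation_on \<A> \<Phi> \<longleftrightarrow> \<Phi> \<in> \<A> \<rightarrow> \<A> \<and>
     (\<forall>X\<in>\<A>. \<forall>Y\<in>\<A>. \<Phi> (X + Y) = \<Phi> X + \<Phi> Y) \<and>
     (\<forall>c. \<forall>X\<in>\<A>. \<Phi> (c *\<^sub>M X) = c *\<^sub>M \<Phi> X) \<and>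
     completely_positive_on \<A> \<Phi> \<and>
     (\<forall>X\<in>\<A>. normalized_trace (\<Phi> X) = normalized_trace X)"


section \<open>CAR fields and Gaussian states\<close>

definition CAR_field :: "(complex ^ 'n \<Rightarrow> 'k::finite cop) \<Rightarrow> bool" where
  "CAR_field Z \<longleftrightarrow>
     (\<forall>\<psi> \<phi>. Z (\<psi> + \<phi>) = Z \<psi> + Z \<phi>) \<and> (\<forall>c \<psi>. Z (c *s \<psi>) = cnj c *\<^sub>M Z \<psi>) \<and>
     (\<forall>\<psi> \<phi>. Z \<psi> ** dagger (Z \<phi>) + dagger (Z \<phi>) ** Z \<psi> = cinner \<psi> \<phi> *\<^sub>M mat 1) \<and>
     (\<forall>\<psi> \<phi>. Z \<psi> ** Z \<phi> + Z \<phi> ** Z \<psi> = 0)"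

definition acts_irreducibly :: "(complex ^ 'n \<Rightarrow> 'k::finite cop) \<Rightarrow> bool" where
  "acts_irreducibly Z \<longleftrightarrow> (\<forall>V. vec.subspace V \<longrightarrow>
     (\<forall>\<psi>. \<forall>v\<in>V. Z \<psi> *v v \<in> V \<and> dagger (Z \<psi>) *v v \<in> V) \<longrightarrow> V = {0} \<or> V = UNIV)"

text \<open>
  For an irreducible field the generated *-algebra consists of all operators on
  \<open>complex ^ 'k\<close>. So the algebra of the CAR field is taken to be \<open>UNIV\<close>.
\<close>

definition number_op :: "(complex ^ 'n::finite \<Rightarrow> 'k::finite cop) \<Rightarrow> 'k cop" where
  "number_op Z = (\<Sum>j\<in>UNIV. dagger (Z (axis j 1)) ** Z (axis j 1))"

definition gauge_alg :: "(complex ^ 'n::finite \<Rightarrow> 'k::finite cop) \<Rightarrow> 'k cop set" where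
  "gauge_alg Z = {X. number_op Z ** X = X ** number_op Z}"

definition symbols :: "'n::finite cop set" where
  "symbols = {Q. op_le 0 Q \<and> op_le Q (mat 1)}"

definition gaussian_factor ::
    "(complex ^ 'n \<Rightarrow> 'k::finite cop) \<Rightarrow> complex ^ 'n \<Rightarrow> real \<Rightarrow> 'k cop" where
  "gaussian_factor Z \<psi> \<mu> = (2 * (1 - \<mu>)) *\<^sub>R (Z \<psi> ** dagger (Z \<psi>)) +
                           (2 * \<mu>) *\<^sub>R (dagger (Z \<psi>) ** Z \<psi>)"

text \<open>
  The factors belonging to an orthonormal basis commute, so that \<open>Finite_Set.fold\<close> is their
  unordered product. The product does not depend on the choice of the spectral decomposition.
\<close>

definition gig_density :: "(complex ^ 'n::finite \<Rightarrow> 'k::finite cop) \<Rightarrow> 'n cop \<Rightarrow> 'k cop" where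
  "gig_density Z Q = (THE \<rho>. \<exists>\<psi> \<mu>. orthonormal_basis \<psi> \<and>
     Q = (\<Sum>j\<in>UNIV. \<mu> j *\<^sub>R ketbra (\<psi> j) (\<psi> j)) \<and>
     \<rho> = Finite_Set.fold (\<lambda>j M. gaussian_factor Z (\<psi> j) (\<mu> j) ** M) (mat 1) UNIV)"

definition gig_densities :: "(complex ^ 'n::finite \<Rightarrow> 'k::finite cop) \<Rightarrow> 'k cop set" where
  "gig_densities Z = gig_density Z ` symbols"

definition gauge_covariant ::
    "(complex ^ 'n::finite \<Rightarrow> 'k::finite cop) \<Rightarrow> ('k cop \<Rightarrow> 'k cop) \<Rightarrow> bool" where
  "gauge_covariant Z \<Phi> \<longleftrightarrow> (\<forall>t::real. \<forall>X.
     (let N = number_op Z; U = op_exp ((- \<i> * t) *\<^sub>M N); V = op_exp ((\<i> * t) *\<^sub>M N)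
      in \<Phi> (U ** X ** V) = U ** \<Phi> X ** V))"

definition gig_quantum_operation ::
    "(complex ^ 'n::finite \<Rightarrow> 'k::finite cop) \<Rightarrow> ('k cop \<Rightarrow> 'k cop) \<Rightarrow> bool" where
  "gig_quantum_operation Z \<Phi> \<longleftrightarrow> quantum_operation_on UNIV \<Phi> \<and>
     \<Phi> ` gig_densities Z \<subseteq> gig_densities Z \<and> gauge_covariant Z \<Phi>"

text \<open>
  Families are normalized to be \<open>undefined\<close> at negative times and outside the gauge invariant
  algebra, so that two semigroups are equal as functions iff they agree where they are meant to
  be defined. As everything is finite-dimensional, continuity of \<open>t \<mapsto> \<P>\<^sub>t\<close> is the
  continuity of all its orbits.
\<close>

definition gig_semigroups ::
    "(complex ^ 'n::finite \<Rightarrow> 'k::finite cop) \<Rightarrow> (real \<Rightarrow> 'k cop \<Rightarrow> 'k cop) set" where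
  "gig_semigroups Z = {P.
     P \<in> extensional {0..} \<and> (\<forall>t\<ge>0. P t \<in> extensional (gauge_alg Z)) \<and>
     (\<forall>t\<ge>0. quantum_operation_on (gauge_alg Z) (P t)) \<and>
     (\<forall>X\<in>gauge_alg Z. P 0 X = X) \<and>
     (\<forall>s\<ge>0. \<forall>t\<ge>0. \<forall>X\<in>gauge_alg Z. P s (P t X) = P (s + t) X) \<and>
     (\<forall>X\<in>gauge_alg Z. continuous_on {0..} (\<lambda>t. P t X)) \<and>
     (\<forall>t\<ge>0. P t ` gig_densities Z \<subseteq> gig_densities Z)}"


section \<open>The Evans--Hugenholtz--Kadison construction\<close>

definition compatible :: "'n::finite cop \<Rightarrow> 'n cop \<Rightarrow> bool" where
  "compatible S R \<longleftrightarrow> contraction S \<and> op_le 0 R \<and> op_le R (mat 1 - S ** dagger S)"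

definition ehk_T :: "'n::finite cop \<Rightarrow> 'n cop \<Rightarrow> 'n cop" where
  "ehk_T S R = (let D = mat 1 - S ** dagger S in
     THE T. T \<in> symbols \<and> (\<forall>v. D *v v = 0 \<longrightarrow> T *v v = 0) \<and> R = op_sqrt D ** T ** op_sqrt D)"

definition ehk_U :: "'n::finite cop \<Rightarrow> ('n + 'n) cop" where
  "ehk_U S = block_op (- op_sqrt (mat 1 - S ** dagger S)) S
                      (dagger S) (op_sqrt (mat 1 - dagger S ** S))"

definition double_field ::
    "(complex ^ 'n::finite \<Rightarrow> 'k::finite cop) \<Rightarrow> complex ^ ('n + 'n) \<Rightarrow> ('k \<times> 'k) cop" where
  "double_field Z \<xi> = kron (Z (\<chi> i. \<xi> $ Inl i)) (op_exp ((\<i> * pi) *\<^sub>M number_op Z))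
                      + kron (mat 1) (Z (\<chi> i. \<xi> $ Inr i))"

definition alg_A :: "(complex ^ 'n::finite \<Rightarrow> 'k::finite cop) \<Rightarrow> ('k \<times> 'k) cop set" where
  "alg_A Z = star_subalgebra hull (range (\<lambda>\<psi>. double_field Z (direct_sum \<psi> 0)))"

text \<open>
  The identifications of the algebra of \<open>Z\<close> with \<open>\<A>\<close> and \<open>\<B>\<close>. They are determined by
  their values on the field because \<open>Z\<close> acts irreducibly. Note that \<open>emb_A Z\<close> is not
  \<open>X \<mapsto> kron X (mat 1)\<close>.
\<close>

definition emb_A :: "(complex ^ 'n::finite \<Rightarrow> 'k::finite cop) \<Rightarrow> 'k cop \<Rightarrow> ('k \<times> 'k) cop" where
  "emb_A Z = (THE f. star_hom f \<and> (\<forall>\<psi>. f (Z \<psi>) = double_field Z (direct_sum \<psi> 0)))"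

definition emb_B :: "(complex ^ 'n::finite \<Rightarrow> 'k::finite cop) \<Rightarrow> 'k cop \<Rightarrow> ('k \<times> 'k) cop" where
  "emb_B Z = (THE f. star_hom f \<and> (\<forall>\<psi>. f (Z \<psi>) = double_field Z (direct_sum 0 \<psi>)))"

definition bogoliubov ::
    "(complex ^ 'n::finite \<Rightarrow> 'k::finite cop) \<Rightarrow> ('n + 'n) cop \<Rightarrow> ('k \<times> 'k) cop \<Rightarrow> ('k \<times> 'k) cop" where
  "bogoliubov Z U = (THE \<alpha>. star_hom \<alpha> \<and> bij \<alpha> \<and>
     (\<forall>\<xi>. \<alpha> (double_field Z \<xi>) = double_field Z (U *v \<xi>)))"

definition ehk_map ::
    "(complex ^ 'n::finite \<Rightarrow> 'k::finite cop) \<Rightarrow> 'n cop \<Rightarrow> 'n cop \<Rightarrow> 'k cop \<Rightarrow> 'k cop" where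
  "ehk_map Z S R X = the_inv (emb_A Z) (trace_proj (alg_A Z)
     (bogoliubov Z (ehk_U S) (emb_A Z (gig_density Z (ehk_T S R)) ** emb_B Z X)))"


section \<open>Generating pairs\<close>

definition contraction_semigroup_generator :: "'n::finite cop \<Rightarrow> bool" where
  "contraction_semigroup_generator G \<longleftrightarrow> (\<forall>t\<ge>0. contraction (op_exp (t *\<^sub>R G)))"

definition generating_pairs :: "('n::finite cop \<times> 'n cop) set" where
  "generating_pairs = {(G, A). contraction_semigroup_generator G \<and>
     op_le 0 A \<and> op_le A (- G - dagger G)}"

definition covariance_integral :: "'n::finite cop \<Rightarrow> 'n cop \<Rightarrow> real \<Rightarrow> 'n cop" where
  "covariance_integral G A t =
     integral {0..t} (\<lambda>s. op_exp (s *\<^sub>R G) ** A ** op_exp (s *\<^sub>R dagger G))"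

end

theory Submission
  imports Defs
begin

text \<open>
  A gauge invariant Gaussian density is characterized by linear relations between \<open>Z(\<psi>)\<rho>\<close> and
  \<open>\<rho>Z(\<psi>)\<close> in which the symbol enters linearly. The reflection \<open>U\<^sub>S\<close> is implemented by a unitary, so these
  relations pass through the construction and \<open>\<Phi>\<^sub>S\<^sub>,\<^sub>R\<close> acts on symbols as \<open>Q \<mapsto> S Q S\<^sup>* + R\<close>. As the
  densities span the gauge invariant algebra, the semigroup law for \<open>(e\<^sup>t\<^sup>G, R\<^sub>t)\<close> and the uniqueness of
  \<open>A\<close> and of \<open>G\<close> up to a phase can be read off from this affine action.

  Conversely, a semigroup preserving the Gaussian densities induces a drift on symbols. Along one
  eigenvalue of the symbol the density is affine, and its four point function is a two by two minor
  of the symbol; linearity of the semigroup therefore forces symbol increments to have rank at most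
  one. Differentiated at time zero this makes the drift affine in the symbol, with linear part tangent
  to the rank one projections. Such a drift has the form \<open>Q \<mapsto> G Q + Q G\<^sup>* + A\<close>, and the paths starting
  at \<open>0\<close> and \<open>1\<close> stay between \<open>0\<close> and \<open>1\<close>, which yields \<open>0 \<le> A \<le> - G - G\<^sup>*\<close>.
\<close>

section \<open>Matrices as operators\<close>

text \<open>The obstacle in the converse direction is that the densities do not form a convex set:
  the symbol is a linear function of the density, but the correlations of the density are minors of
  the symbol. So linearity of \<open>P t\<close> says nothing directly about the motion of symbols;
  the segments of densities that are exploited vary one eigenvalue in a fixed eigenbasis. Two
  partial linearities are then glued: in one fixed basis the drift is additive over the eigenvalues,
  and the density of a rank one projection is sesquilinear in its unit vector. Neither alone gives
  an affine drift, since the first does not compare different bases and the second sees one particle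
  states only. The parity condition in \<open>is_gaussian\<close> is the price for working with
  relations instead of products: it disposes of odd monomials, on which the cancellation argument
  does not work, and lets densities pass through \<open>W\<close>. Generators that differ by an
  imaginary scalar give the same semigroup, which is why uniqueness and bijection are separate
  claims.\<close>

lemma cinner_add_left: "cinner (x + y) z = cinner x z + cinner y z"
  by (simp add: cinner_def distrib_right sum.distrib)

lemma cinner_add_right: "cinner z (x + y) = cinner z x + cinner z y"
  by (simp add: cinner_def distrib_left sum.distrib)

lemma cinner_diff_left: "cinner (x - y) z = cinner x z - cinner y z"
  by (simp add: cinner_def left_diff_distrib sum_subtractf)

lemma cinner_diff_right: "cinner z (x - y) = cinner z x - cinner z y"
  by (simp add: cinner_def right_diff_distrib sum_subtractf)

lemma cinner_minus_left: "cinner (- x) z = - cinner x z"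
  by (simp add: cinner_def sum_negf)

lemma cinner_minus_right: "cinner z (- x) = - cinner z x"
  by (simp add: cinner_def sum_negf)

lemma cinner_scale_left: "cinner (c *s x) z = cnj c * cinner x z"
  by (simp add: cinner_def sum_distrib_left mult.assoc)

lemma cinner_scale_right: "cinner z (c *s x) = c * cinner z x"
  by (simp add: cinner_def sum_distrib_left mult.left_commute)

lemma cinner_scaleR_left: "cinner (r *\<^sub>R x) z = of_real r * cinner x z"
  by (simp add: cinner_def sum_distrib_left mult.assoc scaleR_conv_of_real[where 'a=complex])

lemma cinner_scaleR_right: "cinner z (r *\<^sub>R x) = of_real r * cinner z x"
  by (simp add: cinner_def sum_distrib_left mult.left_commute scaleR_conv_of_real[where 'a=complex])

lemma cinner_zero_left [simp]: "cinner 0 x = 0"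
  by (simp add: cinner_def)

lemma cinner_zero_right [simp]: "cinner x 0 = 0"
  by (simp add: cinner_def)

lemma cinner_sum_left: "cinner (sum f S) z = (\<Sum>i\<in>S. cinner (f i) z)"
  by (induction S rule: infinite_finite_induct) (simp_all add: cinner_add_left)

lemma cinner_sum_right: "cinner z (sum f S) = (\<Sum>i\<in>S. cinner z (f i))"
  by (induction S rule: infinite_finite_induct) (simp_all add: cinner_add_right)

lemmas cinner_simps = cinner_add_left cinner_add_right cinner_diff_left cinner_diff_right
  cinner_minus_left cinner_minus_right cinner_scale_left cinner_scale_right
  cinner_scaleR_left cinner_scaleR_right cinner_sum_left cinner_sum_right

lemma cnj_cinner [simp]: "cnj (cinner x y) = cinner y x"
  by (simp add: cinner_def mult.commute)

lemma Re_cinner: "Re (cinner x y) = inner x y"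
  by (simp add: cinner_def inner_vec_def inner_complex_def)

lemma cinner_same: "cinner x x = of_real ((norm x)\<^sup>2)"
proof (rule complex_eqI)
  show "Re (cinner x x) = Re (of_real ((norm x)\<^sup>2))"
    by (simp add: Re_cinner power2_norm_eq_inner)
  have "cnj (cinner x x) = cinner x x" by simp
  then show "Im (cinner x x) = Im (of_real ((norm x)\<^sup>2))"
    by (metis Im_complex_of_real Reals_cnj_iff complex_is_Real_iff)
qed

lemma cinner_self_eq_0 [simp]: "cinner x x = 0 \<longleftrightarrow> x = 0"
  by (simp add: cinner_same)

lemma cinner_self_nonneg: "cinner x x \<in> \<real>\<^sub>\<ge>\<^sub>0"
  unfolding cinner_same nonneg_Reals_of_real_iff by simp

lemma cinner_axis_left: "cinner (axis i 1) y = y $ i"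
  by (simp add: cinner_def axis_def if_distrib[of cnj] if_distrib[of "\<lambda>z. z * _"] cong: if_cong)

lemma cinner_axis_right: "cinner y (axis i 1) = cnj (y $ i)"
  by (metis cinner_axis_left cnj_cinner)

lemma cinner_axis_axis: "cinner (axis i 1) (axis j 1) = (if i = j then 1 else 0)"
  unfolding cinner_axis_left by (simp add: axis_def)

text \<open>A unimodular multiple of \<open>y\<close> makes the inner product real and nonnegative
  without changing \<open>norm y\<close>, so the real Cauchy-Schwarz inequality applies.\<close>

lemma cinner_cauchy: "cmod (cinner x y) \<le> norm x * norm y"
proof (cases "cinner x y = 0")
  case False
  define u where "u = cnj (cinner x y) / of_real (cmod (cinner x y))"
  have u: "cmod u = 1" using False by (simp add: u_def norm_divide del: cnj_cinner)
  have "cinner x (u *s y) = (cinner x y * cnj (cinner x y)) / of_real (cmod (cinner x y))"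
    by (simp add: u_def cinner_scale_right del: cnj_cinner)
  also have "\<dots> = of_real (cmod (cinner x y))"
    unfolding complex_norm_square[symmetric] using False by (simp add: power2_eq_square)
  finally have "cinner x (u *s y) = of_real (cmod (cinner x y))" .
  then have "cmod (cinner x y) = inner x (u *s y)"
    using Re_cinner[of x "u *s y"] by simp
  also have "\<dots> \<le> norm x * norm (u *s y)" by (rule norm_cauchy_schwarz)
  also have "norm (u *s y) = norm y"
    using u by (simp add: norm_vec_def L2_set_def norm_mult)
  finally show ?thesis .
qed simp

lemma vec_scale_simps: "c *s (x + y :: complex^'n) = c *s x + c *s y" "(c + d) *s x = c *s x + d *s x"
  "c *s (d *s x) = (c * d) *s x" "(1::complex) *s x = x" "0 *s x = 0" "c *s (0 :: complex^'n) = 0"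
  by (auto simp: vec_eq_iff algebra_simps)

lemma cscale_nth [simp]: "(c *\<^sub>M A) $ i $ j = c * A $ i $ j"
  by (simp add: cscale_def)

lemma mat_eqI: "(\<And>i j. A $ i $ j = B $ i $ j) \<Longrightarrow> A = B"
  by (simp add: vec_eq_iff)

lemma matrix_mult_nth: "(A ** B) $ i $ j = (\<Sum>l\<in>UNIV. A $ i $ l * B $ l $ j)"
  by (simp add: matrix_matrix_mult_def)

lemma matrix_add_rdistrib': "(A + B) ** (C :: 'n::finite cop) = A ** C + B ** C"
  by (rule mat_eqI) (simp add: matrix_mult_nth distrib_right sum.distrib)

lemma matrix_sub_ldistrib: "(C :: 'n::finite cop) ** (A - B) = C ** A - C ** B"
  by (rule mat_eqI) (simp add: matrix_mult_nth right_diff_distrib sum_subtractf)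

lemma matrix_sub_rdistrib: "(A - B) ** (C :: 'n::finite cop) = A ** C - B ** C"
  by (rule mat_eqI) (simp add: matrix_mult_nth left_diff_distrib sum_subtractf)

lemma matrix_neg_left: "(- A) ** (C :: 'n::finite cop) = - (A ** C)"
  by (rule mat_eqI) (simp add: matrix_mult_nth sum_negf)

lemma matrix_neg_right: "(C :: 'n::finite cop) ** (- A) = - (C ** A)"
  by (rule mat_eqI) (simp add: matrix_mult_nth sum_negf)

lemma cscale_mult_left: "(c *\<^sub>M A) ** B = c *\<^sub>M (A ** B)"
  by (rule mat_eqI) (simp add: matrix_mult_nth sum_distrib_left mult.assoc)

lemma cscale_mult_right: "A ** (c *\<^sub>M B) = c *\<^sub>M (A ** B)"
  by (rule mat_eqI) (simp add: matrix_mult_nth sum_distrib_left mult.left_commute)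

lemma scaleR_cscale: "r *\<^sub>R A = of_real r *\<^sub>M A"
  by (rule mat_eqI) (simp add: scaleR_conv_of_real[where 'a=complex])

lemma scaleR_mult_left:
  fixes A B :: "'n::finite cop"
  shows "(r *\<^sub>R A) ** B = r *\<^sub>R (A ** B)"
  by (simp add: scaleR_cscale cscale_mult_left)

lemma scaleR_mult_right:
  fixes A B :: "'n::finite cop"
  shows "A ** (r *\<^sub>R B) = r *\<^sub>R (A ** B)"
  by (simp add: scaleR_cscale cscale_mult_right)

lemma cscale_add_right: "c *\<^sub>M (A + B) = c *\<^sub>M A + c *\<^sub>M B"
  by (rule mat_eqI) (simp add: distrib_left)

lemma cscale_add_left: "(c + d) *\<^sub>M A = c *\<^sub>M A + d *\<^sub>M A"
  by (rule mat_eqI) (simp add: distrib_right)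

lemma cscale_diff_right: "c *\<^sub>M (A - B) = c *\<^sub>M A - c *\<^sub>M B"
  by (rule mat_eqI) (simp add: right_diff_distrib)

lemma cscale_minus_right: "c *\<^sub>M (- A) = - (c *\<^sub>M A)"
  by (rule mat_eqI) simp

lemma cscale_minus_left: "(- c) *\<^sub>M A = - (c *\<^sub>M A)"
  by (rule mat_eqI) simp

lemma cscale_cscale [simp]: "c *\<^sub>M d *\<^sub>M A = (c * d) *\<^sub>M A"
  by (rule mat_eqI) simp

lemma cscale_one [simp]: "1 *\<^sub>M A = A"
  by (rule mat_eqI) simp

lemma cscale_zero_left [simp]: "0 *\<^sub>M A = 0"
  by (rule mat_eqI) simp

lemma cscale_zero_right [simp]: "c *\<^sub>M 0 = 0"
  by (rule mat_eqI) simp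

lemma cscale_sum: "c *\<^sub>M sum f S = (\<Sum>i\<in>S. c *\<^sub>M f i)"
  by (induction S rule: infinite_finite_induct) (simp_all add: cscale_add_right)

lemma cscale_eq_0_iff: "c *\<^sub>M A = 0 \<longleftrightarrow> c = 0 \<or> A = 0"
  by (auto simp: vec_eq_iff)

lemma matrix_sum_left: "sum f S ** B = (\<Sum>i\<in>S. f i ** (B :: 'n::finite cop))"
  by (induction S rule: infinite_finite_induct) (simp_all add: matrix_add_rdistrib')

lemma matrix_sum_right: "B ** sum f S = (\<Sum>i\<in>S. (B :: 'n::finite cop) ** f i)"
  by (induction S rule: infinite_finite_induct) (simp_all add: matrix_add_ldistrib)

lemmas mtx_distrib = matrix_add_ldistrib matrix_add_rdistrib' matrix_sub_ldistrib matrix_sub_rdistrib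
  matrix_neg_left matrix_neg_right

lemmas mtx_scale = cscale_mult_left cscale_mult_right cscale_add_right cscale_diff_right
  cscale_minus_right cscale_minus_left

lemmas mtx_assoc = matrix_mul_assoc[symmetric]

lemma cscale_vec: "(c *\<^sub>M A) *v x = c *s (A *v x)"
  by (simp add: vec_eq_iff matrix_vector_mult_def sum_distrib_left mult.assoc)

lemma scaleR_vec: "(r *\<^sub>R (A :: 'n::finite cop)) *v x = r *\<^sub>R (A *v x)"
  by (simp add: vec_eq_iff matrix_vector_mult_def scaleR_right.sum)

lemma matrix_vector_scale: "A *v (c *s x) = c *s (A *v (x :: complex^'n))"
  by (simp add: vec_eq_iff matrix_vector_mult_def sum_distrib_left mult.left_commute)

lemma matrix_vector_scaleR: "A *v (r *\<^sub>R x) = r *\<^sub>R (A *v (x :: complex^'n))"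
  by (simp add: vec_eq_iff matrix_vector_mult_def scaleR_right.sum)

lemma matrix_vector_sum: "A *v (sum f S) = (\<Sum>i\<in>S. (A :: 'n::finite cop) *v f i)"
  by (induction S rule: infinite_finite_induct) (simp_all add: matrix_vector_right_distrib)

lemma sum_matrix_vector: "(sum f S) *v x = (\<Sum>i\<in>S. (f i :: 'n::finite cop) *v x)"
  by (induction S rule: infinite_finite_induct) (simp_all add: matrix_vector_mult_add_rdistrib)

lemma neg_matrix_vector: "(- (A :: 'n::finite cop)) *v x = - (A *v x)"
  by (simp add: vec_eq_iff matrix_vector_mult_def sum_negf)

lemma matrix_vector_neg: "(A :: 'n::finite cop) *v (- x) = - (A *v x)"
  by (simp add: vec_eq_iff matrix_vector_mult_def sum_negf)

lemma matrix_vector_mult_mult: "(A ** B) *v x = A *v (B *v (x :: complex^'n::finite))"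
  by (simp add: matrix_vector_mul_assoc)

lemmas mtx_vec = matrix_vector_right_distrib matrix_vector_mult_diff_distrib
  matrix_vector_mult_add_rdistrib matrix_vector_mult_diff_rdistrib cscale_vec scaleR_vec
  matrix_vector_scale matrix_vector_scaleR matrix_vector_sum sum_matrix_vector neg_matrix_vector matrix_vector_neg
  matrix_vector_mult_mult

lemma dagger_nth [simp]: "dagger A $ i $ j = cnj (A $ j $ i)"
  by (simp add: dagger_def)

lemma dagger_mult: "dagger (A ** B) = dagger B ** dagger A"
  by (rule mat_eqI) (simp add: matrix_mult_nth mult.commute)

lemma dagger_add: "dagger (A + B) = dagger A + dagger B"
  by (rule mat_eqI) simp

lemma dagger_diff: "dagger (A - B) = dagger A - dagger B"
  by (rule mat_eqI) simp

lemma dagger_minus: "dagger (- A) = - dagger A"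
  by (rule mat_eqI) simp

lemma dagger_cscale: "dagger (c *\<^sub>M A) = cnj c *\<^sub>M dagger A"
  by (rule mat_eqI) simp

lemma dagger_scaleR: "dagger (r *\<^sub>R A) = r *\<^sub>R dagger A"
  by (simp add: scaleR_cscale dagger_cscale)

lemma dagger_dagger [simp]: "dagger (dagger A) = A"
  by (rule mat_eqI) simp

lemma dagger_zero [simp]: "dagger 0 = 0"
  by (rule mat_eqI) simp

lemma dagger_one [simp]: "dagger (mat 1) = mat 1"
  by (rule mat_eqI) (simp add: mat_def)

lemma dagger_sum: "dagger (sum f S) = (\<Sum>i\<in>S. dagger (f i))"
  by (induction S rule: infinite_finite_induct) (simp_all add: dagger_add)

lemmas dagger_simps = dagger_mult dagger_add dagger_diff dagger_minus dagger_cscale dagger_scaleR dagger_sum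

lemma cinner_dagger: "cinner x (A *v y) = cinner (dagger A *v x) y"
  unfolding cinner_def matrix_vector_mult_def
  by (simp add: sum_distrib_left sum_distrib_right mult.assoc mult.left_commute) (rule sum.swap)

lemma cinner_dagger_left: "cinner (A *v x) y = cinner x (dagger A *v y)"
  by (simp add: cinner_dagger)

lemma matrix_eqI_vec: "(\<And>v. A *v v = B *v v) \<Longrightarrow> A = (B :: 'n::finite cop)"
  by (simp add: matrix_eq)

lemma vec_eqI_cinner: "(\<And>u. cinner u x = cinner u y) \<Longrightarrow> x = y"
  by (metis cinner_axis_left vec_eq_iff)

lemma matrix_eqI_cinner: "(\<And>u v. cinner u (A *v v) = cinner u (B *v v)) \<Longrightarrow> A = (B :: 'n::finite cop)"
  by (rule matrix_eqI_vec, rule vec_eqI_cinner)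

lemma matrix_axis_nth: "A $ i $ j = cinner (axis i 1) (A *v axis j 1)" for A :: "'n::finite cop"
  unfolding cinner_axis_left
  by (simp add: matrix_vector_mult_def axis_def if_distrib[of "\<lambda>z. _ * z"] cong: if_cong)

text \<open>Only \<open>cinner u (A *v v)\<close> survives, because the fourth roots of unity and
  their squares sum to zero. Hence quadratic forms determine arbitrary operators, not only Hermitian
  ones.\<close>

lemma polarization_4:
  "4 * cinner u (A *v v) = (\<Sum>k<4. cnj (\<i> ^ k) * cinner (u + \<i> ^ k *s v) (A *v (u + \<i> ^ k *s v)))"
  for A :: "'n::finite cop"
proof -
  have "{..<4::nat} = {0,1,2,3}" by auto
  then show ?thesis
    by (simp add: cinner_simps mtx_vec power3_eq_cube power2_eq_square algebra_simps)
qed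

lemma matrix_eqI_quadratic:
  assumes "\<And>v. cinner v (A *v v) = cinner v (B *v v)"
  shows "A = (B :: 'n::finite cop)"
proof (rule matrix_eqI_cinner)
  fix u v
  have "4 * cinner u (A *v v) = 4 * cinner u (B *v v)"
    unfolding polarization_4 using assms by simp
  then show "cinner u (A *v v) = cinner u (B *v v)" by simp
qed

lemma psd_hermitian: "psd A \<Longrightarrow> dagger A = A"
proof (rule matrix_eqI_quadratic)
  fix v assume "psd A"
  then have "cinner v (A *v v) \<in> \<real>"
    unfolding psd_def by (metis nonneg_Reals_subset_Reals subsetD)
  then have "cnj (cinner v (A *v v)) = cinner v (A *v v)" by (simp add: Reals_cnj_iff)
  then show "cinner v (dagger A *v v) = cinner v (A *v v)"
    by (simp add: cinner_dagger)
qed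

lemma hermitian_cinner_real: "dagger A = A \<Longrightarrow> cinner v (A *v v) = of_real (Re (cinner v (A *v v)))"
  by (metis Reals_cnj_iff cinner_dagger cnj_cinner of_real_Re)

lemma psd_iff: "psd A \<longleftrightarrow> dagger A = A \<and> (\<forall>v. 0 \<le> Re (cinner v (A *v v)))"
proof
  assume "psd A" then show "dagger A = A \<and> (\<forall>v. 0 \<le> Re (cinner v (A *v v)))"
    using psd_hermitian by (auto simp: psd_def complex_nonneg_Reals_iff)
next
  assume *: "dagger A = A \<and> (\<forall>v. 0 \<le> Re (cinner v (A *v v)))"
  then show "psd A" unfolding psd_def
    using hermitian_cinner_real by (metis nonneg_Reals_of_real_iff)
qed

lemma psd_square: "psd (dagger X ** X)"
  by (simp add: psd_def mtx_vec cinner_dagger[of _ "dagger X"] cinner_self_nonneg)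

lemma psd_conj: "psd A \<Longrightarrow> psd (dagger X ** A ** X)"
  by (auto simp: psd_def mtx_vec cinner_dagger[of _ "dagger X"])

lemma psd_conj': "psd A \<Longrightarrow> psd (X ** A ** dagger X)"
  using psd_conj[of A "dagger X"] by simp

lemma psd_add: "psd A \<Longrightarrow> psd B \<Longrightarrow> psd (A + B)"
  by (auto simp: psd_def mtx_vec cinner_simps nonneg_Reals_add_I)

lemma psd_scale: "psd A \<Longrightarrow> 0 \<le> r \<Longrightarrow> psd (r *\<^sub>R A)"
  by (auto simp: psd_def mtx_vec cinner_simps intro!: nonneg_Reals_mult_I)

lemma psd_zero [simp]: "psd 0"
  by (simp add: psd_def)

lemma psd_one [simp]: "psd (mat 1)"
  by (simp add: psd_def cinner_self_nonneg)

lemma psd_sum: "(\<And>i. i \<in> S \<Longrightarrow> psd (f i)) \<Longrightarrow> psd (sum f S)"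
  by (induction S rule: infinite_finite_induct) (simp_all add: psd_add)

lemma quadratic_nonneg_imp_zero:
  fixes b c :: real
  assumes "\<And>t. 0 \<le> 2 * t * b + t\<^sup>2 * c"
  shows "b = 0"
proof (rule ccontr)
  assume b: "b \<noteq> 0"
  \<comment> \<open>At \<open>t = - b / d\<close> the parabola takes the value
    \<open>b\<^sup>2 / d * (c / d - 2)\<close>, which is negative because
    \<open>c < d\<close>.\<close>
  define d where "d = \<bar>c\<bar> + 1"
  have d: "d > 0" "c < d" by (auto simp: d_def)
  have "0 \<le> 2 * (- b / d) * b + (- b / d)\<^sup>2 * c" using assms .
  also have "\<dots> = b\<^sup>2 / d * (c / d - 2)"
    using d by (simp add: field_simps power2_eq_square)
  finally have "0 \<le> c / d - 2" using b d by (simp add: zero_le_mult_iff zero_le_divide_iff)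
  then show False using d by (simp add: field_simps)
qed

text \<open>\<open>v\<close> minimizes a nonnegative quadratic form, so the first variation vanishes
  in every direction \<open>y\<close>; the direction \<open>y = A *v v\<close> finishes.\<close>

lemma psd_zero_form:
  assumes "psd A" "cinner v (A *v v) = 0"
  shows "A *v v = 0"
proof -
  have h: "dagger A = A" using assms psd_hermitian by blast
  have real: "Re (cinner y (A *v v)) = 0" for y
  proof -
    define b where "b = Re (cinner y (A *v v))"
    define c where "c = Re (cinner y (A *v y))"
    have "0 \<le> 2 * t * b + t\<^sup>2 * c" for t
    proof -
      have "cinner v (A *v y) = cnj (cinner y (A *v v))"
        using h by (metis cinner_dagger cnj_cinner)
      moreover have "Re (cinner (A *v v) y) = Re (cinner y (A *v v))"
        by (simp add: Re_cinner inner_commute)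
      ultimately have "Re (cinner (v + t *\<^sub>R y) (A *v (v + t *\<^sub>R y))) = 2 * t * b + t\<^sup>2 * c"
        using assms(2)
        by (simp add: cinner_simps matrix_vector_scaleR matrix_vector_right_distrib b_def c_def power2_eq_square algebra_simps)
      then show ?thesis using assms(1) unfolding psd_iff by metis
    qed
    then have "b = 0" by (rule quadratic_nonneg_imp_zero)
    then show ?thesis by (simp add: b_def)
  qed
  have "cinner (A *v v) (A *v v) = 0"
    using real[of "A *v v"] by (simp add: cinner_same)
  then show ?thesis by simp
qed

lemma ketbra_nth [simp]: "ketbra x y $ i $ j = x $ i * cnj (y $ j)"
  by (simp add: ketbra_def)

lemma ketbra_vec: "ketbra x y *v z = cinner y z *s x"
  by (simp add: vec_eq_iff matrix_vector_mult_def cinner_def sum_distrib_left mult_ac)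

lemma mult_ketbra: "A ** ketbra x y = ketbra (A *v x) y"
  by (rule matrix_eqI_vec) (simp add: mtx_vec ketbra_vec)

lemma dagger_ketbra: "dagger (ketbra x y) = ketbra y x"
  by (rule mat_eqI) (simp add: mult.commute)

lemma ketbra_mult: "ketbra x y ** A = ketbra x (dagger A *v y)"
  by (rule matrix_eqI_vec) (simp add: mtx_vec ketbra_vec cinner_dagger)

lemma ketbra_mult_ketbra: "ketbra x y ** ketbra z w = cinner y z *\<^sub>M ketbra x w"
  by (rule matrix_eqI_vec) (simp add: mtx_vec ketbra_vec mult.commute)

lemma trace_ketbra: "trace (ketbra x y) = cinner y x"
  by (simp add: trace_def cinner_def mult.commute)

lemma trace_cscale: "trace (c *\<^sub>M A) = c * trace A"
  by (simp add: trace_def sum_distrib_left)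

lemma trace_zero [simp]: "trace 0 = (0::complex)"
  by (simp add: trace_def)

lemma trace_minus: "trace (- A) = - trace (A :: 'n::finite cop)"
  by (simp add: trace_def sum_negf)

lemma trace_dagger: "trace (dagger A) = cnj (trace A)"
  by (simp add: trace_def)

lemma trace_mult_ketbra: "trace (A ** ketbra x y) = cinner y (A *v x)"
  by (simp add: mult_ketbra trace_ketbra)

lemma trace_square_eq_0: "trace (dagger A ** A) = 0 \<longleftrightarrow> A = 0"
proof
  assume "trace (dagger A ** A) = 0"
  then have "(\<Sum>i\<in>UNIV. \<Sum>l\<in>UNIV. complex_of_real ((cmod (A $ l $ i))\<^sup>2)) = 0"
    by (simp add: trace_def matrix_mult_nth complex_norm_square mult.commute del: of_real_power)
  then have "(\<Sum>i\<in>UNIV. \<Sum>l\<in>UNIV. (cmod (A $ l $ i))\<^sup>2) = 0"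
    by (metis (no_types, lifting) of_real_eq_0_iff of_real_sum sum.cong)
  then show "A = 0"
    by (auto simp: sum_nonneg_eq_0_iff sum_nonneg vec_eq_iff)
qed simp

lemma matrix_eqI_trace: "(\<And>V. trace (V ** A) = trace (V ** B)) \<Longrightarrow> A = (B :: 'n::finite cop)"
  using trace_square_eq_0[of "A - B"] by (simp add: mtx_distrib trace_sub)

lemma tau_linear:
  "normalized_trace (A + B) = normalized_trace A + normalized_trace B"
  "normalized_trace (A - B) = normalized_trace A - normalized_trace B"
  "normalized_trace (- A) = - normalized_trace A"
  "normalized_trace (c *\<^sub>M A) = c * normalized_trace A"
  "normalized_trace (r *\<^sub>R A) = of_real r * normalized_trace A"
  "normalized_trace 0 = 0"
  "normalized_trace (mat 1) = 1"
  by (simp_all add: normalized_trace_def trace_add trace_sub trace_cscale trace_I trace_minus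
      scaleR_cscale add_divide_distrib diff_divide_distrib)

lemma tau_commute: "normalized_trace (A ** B) = normalized_trace (B ** (A :: 'n::finite cop))"
  unfolding normalized_trace_def by (subst trace_mul_sym) (rule refl)

lemma tau_eqI: "(\<And>V. normalized_trace (V ** A) = normalized_trace (V ** B)) \<Longrightarrow> A = (B :: 'n::finite cop)"
  by (rule matrix_eqI_trace) (simp add: normalized_trace_def)


section \<open>The spectral theorem\<close>

lemma orthonormal_basisD:
  assumes "orthonormal_basis \<psi>"
  shows "cinner (\<psi> i) (\<psi> j) = (if i = j then 1 else 0)"
  using assms by (simp add: orthonormal_basis_def)

text \<open>The index type has as many elements as the dimension, so the matrix with columns
  \<open>\<psi> j\<close> is square and its left inverse is also a right inverse.\<close>

lemma orthonormal_basis_completeness: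
  fixes \<psi> :: "'n::finite \<Rightarrow> complex ^ 'n"
  assumes "orthonormal_basis \<psi>"
  shows "(\<Sum>j\<in>UNIV. ketbra (\<psi> j) (\<psi> j)) = mat 1"
proof -
  define M :: "'n cop" where "M = (\<chi> i j. \<psi> j $ i)"
  have "dagger M ** M = mat 1"
    using assms by (intro mat_eqI) (simp add: M_def matrix_mult_nth mat_def orthonormal_basis_def cinner_def)
  then have "M ** dagger M = mat 1" using matrix_left_right_inverse by blast
  then show ?thesis
    by (auto simp: vec_eq_iff M_def matrix_mult_nth)
qed

lemma orthonormal_basis_expand:
  fixes \<psi> :: "'n::finite \<Rightarrow> complex ^ 'n"
  assumes "orthonormal_basis \<psi>"
  shows "v = (\<Sum>j\<in>UNIV. cinner (\<psi> j) v *s \<psi> j)"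
  using arg_cong[OF orthonormal_basis_completeness[OF assms], of "\<lambda>A. A *v v"]
  by (simp add: sum_matrix_vector ketbra_vec)

lemma orthonormal_basis_axis: "orthonormal_basis (\<lambda>i. axis i 1)"
  by (simp add: orthonormal_basis_def cinner_axis_axis)

text \<open>The conditions are the rows of a square matrix padded with zero rows. Row
  \<open>i\<close> is zero, so the matrix has a kernel.\<close>

lemma exists_orthogonal_vector:
  fixes \<psi> :: "'n::finite \<Rightarrow> complex ^ 'n"
  assumes "i \<notin> S"
  shows "\<exists>v. v \<noteq> 0 \<and> (\<forall>j\<in>S. cinner (\<psi> j) v = 0)"
proof -
  define B :: "'n cop" where "B = (\<chi> j l. if j \<in> S then cnj (\<psi> j $ l) else 0)"
  have B: "(B *v v) $ j = (if j \<in> S then cinner (\<psi> j) v else 0)" for j v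
    by (simp add: B_def matrix_vector_mult_def cinner_def)
  have "\<not> (\<exists>C. C ** B = mat 1)"
  proof
    assume "\<exists>C. C ** B = mat 1"
    then obtain C where "B ** C = mat 1" using matrix_left_right_inverse by blast
    then have "B *v (C *v axis i 1) = axis i 1"
      by (simp add: matrix_vector_mul_assoc)
    then have "(B *v (C *v axis i 1)) $ i = 1" by simp
    then show False using B assms by simp
  qed
  then obtain v where "B *v v = 0" "v \<noteq> 0"
    unfolding matrix_left_invertible_ker by blast
  then show ?thesis using B by (metis zero_index)
qed

text \<open>Maximize the Rayleigh quotient on the unit sphere of the orthogonal complement
  \<open>M\<close> of the given eigenvectors, a space that \<open>A\<close> leaves
  invariant.\<close>

lemma hermitian_eigenvector_orthogonal:
  fixes A :: "'n::finite cop" and \<psi> :: "'n \<Rightarrow> complex ^ 'n"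
  assumes A: "dagger A = A" and i: "i \<notin> S"
    and eig: "\<And>j. j \<in> S \<Longrightarrow> A *v \<psi> j = \<mu> j *\<^sub>R \<psi> j"
  shows "\<exists>x r. norm x = 1 \<and> (\<forall>j\<in>S. cinner (\<psi> j) x = 0) \<and> A *v x = r *\<^sub>R x"
proof -
  define M where "M = {x. \<forall>j\<in>S. cinner (\<psi> j) x = 0}"
  define q where "q x = Re (cinner x (A *v x))" for x
  have M_add: "x + y \<in> M" "x - y \<in> M" "r *\<^sub>R x \<in> M" if "x \<in> M" "y \<in> M" for x y r
    using that by (auto simp: M_def cinner_simps)
  have M_A: "A *v x \<in> M" if "x \<in> M" for x
    using that eig A by (auto simp: M_def cinner_dagger cinner_simps)
  have cont_c: "continuous_on UNIV (\<lambda>x. cinner y x)" for y :: "complex^'n"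
    unfolding cinner_def by (intro continuous_intros)
  have "closed M"
    unfolding M_def Ball_def by (intro closed_Collect_all closed_Collect_imp closed_Collect_eq cont_c continuous_on_const) simp
  then have comp: "compact (M \<inter> sphere 0 1)" by (simp add: closed_Int_compact Int_commute)
  obtain v where v: "v \<in> M" "v \<noteq> 0" using exists_orthogonal_vector[OF i, of \<psi>] by (auto simp: M_def)
  have "(1 / norm v) *\<^sub>R v \<in> M \<inter> sphere 0 1" using v M_add(3) by simp
  then have ne: "M \<inter> sphere 0 1 \<noteq> {}" by blast
  have "continuous_on (M \<inter> sphere 0 1) q"
    unfolding q_def Re_cinner
    by (intro continuous_intros linear_continuous_on matrix_vector_mul_bounded_linear)
  from continuous_attains_sup[OF comp ne this]
  obtain x where x: "x \<in> M" "norm x = 1" and sup: "\<And>y. y \<in> M \<Longrightarrow> norm y = 1 \<Longrightarrow> q y \<le> q x"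
    by auto
  define l where "l = q x"
  define C where "C = l *\<^sub>R mat 1 - A"
  have pos: "0 \<le> Re (cinner y (C *v y))" if "y \<in> M" for y
  proof (cases "y = 0")
    case False
    have "q ((1 / norm y) *\<^sub>R y) \<le> l"
      unfolding l_def using False that M_add(3) by (intro sup) auto
    then have "q y / (norm y)\<^sup>2 \<le> l"
      by (simp add: q_def cinner_simps matrix_vector_scaleR power2_eq_square)
    then have "q y \<le> l * (norm y)\<^sup>2" using False by (simp add: field_simps)
    then show ?thesis
      by (simp add: C_def q_def cinner_simps matrix_vector_mult_diff_rdistrib scaleR_vec cinner_same)
  qed simp
  \<comment> \<open>\<open>C\<close> is nonnegative on \<open>M\<close> and its form vanishes at
    \<open>x\<close>; the first variation in the direction \<open>w\<close> is twice
    \<open>(norm w)\<^sup>2\<close>, so it has to be zero.\<close>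
  define w where "w = C *v x"
  have w: "w \<in> M" using x M_A M_add by (simp add: w_def C_def matrix_vector_mult_diff_rdistrib scaleR_vec)
  have Ch: "dagger C = C" by (simp add: C_def dagger_diff dagger_scaleR A)
  have x0: "Re (cinner x w) = 0"
    using x by (simp add: w_def C_def l_def q_def cinner_simps matrix_vector_mult_diff_rdistrib scaleR_vec cinner_same)
  have "cinner x (C *v w) = cinner w w" using Ch by (simp add: w_def cinner_dagger)
  then have quad: "Re (cinner (x + t *\<^sub>R w) (C *v (x + t *\<^sub>R w)))
      = 2 * t * (norm w)\<^sup>2 + t\<^sup>2 * Re (cinner w (C *v w))" for t
    using x0 by (simp add: cinner_simps matrix_vector_right_distrib matrix_vector_scaleR
        cinner_same power2_eq_square w_def[symmetric] algebra_simps)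
  define c where "c = Re (cinner w (C *v w))"
  have nn: "0 \<le> 2 * t * (norm w)\<^sup>2 + t\<^sup>2 * c" for t
    using pos[of "x + t *\<^sub>R w"] quad[of t] x w M_add by (simp add: c_def)
  have "(norm w)\<^sup>2 = 0" using quadratic_nonneg_imp_zero[OF nn] .
  then have "w = 0" by simp
  then have "A *v x = l *\<^sub>R x"
    by (simp add: w_def C_def matrix_vector_mult_diff_rdistrib scaleR_vec)
  then show ?thesis using x by (auto simp: M_def)
qed

theorem spectral_theorem:
  fixes A :: "'n::finite cop"
  assumes A: "dagger A = A"
  obtains \<psi> \<mu> where "orthonormal_basis \<psi>" "\<And>j. A *v \<psi> j = \<mu> j *\<^sub>R \<psi> j"
    "A = (\<Sum>j\<in>UNIV. \<mu> j *\<^sub>R ketbra (\<psi> j) (\<psi> j))"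
proof -
  have "\<exists>\<psi> \<mu>. (\<forall>i\<in>S. \<forall>j\<in>S. cinner (\<psi> i) (\<psi> j) = (if i = j then 1 else 0)) \<and>
          (\<forall>j\<in>S. A *v \<psi> j = \<mu> j *\<^sub>R \<psi> j)" for S :: "'n set"
    using finite[of S]
  proof (induction S rule: finite_induct)
    case (insert i S)
    then obtain \<psi> \<mu> where o: "\<forall>i\<in>S. \<forall>j\<in>S. cinner (\<psi> i) (\<psi> j) = (if i = j then 1 else 0)"
      and e: "\<forall>j\<in>S. A *v \<psi> j = \<mu> j *\<^sub>R \<psi> j" by blast
    obtain x r where x: "norm x = 1" "\<forall>j\<in>S. cinner (\<psi> j) x = 0" "A *v x = r *\<^sub>R x"
      using hermitian_eigenvector_orthogonal[OF A insert(2), of \<psi> \<mu>] e by blast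
    have x': "\<forall>j\<in>S. cinner x (\<psi> j) = 0" using x(2) by (metis cnj_cinner complex_cnj_zero)
    have xx: "cinner x x = 1" using x(1) by (simp add: cinner_same)
    have "(\<forall>k\<in>insert i S. \<forall>j\<in>insert i S. cinner ((\<psi>(i := x)) k) ((\<psi>(i := x)) j) = (if k = j then 1 else 0)) \<and>
          (\<forall>j\<in>insert i S. A *v (\<psi>(i := x)) j = (\<mu>(i := r)) j *\<^sub>R (\<psi>(i := x)) j)"
      using o e x x' xx insert(2) by auto
    then show ?case by blast
  qed simp
  from this[of UNIV] obtain \<psi> \<mu> where o: "orthonormal_basis \<psi>" and e: "\<And>j. A *v \<psi> j = \<mu> j *\<^sub>R \<psi> j"
    unfolding orthonormal_basis_def by blast
  have "A = A ** (\<Sum>j\<in>UNIV. ketbra (\<psi> j) (\<psi> j))"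
    by (simp add: orthonormal_basis_completeness[OF o])
  also have "\<dots> = (\<Sum>j\<in>UNIV. \<mu> j *\<^sub>R ketbra (\<psi> j) (\<psi> j))"
    unfolding matrix_sum_right mult_ketbra e
    by (intro sum.cong refl mat_eqI) (simp add: scaleR_conv_of_real[where 'a=complex])
  finally show ?thesis using that[OF o e] by blast
qed

lemma spectral_vec:
  fixes \<psi> :: "'n::finite \<Rightarrow> complex ^ 'n"
  assumes "orthonormal_basis \<psi>"
  shows "(\<Sum>j\<in>UNIV. \<mu> j *\<^sub>R ketbra (\<psi> j) (\<psi> j)) *v \<psi> i = \<mu> i *\<^sub>R \<psi> i"
proof -
  have "(\<Sum>j\<in>UNIV. \<mu> j *\<^sub>R ketbra (\<psi> j) (\<psi> j)) *v \<psi> i = (\<Sum>j\<in>UNIV. if j = i then \<mu> i *\<^sub>R \<psi> i else 0)"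
    unfolding sum_matrix_vector
    by (intro sum.cong refl) (simp add: scaleR_vec ketbra_vec orthonormal_basisD[OF assms] vec_scale_simps)
  then show ?thesis by simp
qed

lemma orthonormal_matrix_eqI:
  fixes \<psi> :: "'n::finite \<Rightarrow> complex ^ 'n"
  assumes "orthonormal_basis \<psi>" "\<And>j. A *v \<psi> j = B *v \<psi> j"
  shows "A = (B :: 'n cop)"
proof (rule matrix_eqI_vec)
  fix v
  have "A *v (\<Sum>j\<in>UNIV. cinner (\<psi> j) v *s \<psi> j) = B *v (\<Sum>j\<in>UNIV. cinner (\<psi> j) v *s \<psi> j)"
    by (simp add: mtx_vec assms(2))
  then show "A *v v = B *v v" using orthonormal_basis_expand[OF assms(1), of v] by simp
qed

lemma spectral_hermitian: "dagger (\<Sum>j\<in>UNIV. \<mu> j *\<^sub>R ketbra (\<psi> j) (\<psi> j)) = (\<Sum>j\<in>UNIV. \<mu> j *\<^sub>R ketbra (\<psi> j) (\<psi> j))"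
  by (simp add: dagger_simps dagger_ketbra)

lemma psd_ketbra: "psd (ketbra x x)"
proof -
  \<comment> \<open>The value is the squared modulus of \<open>cinner x v\<close>, written as the
    inner product of a vector with itself.\<close>
  have "cinner v (ketbra x x *v v) = cinner (cinner x v *s axis undefined 1) (cinner x v *s axis undefined (1::complex))" for v
    by (simp add: ketbra_vec cinner_simps cinner_axis_axis)
  then show ?thesis unfolding psd_def using cinner_self_nonneg by metis
qed

lemma spectral_psd:
  assumes "\<And>j. 0 \<le> \<mu> j"
  shows "psd (\<Sum>j\<in>UNIV. \<mu> j *\<^sub>R ketbra (\<psi> j) (\<psi> j))"
  by (intro psd_sum psd_scale psd_ketbra assms)

lemma psd_eigenvalue:
  assumes "psd A" "A *v x = r *\<^sub>R x" "x \<noteq> 0"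
  shows "0 \<le> r"
proof -
  have "0 \<le> Re (cinner x (A *v x))" using assms(1) by (simp add: psd_iff)
  then have "0 \<le> r * (norm x)\<^sup>2" unfolding assms(2) by (simp add: cinner_simps cinner_same)
  then show ?thesis using assms(3) by (simp add: zero_le_mult_iff)
qed

lemma orthonormal_nonzero: "orthonormal_basis \<psi> \<Longrightarrow> \<psi> j \<noteq> 0"
  by (metis cinner_zero_left orthonormal_basisD zero_neq_one)

lemma symbols_iff: "Q \<in> symbols \<longleftrightarrow> psd Q \<and> psd (mat 1 - Q)"
  by (simp add: symbols_def op_le_def)

lemma spectral_symbols:
  assumes \<psi>: "orthonormal_basis \<psi>" and \<mu>: "\<And>j. 0 \<le> \<mu> j" "\<And>j. \<mu> j \<le> 1"
  shows "(\<Sum>j\<in>UNIV. \<mu> j *\<^sub>R ketbra (\<psi> j) (\<psi> j)) \<in> symbols"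
proof -
  have "mat 1 - (\<Sum>j\<in>UNIV. \<mu> j *\<^sub>R ketbra (\<psi> j) (\<psi> j)) = (\<Sum>j\<in>UNIV. (1 - \<mu> j) *\<^sub>R ketbra (\<psi> j) (\<psi> j))"
    by (simp add: orthonormal_basis_completeness[OF \<psi>, symmetric] sum_subtractf scaleR_left_diff_distrib)
  then show ?thesis
    unfolding symbols_iff using \<mu> by (auto intro!: spectral_psd)
qed

lemma symbols_spectral:
  fixes Q :: "'n::finite cop"
  assumes "Q \<in> symbols"
  obtains \<psi> \<mu> where "orthonormal_basis \<psi>" "\<And>j. 0 \<le> \<mu> j" "\<And>j. \<mu> j \<le> 1"
    "Q = (\<Sum>j\<in>UNIV. \<mu> j *\<^sub>R ketbra (\<psi> j) (\<psi> j))"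
proof -
  have Q: "psd Q" "psd (mat 1 - Q)" using assms by (auto simp: symbols_iff)
  obtain \<psi> \<mu> where s: "orthonormal_basis \<psi>" "\<And>j. Q *v \<psi> j = \<mu> j *\<^sub>R \<psi> j"
    "Q = (\<Sum>j\<in>UNIV. \<mu> j *\<^sub>R ketbra (\<psi> j) (\<psi> j))"
    using spectral_theorem[OF psd_hermitian[OF Q(1)]] by blast
  have "0 \<le> \<mu> j" for j using psd_eigenvalue[OF Q(1) s(2) orthonormal_nonzero[OF s(1)]] .
  moreover have "0 \<le> 1 - \<mu> j" for j
    by (rule psd_eigenvalue[OF Q(2) _ orthonormal_nonzero[OF s(1)], of j])
      (simp add: s(2) matrix_vector_mult_diff_rdistrib scaleR_left_diff_distrib)
  ultimately show ?thesis using that[OF s(1) _ _ s(3)] by (metis diff_ge_0_iff_ge)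
qed


section \<open>Square roots\<close>

text \<open>From \<open>(B + b) (B - b) x = 0\<close>, the vector \<open>y = (B - b) x\<close>
  satisfies \<open>B y = - b y\<close>, which positivity of \<open>B\<close> excludes for nonzero
  \<open>y\<close> when \<open>b > 0\<close>. Uniqueness of the root and its compatibility with
  intertwiners rest on this, without a functional calculus.\<close>

lemma psd_sqrt_eigenvector:
  assumes B: "psd B" and b: "0 \<le> b" and eq: "B *v (B *v x) = b\<^sup>2 *\<^sub>R x"
  shows "B *v x = b *\<^sub>R x"
proof -
  have h: "dagger B = B" using B psd_hermitian by blast
  show ?thesis
  proof (cases "b = 0")
    case True
    then have "cinner (B *v x) (B *v x) = 0"
      using eq h by (simp add: cinner_dagger_left)
    then show ?thesis using True by simp
  next
    case False
    define y where "y = B *v x - b *\<^sub>R x"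
    have "B *v y = - (b *\<^sub>R y)"
      by (simp add: y_def matrix_vector_mult_diff_distrib matrix_vector_scaleR eq power2_eq_square algebra_simps)
    then have "Re (cinner y (B *v y)) = - (b * (norm y)\<^sup>2)"
      by (simp add: cinner_simps cinner_same)
    then have "b * (norm y)\<^sup>2 \<le> 0" using B by (metis neg_0_le_iff_le psd_iff)
    then have "y = 0" using b False
      by (simp add: mult_le_0_iff)
    then show ?thesis by (simp add: y_def)
  qed
qed

lemma psd_sqrt_unique:
  assumes "psd B" "psd C" "B ** B = C ** (C :: 'n::finite cop)"
  shows "B = C"
proof -
  obtain \<psi> \<mu> where s: "orthonormal_basis \<psi>" "\<And>j. B *v \<psi> j = \<mu> j *\<^sub>R \<psi> j"
    using spectral_theorem[OF psd_hermitian[OF assms(1)]] by blast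
  have "C *v \<psi> j = \<mu> j *\<^sub>R \<psi> j" for j
  proof (rule psd_sqrt_eigenvector[OF assms(2)])
    show "0 \<le> \<mu> j" using psd_eigenvalue[OF assms(1) s(2) orthonormal_nonzero[OF s(1)]] .
    show "C *v (C *v \<psi> j) = (\<mu> j)\<^sup>2 *\<^sub>R \<psi> j"
      by (simp add: matrix_vector_mul_assoc assms(3)[symmetric])
        (simp add: matrix_vector_mult_mult s(2) matrix_vector_scaleR power2_eq_square)
  qed
  then show ?thesis using orthonormal_matrix_eqI[OF s(1)] s(2) by metis
qed

lemma psd_sqrt_exists:
  assumes "psd (A :: 'n::finite cop)"
  shows "\<exists>B. psd B \<and> B ** B = A"
proof -
  obtain \<psi> \<mu> where s: "orthonormal_basis \<psi>" "\<And>j. A *v \<psi> j = \<mu> j *\<^sub>R \<psi> j"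
    using spectral_theorem[OF psd_hermitian[OF assms(1)]] by blast
  have \<mu>: "0 \<le> \<mu> j" for j using psd_eigenvalue[OF assms(1) s(2) orthonormal_nonzero[OF s(1)]] .
  define B where "B = (\<Sum>j\<in>UNIV. sqrt (\<mu> j) *\<^sub>R ketbra (\<psi> j) (\<psi> j))"
  have "psd B" unfolding B_def using \<mu> by (intro spectral_psd) simp
  moreover have "B ** B = A"
  proof (rule orthonormal_matrix_eqI[OF s(1)])
    fix j
    have "B *v \<psi> j = sqrt (\<mu> j) *\<^sub>R \<psi> j" unfolding B_def by (rule spectral_vec[OF s(1)])
    then show "(B ** B) *v \<psi> j = A *v \<psi> j"
      using \<mu> s(2) by (simp add: matrix_vector_mult_mult matrix_vector_scaleR)
  qed
  ultimately show ?thesis by blast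
qed

lemma op_sqrt_psd:
  assumes "psd (A :: 'n::finite cop)"
  shows "psd (op_sqrt A)" "op_sqrt A ** op_sqrt A = A"
proof -
  have "\<exists>!B. psd B \<and> B ** B = A"
  proof -
    obtain B where B: "psd B" "B ** B = A" using psd_sqrt_exists[OF assms] by blast
    show ?thesis
    proof (rule ex1I[of _ B])
      show "C = B" if "psd C \<and> C ** C = A" for C
        using that B psd_sqrt_unique[of C B] by simp
    qed (use B in simp)
  qed
  from theI'[OF this] have "psd (op_sqrt A) \<and> op_sqrt A ** op_sqrt A = A"
    unfolding op_sqrt_def .
  then show "psd (op_sqrt A)" "op_sqrt A ** op_sqrt A = A"
    by (rule conjunct1, rule conjunct2)
qed

text \<open>\<open>X\<close> maps an eigenvector of \<open>A\<close> to zero or to an eigenvector of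
  \<open>B\<close> with the same eigenvalue, and both roots act there by the root of that
  eigenvalue.\<close>

lemma op_sqrt_intertwine:
  fixes A B X :: "'n::finite cop"
  assumes A: "psd A" and B: "psd B" and X: "B ** X = X ** A"
  shows "op_sqrt B ** X = X ** op_sqrt A"
proof -
  obtain \<psi> \<mu> where s: "orthonormal_basis \<psi>" "\<And>j. A *v \<psi> j = \<mu> j *\<^sub>R \<psi> j"
    using spectral_theorem[OF psd_hermitian[OF A]] by blast
  have \<mu>: "0 \<le> \<mu> j" for j using psd_eigenvalue[OF A s(2) orthonormal_nonzero[OF s(1)]] .
  show ?thesis
  proof (rule orthonormal_matrix_eqI[OF s(1)])
    fix j
    have a: "op_sqrt A *v \<psi> j = sqrt (\<mu> j) *\<^sub>R \<psi> j"
      using \<mu> by (intro psd_sqrt_eigenvector op_sqrt_psd A)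
        (simp_all add: matrix_vector_mul_assoc op_sqrt_psd(2)[OF A] s(2))
    have "B *v (X *v \<psi> j) = \<mu> j *\<^sub>R (X *v \<psi> j)"
      by (simp add: matrix_vector_mul_assoc X) (simp add: matrix_vector_mult_mult s(2) matrix_vector_scaleR)
    then have "op_sqrt B *v (X *v \<psi> j) = sqrt (\<mu> j) *\<^sub>R (X *v \<psi> j)"
      using \<mu> by (intro psd_sqrt_eigenvector op_sqrt_psd B)
        (simp_all add: matrix_vector_mul_assoc[of "op_sqrt B" "op_sqrt B"] op_sqrt_psd(2)[OF B])
    then show "(op_sqrt B ** X) *v \<psi> j = (X ** op_sqrt A) *v \<psi> j"
      by (simp add: matrix_vector_mult_mult a matrix_vector_scaleR)
  qed
qed

section \<open>The operator exponential\<close>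

lemma linear_matI:
  assumes "\<And>A B. f (A + B) = f A + f B" "\<And>c A. f (c *\<^sub>M A) = c *\<^sub>M f A"
  shows "bounded_linear (f :: 'n::finite cop \<Rightarrow> 'm::finite cop)"
proof -
  have "linear f" by (rule linearI) (simp_all add: assms scaleR_cscale)
  then show ?thesis by (simp add: linear_conv_bounded_linear)
qed

lemma bounded_linear_mult_left: "bounded_linear (\<lambda>A :: 'n::finite cop. A ** (B :: 'n cop))"
  by (rule linear_matI) (simp_all add: mtx_distrib mtx_scale)

lemma bounded_linear_mult_right: "bounded_linear (\<lambda>A :: 'n::finite cop. (B :: 'n cop) ** A)"
  by (rule linear_matI) (simp_all add: mtx_distrib mtx_scale)

lemma bounded_linear_cscale: "bounded_linear (\<lambda>A :: 'n::finite cop. c *\<^sub>M A)"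
  by (rule linear_matI) (simp_all add: mtx_scale mult.commute)

lemma bounded_linear_dagger: "bounded_linear (dagger :: 'n::finite cop \<Rightarrow> _)"
proof -
  have "linear (dagger :: 'n::finite cop \<Rightarrow> _)" by (rule linearI) (simp_all add: dagger_simps)
  then show ?thesis by (simp add: linear_conv_bounded_linear)
qed

lemma bounded_linear_mat_vec: "bounded_linear (\<lambda>A :: 'n::finite cop. A *v x)"
proof -
  have "linear (\<lambda>A :: 'n::finite cop. A *v x)" by (rule linearI) (simp_all add: mtx_vec)
  then show ?thesis by (simp add: linear_conv_bounded_linear)
qed

lemma bounded_linear_cinner: "bounded_linear (cinner (x :: complex^'n::finite))"
proof -
  have "linear (cinner x)" by (rule linearI) (simp_all add: cinner_simps scaleR_conv_of_real[where 'a=complex])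
  then show ?thesis by (simp add: linear_conv_bounded_linear)
qed

lemma bounded_linear_form: "bounded_linear (\<lambda>A :: 'n::finite cop. cinner x (A *v y))"
  by (rule bounded_linear_compose[OF bounded_linear_cinner bounded_linear_mat_vec])

lemma bounded_linear_tau: "bounded_linear (normalized_trace :: 'n::finite cop \<Rightarrow> complex)"
proof -
  have "linear (normalized_trace :: 'n::finite cop \<Rightarrow> complex)"
    by (rule linearI) (simp_all add: tau_linear scaleR_conv_of_real[where 'a=complex])
  then show ?thesis by (simp add: linear_conv_bounded_linear)
qed

lemma bounded_bilinear_mtx: "bounded_bilinear (\<lambda>(A :: 'n::finite cop) (B :: 'n cop). A ** B)"
proof -
  have "bilinear (\<lambda>(A :: 'n::finite cop) (B :: 'n cop). A ** B)"
    unfolding bilinear_def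
    by (intro conjI allI bounded_linear.linear[OF bounded_linear_mult_left] bounded_linear.linear[OF bounded_linear_mult_right])
  then show ?thesis by (simp add: bilinear_conv_bounded_bilinear)
qed

lemmas continuous_on_mtx_mult [continuous_intros] = bounded_bilinear.continuous_on[OF bounded_bilinear_mtx]
lemmas has_vector_derivative_mtx_mult = bounded_bilinear.has_vector_derivative[OF bounded_bilinear_mtx]
lemma tendsto_matI: "(\<And>i j. ((\<lambda>x. f x $ i $ j) \<longlongrightarrow> L $ i $ j) F) \<Longrightarrow> (f \<longlongrightarrow> (L :: 'n::finite cop)) F"
  by (intro vec_tendstoI) auto

lemma sums_matI: "(\<And>i j. (\<lambda>k. f k $ i $ j) sums (L $ i $ j)) \<Longrightarrow> f sums (L :: 'n::finite cop)"
  unfolding sums_def by (rule tendsto_matI) simp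

lemma has_vector_derivative_matI:
  fixes f :: "real \<Rightarrow> 'n::finite cop"
  assumes "\<And>i j. ((\<lambda>t. f t $ i $ j) has_vector_derivative (D $ i $ j)) (at t within S)"
  shows "(f has_vector_derivative D) (at t within S)"
  unfolding has_vector_derivative_def has_derivative_def
proof
  show "bounded_linear (\<lambda>x. x *\<^sub>R D)" by (rule bounded_linear_scaleR_left)
  show "((\<lambda>y. (f y - f (Lim (at t within S) (\<lambda>x. x)) - (y - Lim (at t within S) (\<lambda>x. x)) *\<^sub>R D) /\<^sub>R
      norm (y - Lim (at t within S) (\<lambda>x. x))) \<longlongrightarrow> 0) (at t within S)"
    using assms unfolding has_vector_derivative_def has_derivative_def
    by (intro tendsto_matI) simp
qed

lemma op_power_0 [simp]: "op_power A 0 = mat 1"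
  by (simp add: op_power_def)

lemma op_power_Suc [simp]: "op_power A (Suc k) = A ** op_power A k"
  by (simp add: op_power_def)

text \<open>The sum of the moduli of all entries serves as a crude submultiplicative norm, enough
  for comparison with a scalar exponential series.\<close>

lemma op_power_bound: "cmod (op_power A k $ i $ j) \<le> (\<Sum>a\<in>UNIV. \<Sum>b\<in>UNIV. cmod (A $ a $ b)) ^ k"
proof (induction k arbitrary: i j)
  case 0
  then show ?case by (simp add: mat_def)
next
  case (Suc k)
  let ?c = "\<Sum>a\<in>UNIV. \<Sum>b\<in>UNIV. cmod (A $ a $ b)"
  have c: "0 \<le> ?c" by (intro sum_nonneg) simp
  have "cmod (op_power A (Suc k) $ i $ j) \<le> (\<Sum>l\<in>UNIV. cmod (A $ i $ l) * cmod (op_power A k $ l $ j))"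
    by (simp add: matrix_mult_nth) (metis (no_types, lifting) norm_mult norm_sum sum.cong)
  also have "\<dots> \<le> (\<Sum>l\<in>UNIV. cmod (A $ i $ l) * ?c ^ k)"
    by (intro sum_mono mult_left_mono Suc.IH) simp
  also have "\<dots> = (\<Sum>l\<in>UNIV. cmod (A $ i $ l)) * ?c ^ k" by (simp add: sum_distrib_right)
  also have "\<dots> \<le> ?c * ?c ^ k"
    using c by (intro mult_right_mono member_le_sum[of i UNIV "\<lambda>i. \<Sum>l\<in>UNIV. cmod (A $ i $ l)"]) (auto intro: sum_nonneg)
  finally show ?case by simp
qed

lemma op_power_cscale: "op_power (c *\<^sub>M A) k = c ^ k *\<^sub>M op_power A k"
  by (induction k) (simp_all add: mtx_scale mult.commute)

text \<open>With a complex variable \<open>z\<close>, each entry of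
  \<open>op_exp (z *\<^sub>M A)\<close> is an everywhere convergent power series, so that the
  derivative later comes from termwise differentiation of scalar series.\<close>

lemma summable_op_power: "summable (\<lambda>k. op_power A k $ i $ j / fact k * z ^ k)"
proof (rule summable_comparison_test)
  let ?c = "\<Sum>a\<in>UNIV. \<Sum>b\<in>UNIV. cmod (A $ a $ b)"
  show "summable (\<lambda>k. (cmod z * ?c) ^ k /\<^sub>R fact k)" by (rule summable_exp_generic)
  have "cmod (op_power A k $ i $ j / fact k * z ^ k) \<le> (cmod z * ?c) ^ k /\<^sub>R fact k" for k
    using mult_right_mono[OF op_power_bound[of A k i j], of "cmod z ^ k / fact k"]
    by (simp add: norm_mult norm_divide norm_power power_mult_distrib divide_inverse norm_inverse mult_ac)
  then show "\<exists>N. \<forall>k\<ge>N. cmod (op_power A k $ i $ j / fact k * z ^ k) \<le> (cmod z * ?c) ^ k /\<^sub>R fact k"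
    by blast
qed

lemma op_exp_nth_cscale: "op_exp (z *\<^sub>M A) $ i $ j = (\<Sum>k. op_power A k $ i $ j / fact k * z ^ k)"
  and op_exp_sums: "(\<lambda>k. op_power A k /\<^sub>R fact k) sums op_exp A"
proof -
  have s: "(\<lambda>k. op_power (z *\<^sub>M A) k /\<^sub>R fact k) sums (\<chi> i j. \<Sum>k. op_power A k $ i $ j / fact k * z ^ k)" for z
  proof (rule sums_matI)
    fix i j
    have "(\<lambda>k. (op_power (z *\<^sub>M A) k /\<^sub>R fact k) $ i $ j) = (\<lambda>k. op_power A k $ i $ j / fact k * z ^ k)"
      by (simp add: op_power_cscale scaleR_conv_of_real[where 'a=complex] divide_inverse mult_ac)
    then show "(\<lambda>k. (op_power (z *\<^sub>M A) k /\<^sub>R fact k) $ i $ j) sums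
        ((\<chi> i j. \<Sum>k. op_power A k $ i $ j / fact k * z ^ k) $ i $ j)"
      using summable_sums[OF summable_op_power] by simp
  qed
  have e: "op_exp (z *\<^sub>M A) = (\<chi> i j. \<Sum>k. op_power A k $ i $ j / fact k * z ^ k)" for z
    unfolding op_exp_def by (rule sums_unique[OF s, symmetric])
  show "op_exp (z *\<^sub>M A) $ i $ j = (\<Sum>k. op_power A k $ i $ j / fact k * z ^ k)"
    by (simp add: e)
  show "(\<lambda>k. op_power A k /\<^sub>R fact k) sums op_exp A"
    using s[of 1, folded e] by simp
qed

lemma op_exp_intertwine:
  fixes A B X :: "'n::finite cop"
  assumes "B ** X = X ** A"
  shows "op_exp B ** X = X ** op_exp A"
proof -
  have p: "op_power B k ** X = X ** op_power A k" for k
  proof (induction k)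
    case (Suc k)
    have "op_power B (Suc k) ** X = B ** (op_power B k ** X)" by (simp add: mtx_assoc)
    also have "\<dots> = (B ** X) ** op_power A k" by (simp add: Suc mtx_assoc)
    also have "\<dots> = X ** op_power A (Suc k)" by (simp add: assms mtx_assoc)
    finally show ?case .
  qed simp
  have "(\<lambda>k. (op_power B k /\<^sub>R fact k) ** X) sums (op_exp B ** X)"
    by (rule bounded_linear.sums[OF bounded_linear_mult_left op_exp_sums])
  moreover have "(\<lambda>k. X ** (op_power A k /\<^sub>R fact k)) sums (X ** op_exp A)"
    by (rule bounded_linear.sums[OF bounded_linear_mult_right op_exp_sums])
  ultimately show ?thesis
    unfolding scaleR_mult_left scaleR_mult_right p by (rule sums_unique2)
qed

lemma op_exp_dagger: "dagger (op_exp A) = op_exp (dagger (A :: 'n::finite cop))"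
proof -
  have comm: "op_power B k ** B = B ** op_power B k" for B :: "'n cop" and k
    by (induction k) (simp_all add: mtx_assoc)
  have p: "dagger (op_power A k) = op_power (dagger A) k" for k
    by (induction k) (simp_all add: dagger_mult comm)
  have "(\<lambda>k. dagger (op_power A k /\<^sub>R fact k)) sums (dagger (op_exp A))"
    by (rule bounded_linear.sums[OF bounded_linear_dagger op_exp_sums])
  then show ?thesis
    unfolding dagger_scaleR p using op_exp_sums by (rule sums_unique2)
qed

lemma op_exp_eigenvector:
  fixes A :: "'n::finite cop"
  assumes "A *v x = c *s x"
  shows "op_exp A *v x = exp c *s x"
proof -
  have p: "op_power A k *v x = c ^ k *s x" for k
    by (induction k) (simp_all add: mtx_vec assms vec_scale_simps mult.commute)
  have "(\<lambda>k. (op_power A k /\<^sub>R fact k) *v x) sums (op_exp A *v x)"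
    by (rule bounded_linear.sums[OF bounded_linear_mat_vec op_exp_sums])
  moreover have "(\<lambda>k. (op_power A k /\<^sub>R fact k) *v x) = (\<lambda>k. (c ^ k /\<^sub>R fact k) *s x)"
    by (rule ext) (simp add: mtx_vec p vec_eq_iff scaleR_conv_of_real[where 'a=complex])
  moreover have "(\<lambda>k. (c ^ k /\<^sub>R fact k) *s x) sums (exp c *s x)"
  proof -
    have "linear (\<lambda>z. z *s x)"
      by (rule linearI) (simp_all add: vec_eq_iff algebra_simps scaleR_conv_of_real[where 'a=complex])
    then have "bounded_linear (\<lambda>z. z *s x)" by (simp add: linear_conv_bounded_linear)
    from bounded_linear.sums[OF this exp_converges] show ?thesis .
  qed
  ultimately show ?thesis using sums_unique2 by metis
qed

lemma op_exp_derivative: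
  fixes A :: "'n::finite cop"
  shows "((\<lambda>t. op_exp (t *\<^sub>R A)) has_vector_derivative A ** op_exp (t *\<^sub>R A)) (at t within S)"
proof (rule has_vector_derivative_matI)
  fix i j
  let ?c = "\<lambda>k. op_power A k $ i $ j / fact k"
  \<comment> \<open>Differentiation shifts the coefficients, and the factor \<open>Suc k\<close>
    cancels against \<open>fact (Suc k)\<close>, which leaves one factor \<open>A\<close> in
    front.\<close>
  have "diffs ?c = (\<lambda>k. \<Sum>l\<in>UNIV. A $ i $ l * (op_power A k $ l $ j / fact k))"
    by (rule ext) (simp add: diffs_def matrix_mult_nth sum_divide_distrib[symmetric] del: of_nat_Suc)
  then have "(\<Sum>k. diffs ?c k * z ^ k) = (\<Sum>k. \<Sum>l\<in>UNIV. A $ i $ l * (op_power A k $ l $ j / fact k * z ^ k))" for z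
    by (simp add: sum_distrib_right mult.assoc)
  also have "\<dots> z = (\<Sum>l\<in>UNIV. \<Sum>k. A $ i $ l * (op_power A k $ l $ j / fact k * z ^ k))" for z
    by (intro suminf_sum summable_mult summable_op_power)
  also have "\<dots> z = (A ** op_exp (z *\<^sub>M A)) $ i $ j" for z
    unfolding matrix_mult_nth op_exp_nth_cscale suminf_mult[OF summable_op_power] ..
  finally have "(\<Sum>k. diffs ?c k * z ^ k) = (A ** op_exp (z *\<^sub>M A)) $ i $ j" for z .
  then have "((\<lambda>z. op_exp (z *\<^sub>M A) $ i $ j) has_field_derivative (A ** op_exp (z *\<^sub>M A)) $ i $ j) (at z)" for z
    using termdiffs_strong_converges_everywhere[OF summable_op_power[of A i j], of z]
    by (simp add: op_exp_nth_cscale)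
  from has_vector_derivative_real_field[OF this]
  show "((\<lambda>t. op_exp (t *\<^sub>R A) $ i $ j) has_vector_derivative (A ** op_exp (t *\<^sub>R A)) $ i $ j) (at t within S)"
    by (simp add: scaleR_cscale)
qed

lemma op_exp_zero [simp]: "op_exp (0 :: 'n::finite cop) = mat 1"
proof -
  have "(\<Sum>k. op_power A k $ i $ j / fact k * 0 ^ k) = op_power A 0 $ i $ j / fact 0" for A :: "'n cop" and i j
    by (rule powser_zero)
  then show ?thesis
    using op_exp_nth_cscale[of 0 "0 :: 'n cop"] by (intro mat_eqI) simp
qed

text \<open>By differentiation \<open>E (- s) ** E (s + t)\<close> does not depend on
  \<open>s\<close>. The case \<open>t = 0\<close> shows that \<open>E s\<close> and
  \<open>E (- s)\<close> are inverse to each other, which allows solving for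
  \<open>E (s + t)\<close>.\<close>

lemma op_exp_add:
  fixes A :: "'n::finite cop"
  shows "op_exp ((s + t) *\<^sub>R A) = op_exp (s *\<^sub>R A) ** op_exp (t *\<^sub>R A)"
proof -
  define E where "E t = op_exp (t *\<^sub>R A)" for t
  have D: "(E has_vector_derivative A ** E t) (at t within S)" for t S
    unfolding E_def by (rule op_exp_derivative)
  have c: "A ** E t = E t ** A" for t
    unfolding E_def by (rule op_exp_intertwine[symmetric]) (simp add: scaleR_mult_left scaleR_mult_right)
  have const: "E (- s) ** E (s + t) = E t" for s t
  proof -
    have D1: "((\<lambda>s. E (- s)) has_vector_derivative - (E (- s) ** A)) (at s within UNIV)" for s
      using vector_diff_chain_within[OF has_vector_derivative_minus[OF has_vector_derivative_id] D, of s UNIV]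
      by (simp add: o_def c)
    have D2: "((\<lambda>s. E (s + t)) has_vector_derivative A ** E (s + t)) (at s within UNIV)" for s
      using vector_diff_chain_within[OF has_vector_derivative_add[OF has_vector_derivative_id has_vector_derivative_const] D, of t s UNIV]
      by (simp add: o_def)
    have "((\<lambda>s. E (- s) ** E (s + t)) has_vector_derivative 0) (at s within UNIV)" for s
      using has_vector_derivative_mtx_mult[OF D1[of s] D2[of s]] by (simp add: mtx_distrib mtx_assoc)
    then obtain C where C: "\<And>s. E (- s) ** E (s + t) = C"
      using has_vector_derivative_zero_constant[of UNIV "\<lambda>s. E (- s) ** E (s + t)"] by auto
    show ?thesis using C[of s] C[of 0] by (simp add: E_def)
  qed
  have inv: "E s ** E (- s) = mat 1" for s
    using const[of "- s" 0] by (simp add: E_def)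
  have "E s ** (E (- s) ** E (s + t)) = E (s + t)"
    unfolding matrix_mul_assoc inv by simp
  then show ?thesis using const by (simp add: E_def)
qed

lemma op_exp_minus:
  fixes A :: "'n::finite cop"
  shows "op_exp (- A) ** op_exp A = mat 1" "op_exp A ** op_exp (- A) = mat 1"
  using op_exp_add[of "- 1" 1 A] op_exp_add[of 1 "- 1" A] by simp_all

lemma op_exp_derivative_right:
  fixes A :: "'n::finite cop"
  shows "((\<lambda>t. op_exp (t *\<^sub>R A)) has_vector_derivative op_exp (t *\<^sub>R A) ** A) (at t within S)"
  using op_exp_derivative[of A t S] op_exp_intertwine[of "t *\<^sub>R A" A "t *\<^sub>R A"]
  by (simp add: scaleR_mult_left scaleR_mult_right)

lemma op_exp_minus_derivative:
  fixes A :: "'n::finite cop"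
  shows "((\<lambda>t. op_exp (- (t *\<^sub>R A))) has_vector_derivative - (op_exp (- (t *\<^sub>R A)) ** A)) (at t within S)"
  using op_exp_derivative_right[of "- A" t S] by (simp add: matrix_neg_right)

text \<open>The variation of constants trick, in the form of uniqueness for \<open>X' = BX + XC\<close>.\<close>

lemma linear_ode_unique:
  fixes X :: "real \<Rightarrow> 'n::finite cop"
  assumes "\<And>t. 0 \<le> t \<Longrightarrow> (X has_vector_derivative B ** X t + X t ** C) (at t within {0..})" and "0 \<le> t"
  shows "X t = op_exp (t *\<^sub>R B) ** X 0 ** op_exp (t *\<^sub>R C)"
proof -
  define F where "F t = op_exp (- (t *\<^sub>R B)) ** X t ** op_exp (- (t *\<^sub>R C))" for t
  have cC: "op_exp (- (t *\<^sub>R C)) ** C = C ** op_exp (- (t *\<^sub>R C))" for t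
    by (rule op_exp_intertwine) (simp add: mtx_distrib scaleR_mult_left scaleR_mult_right)
  have "(F has_vector_derivative 0) (at t within {0..})" if "0 \<le> t" for t
    unfolding F_def
    using has_vector_derivative_mtx_mult[OF has_vector_derivative_mtx_mult[OF op_exp_minus_derivative assms(1)[OF that]]
        op_exp_minus_derivative, of B C]
    by (simp add: mtx_distrib mtx_assoc cC)
  then obtain K where K: "\<And>t. 0 \<le> t \<Longrightarrow> F t = K"
    using has_vector_derivative_zero_constant[of "{0..}" F] by auto
  have "F t = F 0" using K assms(2) by simp
  then have "op_exp (t *\<^sub>R B) ** F t ** op_exp (t *\<^sub>R C) = op_exp (t *\<^sub>R B) ** X 0 ** op_exp (t *\<^sub>R C)"
    by (simp add: F_def)
  moreover have "op_exp (t *\<^sub>R B) ** F t ** op_exp (t *\<^sub>R C)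
      = (op_exp (t *\<^sub>R B) ** op_exp (- (t *\<^sub>R B))) ** X t ** (op_exp (- (t *\<^sub>R C)) ** op_exp (t *\<^sub>R C))"
    by (simp add: F_def mtx_assoc)
  ultimately show ?thesis by (simp add: op_exp_minus)
qed

text \<open>With the exponents scaled by \<open>t\<close>, the right side solves
  \<open>X' = (A + c) X\<close> with value one at zero; that solution is unique, and
  \<open>t = 1\<close> is the claim.\<close>

lemma op_exp_scalar_shift:
  fixes A :: "'n::finite cop"
  shows "op_exp (A + c *\<^sub>M mat 1) = exp c *\<^sub>M op_exp A"
proof -
  define X where "X t = exp (t *\<^sub>R c) *\<^sub>M op_exp (t *\<^sub>R A)" for t :: real
  have "(X has_vector_derivative (A + c *\<^sub>M mat 1) ** X t + X t ** 0) (at t within {0..})" if "0 \<le> t" for t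
  proof (rule has_vector_derivative_matI)
    fix i j
    have 1: "((\<lambda>t. op_exp (t *\<^sub>R A) $ i $ j) has_vector_derivative (A ** op_exp (t *\<^sub>R A)) $ i $ j) (at t within {0..})"
      by (rule bounded_linear.has_vector_derivative[OF _ op_exp_derivative])
        (intro bounded_linear_compose[OF bounded_linear_vec_nth] bounded_linear_vec_nth)
    have 2: "((\<lambda>t. exp (t *\<^sub>R c)) has_vector_derivative exp (t *\<^sub>R c) * c) (at t within {0..})"
      by (rule exp_scaleR_has_vector_derivative_right)
    show "((\<lambda>t. X t $ i $ j) has_vector_derivative ((A + c *\<^sub>M mat 1) ** X t + X t ** 0) $ i $ j) (at t within {0..})"
      using has_vector_derivative_mult[OF 2 1]
      by (simp add: X_def mtx_distrib mtx_scale algebra_simps)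
  qed
  from linear_ode_unique[OF this, of 1]
  show ?thesis by (simp add: X_def)
qed


section \<open>Contractions\<close>

lemma contraction_iff: "contraction S \<longleftrightarrow> (\<forall>v. norm (S *v v) \<le> norm v)" for S :: "'n::finite cop"
proof
  assume "contraction S"
  then have "onorm ((*v) S) \<le> 1" by (simp add: contraction_def)
  then show "\<forall>v. norm (S *v v) \<le> norm v"
    using onorm[OF matrix_vector_mul_bounded_linear, of S] by (metis mult_right_mono mult_1 norm_ge_zero order_trans)
next
  assume "\<forall>v. norm (S *v v) \<le> norm v"
  then show "contraction S"
    unfolding contraction_def by (intro onorm_bound) auto
qed

lemma contraction_imp_psd:
  fixes S :: "'n::finite cop"
  assumes "contraction S"
  shows "psd (mat 1 - dagger S ** S)" "psd (mat 1 - S ** dagger S)"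
proof -
  have key: "psd (mat 1 - dagger X ** X)" if "\<And>v. norm (X *v v) \<le> norm v" for X :: "'n cop"
    unfolding psd_iff
  proof (intro conjI allI)
    show "dagger (mat 1 - dagger X ** X) = mat 1 - dagger X ** X" by (simp add: dagger_simps)
    fix v
    have "Re (cinner v ((mat 1 - dagger X ** X) *v v)) = (norm v)\<^sup>2 - (norm (X *v v))\<^sup>2"
      by (simp add: mtx_vec cinner_simps cinner_dagger[of _ "dagger X"] cinner_same)
    then show "0 \<le> Re (cinner v ((mat 1 - dagger X ** X) *v v))"
      using power_mono[OF that[of v]] by simp
  qed
  have S: "norm (S *v v) \<le> norm v" for v using assms by (simp add: contraction_iff)
  \<comment> \<open>Contractivity passes to the adjoint: the square of
    \<open>norm (dagger S *v v)\<close> is the inner product of \<open>v\<close> with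
    \<open>S *v (dagger S *v v)\<close>, to which Cauchy-Schwarz applies.\<close>
  have "norm (dagger S *v v) \<le> norm v" for v
  proof (cases "dagger S *v v = 0")
    case False
    define w where "w = dagger S *v v"
    have "(norm w)\<^sup>2 = Re (cinner v (S *v w))"
      using cinner_same[of w] by (simp add: w_def cinner_dagger)
    also have "\<dots> \<le> norm v * norm (S *v w)"
      using cinner_cauchy[of v "S *v w"] abs_Re_le_cmod order_trans abs_le_D1 by meson
    also have "\<dots> \<le> norm v * norm w" using S by (intro mult_left_mono) auto
    finally show ?thesis using False by (simp add: power2_eq_square w_def)
  qed simp
  then show "psd (mat 1 - dagger S ** S)" "psd (mat 1 - S ** dagger S)"
    using key[of S] key[of "dagger S"] S by simp_all
qed

section \<open>CAR fields\<close>

text \<open>A product of creation operators. Its adjoint is a product of annihilators in reverse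
  order, so \<open>cre Z fs ** dagger (cre Z gs)\<close> is a normally ordered monomial, and applied
  to the vacuum \<open>cre Z fs\<close> gives a Fock vector.\<close>

definition cre :: "(complex ^ 'n \<Rightarrow> 'k::finite cop) \<Rightarrow> (complex ^ 'n) list \<Rightarrow> 'k cop" where
  "cre Z fs = foldr (\<lambda>f M. dagger (Z f) ** M) fs (mat 1)"

lemma cre_Nil [simp]: "cre Z [] = mat 1"
  by (simp add: cre_def)

lemma cre_Cons [simp]: "cre Z (f # fs) = dagger (Z f) ** cre Z fs"
  by (simp add: cre_def)

lemma cre_append: "cre Z (fs @ gs) = cre Z fs ** cre Z gs"
  by (induction fs) (simp_all add: mtx_assoc)

inductive_set normal_words :: "(complex ^ 'n \<Rightarrow> 'k::finite cop) \<Rightarrow> 'k cop set" for Z where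
  word: "cre Z fs ** dagger (cre Z gs) \<in> normal_words Z"
| add: "X \<in> normal_words Z \<Longrightarrow> Y \<in> normal_words Z \<Longrightarrow> X + Y \<in> normal_words Z"
| scale: "X \<in> normal_words Z \<Longrightarrow> c *\<^sub>M X \<in> normal_words Z"

definition parity_op :: "(complex ^ 'n::finite \<Rightarrow> 'k::finite cop) \<Rightarrow> 'k cop" where
  "parity_op Z = op_exp ((\<i> * pi) *\<^sub>M number_op Z)"

lemma subspace_preimage: "vec.subspace V \<Longrightarrow> vec.subspace {x. (A :: 'k::finite cop) *v x \<in> V}"
  by (auto simp: vec.subspace_def mtx_vec)

lemma subspace_kernel: "vec.subspace {x. (A :: 'k::finite cop) *v x = B *v x}"
  by (auto simp: vec.subspace_def mtx_vec)

lemma ketbra_linear: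
  "ketbra (x + y) z = ketbra x z + ketbra y z" "ketbra z (x + y) = ketbra z x + ketbra z y"
  "ketbra (c *s x) z = c *\<^sub>M ketbra x z" "ketbra z (c *s x) = cnj c *\<^sub>M ketbra z x"
  "ketbra 0 z = 0" "ketbra z 0 = 0"
  by (auto intro!: mat_eqI simp: algebra_simps)

lemma matrix_ketbra_sum: "A = (\<Sum>j\<in>UNIV. ketbra (A *v axis j 1) (axis j 1))" for A :: "'k::finite cop"
  unfolding mult_ketbra[symmetric] matrix_sum_right[symmetric]
  by (simp add: orthonormal_basis_completeness[OF orthonormal_basis_axis])

section \<open>Algebraic consequences of the anticommutation relations\<close>

locale car =
  fixes Z :: "complex ^ 'n::finite \<Rightarrow> 'k::finite cop"
  assumes car: "CAR_field Z"
begin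

abbreviation "Zd \<psi> \<equiv> dagger (Z \<psi>)"

lemma Z_add: "Z (\<psi> + \<phi>) = Z \<psi> + Z \<phi>"
  and Z_scale: "Z (c *s \<psi>) = cnj c *\<^sub>M Z \<psi>"
  using car by (auto simp: CAR_field_def)

lemma Zd_Z_anti: "Z \<psi> ** Zd \<phi> = cinner \<psi> \<phi> *\<^sub>M mat 1 - Zd \<phi> ** Z \<psi>"
  using car by (simp add: CAR_field_def eq_diff_eq)

lemma Z_anti: "Z \<psi> ** Z \<phi> = - (Z \<phi> ** Z \<psi>)"
  using car by (simp add: CAR_field_def eq_neg_iff_add_eq_0)

lemma Zd_anti: "Zd \<psi> ** Zd \<phi> = - (Zd \<phi> ** Zd \<psi>)"
  using arg_cong[OF Z_anti[of \<phi> \<psi>], of dagger] by (simp add: dagger_simps)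

lemma Z_zero [simp]: "Z 0 = 0"
  using Z_scale[of 0 0] by (simp add: vec_scale_simps)

lemma Z_minus: "Z (- \<psi>) = - Z \<psi>"
  using Z_scale[of "-1" \<psi>] by (simp add: cscale_minus_left)

lemma Z_diff: "Z (\<psi> - \<phi>) = Z \<psi> - Z \<phi>"
  using Z_add[of \<psi> "- \<phi>"] by (simp add: Z_minus)

lemma Z_scaleR: "Z (r *\<^sub>R \<psi>) = r *\<^sub>R Z \<psi>"
proof -
  have "r *\<^sub>R \<psi> = of_real r *s \<psi>" by (simp add: vec_eq_iff scaleR_conv_of_real[where 'a=complex])
  then show ?thesis by (simp add: Z_scale scaleR_cscale)
qed

lemma Z_sum: "Z (sum f S) = (\<Sum>i\<in>S. Z (f i))"
  by (induction S rule: infinite_finite_induct) (simp_all add: Z_add)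

lemmas Z_simps = Z_add Z_scale Z_minus Z_diff Z_scaleR Z_sum

lemma Z_square [simp]: "Z \<psi> ** Z \<psi> = 0"
proof -
  have "2 *\<^sub>R (Z \<psi> ** Z \<psi>) = 0" using Z_anti[of \<psi> \<psi>] by (simp add: scaleR_2 eq_neg_iff_add_eq_0)
  then show ?thesis by simp
qed

lemma Zd_square [simp]: "Zd \<psi> ** Zd \<psi> = 0"
  using arg_cong[OF Z_square[of \<psi>], of dagger] unfolding dagger_mult by simp

lemma bounded_linear_Z: "bounded_linear Z"
proof -
  have "linear Z" by (rule linearI) (simp_all add: Z_simps)
  then show ?thesis by (simp add: linear_conv_bounded_linear)
qed

lemma Z_expand: "Z \<psi> = (\<Sum>j\<in>UNIV. cnj (cinner (\<phi> j) \<psi>) *\<^sub>M Z (\<phi> j))" if "orthonormal_basis \<phi>"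
  by (subst orthonormal_basis_expand[OF that, of \<psi>]) (simp add: Z_simps)

abbreviation "N \<equiv> number_op Z"

lemma N_hermitian: "dagger N = N"
  by (simp add: number_op_def dagger_simps)

lemma N_Z: "N ** Z \<psi> = Z \<psi> ** N - Z \<psi>"
proof -
  have "N ** Z \<psi> = (\<Sum>j\<in>UNIV. Z \<psi> ** Zd (axis j 1) ** Z (axis j 1) - cnj (cinner (axis j 1) \<psi>) *\<^sub>M Z (axis j 1))"
    unfolding number_op_def matrix_sum_left
  proof (rule sum.cong[OF refl])
    fix j
    have "Zd (axis j 1) ** Z (axis j 1) ** Z \<psi> = - (Zd (axis j 1) ** Z \<psi> ** Z (axis j 1))"
      by (simp add: mtx_assoc Z_anti[of "axis j 1" \<psi>] mtx_distrib)
    also have "\<dots> = Z \<psi> ** Zd (axis j 1) ** Z (axis j 1) - cnj (cinner (axis j 1) \<psi>) *\<^sub>M Z (axis j 1)"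
      by (simp add: Zd_Z_anti mtx_distrib mtx_scale)
    finally show "Zd (axis j 1) ** Z (axis j 1) ** Z \<psi> =
      Z \<psi> ** Zd (axis j 1) ** Z (axis j 1) - cnj (cinner (axis j 1) \<psi>) *\<^sub>M Z (axis j 1)" .
  qed
  also have "\<dots> = Z \<psi> ** N - (\<Sum>j\<in>UNIV. cnj (cinner (axis j 1) \<psi>) *\<^sub>M Z (axis j 1))"
    by (simp add: sum_subtractf number_op_def matrix_sum_right mtx_assoc)
  also have "\<dots> = Z \<psi> ** N - Z \<psi>"
    using Z_expand[OF orthonormal_basis_axis, of \<psi>] by simp
  finally show ?thesis .
qed

lemma N_Zd: "N ** Zd \<psi> = Zd \<psi> ** N + Zd \<psi>"
  using arg_cong[OF N_Z[of \<psi>], of dagger] by (simp add: dagger_simps N_hermitian)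

text \<open>Moving \<open>Z \<psi>\<close> across \<open>N\<close> shifts \<open>N\<close> by one,
  so the exponential picks up a scalar. This is the gauge action on the field; at angle
  \<open>pi\<close> it is the parity sign.\<close>

lemma exp_N_Z: "op_exp (c *\<^sub>M N) ** Z \<psi> = exp (- c) *\<^sub>M (Z \<psi> ** op_exp (c *\<^sub>M N))"
proof -
  have "op_exp (c *\<^sub>M N) ** Z \<psi> = Z \<psi> ** op_exp (c *\<^sub>M N + (- c) *\<^sub>M mat 1)"
    by (rule op_exp_intertwine) (simp add: mtx_scale mtx_distrib N_Z)
  then show ?thesis unfolding op_exp_scalar_shift by (simp add: mtx_scale)
qed

lemma exp_N_Zd: "op_exp (c *\<^sub>M N) ** Zd \<psi> = exp c *\<^sub>M (Zd \<psi> ** op_exp (c *\<^sub>M N))"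
proof -
  have "op_exp (c *\<^sub>M N) ** Zd \<psi> = Zd \<psi> ** op_exp (c *\<^sub>M N + c *\<^sub>M mat 1)"
    by (rule op_exp_intertwine) (simp add: mtx_scale mtx_distrib N_Zd)
  then show ?thesis unfolding op_exp_scalar_shift by (simp add: mtx_scale)
qed

abbreviation "W \<equiv> parity_op Z"

lemma W_Z: "W ** Z \<psi> = - (Z \<psi> ** W)" and W_Zd: "W ** Zd \<psi> = - (Zd \<psi> ** W)"
  using exp_N_Z[of "\<i> * pi" \<psi>] exp_N_Zd[of "\<i> * pi" \<psi>]
  by (simp_all add: parity_op_def exp_minus cscale_minus_left)

text \<open>The modes are emptied one at a time: if \<open>Z (axis i 1)\<close> does not annihilate
  \<open>v\<close>, its image does the job, since the operator squares to zero and anticommutes with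
  those of the modes emptied before.\<close>

lemma vacuum_exists: "\<exists>v. norm v = 1 \<and> (\<forall>\<psi>. Z \<psi> *v v = 0)"
proof -
  have "\<exists>v. v \<noteq> 0 \<and> (\<forall>j\<in>S. Z (axis j 1) *v v = 0)" for S :: "'n set"
    using finite[of S]
  proof (induction S rule: finite_induct)
    case empty
    have "axis undefined (1::complex) \<noteq> 0" by (simp add: axis_eq_0_iff)
    then show ?case by blast
  next
    case (insert i S)
    then obtain v where v: "v \<noteq> 0" "\<forall>j\<in>S. Z (axis j 1) *v v = 0" by blast
    show ?case
    proof (cases "Z (axis i 1) *v v = 0")
      case False
      have "Z (axis i 1) *v (Z (axis i 1) *v v) = 0"
        by (simp add: matrix_vector_mul_assoc)
      moreover have "Z (axis j 1) *v (Z (axis i 1) *v v) = 0" if "j \<in> S" for j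
        using v that Z_anti[of "axis j 1" "axis i 1"]
        by (simp add: matrix_vector_mul_assoc) (simp add: mtx_vec)
      ultimately show ?thesis using False by blast
    qed (use v in blast)
  qed
  from this[of UNIV] obtain v where v: "v \<noteq> 0" "\<And>j. Z (axis j 1) *v v = 0" by blast
  have "Z \<psi> *v v = 0" for \<psi>
    using Z_expand[OF orthonormal_basis_axis, of \<psi>] v(2) by (simp add: mtx_vec)
  then have "norm ((1 / norm v) *\<^sub>R v) = 1 \<and> (\<forall>\<psi>. Z \<psi> *v ((1 / norm v) *\<^sub>R v) = 0)"
    using v(1) by (simp add: mtx_vec)
  then show ?thesis by blast
qed

definition vac where "vac = (SOME v. norm v = 1 \<and> (\<forall>\<psi>. Z \<psi> *v v = 0))"

lemma vac: "norm vac = 1" "Z \<psi> *v vac = 0" "cinner vac vac = 1"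
  using someI_ex[OF vacuum_exists] by (auto simp: vac_def[symmetric] cinner_same)

abbreviation "fock fs \<equiv> cre Z fs *v vac"

lemma fock_Cons: "fock (f # fs) = Zd f *v fock fs"
  by (simp add: mtx_vec)

lemma N_fock: "N *v fock fs = of_nat (length fs) *s fock fs"
proof (induction fs)
  case Nil
  show ?case by (simp add: number_op_def mtx_vec vac)
next
  case (Cons f fs)
  have "N *v fock (f # fs) = (N ** Zd f) *v fock fs" by (simp add: mtx_vec)
  also have "\<dots> = of_nat (length (f # fs)) *s fock (f # fs)"
    unfolding N_Zd fock_Cons by (simp add: mtx_vec Cons vec_scale_simps)
  finally show ?case .
qed

lemma W_fock: "W *v fock fs = (- 1) ^ length fs *s fock fs"
proof -
  have "((\<i> * pi) *\<^sub>M N) *v fock fs = (of_nat (length fs) * (\<i> * pi)) *s fock fs"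
    by (simp add: mtx_vec N_fock vec_scale_simps mult_ac)
  from op_exp_eigenvector[OF this] show ?thesis
    by (simp add: parity_op_def exp_of_nat_mult)
qed

end

section \<open>Fock vectors, generation of the algebra and normal ordering\<close>

locale irreducible_car = car Z for Z :: "complex ^ 'n::finite \<Rightarrow> 'k::finite cop" +
  assumes irreducible: "acts_irreducibly Z"
begin

lemma fock_span: "vec.span (range fock) = UNIV"
proof -
  let ?V = "vec.span (range fock)"
  have sub: "vec.subspace ?V" by (rule vec.subspace_span)
  have base: "fock fs \<in> ?V" for fs by (rule vec.span_base) simp
  have base': "Zd f *v fock fs \<in> ?V" for f fs using base[of "f # fs"] by (simp add: mtx_vec)
  \<comment> \<open>Invariance under annihilators is the nontrivial half: \<open>Z \<psi>\<close> is
    exchanged with the leading creator, which leaves a contraction and a shorter Fock vector to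
    treat.\<close>
  have Zfock: "Z \<psi> *v fock fs \<in> ?V" for \<psi> fs
  proof (induction fs)
    case Nil
    then show ?case by (simp add: vac vec.span_zero)
  next
    case (Cons f fs)
    have "Z \<psi> *v fock (f # fs) = (Z \<psi> ** Zd f) *v fock fs" by (simp add: mtx_vec)
    also have "\<dots> = cinner \<psi> f *s fock fs - Zd f *v (Z \<psi> *v fock fs)"
      unfolding Zd_Z_anti by (simp add: mtx_vec)
    finally have e: "Z \<psi> *v fock (f # fs) = cinner \<psi> f *s fock fs - Zd f *v (Z \<psi> *v fock fs)" .
    have "?V \<subseteq> {x. Zd f *v x \<in> ?V}"
      by (rule vec.span_minimal[OF _ subspace_preimage[OF sub]]) (auto intro: base')
    then have "Zd f *v (Z \<psi> *v fock fs) \<in> ?V" using Cons by blast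
    then show ?case unfolding e by (intro vec.span_diff vec.span_scale base)
  qed
  have "?V \<subseteq> {x. Z \<psi> *v x \<in> ?V}" "?V \<subseteq> {x. Zd \<psi> *v x \<in> ?V}" for \<psi>
    by (rule vec.span_minimal[OF _ subspace_preimage[OF sub]];
        auto intro: base' Zfock)+
  then have "\<forall>\<psi>. \<forall>v\<in>?V. Z \<psi> *v v \<in> ?V \<and> Zd \<psi> *v v \<in> ?V" by auto
  then have "?V = {0} \<or> ?V = UNIV"
    by (rule irreducible[unfolded acts_irreducibly_def, THEN spec, THEN mp, THEN mp, OF sub])
  moreover have "vac \<in> ?V" "vac \<noteq> 0" using base[of "[]"] vac(1) by auto
  ultimately show ?thesis by blast
qed

lemma fock_subspace_UNIV: "vec.subspace H \<Longrightarrow> (\<And>fs. fock fs \<in> H) \<Longrightarrow> x \<in> H"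
  using vec.span_minimal[of "range fock" H] fock_span by auto

lemma fock_matrix_eqI: "(\<And>fs. A *v fock fs = B *v fock fs) \<Longrightarrow> A = (B :: 'k cop)"
  using fock_subspace_UNIV[OF subspace_kernel[of A B]] by (intro matrix_eqI_vec) auto

text \<open>The part of \<open>v\<close> orthogonal to \<open>vac\<close> is orthogonal to every
  Fock vector, because a creator moves across the inner product as an annihilator; and Fock vectors
  span.\<close>

lemma vacuum_unique:
  assumes "\<And>\<psi>. Z \<psi> *v v = 0"
  shows "v = cinner vac v *s vac"
proof -
  define w where "w = v - cinner vac v *s vac"
  have Zw: "Z \<psi> *v w = 0" for \<psi> using assms by (simp add: w_def mtx_vec vac vec_scale_simps)
  have "cinner (fock fs) w = 0" for fs
  proof (cases fs)
    case Nil then show ?thesis by (simp add: w_def cinner_simps vac)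
  next
    case (Cons f gs)
    then show ?thesis unfolding Cons fock_Cons by (simp add: cinner_dagger_left Zw)
  qed
  moreover have "vec.subspace {x. cinner x w = 0}"
    by (auto simp: vec.subspace_def cinner_simps)
  ultimately have "cinner w w = 0" using fock_subspace_UNIV[of "{x. cinner x w = 0}" w] by simp
  then show ?thesis by (simp add: w_def)
qed

lemma W_square [simp]: "W ** W = mat 1"
proof (rule fock_matrix_eqI)
  fix fs
  have "(W ** W) *v fock fs = ((- 1) ^ length fs * (- 1) ^ length fs) *s fock fs"
    by (simp add: mtx_vec W_fock vec_scale_simps)
  then show "(W ** W) *v fock fs = mat 1 *v fock fs"
    by (simp add: vec_scale_simps flip: power_mult_distrib)
qed

lemma W_hermitian [simp]: "dagger W = W"
proof -
  have "dagger ((\<i> * pi) *\<^sub>M N) = - ((\<i> * pi) *\<^sub>M N)"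
    by (simp add: dagger_cscale N_hermitian cscale_minus_left)
  then have "dagger W ** W = mat 1"
    by (simp add: parity_op_def op_exp_dagger op_exp_minus)
  then have "dagger W ** W ** W = W" by simp
  then show ?thesis by (simp add: mtx_assoc)
qed

text \<open>The vacuum projection is a product of the projections
  \<open>Z (axis i 1) ** Zd (axis i 1)\<close> over all modes, so it lies in \<open>C\<close>;
  between creation words and their adjoints it yields all rank one operators. Uniqueness of
  homomorphisms with given values on the field is derived from this.\<close>

lemma algebra_generated:
  assumes C: "star_subalgebra C" and Z: "\<And>\<psi>. Z \<psi> \<in> C"
  shows "C = UNIV"
proof -
  have add: "X + Y \<in> C" and mult: "X ** Y \<in> C" if "X \<in> C" "Y \<in> C" for X Y
    using C that by (auto simp: star_subalgebra_def)
  have scale: "c *\<^sub>M X \<in> C" and dag: "dagger X \<in> C" if "X \<in> C" for c X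
    using C that by (auto simp: star_subalgebra_def)
  have zero: "0 \<in> C" using C by (auto simp: star_subalgebra_def)
  have sum: "(\<And>i. i \<in> S \<Longrightarrow> f i \<in> C) \<Longrightarrow> sum f S \<in> C" for f and S :: "'k set"
    by (induction S rule: infinite_finite_induct) (auto intro: zero add)
  \<comment> \<open>\<open>star_subalgebra\<close> does not include the unit; the anticommutator of
    a unit vector supplies it.\<close>
  have one: "mat 1 \<in> C"
  proof -
    define e :: "complex^'n" where "e = axis undefined 1"
    have "mat 1 = Z e ** Zd e + Zd e ** Z e"
      by (simp add: Zd_Z_anti e_def cinner_axis_axis)
    then show ?thesis by (simp add: add mult dag Z)
  qed
  \<comment> \<open>The condition on \<open>dagger E\<close> is carried along because it later turns
    the scalar \<open>cinner vac (E *v v)\<close> into \<open>cinner vac v\<close>, which identifies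
    \<open>E\<close> with the vacuum projection.\<close>
  have "\<exists>E\<in>C. E *v vac = vac \<and> dagger E *v vac = vac \<and> (\<forall>j\<in>S. Z (axis j 1) ** E = 0)" for S
    using finite[of S]
  proof (induction S rule: finite_induct)
    case empty
    show ?case using one by (intro bexI[of _ "mat 1"]) auto
  next
    case (insert i S)
    then obtain E where E: "E \<in> C" "E *v vac = vac" "dagger E *v vac = vac"
      "\<forall>j\<in>S. Z (axis j 1) ** E = 0" by blast
    define F where "F = Z (axis i 1) ** Zd (axis i 1) ** E"
    have v: "(Z (axis i 1) ** Zd (axis i 1)) *v vac = vac"
      unfolding Zd_Z_anti by (simp add: mtx_vec vac cinner_axis_axis vec_scale_simps)
    have "F \<in> C" using E by (simp add: F_def mult dag Z)
    moreover have "F *v vac = vac" using E v by (simp add: F_def matrix_vector_mult_mult[of _ E])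
    moreover have "dagger F *v vac = vac"
      using E v by (simp add: F_def dagger_simps matrix_vector_mult_mult[of "dagger E"])
    moreover have "Z (axis j 1) ** F = 0" if "j \<in> insert i S" for j
    proof (cases "j = i")
      case True
      then show ?thesis by (simp add: F_def matrix_mul_assoc)
    next
      case False
      have 1: "Z (axis j 1) ** Z (axis i 1) ** Zd (axis i 1) = Z (axis i 1) ** Zd (axis i 1) ** Z (axis j 1)"
        using False by (simp add: Z_anti[of "axis j 1"] mtx_distrib mtx_assoc Zd_Z_anti[of "axis j 1"] cinner_axis_axis)
      have "Z (axis j 1) ** F = (Z (axis j 1) ** Z (axis i 1) ** Zd (axis i 1)) ** E"
        by (simp add: F_def mtx_assoc)
      also have "\<dots> = Z (axis i 1) ** Zd (axis i 1) ** (Z (axis j 1) ** E)"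
        unfolding 1 by (simp add: mtx_assoc)
      finally show ?thesis using False that E by simp
    qed
    ultimately show ?case by blast
  qed
  from this[of UNIV] obtain E where E: "E \<in> C" "E *v vac = vac" "dagger E *v vac = vac"
      "\<And>j. Z (axis j 1) ** E = 0" by blast
  have "Z \<psi> ** E = 0" for \<psi>
    using Z_expand[OF orthonormal_basis_axis, of \<psi>] E(4) by (simp add: matrix_sum_left mtx_scale)
  then have "Z \<psi> *v (E *v v) = 0" for \<psi> v by (simp add: matrix_vector_mul_assoc)
  then have "E *v v = cinner vac (E *v v) *s vac" for v by (rule vacuum_unique)
  then have "E *v v = ketbra vac vac *v v" for v using E(3) by (simp add: ketbra_vec cinner_dagger)
  then have P: "ketbra vac vac \<in> C" using E(1) matrix_eqI_vec by metis
  have creC: "cre Z fs \<in> C" for fs by (induction fs) (auto intro: one mult dag Z)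
  have "cre Z fs ** ketbra vac vac ** dagger (cre Z gs) \<in> C" for fs gs
    by (intro mult P creC dag)
  then have "ketbra (fock fs) (fock gs) \<in> C" for fs gs
    by (simp add: mult_ketbra ketbra_mult)
  moreover have "vec.subspace {x. ketbra x y \<in> C}" "vec.subspace {x. ketbra y x \<in> C}" for y
    by (auto simp: vec.subspace_def ketbra_linear zero add scale)
  ultimately have "ketbra x (fock gs) \<in> C" for x gs
    using fock_subspace_UNIV[of "{x. ketbra x (fock gs) \<in> C}" x] by simp
  with \<open>\<And>y. vec.subspace {x. ketbra y x \<in> C}\<close> have "ketbra x y \<in> C" for x y
    using fock_subspace_UNIV[of "{y. ketbra x y \<in> C}" y] by simp
  then have "A \<in> C" for A
    by (subst matrix_ketbra_sum) (intro sum)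
  then show ?thesis by blast
qed

lemma dagger_cre_snoc: "Z h ** dagger (cre Z gs) = dagger (cre Z (gs @ [h]))"
  by (simp add: cre_append dagger_simps)

lemma normal_words_star_subalgebra: "star_subalgebra (normal_words Z)"
proof -
  have Zd: "Zd h ** X \<in> normal_words Z" if "X \<in> normal_words Z" for h X
    using that
  proof induction
    case (word fs gs)
    show ?case using normal_words.word[of Z "h # fs" gs] by (simp add: mtx_assoc)
  qed (auto simp: mtx_distrib mtx_scale intro: normal_words.add normal_words.scale)
  \<comment> \<open>Normal ordering: each exchange with a creator leaves a contraction, which is a
    normal word, and at the end \<open>Z h\<close> joins the annihilators.\<close>
  have Zw: "Z h ** (cre Z fs ** dagger (cre Z gs)) \<in> normal_words Z" for h fs gs
  proof (induction fs)
    case Nil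
    show ?case using normal_words.word[of Z "[]" "gs @ [h]"] by (simp add: dagger_cre_snoc)
  next
    case (Cons f fs)
    let ?X = "cre Z fs ** dagger (cre Z gs)"
    have "Z h ** (cre Z (f # fs) ** dagger (cre Z gs)) = (Z h ** Zd f) ** ?X" by (simp add: mtx_assoc)
    also have "\<dots> = cinner h f *\<^sub>M ?X + (- 1) *\<^sub>M (Zd f ** (Z h ** ?X))"
      unfolding Zd_Z_anti by (simp add: mtx_distrib mtx_scale cscale_minus_left mtx_assoc)
    finally show ?case using Cons Zd by (simp add: normal_words.add normal_words.scale normal_words.word)
  qed
  have Z: "Z h ** X \<in> normal_words Z" if "X \<in> normal_words Z" for h X
    using that by induction (auto simp: mtx_distrib mtx_scale intro: normal_words.add normal_words.scale Zw)
  have cre: "cre Z fs ** X \<in> normal_words Z" "dagger (cre Z fs) ** X \<in> normal_words Z"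
    if "X \<in> normal_words Z" for fs X
    using that by (induction fs arbitrary: X) (auto simp: mtx_assoc dagger_mult intro: Zd Z)
  have mult: "Y ** X \<in> normal_words Z" if "Y \<in> normal_words Z" "X \<in> normal_words Z" for X Y
    using that by induction (auto simp: mtx_distrib mtx_scale mtx_assoc intro: normal_words.add normal_words.scale cre)
  have dag: "dagger X \<in> normal_words Z" if "X \<in> normal_words Z" for X
    using that
  proof induction
    case (word fs gs)
    show ?case using normal_words.word[of Z gs fs] by (simp add: dagger_simps)
  qed (auto simp: dagger_simps intro: normal_words.add normal_words.scale)
  have "0 *\<^sub>M (cre Z [] ** dagger (cre Z [])) \<in> normal_words Z"
    by (intro normal_words.intros)
  then show ?thesis unfolding star_subalgebra_def
    using mult dag normal_words.add normal_words.scale by auto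
qed

lemma normal_words_UNIV: "normal_words Z = UNIV"
proof (rule algebra_generated[OF normal_words_star_subalgebra])
  show "Z \<psi> \<in> normal_words Z" for \<psi>
    using normal_words.word[of Z "[]" "[\<psi>]"] by (simp add: dagger_simps)
qed


subsection \<open>Gaussian states\<close>

text \<open>
  The relation between \<open>Z \<psi> \<rho>\<close> and \<open>\<rho> Z \<psi>\<close> is linear in the symbol and does not refer to a
  spectral decomposition. It characterizes the density: it reduces the degree of a normal ordered
  monomial under the trace (Wick's theorem).
\<close>

definition is_gaussian where
  "is_gaussian Q \<rho> \<longleftrightarrow> dagger \<rho> = \<rho> \<and> normalized_trace \<rho> = 1 \<and> W ** \<rho> = \<rho> ** W \<and>
     (\<forall>\<psi>. Z \<psi> ** \<rho> = Z (Q *v \<psi>) ** \<rho> + \<rho> ** Z (Q *v \<psi>))"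

lemma Z_dagger_cre: "Z h ** dagger (cre Z gs) = (- 1) ^ length gs *\<^sub>M (dagger (cre Z gs) ** Z h)"
proof (induction gs)
  case (Cons g gs)
  have "Z h ** dagger (cre Z (g # gs)) = (Z h ** dagger (cre Z gs)) ** Z g"
    by (simp add: dagger_simps mtx_assoc)
  also have "\<dots> = (- 1) ^ length gs *\<^sub>M (dagger (cre Z gs) ** (Z h ** Z g))"
    unfolding Cons by (simp add: mtx_scale mtx_assoc)
  also have "\<dots> = (- 1) ^ length (g # gs) *\<^sub>M (dagger (cre Z (g # gs)) ** Z h)"
    by (subst Z_anti) (simp add: mtx_scale mtx_distrib mtx_assoc dagger_simps)
  finally show ?case .
qed simp

lemma Zd_cre: "Zd h ** cre Z gs = (- 1) ^ length gs *\<^sub>M (cre Z gs ** Zd h)"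
proof -
  have "cre Z gs ** Zd h = (- 1) ^ length gs *\<^sub>M (Zd h ** cre Z gs)"
    using arg_cong[OF Z_dagger_cre[of h gs], of dagger] by (simp add: dagger_simps)
  then show ?thesis by (simp flip: power_mult_distrib)
qed

text \<open>Moving \<open>Z h\<close> to the right through \<open>fs\<close> produces contractions
  that have lost one creator. On these \<open>l\<close> vanishes by assumption, so only the sign of
  the permutation is left.\<close>

lemma functional_anticommute:
  fixes l :: "'k cop \<Rightarrow> complex"
  assumes "\<And>X Y. l (X + Y) = l X + l Y" "\<And>c X. l (c *\<^sub>M X) = c * l X"
    and "\<And>fs'. length fs' + 1 = length fs \<Longrightarrow> l (cre Z fs' ** dagger (cre Z gs)) = 0"
  shows "l (Z h ** (cre Z fs ** dagger (cre Z gs))) =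
    (- 1) ^ (length fs + length gs) * l (cre Z fs ** dagger (cre Z gs) ** Z h)"
  using assms
proof (induction fs arbitrary: l)
  case Nil
  then show ?case by (simp add: Z_dagger_cre)
next
  case (Cons f fs)
  let ?X = "cre Z fs ** dagger (cre Z gs)"
  have neg: "l (- X) = - l X" for X
    using Cons.prems(2)[of "-1" X] by (simp add: cscale_minus_left)
  have diff: "l (X - Y) = l X - l Y" for X Y
    using Cons.prems(1)[of X "- Y"] by (simp add: neg)
  have "l (Z h ** (cre Z (f # fs) ** dagger (cre Z gs))) = l ((Z h ** Zd f) ** ?X)"
    by (simp add: mtx_assoc)
  also have "\<dots> = cinner h f * l ?X - l (Zd f ** (Z h ** ?X))"
    unfolding Zd_Z_anti by (simp add: mtx_distrib mtx_scale mtx_assoc Cons.prems(2) diff)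
  also have "l ?X = 0" using Cons.prems(3)[of fs] by simp
  \<comment> \<open>The induction runs over all functionals: the leading creator is absorbed into
    \<open>l\<close>.\<close>
  also have "l (Zd f ** (Z h ** ?X)) = (- 1) ^ (length fs + length gs) * l (Zd f ** (?X ** Z h))"
  proof (rule Cons.IH[of "\<lambda>X. l (Zd f ** X)"])
    show "l (Zd f ** (cre Z fs' ** dagger (cre Z gs))) = 0" if "length fs' + 1 = length fs" for fs'
      using Cons.prems(3)[of "f # fs'"] that by (simp add: mtx_assoc)
  qed (simp_all add: mtx_distrib mtx_scale Cons.prems)
  finally show ?case by (simp add: mtx_assoc)
qed

text \<open>The functional \<open>l\<close> vanishes on normal words by induction on the degree. In
  even degree the relation replaces the last annihilator by two terms that cancel, because the
  remaining word is odd and its contractions vanish by induction; in odd degree conjugation by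
  \<open>W\<close> gives \<open>l ?X = - l ?X\<close>.\<close>

lemma wick_zero:
  assumes h: "dagger \<delta> = \<delta>" and t: "normalized_trace \<delta> = 0" and w: "W ** \<delta> = \<delta> ** W"
    and rel: "\<And>\<psi>. Z \<psi> ** \<delta> = Z (Q *v \<psi>) ** \<delta> + \<delta> ** Z (Q *v \<psi>)"
  shows "\<delta> = 0"
proof -
  define l where "l X = normalized_trace (\<delta> ** X)" for X
  have lin: "l (X + Y) = l X + l Y" "l (c *\<^sub>M X) = c * l X" "l (- X) = - l X" for X Y c
    by (simp_all add: l_def mtx_distrib mtx_scale tau_linear)
  have relZ: "l (X ** Z g) = l (X ** Z (Q *v g)) + l (Z (Q *v g) ** X)" for X g
  proof -
    have "l (X ** Z g) = normalized_trace (Z g ** \<delta> ** X)"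
      using tau_commute[of "\<delta> ** X" "Z g"] by (simp add: l_def mtx_assoc)
    also have "\<dots> = normalized_trace (Z (Q *v g) ** (\<delta> ** X)) + l (Z (Q *v g) ** X)"
      unfolding rel[of g] by (simp add: mtx_distrib tau_linear l_def mtx_assoc)
    finally show ?thesis by (simp add: l_def tau_commute[of "Z (Q *v g)"] mtx_assoc)
  qed
  have "Zd f ** \<delta> + \<delta> ** Zd f - Zd f ** \<delta> = \<delta> ** Zd f" for f by simp
  have reld: "\<delta> ** Zd f = \<delta> ** Zd (Q *v f) + Zd (Q *v f) ** \<delta>" for f
    using arg_cong[OF rel[of f], of dagger] by (simp add: dagger_simps h)
  have relZd: "l (Zd f ** X) = l (Zd (Q *v f) ** X) + l (X ** Zd (Q *v f))" for X f
  proof -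
    have "l (Zd f ** X) = normalized_trace ((\<delta> ** Zd f) ** X)"
      by (simp add: l_def mtx_assoc)
    also have "\<dots> = l (Zd (Q *v f) ** X) + normalized_trace (Zd (Q *v f) ** (\<delta> ** X))"
      unfolding reld[of f] by (simp add: mtx_distrib tau_linear l_def mtx_assoc)
    finally show ?thesis by (simp add: l_def tau_commute[of "Zd (Q *v f)"] mtx_assoc)
  qed
  have Wc: "W ** cre Z fs = (- 1) ^ length fs *\<^sub>M (cre Z fs ** W)" for fs
  proof (induction fs)
    case (Cons f fs)
    have "W ** cre Z (f # fs) = - (Zd f ** (W ** cre Z fs))"
      by (simp add: matrix_mul_assoc W_Zd mtx_distrib)
    then show ?case unfolding Cons by (simp add: mtx_scale mtx_assoc)
  qed simp
  have Wd: "W ** dagger (cre Z fs) = (- 1) ^ length fs *\<^sub>M (dagger (cre Z fs) ** W)" for fs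
  proof -
    have "dagger (cre Z fs) ** W = (- 1) ^ length fs *\<^sub>M (W ** dagger (cre Z fs))"
      using arg_cong[OF Wc[of fs], of dagger] by (simp add: dagger_simps)
    then show ?thesis by (simp flip: power_mult_distrib)
  qed
  have words: "l (cre Z fs ** dagger (cre Z gs)) = 0" for fs gs
  proof (induction "length fs + length gs" arbitrary: fs gs rule: less_induct)
    case less
    let ?X = "cre Z fs ** dagger (cre Z gs)"
    show ?case
    proof (cases "even (length fs + length gs)")
      case False
      have "W ** ?X = (W ** cre Z fs) ** dagger (cre Z gs)" by (simp add: mtx_assoc)
      also have "\<dots> = (- 1) ^ length fs *\<^sub>M (cre Z fs ** (W ** dagger (cre Z gs)))"
        unfolding Wc by (simp add: mtx_scale mtx_assoc)
      also have "\<dots> = (- 1) ^ (length fs + length gs) *\<^sub>M (?X ** W)"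
        unfolding Wd by (simp add: mtx_scale mtx_assoc power_add)
      finally have WX: "W ** ?X = - (?X ** W)" using False by (simp add: cscale_minus_left)
      have "l ?X = normalized_trace (W ** (W ** (\<delta> ** ?X)))" by (simp add: l_def matrix_mul_assoc)
      also have "\<dots> = normalized_trace (W ** (\<delta> ** ?X) ** W)" by (rule tau_commute)
      also have "W ** (\<delta> ** ?X) ** W = \<delta> ** (W ** ?X) ** W" by (simp add: matrix_mul_assoc w)
      also have "\<dots> = - (\<delta> ** ?X ** (W ** W))" unfolding WX by (simp only: mtx_distrib mtx_assoc)
      finally have "l ?X = - l ?X" by (simp add: tau_linear l_def)
      then show ?thesis by simp
    next
      case even: True
      show ?thesis
      proof (cases gs)
        case (Cons g gs')
        let ?Y = "cre Z fs ** dagger (cre Z gs')"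
        have "l (Z (Q *v g) ** ?Y) = (- 1) ^ (length fs + length gs') * l (?Y ** Z (Q *v g))"
        proof (rule functional_anticommute)
          show "l (cre Z fs' ** dagger (cre Z gs')) = 0" if "length fs' + 1 = length fs" for fs'
            by (rule less) (use that Cons in auto)
        qed (rule lin)+
        moreover have "odd (length fs + length gs')" using even Cons by simp
        ultimately have "l (?Y ** Z (Q *v g)) + l (Z (Q *v g) ** ?Y) = 0" by simp
        then have "l (?Y ** Z g) = 0" using relZ[of ?Y g] by simp
        then show ?thesis by (simp add: Cons dagger_simps mtx_assoc)
      next
        case Nil
        \<comment> \<open>Without annihilators the adjoint relation removes the leading creator; no
          contractions occur here, since creators anticommute exactly.\<close>
        show ?thesis
        proof (cases fs)
          case (Cons f fs')
          have "odd (length fs')" using even Nil Cons by simp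
          then have "Zd (Q *v f) ** cre Z fs' = - (cre Z fs' ** Zd (Q *v f))"
            by (simp add: Zd_cre cscale_minus_left)
          then have "l (Zd f ** cre Z fs') = 0" unfolding relZd[of f] by (simp add: lin)
          then show ?thesis by (simp add: Cons Nil)
        qed (simp add: Nil l_def t)
      qed
    qed
  qed
  have "X \<in> normal_words Z \<Longrightarrow> l X = 0" for X
    by (induction rule: normal_words.induct) (simp_all add: words lin)
  then have "normalized_trace (V ** \<delta>) = normalized_trace (V ** 0)" for V
    by (simp add: normal_words_UNIV l_def tau_commute[of V] tau_linear)
  then show ?thesis by (rule tau_eqI)
qed

lemma is_gaussianD:
  assumes "is_gaussian Q \<rho>"
  shows "dagger \<rho> = \<rho>" "normalized_trace \<rho> = 1" "W ** \<rho> = \<rho> ** W"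
    "Z \<psi> ** \<rho> = Z (Q *v \<psi>) ** \<rho> + \<rho> ** Z (Q *v \<psi>)"
  using assms unfolding is_gaussian_def by blast+

lemma is_gaussian_unique:
  assumes \<rho>: "is_gaussian Q \<rho>" and \<sigma>: "is_gaussian Q \<sigma>"
  shows "\<rho> = \<sigma>"
proof -
  have "\<rho> - \<sigma> = 0"
  proof (rule wick_zero)
    show "dagger (\<rho> - \<sigma>) = \<rho> - \<sigma>" by (simp add: dagger_simps is_gaussianD(1)[OF \<rho>] is_gaussianD(1)[OF \<sigma>])
    show "normalized_trace (\<rho> - \<sigma>) = 0" by (simp add: tau_linear is_gaussianD(2)[OF \<rho>] is_gaussianD(2)[OF \<sigma>])
    show "W ** (\<rho> - \<sigma>) = (\<rho> - \<sigma>) ** W" by (simp add: mtx_distrib is_gaussianD(3)[OF \<rho>] is_gaussianD(3)[OF \<sigma>])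
    show "Z \<psi> ** (\<rho> - \<sigma>) = Z (Q *v \<psi>) ** (\<rho> - \<sigma>) + (\<rho> - \<sigma>) ** Z (Q *v \<psi>)" for \<psi>
      unfolding matrix_sub_ldistrib matrix_sub_rdistrib is_gaussianD(4)[OF \<rho>, of \<psi>] is_gaussianD(4)[OF \<sigma>, of \<psi>]
      by simp
  qed
  then show ?thesis by simp
qed

end

section \<open>Orthonormal lists and the projections onto their spans\<close>

fun orthonormal_list :: "(complex ^ 'n) list \<Rightarrow> bool" where
  "orthonormal_list [] \<longleftrightarrow> True"
| "orthonormal_list (e # es) \<longleftrightarrow> cinner e e = 1 \<and> (\<forall>x\<in>set es. cinner e x = 0) \<and> orthonormal_list es"

fun list_proj :: "(complex ^ 'n) list \<Rightarrow> 'n::finite cop" where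
  "list_proj [] = 0"
| "list_proj (e # es) = ketbra e e + list_proj es"

lemma list_proj_hermitian: "dagger (list_proj es) = list_proj es"
  by (induction es) (simp_all add: dagger_simps dagger_ketbra)

lemma list_proj_orthogonal: "(\<And>e. e \<in> set es \<Longrightarrow> cinner e x = 0) \<Longrightarrow> list_proj es *v x = 0"
  by (induction es) (simp_all add: mtx_vec ketbra_vec vec_scale_simps)

lemma cinner_eq_0_commute: "cinner x y = 0 \<longleftrightarrow> cinner y x = 0"
  by (metis cnj_cinner complex_cnj_zero)

lemma list_proj_member: "orthonormal_list es \<Longrightarrow> e \<in> set es \<Longrightarrow> list_proj es *v e = e"
proof (induction es)
  case (Cons a es)
  show ?case
  proof (cases "e = a")
    case True
    have "list_proj es *v e = 0"
      using Cons.prems True cinner_eq_0_commute by (intro list_proj_orthogonal) auto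
    then show ?thesis using Cons.prems True by (simp add: mtx_vec ketbra_vec vec_scale_simps)
  next
    case False
    then show ?thesis using Cons by (simp add: mtx_vec ketbra_vec vec_scale_simps)
  qed
qed simp

lemma list_proj_residual:
  assumes "orthonormal_list es" "e \<in> set es"
  shows "cinner e (x - list_proj es *v x) = 0"
  by (simp add: cinner_diff_right cinner_dagger list_proj_hermitian list_proj_member[OF assms])

lemma list_proj_idem:
  assumes "orthonormal_list es"
  shows "list_proj es ** list_proj es = list_proj es"
proof (rule matrix_eqI_vec)
  fix x
  have "list_proj es *v (x - list_proj es *v x) = 0"
    by (rule list_proj_orthogonal) (rule list_proj_residual[OF assms])
  then show "(list_proj es ** list_proj es) *v x = list_proj es *v x" by (simp add: mtx_vec)
qed

lemma projection_symbol:
  assumes "dagger P = P" "P ** P = P"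
  shows "P \<in> symbols"
proof -
  have "psd (dagger P ** P)" "psd (dagger (mat 1 - P) ** (mat 1 - P))" by (rule psd_square)+
  then show ?thesis using assms by (simp add: symbols_iff dagger_simps mtx_distrib)
qed

lemma list_proj_symbol: "orthonormal_list es \<Longrightarrow> list_proj es \<in> symbols"
  by (intro projection_symbol list_proj_hermitian list_proj_idem)

section \<open>Products of mode factors and the Gaussian densities\<close>

context irreducible_car
begin

text \<open>The coefficients on the empty and on the occupied state of the mode are left free, so
  that for unit vectors the family is closed under products and square roots.\<close>

definition mode_factor :: "complex ^ 'n \<Rightarrow> real \<Rightarrow> real \<Rightarrow> 'k cop" where
  "mode_factor \<psi> a b = a *\<^sub>R (Z \<psi> ** Zd \<psi>) + b *\<^sub>R (Zd \<psi> ** Z \<psi>)"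

lemma gaussian_mode_factor: "gaussian_factor Z \<psi> \<mu> = mode_factor \<psi> (2 * (1 - \<mu>)) (2 * \<mu>)"
  by (simp add: gaussian_factor_def mode_factor_def)

lemma mode_factor_hermitian: "dagger (mode_factor \<psi> a b) = mode_factor \<psi> a b"
  by (simp add: mode_factor_def dagger_simps)

text \<open>Each term has an even number of field operators of the orthogonal mode, so the sign
  changes cancel.\<close>

lemma Z_mode_factor:
  assumes "cinner \<psi> \<phi> = 0"
  shows "Z \<psi> ** mode_factor \<phi> a b = mode_factor \<phi> a b ** Z \<psi>"
proof -
  have 1: "Z \<psi> ** Zd \<phi> = - (Zd \<phi> ** Z \<psi>)" by (simp add: Zd_Z_anti assms)
  have "Z \<psi> ** (Z \<phi> ** Zd \<phi>) = - (Z \<phi> ** (Z \<psi> ** Zd \<phi>))"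
    by (simp add: matrix_mul_assoc Z_anti[of \<psi>] mtx_distrib)
  then have 2: "Z \<psi> ** (Z \<phi> ** Zd \<phi>) = Z \<phi> ** Zd \<phi> ** Z \<psi>"
    unfolding 1 by (simp add: mtx_distrib mtx_assoc)
  have "Z \<psi> ** (Zd \<phi> ** Z \<phi>) = - (Zd \<phi> ** (Z \<psi> ** Z \<phi>))"
    by (simp add: matrix_mul_assoc 1 mtx_distrib)
  then have 3: "Z \<psi> ** (Zd \<phi> ** Z \<phi>) = Zd \<phi> ** Z \<phi> ** Z \<psi>"
    unfolding Z_anti[of \<psi>] by (simp add: mtx_distrib mtx_assoc)
  show ?thesis
    by (simp add: mode_factor_def mtx_distrib scaleR_mult_left scaleR_mult_right 2 3)
qed

lemma Zd_mode_factor: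
  assumes "cinner \<psi> \<phi> = 0"
  shows "Zd \<psi> ** mode_factor \<phi> a b = mode_factor \<phi> a b ** Zd \<psi>"
  using arg_cong[OF Z_mode_factor[OF assms, of a b], of dagger] by (simp add: dagger_mult mode_factor_hermitian)

lemma mode_factor_commute:
  assumes "cinner \<psi> \<phi> = 0"
  shows "mode_factor \<psi> a b ** mode_factor \<phi> c d = mode_factor \<phi> c d ** mode_factor \<psi> a b"
proof -
  let ?F = "mode_factor \<phi> c d"
  have 1: "Z \<psi> ** Zd \<psi> ** ?F = ?F ** (Z \<psi> ** Zd \<psi>)"
    by (metis Z_mode_factor Zd_mode_factor assms matrix_mul_assoc)
  have 2: "Zd \<psi> ** Z \<psi> ** ?F = ?F ** (Zd \<psi> ** Z \<psi>)"
    by (metis Z_mode_factor Zd_mode_factor assms matrix_mul_assoc)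
  show ?thesis
    unfolding mode_factor_def[of \<psi>]
    by (simp add: mtx_distrib scaleR_mult_left scaleR_mult_right 1 2)
qed

lemma Z_Zd_Z: "Z \<psi> ** Zd \<psi> ** Z \<psi> = cinner \<psi> \<psi> *\<^sub>M Z \<psi>"
  unfolding Zd_Z_anti by (simp add: mtx_distrib mtx_scale mtx_assoc)

text \<open>For a unit vector the two products of \<open>Z \<psi>\<close> and its adjoint are
  complementary projections, so the coefficients multiply.\<close>

lemma mode_factor_mult:
  assumes "cinner \<psi> \<psi> = 1"
  shows "mode_factor \<psi> a b ** mode_factor \<psi> c d = mode_factor \<psi> (a * c) (b * d)"
proof -
  let ?p = "Z \<psi> ** Zd \<psi>" and ?n = "Zd \<psi> ** Z \<psi>"
  have "?p ** ?p = (Z \<psi> ** Zd \<psi> ** Z \<psi>) ** Zd \<psi>" by (simp add: mtx_assoc)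
  then have pp: "?p ** ?p = ?p" unfolding Z_Zd_Z by (simp add: assms)
  have "?n ** ?n = Zd \<psi> ** (Z \<psi> ** Zd \<psi> ** Z \<psi>)" by (simp add: mtx_assoc)
  then have nn: "?n ** ?n = ?n" unfolding Z_Zd_Z by (simp add: assms)
  have "?p ** ?n = Z \<psi> ** (Zd \<psi> ** Zd \<psi>) ** Z \<psi>" by (simp add: mtx_assoc del: Zd_square)
  then have pn: "?p ** ?n = 0" by simp
  have "?n ** ?p = Zd \<psi> ** (Z \<psi> ** Z \<psi>) ** Zd \<psi>" by (simp add: mtx_assoc del: Z_square)
  then have np: "?n ** ?p = 0" by simp
  show ?thesis
    unfolding mode_factor_def
    by (simp add: mtx_distrib scaleR_mult_left scaleR_mult_right pp nn pn np mult.commute)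
qed

lemma Z_mode_factor_same:
  assumes "cinner \<psi> \<psi> = 1"
  shows "Z \<psi> ** mode_factor \<psi> a b = b *\<^sub>R Z \<psi>" "mode_factor \<psi> a b ** Z \<psi> = a *\<^sub>R Z \<psi>"
proof -
  have "Z \<psi> ** (Zd \<psi> ** Z \<psi>) = Z \<psi>" using Z_Zd_Z[of \<psi>] assms by (simp add: mtx_assoc)
  moreover have "Z \<psi> ** (Z \<psi> ** Zd \<psi>) = 0" by (simp add: matrix_mul_assoc)
  ultimately show "Z \<psi> ** mode_factor \<psi> a b = b *\<^sub>R Z \<psi>" "mode_factor \<psi> a b ** Z \<psi> = a *\<^sub>R Z \<psi>"
    by (simp_all add: mode_factor_def mtx_distrib scaleR_mult_left scaleR_mult_right mtx_assoc)
qed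

lemma mode_factor_one: "cinner \<psi> \<psi> = 1 \<Longrightarrow> mode_factor \<psi> 1 1 = mat 1"
  by (simp add: mode_factor_def Zd_Z_anti)

text \<open>By cyclicity both projections of the mode have the same trace against \<open>X\<close>,
  and they add up to the identity: each contributes one half.\<close>

lemma tau_mode_factor:
  assumes "cinner \<psi> \<psi> = 1" "Z \<psi> ** X = X ** Z \<psi>"
  shows "normalized_trace (mode_factor \<psi> a b ** X) = (of_real a + of_real b) / 2 * normalized_trace X"
proof -
  have e: "normalized_trace (Z \<psi> ** Zd \<psi> ** X) = normalized_trace (Zd \<psi> ** Z \<psi> ** X)"
    using tau_commute[of "Z \<psi>" "Zd \<psi> ** X"] by (simp add: mtx_assoc assms(2))
  have "normalized_trace (mode_factor \<psi> 1 1 ** X) = normalized_trace X"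
    by (simp add: mode_factor_one assms)
  then have "2 * normalized_trace (Zd \<psi> ** Z \<psi> ** X) = normalized_trace X"
    by (simp add: mode_factor_def mtx_distrib tau_linear e)
  then have h: "normalized_trace (Zd \<psi> ** Z \<psi> ** X) = normalized_trace X / 2"
    by (simp add: eq_divide_eq mult.commute)
  have "normalized_trace (mode_factor \<psi> a b ** X) =
      of_real a * normalized_trace (Zd \<psi> ** Z \<psi> ** X) + of_real b * normalized_trace (Zd \<psi> ** Z \<psi> ** X)"
    by (simp add: mode_factor_def mtx_distrib scaleR_mult_left tau_linear e)
  then show ?thesis unfolding h by (simp add: field_simps)
qed

definition mode_prod where
  "mode_prod \<psi> a b S = Finite_Set.fold (\<lambda>j M. mode_factor (\<psi> j) (a j) (b j) ** M) (mat 1) (S :: 'n set)"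

definition gig_prod where
  "gig_prod \<psi> \<mu> = mode_prod \<psi> (\<lambda>j. 2 * (1 - \<mu> j)) (\<lambda>j. 2 * \<mu> j) UNIV"

lemma mode_prod_empty [simp]: "mode_prod \<psi> a b {} = mat 1"
  by (simp add: mode_prod_def)

context
  fixes \<psi> :: "'n \<Rightarrow> complex ^ 'n"
  assumes \<psi>: "orthonormal_basis \<psi>"
begin

lemma \<psi>_inner: "cinner (\<psi> i) (\<psi> j) = (if i = j then 1 else 0)"
  by (rule orthonormal_basisD[OF \<psi>])

lemma mode_prod_insert:
  assumes "i \<notin> S"
  shows "mode_prod \<psi> a b (insert i S) = mode_factor (\<psi> i) (a i) (b i) ** mode_prod \<psi> a b S"
proof -
  interpret comp_fun_commute "\<lambda>j M. mode_factor (\<psi> j) (a j) (b j) ** M"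
  proof
    fix i j
    show "(**) (mode_factor (\<psi> j) (a j) (b j)) \<circ> (**) (mode_factor (\<psi> i) (a i) (b i)) =
      (**) (mode_factor (\<psi> i) (a i) (b i)) \<circ> (**) (mode_factor (\<psi> j) (a j) (b j))"
    proof (cases "i = j")
      case False
      then show ?thesis
        by (auto simp: fun_eq_iff matrix_mul_assoc mode_factor_commute[of "\<psi> j" "\<psi> i"] \<psi>_inner)
    qed simp
  qed
  show ?thesis using assms by (simp add: mode_prod_def)
qed

lemma mode_prod_remove: "mode_prod \<psi> a b S = mode_factor (\<psi> i) (a i) (b i) ** mode_prod \<psi> a b (S - {i})" if "i \<in> S"
  using mode_prod_insert[of i "S - {i}" a b] that by (simp add: insert_absorb)

lemma mode_prod_cong: "(\<And>j. j \<in> S \<Longrightarrow> a j = a' j \<and> b j = b' j) \<Longrightarrow> mode_prod \<psi> a b S = mode_prod \<psi> a' b' S"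
  using finite[of S] by (induction S rule: finite_induct) (simp_all add: mode_prod_insert)

lemma mode_prod_commute:
  assumes "\<And>j. j \<in> S \<Longrightarrow> X ** mode_factor (\<psi> j) (a j) (b j) = mode_factor (\<psi> j) (a j) (b j) ** X"
  shows "X ** mode_prod \<psi> a b S = mode_prod \<psi> a b S ** X"
  using finite[of S] assms
proof (induction S rule: finite_induct)
  case (insert i S)
  let ?g = "mode_factor (\<psi> i) (a i) (b i)"
  have "X ** mode_prod \<psi> a b (insert i S) = X ** ?g ** mode_prod \<psi> a b S"
    by (simp add: mode_prod_insert insert.hyps mtx_assoc)
  also have "\<dots> = ?g ** (X ** mode_prod \<psi> a b S)" by (simp add: insert.prems mtx_assoc)
  also have "\<dots> = ?g ** (mode_prod \<psi> a b S ** X)" using insert by simp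
  finally show ?case by (simp add: mode_prod_insert insert.hyps mtx_assoc)
qed simp

lemma Z_mode_prod: "j \<notin> S \<Longrightarrow> Z (\<psi> j) ** mode_prod \<psi> a b S = mode_prod \<psi> a b S ** Z (\<psi> j)"
  by (rule mode_prod_commute) (auto intro!: Z_mode_factor simp: \<psi>_inner)

lemma mode_factor_mode_prod:
  "j \<notin> S \<Longrightarrow> mode_factor (\<psi> j) c d ** mode_prod \<psi> a b S = mode_prod \<psi> a b S ** mode_factor (\<psi> j) c d"
  by (rule mode_prod_commute) (auto intro!: mode_factor_commute simp: \<psi>_inner)

lemma mode_prod_hermitian: "dagger (mode_prod \<psi> a b S) = mode_prod \<psi> a b S"
  using finite[of S]
  by (induction S rule: finite_induct)
    (simp_all add: mode_prod_insert dagger_mult mode_factor_hermitian mode_factor_mode_prod)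

lemma mode_prod_mult:
  "mode_prod \<psi> a b S ** mode_prod \<psi> c d S = mode_prod \<psi> (\<lambda>j. a j * c j) (\<lambda>j. b j * d j) S"
  using finite[of S]
proof (induction S rule: finite_induct)
  case (insert i S)
  let ?g = "mode_factor (\<psi> i) (a i) (b i)" and ?h = "mode_factor (\<psi> i) (c i) (d i)"
  have "mode_prod \<psi> a b (insert i S) ** mode_prod \<psi> c d (insert i S)
      = ?g ** (mode_prod \<psi> a b S ** ?h) ** mode_prod \<psi> c d S"
    by (simp add: mode_prod_insert insert.hyps mtx_assoc)
  also have "\<dots> = (?g ** ?h) ** (mode_prod \<psi> a b S ** mode_prod \<psi> c d S)"
    by (simp add: mode_factor_mode_prod[symmetric] insert.hyps mtx_assoc)
  finally show ?case
    by (simp add: insert mode_factor_mult \<psi>_inner mode_prod_insert)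
qed simp

lemma tau_mode_prod: "(\<And>j. j \<in> S \<Longrightarrow> a j + b j = 2) \<Longrightarrow> normalized_trace (mode_prod \<psi> a b S) = 1"
  using finite[of S]
proof (induction S rule: finite_induct)
  case (insert i S)
  have "complex_of_real (a i) + complex_of_real (b i) = 2"
    using insert.prems[of i] by (metis insertI1 of_real_add of_real_numeral)
  then show ?case
    using insert by (simp add: mode_prod_insert tau_mode_factor \<psi>_inner Z_mode_prod)
qed (simp add: tau_linear)

text \<open>\<open>Z (\<psi> j)\<close> yields \<open>b j\<close> when it stands left of its own
  factor and \<open>a j\<close> when it stands right of it, and it commutes with the other factors.
  Avoiding division keeps the eigenvalues 0 and 1 of a symbol included.\<close>

lemma Z_mode_prod_exchange:
  "a j *\<^sub>R (Z (\<psi> j) ** mode_prod \<psi> a b UNIV) = b j *\<^sub>R (mode_prod \<psi> a b UNIV ** Z (\<psi> j))"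
proof -
  let ?g = "mode_factor (\<psi> j) (a j) (b j)" and ?R = "mode_prod \<psi> a b (UNIV - {j})"
  have r: "mode_prod \<psi> a b UNIV = ?g ** ?R" by (rule mode_prod_remove) simp
  have "Z (\<psi> j) ** (?g ** ?R) = b j *\<^sub>R (Z (\<psi> j) ** ?R)"
    unfolding matrix_mul_assoc by (simp add: Z_mode_factor_same \<psi>_inner scaleR_mult_left)
  moreover have "?g ** ?R ** Z (\<psi> j) = a j *\<^sub>R (Z (\<psi> j) ** ?R)"
    unfolding mtx_assoc using Z_mode_prod[of j "UNIV - {j}" a b, symmetric]
    by (simp add: matrix_mul_assoc Z_mode_factor_same \<psi>_inner scaleR_mult_left)
  ultimately show ?thesis unfolding r by (simp add: mult.commute)
qed

lemma parity_mode_prod: "W ** mode_prod \<psi> a b S = mode_prod \<psi> a b S ** W"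
  by (rule mode_prod_commute)
    (simp add: mode_factor_def mtx_distrib scaleR_mult_left scaleR_mult_right matrix_mul_assoc W_Z W_Zd,
     simp add: mtx_assoc W_Z W_Zd mtx_distrib)

lemma N_mode_prod: "N ** mode_prod \<psi> a b S = mode_prod \<psi> a b S ** N"
  by (rule mode_prod_commute)
    (simp add: mode_factor_def mtx_distrib scaleR_mult_left scaleR_mult_right matrix_mul_assoc N_Z N_Zd,
     simp add: mtx_assoc N_Z N_Zd mtx_distrib)

lemma gig_prod_gaussian: "is_gaussian (\<Sum>j\<in>UNIV. \<mu> j *\<^sub>R ketbra (\<psi> j) (\<psi> j)) (gig_prod \<psi> \<mu>)"
  unfolding is_gaussian_def
proof (intro conjI allI)
  let ?Q = "\<Sum>j\<in>UNIV. \<mu> j *\<^sub>R ketbra (\<psi> j) (\<psi> j)" and ?\<rho> = "gig_prod \<psi> \<mu>"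
  show "dagger ?\<rho> = ?\<rho>" by (simp add: gig_prod_def mode_prod_hermitian)
  show "normalized_trace ?\<rho> = 1" unfolding gig_prod_def by (rule tau_mode_prod) simp
  show "W ** ?\<rho> = ?\<rho> ** W" by (simp add: gig_prod_def parity_mode_prod)
  \<comment> \<open>The exchange relation reads
    \<open>(1 - \<mu>) Z \<rho> = \<mu> \<rho> Z\<close>; adding \<open>\<mu> Z \<rho>\<close>
    brings it to the form that is linear in the symbol.\<close>
  have j: "Z (\<psi> j) ** ?\<rho> = \<mu> j *\<^sub>R (Z (\<psi> j) ** ?\<rho>) + \<mu> j *\<^sub>R (?\<rho> ** Z (\<psi> j))" for j
  proof -
    have "(1 / 2) *\<^sub>R (2 * (1 - \<mu> j)) *\<^sub>R (Z (\<psi> j) ** ?\<rho>) = (1 / 2) *\<^sub>R (2 * \<mu> j) *\<^sub>R (?\<rho> ** Z (\<psi> j))"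
      using Z_mode_prod_exchange[of "\<lambda>j. 2 * (1 - \<mu> j)" j "\<lambda>j. 2 * \<mu> j"] by (simp only: gig_prod_def)
    then have "(1 - \<mu> j) *\<^sub>R (Z (\<psi> j) ** ?\<rho>) = \<mu> j *\<^sub>R (?\<rho> ** Z (\<psi> j))"
      unfolding scaleR_scaleR by (simp add: diff_divide_distrib)
    then show ?thesis by (simp add: algebra_simps)
  qed
  fix \<phi>
  have Q: "?Q *v \<phi> = (\<Sum>j\<in>UNIV. (of_real (\<mu> j) * cinner (\<psi> j) \<phi>) *s \<psi> j)"
    unfolding sum_matrix_vector
    by (intro sum.cong refl) (simp add: scaleR_vec ketbra_vec vec_eq_iff scaleR_conv_of_real[where 'a=complex])
  have ZQ: "Z (?Q *v \<phi>) = (\<Sum>j\<in>UNIV. cnj (cinner (\<psi> j) \<phi>) *\<^sub>M (\<mu> j *\<^sub>R Z (\<psi> j)))"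
    unfolding Q by (simp add: Z_simps scaleR_cscale mult.commute del: cnj_cinner)
  have "Z \<phi> ** ?\<rho> = (\<Sum>j\<in>UNIV. cnj (cinner (\<psi> j) \<phi>) *\<^sub>M (Z (\<psi> j) ** ?\<rho>))"
    by (subst Z_expand[OF \<psi>, of \<phi>]) (simp add: matrix_sum_left mtx_scale)
  also have "\<dots> = (\<Sum>j\<in>UNIV. cnj (cinner (\<psi> j) \<phi>) *\<^sub>M (\<mu> j *\<^sub>R (Z (\<psi> j) ** ?\<rho>) + \<mu> j *\<^sub>R (?\<rho> ** Z (\<psi> j))))"
    using j by simp
  also have "\<dots> = Z (?Q *v \<phi>) ** ?\<rho> + ?\<rho> ** Z (?Q *v \<phi>)"
    unfolding ZQ by (simp add: matrix_sum_left matrix_sum_right mtx_scale scaleR_mult_left scaleR_mult_right sum.distrib)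
  finally show "Z \<phi> ** ?\<rho> = Z (?Q *v \<phi>) ** ?\<rho> + ?\<rho> ** Z (?Q *v \<phi>)" .
qed

text \<open>Only the factor of mode \<open>i\<close> contains \<open>x\<close>, and it does so
  affinely. These are the segments of densities on which linearity of a semigroup becomes
  usable.\<close>

lemma gig_prod_affine: "gig_prod \<psi> (\<mu>(i := x)) = (1 - x) *\<^sub>R gig_prod \<psi> (\<mu>(i := 0)) + x *\<^sub>R gig_prod \<psi> (\<mu>(i := 1))"
proof -
  define R where "R = mode_prod \<psi> (\<lambda>j. 2 * (1 - \<mu> j)) (\<lambda>j. 2 * \<mu> j) (UNIV - {i})"
  have r: "gig_prod \<psi> (\<mu>(i := x)) = mode_factor (\<psi> i) (2 * (1 - x)) (2 * x) ** R" for x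
  proof -
    have "gig_prod \<psi> (\<mu>(i := x)) = mode_factor (\<psi> i) (2 * (1 - x)) (2 * x) **
        mode_prod \<psi> (\<lambda>j. 2 * (1 - (\<mu>(i := x)) j)) (\<lambda>j. 2 * (\<mu>(i := x)) j) (UNIV - {i})"
      unfolding gig_prod_def by (subst mode_prod_remove[of i]) simp_all
    also have "mode_prod \<psi> (\<lambda>j. 2 * (1 - (\<mu>(i := x)) j)) (\<lambda>j. 2 * (\<mu>(i := x)) j) (UNIV - {i}) = R"
      unfolding R_def by (rule mode_prod_cong) simp
    finally show ?thesis .
  qed
  have "mode_factor (\<psi> i) (2 * (1 - x)) (2 * x) =
    (1 - x) *\<^sub>R mode_factor (\<psi> i) (2 * (1 - 0)) (2 * 0) + x *\<^sub>R mode_factor (\<psi> i) (2 * (1 - 1)) (2 * 1)"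
    by (simp add: mode_factor_def algebra_simps)
  then show ?thesis unfolding r by (simp add: mtx_distrib scaleR_mult_left)
qed

text \<open>Taking roots of all coefficients gives an explicit Hermitian square root. It stands in
  for positivity of the density in the norm bound and in the proof of complete positivity.\<close>

lemma gig_prod_square:
  assumes "\<And>j. 0 \<le> \<mu> j" "\<And>j. \<mu> j \<le> 1"
  shows "\<exists>r. dagger r = r \<and> r ** r = gig_prod \<psi> \<mu>"
proof (intro exI conjI)
  let ?r = "mode_prod \<psi> (\<lambda>j. sqrt (2 * (1 - \<mu> j))) (\<lambda>j. sqrt (2 * \<mu> j)) UNIV"
  show "dagger ?r = ?r" by (rule mode_prod_hermitian)
  show "?r ** ?r = gig_prod \<psi> \<mu>"
    unfolding mode_prod_mult gig_prod_def by (rule mode_prod_cong) (use assms in simp)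
qed

end

text \<open>Any two spectral decompositions of \<open>Q\<close> yield products that satisfy the same
  relations, and these determine the density; so the definite description is legitimate for
  degenerate eigenvalues too.\<close>

lemma gig_density_eq:
  assumes \<psi>: "orthonormal_basis \<psi>" and Q: "Q = (\<Sum>j\<in>UNIV. \<mu> j *\<^sub>R ketbra (\<psi> j) (\<psi> j))"
  shows "gig_density Z Q = gig_prod \<psi> \<mu>"
  unfolding gig_density_def
proof (rule the_equality)
  have f: "Finite_Set.fold (\<lambda>j M. gaussian_factor Z (\<psi> j) (\<mu> j) ** M) (mat 1) UNIV = gig_prod \<psi> \<mu>" for \<psi> \<mu>
    by (simp add: gig_prod_def mode_prod_def gaussian_mode_factor)
  show "\<exists>\<psi>' \<mu>'. orthonormal_basis \<psi>' \<and> Q = (\<Sum>j\<in>UNIV. \<mu>' j *\<^sub>R ketbra (\<psi>' j) (\<psi>' j)) \<and>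
      gig_prod \<psi> \<mu> = Finite_Set.fold (\<lambda>j M. gaussian_factor Z (\<psi>' j) (\<mu>' j) ** M) (mat 1) UNIV"
    using \<psi> Q by (auto simp: f)
  fix \<rho>
  assume "\<exists>\<psi>' \<mu>'. orthonormal_basis \<psi>' \<and> Q = (\<Sum>j\<in>UNIV. \<mu>' j *\<^sub>R ketbra (\<psi>' j) (\<psi>' j)) \<and>
      \<rho> = Finite_Set.fold (\<lambda>j M. gaussian_factor Z (\<psi>' j) (\<mu>' j) ** M) (mat 1) UNIV"
  then obtain \<psi>' \<mu>' where "orthonormal_basis \<psi>'" "Q = (\<Sum>j\<in>UNIV. \<mu>' j *\<^sub>R ketbra (\<psi>' j) (\<psi>' j))"
    "\<rho> = gig_prod \<psi>' \<mu>'" by (auto simp: f)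
  then have "is_gaussian Q \<rho>" using gig_prod_gaussian[of \<psi>' \<mu>'] by simp
  moreover have "is_gaussian Q (gig_prod \<psi> \<mu>)" using gig_prod_gaussian[OF \<psi>, of \<mu>] Q by simp
  ultimately show "\<rho> = gig_prod \<psi> \<mu>" by (rule is_gaussian_unique)
qed

lemma symbols_gig_prod:
  assumes "Q \<in> symbols"
  obtains \<psi> \<mu> where "orthonormal_basis \<psi>" "\<And>j. 0 \<le> \<mu> j" "\<And>j. \<mu> j \<le> 1"
    "Q = (\<Sum>j\<in>UNIV. \<mu> j *\<^sub>R ketbra (\<psi> j) (\<psi> j))" "gig_density Z Q = gig_prod \<psi> \<mu>"
proof -
  obtain \<psi> \<mu> where s: "orthonormal_basis \<psi>" "\<And>j. 0 \<le> \<mu> j" "\<And>j. \<mu> j \<le> 1"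
    "Q = (\<Sum>j\<in>UNIV. \<mu> j *\<^sub>R ketbra (\<psi> j) (\<psi> j))"
    using symbols_spectral[OF assms] by blast
  show ?thesis by (rule that[OF s gig_density_eq[OF s(1) s(4)]])
qed

lemma gig_density_gaussian:
  assumes "Q \<in> symbols"
  shows "is_gaussian Q (gig_density Z Q)"
proof -
  obtain \<psi> \<mu> where s: "orthonormal_basis \<psi>" "Q = (\<Sum>j\<in>UNIV. \<mu> j *\<^sub>R ketbra (\<psi> j) (\<psi> j))"
    "gig_density Z Q = gig_prod \<psi> \<mu>"
    using symbols_gig_prod[OF assms] by blast
  show ?thesis unfolding s(3) unfolding s(2) by (rule gig_prod_gaussian[OF s(1)])
qed

lemma gig_density_unique: "Q \<in> symbols \<Longrightarrow> is_gaussian Q \<rho> \<Longrightarrow> gig_density Z Q = \<rho>"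
  by (rule is_gaussian_unique[OF gig_density_gaussian])

lemma gig_density_in_gauge_alg:
  assumes "Q \<in> symbols"
  shows "gig_density Z Q \<in> gauge_alg Z"
proof -
  obtain \<psi> \<mu> where s: "orthonormal_basis \<psi>" "gig_density Z Q = gig_prod \<psi> \<mu>"
    using symbols_gig_prod[OF assms] by blast
  show ?thesis
    unfolding s(2) gauge_alg_def gig_prod_def using N_mode_prod[OF s(1)] by blast
qed

lemma gig_density_square:
  assumes "Q \<in> symbols"
  shows "\<exists>r. dagger r = r \<and> r ** r = gig_density Z Q"
proof -
  obtain \<psi> \<mu> where s: "orthonormal_basis \<psi>" "\<And>j. 0 \<le> \<mu> j" "\<And>j. \<mu> j \<le> 1" "gig_density Z Q = gig_prod \<psi> \<mu>"
    using symbols_gig_prod[OF assms] by blast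
  show ?thesis unfolding s(4) by (rule gig_prod_square[OF s(1-3)])
qed

lemma symbols_hermitian: "Q \<in> symbols \<Longrightarrow> dagger Q = Q"
  by (simp add: symbols_iff psd_hermitian)

text \<open>One step of Wick's theorem: cyclicity brings \<open>Z \<psi>\<close> next to the
  density, where the relation turns it into an anticommutator with
  \<open>Z (Q *v \<psi>)\<close>.\<close>

lemma gaussian_trace_Z:
  assumes "is_gaussian Q \<rho>"
  shows "normalized_trace (\<rho> ** (X ** Z \<psi>)) = normalized_trace (\<rho> ** (X ** Z (Q *v \<psi>) + Z (Q *v \<psi>) ** X))"
proof -
  have "normalized_trace (\<rho> ** (X ** Z \<psi>)) = normalized_trace ((Z \<psi> ** \<rho>) ** X)"
    using tau_commute[of "\<rho> ** X" "Z \<psi>"] by (simp add: mtx_assoc)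
  also have "\<dots> = normalized_trace (Z (Q *v \<psi>) ** (\<rho> ** X)) + normalized_trace (\<rho> ** (Z (Q *v \<psi>) ** X))"
    unfolding is_gaussianD(4)[OF assms, of \<psi>] by (simp add: mtx_distrib tau_linear mtx_assoc)
  also have "normalized_trace (Z (Q *v \<psi>) ** (\<rho> ** X)) = normalized_trace (\<rho> ** (X ** Z (Q *v \<psi>)))"
    using tau_commute[of "Z (Q *v \<psi>)" "\<rho> ** X"] by (simp add: mtx_assoc)
  finally show ?thesis by (simp add: mtx_distrib tau_linear)
qed

lemma two_point:
  assumes "Q \<in> symbols"
  shows "normalized_trace (gig_density Z Q ** (Zd x ** Z y)) = cinner y (Q *v x)"
proof -
  note g = gig_density_gaussian[OF assms]
  have "Zd x ** Z (Q *v y) + Z (Q *v y) ** Zd x = cinner (Q *v y) x *\<^sub>M mat 1"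
    by (simp add: Zd_Z_anti)
  then show ?thesis
    unfolding gaussian_trace_Z[OF g]
    by (simp add: mtx_scale tau_linear is_gaussianD(2)[OF g] cinner_dagger_left symbols_hermitian[OF assms])
qed

text \<open>\<open>Z (Q *v x)\<close> passes an odd word, so the uncontracted terms cancel and the
  contractions with \<open>Zd x\<close> and \<open>Zd y\<close> remain, each multiplied by a two
  point function.\<close>

lemma four_point:
  assumes "Q \<in> symbols"
  shows "normalized_trace (gig_density Z Q ** (Zd x ** Zd y ** Z y ** Z x)) =
    cinner x (Q *v x) * cinner y (Q *v y) - cinner x (Q *v y) * cinner y (Q *v x)"
proof -
  note g = gig_density_gaussian[OF assms]
  let ?X = "Zd x ** Zd y ** Z y" and ?q = "Z (Q *v x)"
  have "?q ** ?X = (?q ** Zd x) ** (Zd y ** Z y)" by (simp add: mtx_assoc)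
  also have "\<dots> = cinner (Q *v x) x *\<^sub>M (Zd y ** Z y) - Zd x ** (?q ** Zd y) ** Z y"
    unfolding Zd_Z_anti[of "Q *v x" x] by (simp add: mtx_distrib mtx_scale mtx_assoc)
  also have "\<dots> = cinner (Q *v x) x *\<^sub>M (Zd y ** Z y) - cinner (Q *v x) y *\<^sub>M (Zd x ** Z y) + Zd x ** Zd y ** (?q ** Z y)"
    unfolding Zd_Z_anti[of "Q *v x" y] by (simp add: mtx_distrib mtx_scale mtx_assoc)
  also have "Zd x ** Zd y ** (?q ** Z y) = - (?X ** ?q)"
    unfolding Z_anti[of "Q *v x" y] by (simp add: mtx_distrib mtx_assoc)
  finally have "?X ** ?q + ?q ** ?X = cinner (Q *v x) x *\<^sub>M (Zd y ** Z y) - cinner (Q *v x) y *\<^sub>M (Zd x ** Z y)"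
    by simp
  then have "normalized_trace (gig_density Z Q ** (?X ** Z x)) =
    cinner (Q *v x) x * normalized_trace (gig_density Z Q ** (Zd y ** Z y)) -
    cinner (Q *v x) y * normalized_trace (gig_density Z Q ** (Zd x ** Z y))"
    unfolding gaussian_trace_Z[OF g, of ?X x] by (simp add: mtx_distrib mtx_scale tau_linear)
  then show ?thesis
    unfolding two_point[OF assms] by (simp add: cinner_dagger_left symbols_hermitian[OF assms])
qed

text \<open>The one particle density matrix. It is linear on all operators, although
  \<open>gig_density\<close>, which it inverts on symbols, is not affine in the symbol.\<close>

definition symbol_of :: "'k cop \<Rightarrow> 'n cop" where
  "symbol_of \<rho> = (\<chi> i j. normalized_trace (\<rho> ** (Zd (axis j 1) ** Z (axis i 1))))"

lemma symbol_of_linear: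
  "symbol_of (X + Y) = symbol_of X + symbol_of Y" "symbol_of (X - Y) = symbol_of X - symbol_of Y"
  "symbol_of (c *\<^sub>M X) = c *\<^sub>M symbol_of X"
  by (rule mat_eqI, simp add: symbol_of_def mtx_distrib mtx_scale tau_linear)+

lemma bounded_linear_symbol_of: "bounded_linear symbol_of"
  by (rule linear_matI) (simp_all add: symbol_of_linear)

lemma symbol_of_gig: "Q \<in> symbols \<Longrightarrow> symbol_of (gig_density Z Q) = Q"
  by (rule mat_eqI) (simp add: symbol_of_def two_point matrix_axis_nth[of Q])

lemma gig_density_inj: "Q \<in> symbols \<Longrightarrow> Q' \<in> symbols \<Longrightarrow> gig_density Z Q = gig_density Z Q' \<Longrightarrow> Q = Q'"
  by (metis symbol_of_gig)

subsection \<open>Gaussian states span the gauge invariant algebra\<close>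

lemma Z_fock_orthogonal: "(\<And>e. e \<in> set es \<Longrightarrow> cinner \<psi> e = 0) \<Longrightarrow> Z \<psi> *v fock es = 0"
proof (induction es)
  case (Cons e es)
  have "Z \<psi> *v fock (e # es) = (Z \<psi> ** Zd e) *v fock es" by (simp add: mtx_vec)
  also have "\<dots> = 0" unfolding Zd_Z_anti using Cons by (simp add: mtx_vec vec_scale_simps)
  finally show ?case .
qed (simp add: vac)

lemma Zd_fock_member: "e \<in> set es \<Longrightarrow> Zd e *v fock es = 0"
proof (induction es)
  case (Cons a es)
  have "Zd e *v fock (a # es) = (Zd e ** Zd a) *v fock es" by (simp add: mtx_vec)
  also have "\<dots> = 0"
  proof (cases "e = a")
    case False
    then show ?thesis unfolding Zd_anti[of e] using Cons by (simp add: mtx_vec)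
  qed simp
  finally show ?case .
qed simp

lemma Zd_list_proj_fock: "set es' \<subseteq> set es \<Longrightarrow> Zd (list_proj es' *v x) *v fock es = 0"
  by (induction es') (simp_all add: mtx_vec ketbra_vec Z_simps dagger_simps Zd_fock_member vec_scale_simps)

lemma fock_normalized: "orthonormal_list es \<Longrightarrow> cinner (fock es) (fock es) = 1"
proof (induction es)
  case (Cons e es)
  have "cinner (fock (e # es)) (fock (e # es)) = cinner (fock es) ((Z e ** Zd e) *v fock es)"
    by (simp add: mtx_vec cinner_dagger_left)
  also have "\<dots> = 1"
    unfolding Zd_Z_anti using Cons Z_fock_orthogonal[of es e] by (simp add: mtx_vec vec_scale_simps)
  finally show ?case .
qed (simp add: vac)

text \<open>In a Slater determinant the annihilators of vectors orthogonal to \<open>es\<close> give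
  zero, and an occupied mode cannot be created again; so its symbol is the projection onto the
  occupied modes. The factor \<open>CARD('k)\<close> compensates the normalization of the
  trace.\<close>

lemma fock_gaussian:
  assumes "orthonormal_list es"
  shows "is_gaussian (list_proj es) (of_nat CARD('k) *\<^sub>M ketbra (fock es) (fock es))"
  unfolding is_gaussian_def
proof (intro conjI allI)
  let ?D = "of_nat CARD('k) *\<^sub>M ketbra (fock es) (fock es)" and ?Q = "list_proj es"
  show "dagger ?D = ?D" by (simp add: dagger_simps dagger_ketbra)
  show "normalized_trace ?D = 1"
    by (simp add: normalized_trace_def trace_cscale trace_ketbra fock_normalized[OF assms])
  show "W ** ?D = ?D ** W"
    by (simp add: mtx_scale mult_ketbra ketbra_mult W_fock ketbra_linear)
  fix \<psi>
  have "Z \<psi> *v fock es = Z (?Q *v \<psi>) *v fock es + Z (\<psi> - ?Q *v \<psi>) *v fock es"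
    by (simp add: Z_simps mtx_vec)
  also have "Z (\<psi> - ?Q *v \<psi>) *v fock es = 0"
    using list_proj_residual[OF assms] cinner_eq_0_commute by (intro Z_fock_orthogonal) blast
  finally show "Z \<psi> ** ?D = Z (?Q *v \<psi>) ** ?D + ?D ** Z (?Q *v \<psi>)"
    by (simp add: mtx_scale mult_ketbra ketbra_mult Zd_list_proj_fock ketbra_linear)
qed

text \<open>Gram--Schmidt: subtracting from \<open>f\<close> a vector in the span of \<open>es\<close> does not change the
  wedge product of \<open>f # es\<close>.\<close>

lemma fock_gram_schmidt: "\<exists>es c. orthonormal_list es \<and> fock fs = c *s fock es"
proof (induction fs)
  case Nil
  show ?case by (intro exI[of _ "[]"] exI[of _ 1]) (simp add: vec_scale_simps)
next
  case (Cons f fs)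
  then obtain es c where es: "orthonormal_list es" "fock fs = c *s fock es" by blast
  define g where "g = f - list_proj es *v f"
  have f: "f = g + list_proj es *v f" by (simp add: g_def)
  have fg: "fock (f # fs) = c *s (Zd g *v fock es)"
    unfolding fock_Cons es(2)
    by (subst f) (simp add: mtx_vec Z_simps dagger_simps Zd_list_proj_fock)
  show ?case
  proof (cases "g = 0")
    case True
    then have "fock (f # fs) = 0 *s fock []" using fg by (simp add: vec_scale_simps)
    then show ?thesis by (intro exI[of _ "[]"] exI[of _ 0]) simp
  next
    case False
    define e where "e = (1 / norm g) *\<^sub>R g"
    have "orthonormal_list (e # es)"
      using False es(1) list_proj_residual[OF es(1), of _ f]
      by (auto simp: e_def cinner_simps cinner_same power2_eq_square g_def[symmetric] cinner_eq_0_commute[of g])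
    moreover have "g = of_real (norm g) *s e"
      using False by (simp add: e_def vec_eq_iff scaleR_conv_of_real[where 'a=complex])
    then have "Zd g = of_real (norm g) *\<^sub>M Zd e"
      using Z_scale[of "of_real (norm g)" e] by (simp add: dagger_cscale)
    then have "fock (f # fs) = (c * of_real (norm g)) *s fock (e # es)"
      unfolding fg by (simp only: fock_Cons cscale_vec vec_scale_simps)
    ultimately show ?thesis by blast
  qed
qed

text \<open>Operators between Fock vectors of equal particle number come from Gaussian densities by
  polarization; those between different numbers are trace orthogonal to the whole gauge algebra. A
  gauge invariant operator of the second kind is orthogonal to itself, hence zero.\<close>

theorem gauge_alg_induct:
  assumes add: "\<And>X Y. X \<in> L \<Longrightarrow> Y \<in> L \<Longrightarrow> X + Y \<in> L" and scale: "\<And>c X. X \<in> L \<Longrightarrow> c *\<^sub>M X \<in> L"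
    and gig: "\<And>Q. Q \<in> symbols \<Longrightarrow> gig_density Z Q \<in> L"
    and X: "X \<in> gauge_alg Z"
  shows "X \<in> L"
proof -
  define M where "M = L \<inter> gauge_alg Z"
  have Madd: "X + Y \<in> M" if "X \<in> M" "Y \<in> M" for X Y
    using that add by (auto simp: M_def gauge_alg_def mtx_distrib)
  have Mscale: "c *\<^sub>M X \<in> M" if "X \<in> M" for c X
    using that scale by (auto simp: M_def gauge_alg_def mtx_scale)
  have Mgig: "Q \<in> symbols \<Longrightarrow> gig_density Z Q \<in> M" for Q
    using gig gig_density_in_gauge_alg by (simp add: M_def)
  have M0: "0 \<in> M" using Mscale[OF Mgig, of "list_proj []" 0] list_proj_symbol[of "[]"] by simp
  have diag: "ketbra (fock fs) (fock fs) \<in> M" for fs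
  proof -
    obtain es c where es: "orthonormal_list es" "fock fs = c *s fock es" using fock_gram_schmidt by blast
    have "of_nat CARD('k) *\<^sub>M ketbra (fock es) (fock es) \<in> M"
      using Mgig[OF list_proj_symbol[OF es(1)]] gig_density_unique[OF list_proj_symbol fock_gaussian, OF es(1) es(1)] by simp
    from Mscale[OF this, of "cnj c * c / of_nat CARD('k)"] show ?thesis
      by (simp add: es(2) ketbra_linear)
  qed
  \<comment> \<open>The slots are polarized one at a time; the prefix \<open>hs\<close> collects the
    slots in which both words already agree.\<close>
  have balanced: "length fs = length gs \<Longrightarrow> ketbra (fock (hs @ fs)) (fock (hs @ gs)) \<in> M" for fs gs hs
  proof (induction fs gs arbitrary: hs rule: list_induct2)
    case Nil
    then show ?case using diag by simp
  next
    case (Cons f fs g gs)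
    define a where "a u = fock (hs @ u # fs)" for u
    define b where "b u = fock (hs @ u # gs)" for u
    have lin: "a (u + c *s v) = a u + c *s a v" "b (u + c *s v) = b u + c *s b v" for u v c
      by (simp_all add: a_def b_def cre_append Z_simps dagger_simps mtx_vec)
    have ab: "ketbra (a u) (b u) \<in> M" for u
      using Cons.IH[of "hs @ [u]"] by (simp add: a_def b_def)
    let ?k = "\<lambda>c. ketbra (a (f + c *s g)) (b (f + c *s g))"
    have "4 *\<^sub>M ketbra (a f) (b g) = ?k 1 + \<i> *\<^sub>M ?k \<i> + (- 1) *\<^sub>M ?k (- 1) + (- \<i>) *\<^sub>M ?k (- \<i>)"
      unfolding lin by (rule mat_eqI) (simp add: algebra_simps)
    also have "\<dots> \<in> M" by (intro Madd Mscale ab)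
    finally have "(1/4) *\<^sub>M 4 *\<^sub>M ketbra (a f) (b g) \<in> M" by (rule Mscale)
    then show ?case by (simp add: a_def b_def)
  qed
  define U where "U = {u. \<forall>Y. N ** Y = Y ** N \<longrightarrow> trace (Y ** u) = 0}"
  have U: "0 \<in> U" "\<And>u v. u \<in> U \<Longrightarrow> v \<in> U \<Longrightarrow> u + v \<in> U" "\<And>c u. u \<in> U \<Longrightarrow> c *\<^sub>M u \<in> U"
    by (auto simp: U_def mtx_distrib mtx_scale trace_add trace_cscale)
  have unbalanced: "ketbra (fock fs) (fock gs) \<in> U" if "length fs \<noteq> length gs" for fs gs
    unfolding U_def
  proof (clarify)
    fix Y assume Y: "N ** Y = Y ** N"
    have "of_nat (length fs) * cinner (fock gs) (Y *v fock fs) = cinner (fock gs) (Y *v (N *v fock fs))"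
      by (simp add: N_fock mtx_vec cinner_simps)
    also have "\<dots> = cinner (N *v fock gs) (Y *v fock fs)"
    proof -
      have "Y *v (N *v x) = N *v (Y *v x)" for x by (simp add: matrix_vector_mul_assoc Y)
      then show ?thesis by (simp only: cinner_dagger[of _ N] N_hermitian)
    qed
    also have "\<dots> = of_nat (length gs) * cinner (fock gs) (Y *v fock fs)"
      by (simp add: N_fock cinner_simps)
    finally show "trace (Y ** ketbra (fock fs) (fock gs)) = 0"
      using that by (simp add: trace_mult_ketbra)
  qed
  define S where "S = {b + u | b u. b \<in> M \<and> u \<in> U}"
  have S0: "M \<subseteq> S" "U \<subseteq> S" using M0 U(1) by (force simp: S_def)+
  have Sadd: "X + Y \<in> S" if XY: "X \<in> S" "Y \<in> S" for X Y
  proof -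
    obtain b u b' u' where "X = b + u" "Y = b' + u'" "b \<in> M" "u \<in> U" "b' \<in> M" "u' \<in> U"
      using XY unfolding S_def by blast
    then have "X + Y = (b + b') + (u + u') \<and> b + b' \<in> M \<and> u + u' \<in> U" using Madd U(2) by simp
    then show ?thesis unfolding S_def by blast
  qed
  have Sscale: "c *\<^sub>M X \<in> S" if "X \<in> S" for c X
    using that Mscale U(3) unfolding S_def by (clarsimp simp: cscale_add_right) blast
  have "ketbra (fock fs) (fock gs) \<in> S" for fs gs
    using balanced[of fs gs "[]"] unbalanced[of fs gs] S0 by (cases "length fs = length gs") auto
  moreover have sub: "vec.subspace {x. ketbra x y \<in> S}" "vec.subspace {x. ketbra y x \<in> S}" for y
    using S0 M0 by (auto simp: vec.subspace_def ketbra_linear Sadd Sscale)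
  ultimately have "ketbra x (fock gs) \<in> S" for x gs
    using fock_subspace_UNIV[of "{x. ketbra x (fock gs) \<in> S}" x] by simp
  with sub(2) have kS: "ketbra x y \<in> S" for x y
    using fock_subspace_UNIV[of "{y. ketbra x y \<in> S}" y] by simp
  have "sum f J \<in> S" if "\<And>j. f j \<in> S" for f and J :: "'k set"
    using that S0 M0 by (induction J rule: infinite_finite_induct) (auto intro: Sadd)
  then have "X \<in> S" by (subst matrix_ketbra_sum) (simp add: kS)
  then obtain b u where bu: "X = b + u" "b \<in> M" "u \<in> U" by (auto simp: S_def)
  have "u = X - b" using bu by simp
  then have "N ** u = u ** N" using X bu(2) by (simp add: M_def gauge_alg_def mtx_distrib)
  then have "dagger (N ** u) = dagger (u ** N)" by simp
  then have "N ** dagger u = dagger u ** N" by (simp add: dagger_mult N_hermitian)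
  then have "trace (dagger u ** u) = 0" using bu(3) by (simp add: U_def)
  then have "u = 0" by (simp add: trace_square_eq_0)
  then show ?thesis using bu by (simp add: M_def)
qed


subsection \<open>Continuity in the symbol\<close>

lemma norm_matrix_bound:
  fixes A :: "'a::finite cop"
  assumes "\<And>i j. cmod (A $ i $ j) \<le> B"
  shows "norm A \<le> real CARD('a) * (real CARD('a) * B)"
proof -
  have l1: "norm v \<le> (\<Sum>j\<in>UNIV. norm (v $ j))" for v :: "'b::real_normed_vector ^ 'a"
    by (simp add: norm_vec_def L2_set_le_sum)
  have row: "norm (A $ i) \<le> real CARD('a) * B" for i
    using l1[of "A $ i"] sum_bounded_above[of UNIV "\<lambda>j. cmod (A $ i $ j)" B] assms by force
  show ?thesis
    using l1[of A] sum_bounded_above[of UNIV "\<lambda>i. norm (A $ i)" "real CARD('a) * B"] row by force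
qed

text \<open>The trace of \<open>r ** r\<close> fixes the Hilbert-Schmidt norm of the root, which
  bounds its entries and those of its square. Only uniformity in \<open>Q\<close> matters, not the
  value of the bound.\<close>

lemma gig_density_norm_bound:
  assumes "Q \<in> symbols"
  shows "norm (gig_density Z Q) \<le> real CARD('k) * (real CARD('k) * real CARD('k) ^ 3)"
proof -
  obtain r where r: "dagger r = r" "r ** r = gig_density Z Q" using gig_density_square[OF assms] by blast
  have t: "trace (gig_density Z Q) = of_nat CARD('k)"
    using is_gaussianD(2)[OF gig_density_gaussian[OF assms]] by (simp add: normalized_trace_def)
  have "trace (dagger r ** r) = (\<Sum>i\<in>UNIV. \<Sum>l\<in>UNIV. complex_of_real ((cmod (r $ l $ i))\<^sup>2))"
    by (simp add: trace_def matrix_mult_nth complex_norm_square mult.commute del: of_real_power)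
  then have "complex_of_real (\<Sum>i\<in>UNIV. \<Sum>l\<in>UNIV. (cmod (r $ l $ i))\<^sup>2) = of_real (real CARD('k))"
    using t r by simp
  then have s: "(\<Sum>i\<in>UNIV. \<Sum>l\<in>UNIV. (cmod (r $ l $ i))\<^sup>2) = real CARD('k)"
    by (simp only: of_real_eq_iff)
  have "cmod (r $ l $ i) \<le> real CARD('k)" for l i
  proof -
    have "(cmod (r $ l $ i))\<^sup>2 \<le> (\<Sum>l\<in>UNIV. (cmod (r $ l $ i))\<^sup>2)"
      by (rule member_le_sum) auto
    also have "\<dots> \<le> (\<Sum>i\<in>UNIV. \<Sum>l\<in>UNIV. (cmod (r $ l $ i))\<^sup>2)"
      by (rule member_le_sum[of i UNIV "\<lambda>i. \<Sum>l\<in>UNIV. (cmod (r $ l $ i))\<^sup>2"]) (auto intro: sum_nonneg)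
    also have "\<dots> \<le> (real CARD('k))\<^sup>2" unfolding s by (simp add: power2_eq_square)
    finally show ?thesis by (rule power2_le_imp_le) simp
  qed
  then have "cmod (gig_density Z Q $ i $ j) \<le> real CARD('k) ^ 3" for i j
  proof -
    have "cmod (gig_density Z Q $ i $ j) \<le> (\<Sum>l\<in>UNIV. cmod (r $ i $ l) * cmod (r $ l $ j))"
      unfolding r(2)[symmetric] matrix_mult_nth by (rule order_trans[OF norm_sum]) (simp add: norm_mult)
    also have "\<dots> \<le> (\<Sum>l\<in>(UNIV :: 'k set). real CARD('k) * real CARD('k))"
      by (intro sum_mono mult_mono \<open>\<And>l i. cmod (r $ l $ i) \<le> real CARD('k)\<close>) auto
    finally show ?thesis by (simp add: power3_eq_cube)
  qed
  then show ?thesis by (rule norm_matrix_bound)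
qed

text \<open>Eigenvectors need not vary continuously with \<open>Q\<close>. Instead, the graph is cut
  out by the closed relations \<open>is_gaussian\<close>, and a closed graph with compact target
  implies continuity.\<close>

lemma continuous_on_gig_density: "continuous_on symbols (gig_density Z)"
proof -
  let ?T = "cball 0 (real CARD('k) * (real CARD('k) * real CARD('k) ^ 3)) :: 'k cop set"
  have T: "compact ?T" by (rule compact_cball)
  have im: "gig_density Z \<in> symbols \<rightarrow> ?T" using gig_density_norm_bound by (simp add: Pi_iff)
  have Zc: "continuous_on UNIV (\<lambda>p :: 'n cop \<times> 'k cop. Z (fst p *v \<psi>))" for \<psi>
    by (intro linear_continuous_on bounded_linear_compose[OF bounded_linear_Z]
        bounded_linear_compose[OF bounded_linear_mat_vec] bounded_linear_fst)
  have "closed {p. is_gaussian (fst p) (snd p)}"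
    unfolding is_gaussian_def
    by (intro closed_Collect_conj closed_Collect_all closed_Collect_eq continuous_intros Zc
        continuous_on_compose2[OF linear_continuous_on[OF bounded_linear_dagger], of UNIV]
        continuous_on_compose2[OF linear_continuous_on[OF bounded_linear_tau], of UNIV]) auto
  moreover have "(\<lambda>Q. (Q, gig_density Z Q)) ` symbols = symbols \<times> ?T \<inter> {p. is_gaussian (fst p) (snd p)}"
  proof (intro subset_antisym subsetI)
    fix p assume "p \<in> (\<lambda>Q. (Q, gig_density Z Q)) ` symbols"
    then obtain Q where Q: "Q \<in> symbols" "p = (Q, gig_density Z Q)" by blast
    then show "p \<in> symbols \<times> ?T \<inter> {p. is_gaussian (fst p) (snd p)}"
      using gig_density_gaussian[OF Q(1)] gig_density_norm_bound[OF Q(1)] by simp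
  next
    fix p assume p: "p \<in> symbols \<times> ?T \<inter> {p. is_gaussian (fst p) (snd p)}"
    then have Q: "fst p \<in> symbols" by auto
    have "gig_density Z (fst p) = snd p" using p by (intro gig_density_unique[OF Q]) simp
    then have "p = (fst p, gig_density Z (fst p))" by simp
    then show "p \<in> (\<lambda>Q. (Q, gig_density Z Q)) ` symbols" using Q by (rule image_eqI)
  qed
  ultimately have "closedin (top_of_set (symbols \<times> ?T)) ((\<lambda>Q. (Q, gig_density Z Q)) ` symbols)"
    by (simp only: closedin_closed_Int)
  then show ?thesis unfolding continuous_closed_graph_eq[OF T im] .
qed

end

section \<open>The Evans--Hugenholtz--Kadison construction\<close>

subsection \<open>Block operators and tensor products\<close>

lemma sum_UNIV_Plus: "(\<Sum>s\<in>(UNIV :: ('a::finite + 'b::finite) set). f s) = (\<Sum>i\<in>UNIV. f (Inl i)) + (\<Sum>j\<in>UNIV. f (Inr j))"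
  unfolding UNIV_Plus_UNIV[symmetric] by (subst sum.Plus) simp_all

lemma direct_sum_nth [simp]: "direct_sum x y $ Inl i = x $ i" "direct_sum x y $ Inr j = y $ j"
  by (simp_all add: direct_sum_def)

lemma vec_sum_eqI: "(\<And>i. x $ Inl i = y $ Inl i) \<Longrightarrow> (\<And>j. x $ Inr j = y $ Inr j) \<Longrightarrow> x = y"
  unfolding vec_eq_iff by (metis obj_sumE)

lemma direct_sum_parts: "direct_sum (\<chi> i. \<xi> $ Inl i) (\<chi> i. \<xi> $ Inr i) = \<xi>"
  by (rule vec_sum_eqI) simp_all

lemma direct_sum_cases: obtains \<psi> \<eta> where "\<xi> = direct_sum \<psi> \<eta>"
  using direct_sum_parts by metis

lemma cinner_direct_sum: "cinner (direct_sum x y) (direct_sum z w) = cinner x z + cinner y w"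
  for x z :: "complex ^ 'a::finite" and y w :: "complex ^ 'b::finite"
  by (simp add: cinner_def sum_UNIV_Plus)

lemma block_op_nth [simp]:
  "block_op A B C D $ Inl i $ Inl j = A $ i $ j" "block_op A B C D $ Inl i $ Inr j = B $ i $ j"
  "block_op A B C D $ Inr i $ Inl j = C $ i $ j" "block_op A B C D $ Inr i $ Inr j = D $ i $ j"
  by (simp_all add: block_op_def)

lemma block_op_vec: "block_op A B C D *v direct_sum x y = direct_sum (A *v x + B *v y) (C *v x + D *v y)"
  by (rule vec_sum_eqI) (simp_all add: matrix_vector_mult_def sum_UNIV_Plus)

lemma block_op_mult:
  "block_op A B C D ** block_op A' B' C' D' =
    block_op (A ** A' + B ** C') (A ** B' + B ** D') (C ** A' + D ** C') (C ** B' + D ** D')"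
  by (rule vec_sum_eqI; rule vec_sum_eqI) (simp_all add: matrix_mult_nth sum_UNIV_Plus)

lemma block_op_dagger: "dagger (block_op A B C D) = block_op (dagger A) (dagger C) (dagger B) (dagger D)"
  by (rule vec_sum_eqI; rule vec_sum_eqI) simp_all

lemma block_op_one: "block_op (mat 1) 0 0 (mat 1) = mat 1"
  by (rule vec_sum_eqI; rule vec_sum_eqI) (simp_all add: mat_def)

lemma kron_nth [simp]: "kron A B $ p $ q = A $ fst p $ fst q * B $ snd p $ snd q"
  by (simp add: kron_def)

lemma sum_UNIV_prod: "(\<Sum>p\<in>(UNIV :: ('a::finite \<times> 'b::finite) set). f p) = (\<Sum>a\<in>UNIV. \<Sum>b\<in>UNIV. f (a, b))"
  unfolding UNIV_Times_UNIV[symmetric] sum.cartesian_product by simp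

lemma kron_linear:
  "kron (A + B) C = kron A C + kron B C" "kron C (A + B) = kron C A + kron C B"
  "kron (A - B) C = kron A C - kron B C" "kron C (A - B) = kron C A - kron C B"
  "kron (- A) C = - kron A C" "kron C (- A) = - kron C A"
  "kron (c *\<^sub>M A) C = c *\<^sub>M kron A C" "kron C (c *\<^sub>M A) = c *\<^sub>M kron C A"
  "kron 0 C = 0" "kron C 0 = 0"
  by (auto intro!: mat_eqI simp: algebra_simps)

lemma kron_mult: "kron A B ** kron C D = kron (A ** C) (B ** D)"
  by (rule mat_eqI) (simp add: matrix_mult_nth sum_UNIV_prod sum_product mult_ac)

lemma kron_dagger: "dagger (kron A B) = kron (dagger A) (dagger B)"
  by (rule mat_eqI) simp

lemma kron_one: "kron (mat 1) (mat 1) = mat 1"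
  by (rule mat_eqI) (simp add: mat_def prod_eq_iff)

lemma tau_kron: "normalized_trace (kron A B) = normalized_trace A * normalized_trace B"
  by (simp add: normalized_trace_def trace_def sum_UNIV_prod sum_product)

lemma tau_dagger: "normalized_trace (dagger A) = cnj (normalized_trace A)"
  by (simp add: normalized_trace_def trace_dagger)

lemma cinner_kron_one:
  "cinner v (kron (mat 1) X *v w) = (\<Sum>a\<in>UNIV. cinner (\<chi> b. v $ (a, b)) (X *v (\<chi> b. w $ (a, b))))"
proof -
  have "(kron (mat 1) X *v w) $ (a, b) = (X *v (\<chi> b. w $ (a, b))) $ b" for a b
  proof -
    have "(kron (mat 1) X *v w) $ (a, b) = (\<Sum>c\<in>UNIV. if a = c then \<Sum>d\<in>UNIV. X $ b $ d * w $ (c, d) else 0)"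
      unfolding matrix_vector_mult_def vec_lambda_beta sum_UNIV_prod kron_nth
      by (intro sum.cong refl) (simp add: mat_def)
    then show ?thesis by (simp add: matrix_vector_mult_def)
  qed
  then show ?thesis by (simp add: cinner_def sum_UNIV_prod)
qed

lemma kron_span:
  assumes add: "\<And>X Y. X \<in> C \<Longrightarrow> Y \<in> C \<Longrightarrow> X + Y \<in> C" and scale: "\<And>c X. X \<in> C \<Longrightarrow> c *\<^sub>M X \<in> C"
    and kron: "\<And>A B. kron A B \<in> C"
  shows "X \<in> (C :: ('k::finite \<times> 'l::finite) cop set)"
proof -
  have zero: "0 \<in> C" using scale[OF kron, of 0 0 0] by simp
  have sum: "(\<And>i. f i \<in> C) \<Longrightarrow> sum f S \<in> C" for f and S :: "('k \<times> 'l) set"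
    by (induction S rule: infinite_finite_induct) (auto intro: add zero)
  have "ketbra (axis p 1) (axis q 1) = kron (ketbra (axis (fst p) 1) (axis (fst q) 1)) (ketbra (axis (snd p) 1) (axis (snd q) 1))"
    for p q :: "'k \<times> 'l"
    by (rule mat_eqI) (auto simp: axis_def prod_eq_iff)
  then have e: "ketbra (axis p 1) (axis q 1) \<in> C" for p q using kron by metis
  have "vec.subspace {x. ketbra x y \<in> C}" for y
    using zero add scale by (auto simp: vec.subspace_def ketbra_linear)
  then have s: "(\<Sum>p\<in>S. c p *s axis p 1) \<in> {x. ketbra x (axis q 1) \<in> C}" for S c q
    using e by (intro vec.subspace_sum vec.subspace_scale) auto
  have "(\<Sum>p\<in>UNIV. x $ p *s axis p 1) = x" for x :: "complex ^ ('k \<times> 'l)"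
    using orthonormal_basis_expand[OF orthonormal_basis_axis, of x, symmetric] by (simp add: cinner_axis_left)
  then have "ketbra x (axis q 1) \<in> C" for x q using s[of "\<lambda>p. x $ p" UNIV q] by simp
  then show ?thesis by (subst matrix_ketbra_sum) (intro sum)
qed

text \<open>Used for the functional that takes the trace against embedded operators, where the
  representing operator is the conditional expectation.\<close>

lemma tau_riesz:
  fixes \<phi> :: "'k::finite cop \<Rightarrow> complex"
  assumes "\<And>X Y. \<phi> (X + Y) = \<phi> X + \<phi> Y" "\<And>c X. \<phi> (c *\<^sub>M X) = c * \<phi> X"
  shows "\<exists>Y. \<forall>V. normalized_trace (V ** Y) = \<phi> V"
proof -
  define Y :: "'k cop" where "Y = (\<chi> i j. of_nat CARD('k) * \<phi> (ketbra (axis j 1) (axis i 1)))"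
  have "\<phi> 0 = 0" using assms(2)[of 0 0] by simp
  then have sum: "\<phi> (sum f S) = (\<Sum>i\<in>S. \<phi> (f i))" for f and S :: "'k set"
    by (induction S rule: infinite_finite_induct) (simp_all add: assms(1))
  have "normalized_trace (V ** Y) = \<phi> V" for V
  proof -
    have k: "ketbra (V *v axis j 1) (axis j 1) = (\<Sum>i\<in>UNIV. V $ i $ j *\<^sub>M ketbra (axis i 1) (axis j 1))" for j
    proof -
      have "V *v axis j 1 = (\<Sum>i\<in>UNIV. V $ i $ j *s axis i 1)"
        using orthonormal_basis_expand[OF orthonormal_basis_axis, of "V *v axis j 1"]
        by (simp add: matrix_axis_nth[of V])
      moreover have "ketbra (\<Sum>i\<in>S. c i *s axis i 1) y = (\<Sum>i\<in>S. c i *\<^sub>M ketbra (axis i 1) y)" for S :: "'k set" and c y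
        by (induction S rule: infinite_finite_induct) (simp_all add: ketbra_linear)
      ultimately show ?thesis by simp
    qed
    have "\<phi> V = (\<Sum>j\<in>UNIV. \<Sum>i\<in>UNIV. V $ i $ j * \<phi> (ketbra (axis i 1) (axis j 1)))"
      by (subst matrix_ketbra_sum[of V]) (simp add: sum k assms(2))
    also have "\<dots> = (\<Sum>i\<in>UNIV. \<Sum>j\<in>UNIV. V $ i $ j * \<phi> (ketbra (axis i 1) (axis j 1)))"
      by (rule sum.swap)
    also have "\<dots> = normalized_trace (V ** Y)"
      by (simp add: normalized_trace_def trace_def matrix_mult_nth Y_def sum_divide_distrib)
    finally show ?thesis by simp
  qed
  then show ?thesis by blast
qed


subsection \<open>Compatible pairs\<close>

text \<open>\<open>S\<close> intertwines \<open>mat 1 - dagger S ** S\<close> with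
  \<open>mat 1 - S ** dagger S\<close>, hence also their roots; this cancels the off-diagonal blocks
  in the square of \<open>ehk_U S\<close>.\<close>

lemma contraction_intertwine:
  fixes S :: "'n::finite cop"
  assumes "contraction S"
  shows "op_sqrt (mat 1 - S ** dagger S) ** S = S ** op_sqrt (mat 1 - dagger S ** S)"
  using contraction_imp_psd[OF assms]
  by (intro op_sqrt_intertwine) (simp_all add: mtx_distrib mtx_assoc)

lemma ehk_U_unitary:
  fixes S :: "'n::finite cop"
  assumes "contraction S"
  shows "dagger (ehk_U S) = ehk_U S" "ehk_U S ** ehk_U S = mat 1"
proof -
  define a where "a = op_sqrt (mat 1 - S ** dagger S)"
  define b where "b = op_sqrt (mat 1 - dagger S ** S)"
  note p = contraction_imp_psd[OF assms]
  have a: "dagger a = a" "a ** a = mat 1 - S ** dagger S"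
    unfolding a_def using op_sqrt_psd[OF p(2)] psd_hermitian by auto
  have b: "dagger b = b" "b ** b = mat 1 - dagger S ** S"
    unfolding b_def using op_sqrt_psd[OF p(1)] psd_hermitian by auto
  have i: "a ** S = S ** b" unfolding a_def b_def by (rule contraction_intertwine[OF assms])
  have i': "dagger S ** a = b ** dagger S" using arg_cong[OF i, of dagger] by (simp add: dagger_simps a b)
  show "dagger (ehk_U S) = ehk_U S"
    by (simp add: ehk_U_def a_def[symmetric] b_def[symmetric] block_op_dagger dagger_simps a b)
  show "ehk_U S ** ehk_U S = mat 1"
    by (simp add: ehk_U_def a_def[symmetric] b_def[symmetric] block_op_mult mtx_distrib a b i i' block_op_one)
qed

text \<open>Let \<open>a\<close> be the root of \<open>D\<close> and \<open>X\<close> its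
  Moore-Penrose inverse. Then \<open>T = X ** R ** X\<close> is forced on the range of
  \<open>D\<close>, and the kernel condition fixes the rest.\<close>

lemma ehk_T_exists:
  fixes S R :: "'n::finite cop"
  assumes "compatible S R"
  defines "D \<equiv> mat 1 - S ** dagger S"
  shows "\<exists>!T. T \<in> symbols \<and> (\<forall>v. D *v v = 0 \<longrightarrow> T *v v = 0) \<and> R = op_sqrt D ** T ** op_sqrt D"
proof -
  have D: "psd D" using assms contraction_imp_psd(2) by (auto simp: compatible_def)
  have R: "psd R" "psd (D - R)" using assms by (auto simp: compatible_def op_le_def)
  define a where "a = op_sqrt D"
  have a: "psd a" "a ** a = D" "dagger a = a" unfolding a_def using op_sqrt_psd[OF D] psd_hermitian by auto
  obtain \<psi> \<mu> where s: "orthonormal_basis \<psi>" "\<And>j. a *v \<psi> j = \<mu> j *\<^sub>R \<psi> j"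
    using spectral_theorem[OF a(3)] by blast
  define X where "X = (\<Sum>j\<in>UNIV. (if \<mu> j = 0 then 0 else 1 / \<mu> j) *\<^sub>R ketbra (\<psi> j) (\<psi> j))"
  have X\<psi>: "X *v \<psi> j = (if \<mu> j = 0 then 0 else 1 / \<mu> j) *\<^sub>R \<psi> j" for j
    unfolding X_def by (rule spectral_vec[OF s(1)])
  have Xh: "dagger X = X" unfolding X_def by (rule spectral_hermitian)
  define p where "p = X ** a"
  have p\<psi>: "p *v \<psi> j = (if \<mu> j = 0 then 0 else \<psi> j)" for j
    by (simp add: p_def mtx_vec s(2) X\<psi>)
  have p2: "p = a ** X" by (rule orthonormal_matrix_eqI[OF s(1)]) (simp add: p\<psi> mtx_vec s(2) X\<psi>)
  have ph: "dagger p = p" by (simp add: p_def dagger_mult Xh a p2[unfolded p_def, symmetric])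
  have pp: "p ** p = p" by (rule orthonormal_matrix_eqI[OF s(1)]) (simp add: mtx_vec p\<psi>)
  have kerD: "D *v v = 0 \<longleftrightarrow> p *v v = 0" for v
  proof
    assume "D *v v = 0"
    then have "X *v (X *v (D *v v)) = 0" by simp
    then have "X ** (X ** a) ** a *v v = 0" by (simp add: a(2)[symmetric] mtx_vec)
    moreover have "X ** (X ** a) ** a = X ** (a ** X) ** a" using p2 p_def by simp
    then have "X ** (X ** a) ** a = p ** p" by (simp add: p_def mtx_assoc)
    ultimately show "p *v v = 0" by (simp add: pp)
  next
    assume "p *v v = 0"
    moreover have "D = D ** p"
      by (rule orthonormal_matrix_eqI[OF s(1)]) (simp add: a(2)[symmetric] mtx_vec p\<psi> s(2))
    then have "D *v v = D *v (p *v v)" by (metis matrix_vector_mult_mult)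
    ultimately show "D *v v = 0" by simp
  qed
  have ker: "M ** p = M" if "\<And>v. D *v v = 0 \<Longrightarrow> M *v v = 0" for M :: "'n cop"
  proof -
    have "p *v (v - p *v v) = p *v v - (p ** p) *v v" for v by (simp add: mtx_vec)
    then have "p *v (v - p *v v) = 0" for v by (simp add: pp)
    then have "M *v (v - p *v v) = 0" for v using that kerD by blast
    then show ?thesis by (intro matrix_eqI_vec) (simp add: mtx_vec)
  qed
  \<comment> \<open>On the kernel of \<open>D\<close> the form of \<open>R\<close> is squeezed
    between zero and the form of \<open>D\<close>; so \<open>R\<close> vanishes there and is not
    changed by the range projection \<open>p\<close>.\<close>
  have kerR: "R *v v = 0" if "D *v v = 0" for v
  proof (rule psd_zero_form[OF R(1)])
    have "0 \<le> Re (cinner v ((D - R) *v v))" using R(2) by (simp add: psd_iff)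
    then have "Re (cinner v (R *v v)) = 0"
      using R(1) that by (simp add: psd_iff mtx_vec cinner_simps order_antisym)
    then show "cinner v (R *v v) = 0"
      using hermitian_cinner_real[OF psd_hermitian[OF R(1)], of v] by simp
  qed
  have Rp: "R ** p = R" by (rule ker[OF kerR])
  have pR: "p ** R = R" using arg_cong[OF Rp, of dagger] by (simp add: dagger_mult ph psd_hermitian[OF R(1)])
  have compress: "p ** T ** p = T" if "dagger T = T" "\<And>v. D *v v = 0 \<Longrightarrow> T *v v = 0" for T
  proof -
    have Tp: "T ** p = T" by (rule ker[OF that(2)])
    have "p ** T = T" using arg_cong[OF Tp, of dagger] by (simp add: dagger_mult ph that(1))
    then show ?thesis using Tp by simp
  qed
  define T where "T = X ** R ** X"
  have T1: "psd T" using psd_conj[OF R(1), of X] by (simp add: T_def Xh)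
  have T2: "psd (mat 1 - T)"
  proof -
    have "psd (X ** (D - R) ** X)" using psd_conj[OF R(2), of X] by (simp add: Xh)
    moreover have "X ** D ** X = (X ** a) ** (a ** X)" by (simp add: a(2)[symmetric] mtx_assoc)
    then have "X ** D ** X = p" by (simp only: p_def[symmetric] p2[symmetric] pp)
    ultimately have "psd (p - T)" by (simp add: T_def mtx_distrib)
    moreover have "psd (mat 1 - p)"
      using psd_square[of "mat 1 - p"] by (simp add: dagger_simps ph mtx_distrib pp)
    ultimately have "psd ((p - T) + (mat 1 - p))" by (intro psd_add)
    then show ?thesis by simp
  qed
  have T3: "T *v v = 0" if "D *v v = 0" for v
  proof -
    have "X = X ** p"
      by (rule orthonormal_matrix_eqI[OF s(1)]) (simp add: mtx_vec X\<psi> p\<psi>)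
    then have "X *v v = X *v (p *v v)" by (metis matrix_vector_mult_mult)
    then show ?thesis using that kerD by (simp add: T_def mtx_vec)
  qed
  have T4: "R = a ** T ** a"
  proof -
    have "a ** T ** a = (a ** X) ** R ** (X ** a)" by (simp add: T_def mtx_assoc)
    also have "\<dots> = R" unfolding p2[symmetric] p_def[symmetric] pR Rp ..
    finally show ?thesis by simp
  qed
  show ?thesis
  proof (rule ex1I[of _ T])
    show "T \<in> symbols \<and> (\<forall>v. D *v v = 0 \<longrightarrow> T *v v = 0) \<and> R = op_sqrt D ** T ** op_sqrt D"
      using T1 T2 T3 T4 by (auto simp: symbols_iff a_def)
    fix T' assume T': "T' \<in> symbols \<and> (\<forall>v. D *v v = 0 \<longrightarrow> T' *v v = 0) \<and> R = op_sqrt D ** T' ** op_sqrt D"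
    have "T' = p ** T' ** p" using T' by (intro compress[symmetric]) (auto simp: symbols_iff psd_hermitian)
    also have "\<dots> = X ** (a ** T' ** a) ** X" by (subst (2) p2) (simp add: p_def mtx_assoc)
    also have "\<dots> = T" using T' by (simp add: T_def a_def[symmetric])
    finally show "T' = T" .
  qed
qed

lemma ehk_T:
  assumes "compatible S R"
  shows "ehk_T S R \<in> symbols"
    "R = op_sqrt (mat 1 - S ** dagger S) ** ehk_T S R ** op_sqrt (mat 1 - S ** dagger S)"
proof -
  have "ehk_T S R \<in> symbols \<and> (\<forall>v. (mat 1 - S ** dagger S) *v v = 0 \<longrightarrow> ehk_T S R *v v = 0) \<and>
      R = op_sqrt (mat 1 - S ** dagger S) ** ehk_T S R ** op_sqrt (mat 1 - S ** dagger S)"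
    unfolding ehk_T_def Let_def by (rule theI'[OF ehk_T_exists[OF assms]])
  then show "ehk_T S R \<in> symbols"
    "R = op_sqrt (mat 1 - S ** dagger S) ** ehk_T S R ** op_sqrt (mat 1 - S ** dagger S)" by blast+
qed

text \<open>This is the upper left block of the direct sum of \<open>ehk_T S R\<close> and
  \<open>Q\<close>, conjugated by \<open>ehk_U S\<close>. The lower component stays unspecified
  since the conditional expectation discards it.\<close>

lemma ehk_U_compress:
  assumes "compatible S R"
  shows "\<exists>\<eta>. ehk_U S *v direct_sum (- (ehk_T S R *v (op_sqrt (mat 1 - S ** dagger S) *v \<psi>))) (Q *v (dagger S *v \<psi>))
    = direct_sum ((S ** Q ** dagger S + R) *v \<psi>) \<eta>"
proof -
  let ?a = "op_sqrt (mat 1 - S ** dagger S)" and ?T = "ehk_T S R"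
  have "R *v \<psi> = ?a *v (?T *v (?a *v \<psi>))"
    by (subst ehk_T(2)[OF assms]) (simp add: mtx_vec)
  then show ?thesis
    unfolding ehk_U_def block_op_vec by (intro exI) (simp add: mtx_vec add.commute)
qed

text \<open>The complement of the new symbol is \<open>S ** (mat 1 - Q) ** dagger S\<close> plus the
  slack \<open>mat 1 - S ** dagger S - R\<close>, both positive.\<close>

lemma ehk_symbol:
  assumes "compatible S R" "Q \<in> symbols"
  shows "S ** Q ** dagger S + R \<in> symbols"
proof -
  have R: "psd R" "psd (mat 1 - S ** dagger S - R)" using assms by (auto simp: compatible_def op_le_def)
  have Q: "psd Q" "psd (mat 1 - Q)" using assms(2) by (auto simp: symbols_iff)
  have "psd (S ** Q ** dagger S + R)" by (intro psd_add psd_conj' Q R)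
  moreover have "psd (S ** (mat 1 - Q) ** dagger S + (mat 1 - S ** dagger S - R))"
    by (intro psd_add psd_conj' Q R)
  then have "psd (mat 1 - (S ** Q ** dagger S + R))" by (simp add: mtx_distrib algebra_simps)
  ultimately show ?thesis by (simp add: symbols_iff)
qed

lemma list_proj_map:
  fixes \<psi> :: "'n::finite \<Rightarrow> complex ^ 'n"
  assumes "orthonormal_basis \<psi>" "distinct js"
  shows "orthonormal_list (map \<psi> js)"
  using assms(2)
  by (induction js) (auto simp: orthonormal_basisD[OF assms(1)])

text \<open>A self-adjoint unitary has only the eigenvalues 1 and -1. Listing an orthonormal basis
  of the second eigenspace decomposes it into reflections that can be implemented one field mode at
  a time.\<close>

lemma reflection_list:
  fixes U :: "'n::finite cop"
  assumes "dagger U = U" "U ** U = mat 1"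
  obtains es where "orthonormal_list es" "U = mat 1 - 2 *\<^sub>R list_proj es"
proof -
  obtain \<psi> \<mu> where s: "orthonormal_basis \<psi>" "\<And>j. U *v \<psi> j = \<mu> j *\<^sub>R \<psi> j"
    using spectral_theorem[OF assms(1)] by blast
  have \<mu>: "\<mu> j = 1 \<or> \<mu> j = - 1" for j
  proof -
    have "U *v (U *v \<psi> j) = \<psi> j" by (simp add: matrix_vector_mul_assoc assms(2))
    then have "(\<mu> j * \<mu> j) *\<^sub>R \<psi> j = 1 *\<^sub>R \<psi> j" by (simp add: s(2) mtx_vec)
    then have "\<mu> j * \<mu> j = 1" using orthonormal_nonzero[OF s(1), of j] by (simp only: scaleR_cancel_right) simp
    then show ?thesis by (simp add: square_eq_1_iff)
  qed
  obtain js where js: "set js = {j. \<mu> j = - 1}" "distinct js" using finite_distinct_list[of "{j. \<mu> j = - 1}"] by auto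
  let ?es = "map \<psi> js"
  have o: "orthonormal_list ?es" by (rule list_proj_map[OF s(1) js(2)])
  have "U = mat 1 - 2 *\<^sub>R list_proj ?es"
  proof (rule orthonormal_matrix_eqI[OF s(1)])
    fix j
    show "U *v \<psi> j = (mat 1 - 2 *\<^sub>R list_proj ?es) *v \<psi> j"
    proof (cases "\<mu> j = - 1")
      case True
      then have "list_proj ?es *v \<psi> j = \<psi> j" using js(1) by (intro list_proj_member[OF o]) auto
      moreover have "\<psi> j - 2 *\<^sub>R \<psi> j = (1 - 2) *\<^sub>R \<psi> j" by (simp only: scaleR_left_diff_distrib scaleR_one)
      ultimately show ?thesis
        using True by (simp only: matrix_vector_mult_diff_rdistrib scaleR_vec matrix_vector_mul_lid s(2)) simp
    next
      case False
      have "cinner e (\<psi> j) = 0" if e: "e \<in> set ?es" for e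
      proof -
        obtain i where "\<mu> i = - 1" "e = \<psi> i" using e js(1) by auto
        then show ?thesis using False orthonormal_basisD[OF s(1), of i j] by auto
      qed
      then have "list_proj ?es *v \<psi> j = 0" by (rule list_proj_orthogonal)
      moreover have "\<mu> j = 1" using False \<mu>[of j] by blast
      ultimately show ?thesis
        by (simp only: matrix_vector_mult_diff_rdistrib scaleR_vec matrix_vector_mul_lid s(2)) simp
    qed
  qed
  then show ?thesis using that[OF o] by blast
qed

text \<open>\<open>1 - 2 Z\<^sup>*(e) Z(e)\<close> implements the reflection along the unit vector \<open>e\<close>.\<close>

lemma (in car) reflection_implementer:
  assumes "orthonormal_list es"
  shows "\<exists>\<Gamma>. dagger \<Gamma> ** \<Gamma> = mat 1 \<and> \<Gamma> ** dagger \<Gamma> = mat 1 \<and>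
    (\<forall>\<xi>. \<Gamma> ** Z \<xi> ** dagger \<Gamma> = Z ((mat 1 - 2 *\<^sub>R list_proj es) *v \<xi>)) \<and>
    (\<forall>X. (\<forall>\<xi>. X ** (Zd \<xi> ** Z \<xi>) = Zd \<xi> ** Z \<xi> ** X) \<longrightarrow> X ** \<Gamma> = \<Gamma> ** X)"
  using assms
proof (induction es)
  case Nil
  show ?case by (intro exI[of _ "mat 1"]) simp
next
  case (Cons e es)
  then obtain \<Gamma> where \<Gamma>: "dagger \<Gamma> ** \<Gamma> = mat 1" "\<Gamma> ** dagger \<Gamma> = mat 1"
    "\<And>\<xi>. \<Gamma> ** Z \<xi> ** dagger \<Gamma> = Z ((mat 1 - 2 *\<^sub>R list_proj es) *v \<xi>)"
    "\<And>X. (\<And>\<xi>. X ** (Zd \<xi> ** Z \<xi>) = Zd \<xi> ** Z \<xi> ** X) \<Longrightarrow> X ** \<Gamma> = \<Gamma> ** X" by auto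
  have e: "cinner e e = 1" using Cons.prems by simp
  define V where "V = mat 1 - 2 *\<^sub>R (Zd e ** Z e)"
  have Vh: "dagger V = V" by (simp add: V_def dagger_simps)
  have zz: "Z e ** (Zd e ** Z e) = Z e"
    unfolding matrix_mul_assoc Zd_Z_anti by (simp add: mtx_distrib e mtx_assoc)
  have "Zd e ** Z e ** (Zd e ** Z e) = Zd e ** (Z e ** (Zd e ** Z e))" by (simp add: mtx_assoc)
  then have nn: "Zd e ** Z e ** (Zd e ** Z e) = Zd e ** Z e" unfolding zz .
  have V2: "V ** V = mat 1"
    by (simp add: V_def mtx_distrib scaleR_mult_left scaleR_mult_right nn) (simp flip: scaleR_add_left add: algebra_simps)
  \<comment> \<open>Exchanging \<open>Z \<xi>\<close> with \<open>V\<close> costs twice the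
    contraction with \<open>e\<close>; as \<open>V\<close> fixes \<open>Z e\<close> from the left
    and squares to one, the field of the reflected vector remains.\<close>
  have VZ: "V ** Z \<xi> ** V = Z (\<xi> - 2 *\<^sub>R (cinner e \<xi> *s e))" for \<xi>
  proof -
    have VZe: "V ** Z e = Z e" by (simp add: V_def mtx_distrib scaleR_mult_left mtx_assoc)
    have "Z \<xi> ** (Zd e ** Z e) = cinner \<xi> e *\<^sub>M Z e + Zd e ** Z e ** Z \<xi>"
      unfolding matrix_mul_assoc Zd_Z_anti by (simp add: mtx_distrib mtx_scale mtx_assoc Z_anti[of \<xi> e])
    then have "Z \<xi> ** V = V ** Z \<xi> - 2 *\<^sub>R (cinner \<xi> e *\<^sub>M Z e)"
      by (simp add: V_def mtx_distrib scaleR_mult_left scaleR_mult_right algebra_simps)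
    then have "V ** Z \<xi> ** V = V ** V ** Z \<xi> - 2 *\<^sub>R (cinner \<xi> e *\<^sub>M (V ** Z e))"
      by (simp add: mtx_assoc mtx_distrib mtx_scale scaleR_mult_right)
    then show ?thesis by (simp add: V2 VZe Z_simps)
  qed
  show ?case
  proof (intro exI[of _ "V ** \<Gamma>"] conjI allI impI)
    have "dagger (V ** \<Gamma>) ** (V ** \<Gamma>) = dagger \<Gamma> ** (V ** V) ** \<Gamma>" by (simp add: dagger_mult Vh mtx_assoc del: V2)
    then show "dagger (V ** \<Gamma>) ** (V ** \<Gamma>) = mat 1" by (simp add: V2 \<Gamma>)
    have "(V ** \<Gamma>) ** dagger (V ** \<Gamma>) = V ** (\<Gamma> ** dagger \<Gamma>) ** V" by (simp add: dagger_mult Vh mtx_assoc)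
    then show "(V ** \<Gamma>) ** dagger (V ** \<Gamma>) = mat 1" by (simp add: V2 \<Gamma>)
    show "V ** \<Gamma> ** Z \<xi> ** dagger (V ** \<Gamma>) = Z ((mat 1 - 2 *\<^sub>R list_proj (e # es)) *v \<xi>)" for \<xi>
    proof -
      have "V ** \<Gamma> ** Z \<xi> ** dagger (V ** \<Gamma>) = V ** (\<Gamma> ** Z \<xi> ** dagger \<Gamma>) ** V"
        by (simp add: dagger_mult Vh mtx_assoc)
      also have "\<dots> = Z ((mat 1 - 2 *\<^sub>R list_proj es) *v \<xi> - 2 *\<^sub>R (cinner e ((mat 1 - 2 *\<^sub>R list_proj es) *v \<xi>) *s e))"
        unfolding \<Gamma>(3) VZ ..
      also have "cinner e ((mat 1 - 2 *\<^sub>R list_proj es) *v \<xi>) = cinner e \<xi>"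
      proof -
        have "list_proj es *v e = 0"
          using Cons.prems cinner_eq_0_commute by (intro list_proj_orthogonal) auto
        then show ?thesis
          by (simp add: mtx_vec cinner_simps cinner_dagger[of _ "list_proj es"] list_proj_hermitian)
      qed
      also have "(mat 1 - 2 *\<^sub>R list_proj es) *v \<xi> - 2 *\<^sub>R (cinner e \<xi> *s e) = (mat 1 - 2 *\<^sub>R list_proj (e # es)) *v \<xi>"
        by (simp add: mtx_vec ketbra_vec algebra_simps)
      finally show ?thesis .
    qed
    \<comment> \<open>The implementer is a polynomial in the operators
      \<open>Zd \<xi> ** Z \<xi>\<close>, so whatever commutes with all of them commutes with it;
      covariance is derived from this.\<close>
    fix X assume X: "\<forall>\<xi>. X ** (Zd \<xi> ** Z \<xi>) = Zd \<xi> ** Z \<xi> ** X"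
    then have "X ** V = V ** X" by (simp add: V_def mtx_distrib scaleR_mult_left scaleR_mult_right)
    moreover have "X ** \<Gamma> = \<Gamma> ** X" using X by (intro \<Gamma>(4)) simp
    ultimately show "X ** (V ** \<Gamma>) = V ** \<Gamma> ** X" by (metis matrix_mul_assoc)
  qed
qed

section \<open>The doubled field, its embeddings and the conditional expectation\<close>

context irreducible_car
begin

abbreviation "Z2 \<equiv> double_field Z"

lemma Z2_direct_sum: "Z2 (direct_sum \<psi> \<eta>) = kron (Z \<psi>) W + kron (mat 1) (Z \<eta>)"
  by (simp add: double_field_def parity_op_def vec_lambda_eta)

lemma CAR_Z2: "CAR_field Z2"
  unfolding CAR_field_def
proof (intro conjI allI)
  fix \<xi> \<zeta> :: "complex ^ ('n + 'n)" and c
  obtain a b where \<xi>: "\<xi> = direct_sum a b" by (rule direct_sum_cases)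
  obtain a' b' where \<zeta>: "\<zeta> = direct_sum a' b'" by (rule direct_sum_cases)
  have "direct_sum a b + direct_sum a' b' = direct_sum (a + a') (b + b')"
    "c *s direct_sum a b = direct_sum (c *s a) (c *s b)" by (rule vec_sum_eqI; simp)+
  then show "Z2 (\<xi> + \<zeta>) = Z2 \<xi> + Z2 \<zeta>" "Z2 (c *s \<xi>) = cnj c *\<^sub>M Z2 \<xi>"
    unfolding \<xi> \<zeta> by (simp_all add: Z2_direct_sum Z_simps kron_linear cscale_add_right)
  show "Z2 \<xi> ** dagger (Z2 \<zeta>) + dagger (Z2 \<zeta>) ** Z2 \<xi> = cinner \<xi> \<zeta> *\<^sub>M mat 1"
    unfolding \<xi> \<zeta> by (simp add: Z2_direct_sum dagger_simps kron_dagger mtx_distrib kron_mult W_Z W_Zd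
        Zd_Z_anti kron_linear kron_one cinner_direct_sum cscale_add_left)
  show "Z2 \<xi> ** Z2 \<zeta> + Z2 \<zeta> ** Z2 \<xi> = 0"
    unfolding \<xi> \<zeta> by (simp add: Z2_direct_sum mtx_distrib kron_mult W_Z Z_anti[of a' a] Z_anti[of b' b] kron_linear)
qed

sublocale D: car Z2
  by unfold_locales (rule CAR_Z2)

definition Wp where "Wp = (1 / 2) *\<^sub>M (mat 1 + W)"
definition Wm where "Wm = (1 / 2) *\<^sub>M (mat 1 - W)"

lemma Wpm: "Wp ** Wp = Wp" "Wm ** Wm = Wm" "Wp ** Wm = 0" "Wm ** Wp = 0"
  "Wp + Wm = mat 1" "Wp - Wm = W" "dagger Wp = Wp" "dagger Wm = Wm"
  unfolding Wp_def Wm_def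
  by (auto simp: mtx_distrib mtx_scale dagger_simps vec_eq_iff field_simps)

lemma Wp_Z: "Wp ** Z \<psi> = Z \<psi> ** Wm" and Wm_Z: "Wm ** Z \<psi> = Z \<psi> ** Wp"
  by (simp_all add: Wp_def Wm_def mtx_distrib mtx_scale W_Z)

text \<open>\<open>Wp\<close> and \<open>Wm\<close> project the second factor onto its even and odd
  sectors. Conjugating the first factor by \<open>W\<close> over the odd sector only turns
  \<open>Z \<psi>\<close> into \<open>kron (Z \<psi>) (Wp - Wm)\<close>, the field with its tail
  \<open>W\<close>, while even operators become \<open>kron X (mat 1)\<close>.\<close>

definition embA where "embA X = kron X Wp + kron (W ** X ** W) Wm"

lemma embA_hom: "star_hom embA"
  unfolding star_hom_def
proof (intro conjI allI)
  fix X Y :: "'k cop" and c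
  have WW: "W ** X ** W ** (W ** Y ** W) = W ** (X ** Y) ** W"
  proof -
    have "W ** X ** W ** (W ** Y ** W) = W ** X ** (W ** W) ** Y ** W" by (simp only: mtx_assoc)
    then show ?thesis by (simp add: mtx_assoc)
  qed
  show "embA (X + Y) = embA X + embA Y" "embA (c *\<^sub>M X) = c *\<^sub>M embA X"
    by (simp_all add: embA_def mtx_distrib mtx_scale kron_linear)
  show "embA (X ** Y) = embA X ** embA Y"
    by (simp add: embA_def mtx_distrib kron_mult Wpm kron_linear WW)
  show "embA (dagger X) = dagger (embA X)"
    by (simp add: embA_def dagger_simps kron_dagger Wpm mtx_assoc)
  have "embA (mat 1) = kron (mat 1) (Wp + Wm)" unfolding kron_linear by (simp add: embA_def)
  then show "embA (mat 1) = mat 1" by (simp add: Wpm kron_one)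
qed

lemmas embA_simps = embA_hom[unfolded star_hom_def, THEN conjunct1, rule_format]
  embA_hom[unfolded star_hom_def, THEN conjunct2, THEN conjunct1, rule_format]
  embA_hom[unfolded star_hom_def, THEN conjunct2, THEN conjunct2, THEN conjunct1, rule_format]
  embA_hom[unfolded star_hom_def, THEN conjunct2, THEN conjunct2, THEN conjunct2, THEN conjunct1, rule_format]
  embA_hom[unfolded star_hom_def, THEN conjunct2, THEN conjunct2, THEN conjunct2, THEN conjunct2]

lemma embA_Z: "embA (Z \<psi>) = Z2 (direct_sum \<psi> 0)"
proof -
  have "W ** Z \<psi> ** W = - (Z \<psi> ** (W ** W))" unfolding W_Z by (simp only: mtx_distrib mtx_assoc)
  then have "embA (Z \<psi>) = kron (Z \<psi>) (Wp - Wm)" by (simp add: embA_def kron_linear)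
  then show ?thesis by (simp add: Wpm Z2_direct_sum kron_linear)
qed

lemma tau_embA: "normalized_trace (embA X) = normalized_trace X"
proof -
  have "normalized_trace (W ** X ** W) = normalized_trace X"
    using tau_commute[of W "X ** W"] by (simp add: mtx_assoc)
  then have "normalized_trace (embA X) = normalized_trace X * normalized_trace (Wp + Wm)"
    by (simp add: embA_def tau_linear tau_kron distrib_left)
  then show ?thesis by (simp add: Wpm tau_linear)
qed

lemma star_hom_eqI:
  assumes "star_hom f" "star_hom g" "\<And>\<psi>. f (Z \<psi>) = g (Z \<psi>)"
  shows "f = g"
proof -
  have f: "f (X + Y) = f X + f Y" "f (X ** Y) = f X ** f Y" "f (c *\<^sub>M X) = c *\<^sub>M f X" "f (dagger X) = dagger (f X)" for X Y c
    using assms(1) by (auto simp: star_hom_def)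
  have g: "g (X + Y) = g X + g Y" "g (X ** Y) = g X ** g Y" "g (c *\<^sub>M X) = c *\<^sub>M g X" "g (dagger X) = dagger (g X)" for X Y c
    using assms(2) by (auto simp: star_hom_def)
  have "f 0 = g 0" using f(3)[of 0 0] g(3)[of 0 0] by simp
  then have "star_subalgebra {X. f X = g X}"
    unfolding star_subalgebra_def by (auto simp: f g)
  then have "{X. f X = g X} = UNIV" by (rule algebra_generated) (simp add: assms(3))
  then show ?thesis by auto
qed

lemma emb_A_eq: "emb_A Z = embA"
  unfolding emb_A_def
  by (rule the_equality) (auto intro!: star_hom_eqI simp: embA_hom embA_Z)

lemma emb_B_eq: "emb_B Z = kron (mat 1)"
  unfolding emb_B_def
proof (rule the_equality)
  have h: "star_hom (kron (mat 1) :: 'k cop \<Rightarrow> ('k \<times> 'k) cop)"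
    by (auto simp: star_hom_def kron_linear kron_mult kron_dagger kron_one)
  show p: "star_hom (kron (mat 1) :: 'k cop \<Rightarrow> ('k \<times> 'k) cop) \<and> (\<forall>\<psi>. kron (mat 1) (Z \<psi>) = Z2 (direct_sum 0 \<psi>))"
    using h by (simp add: Z2_direct_sum kron_linear)
  show "f = kron (mat 1)" if "star_hom f \<and> (\<forall>\<psi>. f (Z \<psi>) = Z2 (direct_sum 0 \<psi>))" for f
    using that p by (intro star_hom_eqI) auto
qed

lemma double_algebra_generated:
  assumes C: "star_subalgebra C" and Z2: "\<And>\<xi>. Z2 \<xi> \<in> C"
  shows "C = UNIV"
proof -
  have add: "X + Y \<in> C" and mult: "X ** Y \<in> C" if "X \<in> C" "Y \<in> C" for X Y
    using C that by (auto simp: star_subalgebra_def)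
  have scale: "c *\<^sub>M X \<in> C" and dag: "dagger X \<in> C" if "X \<in> C" for c X
    using C that by (auto simp: star_subalgebra_def)
  have zero: "0 \<in> C" using C by (auto simp: star_subalgebra_def)
  have "{X. kron (mat 1) X \<in> C} = UNIV"
  proof (rule algebra_generated)
    show "star_subalgebra {X. kron (mat 1) X \<in> C}"
      unfolding star_subalgebra_def
      using add mult scale dag zero
      by (auto simp: kron_linear kron_mult[of "mat 1" _ "mat 1", simplified, symmetric] kron_dagger[of "mat 1", simplified, symmetric])
    show "Z \<psi> \<in> {X. kron (mat 1) X \<in> C}" for \<psi>
      using Z2[of "direct_sum 0 \<psi>"] by (simp add: Z2_direct_sum kron_linear)
  qed
  then have B: "kron (mat 1) X \<in> C" for X by auto
  have "{X. kron X (mat 1) \<in> C} = UNIV"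
  proof (rule algebra_generated)
    show "star_subalgebra {X. kron X (mat 1) \<in> C}"
      unfolding star_subalgebra_def
      using add mult scale dag zero
      by (auto simp: kron_linear kron_mult[of _ "mat 1" _ "mat 1", simplified, symmetric] kron_dagger[of _ "mat 1", simplified, symmetric])
    \<comment> \<open>The tail \<open>W\<close> in the second slot is removed by multiplying with
      \<open>kron (mat 1) W\<close>, which lies in \<open>C\<close> by the first half.\<close>
    show "Z \<psi> \<in> {X. kron X (mat 1) \<in> C}" for \<psi>
      using mult[OF Z2[of "direct_sum \<psi> 0"] B[of W]] by (simp add: Z2_direct_sum kron_linear kron_mult)
  qed
  then have "kron X (mat 1) \<in> C" for X by auto
  then have "kron X Y \<in> C" for X Y using mult[OF _ B, of "kron X (mat 1)" Y] by (simp add: kron_mult)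
  then show ?thesis using kron_span[of C] add scale by blast
qed

lemma bogoliubov_eq:
  assumes "dagger \<Gamma> ** \<Gamma> = mat 1" "\<Gamma> ** dagger \<Gamma> = mat 1" "\<And>\<xi>. \<Gamma> ** Z2 \<xi> ** dagger \<Gamma> = Z2 (U *v \<xi>)"
  shows "bogoliubov Z U = (\<lambda>X. \<Gamma> ** X ** dagger \<Gamma>)"
  unfolding bogoliubov_def
proof (rule the_equality)
  let ?f = "\<lambda>X. \<Gamma> ** X ** dagger \<Gamma>"
  have "\<Gamma> ** X ** dagger \<Gamma> ** (\<Gamma> ** Y ** dagger \<Gamma>) = \<Gamma> ** X ** (dagger \<Gamma> ** \<Gamma>) ** Y ** dagger \<Gamma>" for X Y
    by (simp only: mtx_assoc)
  then have h: "star_hom ?f"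
    by (auto simp: star_hom_def mtx_distrib mtx_scale dagger_mult assms mtx_assoc)
  have "bij ?f"
  proof (rule o_bij[of "\<lambda>X. dagger \<Gamma> ** X ** \<Gamma>"])
    have "dagger \<Gamma> ** (\<Gamma> ** X ** dagger \<Gamma>) ** \<Gamma> = (dagger \<Gamma> ** \<Gamma>) ** X ** (dagger \<Gamma> ** \<Gamma>)"
      "\<Gamma> ** (dagger \<Gamma> ** X ** \<Gamma>) ** dagger \<Gamma> = (\<Gamma> ** dagger \<Gamma>) ** X ** (\<Gamma> ** dagger \<Gamma>)" for X
      by (simp_all only: mtx_assoc)
    then show "(\<lambda>X. dagger \<Gamma> ** X ** \<Gamma>) \<circ> ?f = id" "?f \<circ> (\<lambda>X. dagger \<Gamma> ** X ** \<Gamma>) = id"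
      by (simp_all add: fun_eq_iff assms)
  qed
  then show "star_hom ?f \<and> bij ?f \<and> (\<forall>\<xi>. ?f (Z2 \<xi>) = Z2 (U *v \<xi>))" using h assms(3) by blast
  fix g assume g: "star_hom g \<and> bij g \<and> (\<forall>\<xi>. g (Z2 \<xi>) = Z2 (U *v \<xi>))"
  have f': "?f (X + Y) = ?f X + ?f Y" "?f (X ** Y) = ?f X ** ?f Y" "?f (c *\<^sub>M X) = c *\<^sub>M ?f X" "?f (dagger X) = dagger (?f X)" for X Y c
    using h unfolding star_hom_def by blast+
  have g': "g (X + Y) = g X + g Y" "g (X ** Y) = g X ** g Y" "g (c *\<^sub>M X) = c *\<^sub>M g X" "g (dagger X) = dagger (g X)" for X Y c
    using g unfolding star_hom_def by blast+
  have "g 0 = ?f 0" using f'(3)[of 0 0] g'(3)[of 0 0] by simp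
  then have "star_subalgebra {X. g X = ?f X}"
    unfolding star_subalgebra_def mem_Collect_eq Ball_def by (intro conjI allI impI; simp only: f' g')
  then have "{X. g X = ?f X} = UNIV" by (rule double_algebra_generated) (use g assms(3) in simp)
  then show "g = ?f" by auto
qed

lemma alg_A_eq: "alg_A Z = range embA"
proof -
  have "star_subalgebra (range embA)"
    unfolding star_subalgebra_def
  proof (intro conjI ballI allI)
    have "embA 0 = 0" using embA_simps(2)[of 0 0] by simp
    then show "0 \<in> range embA" by (metis rangeI)
  qed (auto simp flip: embA_simps)
  moreover have "range (\<lambda>\<psi>. Z2 (direct_sum \<psi> 0)) \<subseteq> range embA" by (auto simp flip: embA_Z)
  ultimately have "alg_A Z \<subseteq> range embA" unfolding alg_A_def by (intro hull_minimal)
  moreover have "range embA \<subseteq> alg_A Z"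
  proof -
    have sub: "star_subalgebra (alg_A Z)"
      unfolding alg_A_def hull_def star_subalgebra_def by auto
    have "embA 0 = 0" using embA_simps(2)[of 0 0] by simp
    then have "star_subalgebra {X. embA X \<in> alg_A Z}"
      using sub unfolding star_subalgebra_def by (auto simp: embA_simps)
    moreover have "Z \<psi> \<in> {X. embA X \<in> alg_A Z}" for \<psi>
      using hull_subset[of "range (\<lambda>\<psi>. Z2 (direct_sum \<psi> 0))" star_subalgebra] by (auto simp: embA_Z alg_A_def)
    ultimately have "{X. embA X \<in> alg_A Z} = UNIV" by (rule algebra_generated)
    then show ?thesis by auto
  qed
  ultimately show ?thesis by blast
qed

lemma embA_inj: "inj embA"
proof (rule injI)
  fix X Y assume "embA X = embA Y"
  then have "normalized_trace (V ** X) = normalized_trace (V ** Y)" for V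
    using tau_embA[of "V ** X"] tau_embA[of "V ** Y"] by (simp add: embA_simps)
  then show "X = Y" by (rule tau_eqI)
qed

text \<open>Later arguments use the projection only through this adjointness to \<open>embA\<close>.
  As \<open>embA\<close> preserves the trace, the operator representing the functional on the right
  is the projection.\<close>

lemma conditional_expectation:
  "normalized_trace (V ** the_inv embA (trace_proj (alg_A Z) X)) = normalized_trace (embA V ** X)"
proof -
  obtain Y where Y: "\<And>V. normalized_trace (V ** Y) = normalized_trace (embA V ** X)"
    using tau_riesz[of "\<lambda>V. normalized_trace (embA V ** X)"]
    by (auto simp: embA_simps mtx_distrib mtx_scale tau_linear)
  have "trace_proj (alg_A Z) X = embA Y"
    unfolding trace_proj_def
  proof (rule the_equality)
    have "normalized_trace (dagger (embA V) ** (X - embA Y)) = 0" for V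
      using Y[of "dagger V"] tau_embA[of "dagger V ** Y"]
      by (simp add: embA_simps mtx_distrib tau_linear)
    then show "embA Y \<in> alg_A Z \<and> (\<forall>V\<in>alg_A Z. normalized_trace (dagger V ** (X - embA Y)) = 0)"
      unfolding alg_A_eq by auto
    fix Y2 assume "Y2 \<in> alg_A Z \<and> (\<forall>V\<in>alg_A Z. normalized_trace (dagger V ** (X - Y2)) = 0)"
    then obtain Y' where Y': "Y2 = embA Y'" "\<And>V. normalized_trace (dagger (embA V) ** (X - embA Y')) = 0"
      unfolding alg_A_eq by auto
    have "normalized_trace (V ** Y') = normalized_trace (V ** Y)" for V
      using Y[of V] Y'(2)[of "dagger V"] tau_embA[of "V ** Y'"]
      by (simp add: embA_simps mtx_distrib tau_linear)
    then have "Y' = Y" by (rule tau_eqI)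
    then show "Y2 = embA Y" using Y'(1) by simp
  qed
  then show ?thesis using Y by (simp add: the_inv_f_f[OF embA_inj])
qed

end

section \<open>Properties of the map of a compatible pair\<close>

context irreducible_car
begin

context
  fixes S R :: "'n cop"
  assumes comp: "compatible S R"
begin

definition "ehk_implements \<Gamma> \<longleftrightarrow> dagger \<Gamma> ** \<Gamma> = mat 1 \<and> \<Gamma> ** dagger \<Gamma> = mat 1 \<and>
  (\<forall>\<xi>. \<Gamma> ** Z2 \<xi> ** dagger \<Gamma> = Z2 (ehk_U S *v \<xi>)) \<and>
  (\<forall>X. (\<forall>\<xi>. X ** (D.Zd \<xi> ** Z2 \<xi>) = D.Zd \<xi> ** Z2 \<xi> ** X) \<longrightarrow> X ** \<Gamma> = \<Gamma> ** X)"

lemma ehk_implementer: "\<exists>\<Gamma>. ehk_implements \<Gamma>"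
proof -
  have "contraction S" using comp by (simp add: compatible_def)
  from reflection_list[OF ehk_U_unitary[OF this]]
  obtain es where "orthonormal_list es" "ehk_U S = mat 1 - 2 *\<^sub>R list_proj es" by blast
  then show ?thesis
    using D.reflection_implementer[of es] by (simp add: ehk_implements_def)
qed

definition "\<Gamma> = (SOME \<Gamma>. ehk_implements \<Gamma>)"

lemma \<Gamma>: "dagger \<Gamma> ** \<Gamma> = mat 1" "\<Gamma> ** dagger \<Gamma> = mat 1" "\<Gamma> ** Z2 \<xi> ** dagger \<Gamma> = Z2 (ehk_U S *v \<xi>)"
  "(\<And>\<xi>. X ** (D.Zd \<xi> ** Z2 \<xi>) = D.Zd \<xi> ** Z2 \<xi> ** X) \<Longrightarrow> X ** \<Gamma> = \<Gamma> ** X"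
  using someI_ex[OF ehk_implementer, folded \<Gamma>_def] unfolding ehk_implements_def by blast+

definition "\<rho>T = gig_density Z (ehk_T S R)"

lemma \<rho>T: "is_gaussian (ehk_T S R) \<rho>T" "\<rho>T \<in> gauge_alg Z" "\<exists>r. dagger r = r \<and> r ** r = \<rho>T"
  unfolding \<rho>T_def
  using ehk_T(1)[OF comp] by (simp_all add: gig_density_gaussian gig_density_in_gauge_alg gig_density_square)

abbreviation "\<Phi> \<equiv> ehk_map Z S R"

text \<open>The weak form of the construction: \<rho>T is even, so its embedding is
  \<open>kron \<rho>T (mat 1)\<close> and the input becomes a product operator. Linearity, trace,
  positivity, covariance and the action on symbols are read off by testing against
  \<open>V\<close>.\<close>

lemma ehk_duality:
  "normalized_trace (V ** \<Phi> X) = normalized_trace (embA V ** (\<Gamma> ** kron \<rho>T X ** dagger \<Gamma>))"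
proof -
  have "W ** \<rho>T ** W = \<rho>T ** (W ** W)" unfolding is_gaussianD(3)[OF \<rho>T(1)] by (simp only: mtx_assoc)
  then have "embA \<rho>T = kron \<rho>T (Wp + Wm)" by (simp add: embA_def kron_linear)
  then have "embA \<rho>T ** kron (mat 1) X = kron \<rho>T X" by (simp add: Wpm kron_mult)
  then show ?thesis
    unfolding ehk_map_def emb_A_eq emb_B_eq bogoliubov_eq[OF \<Gamma>(1-3)] conditional_expectation
    by (simp add: \<rho>T_def)
qed

lemma ehk_additive: "\<Phi> (X + Y) = \<Phi> X + \<Phi> Y"
  by (rule tau_eqI) (simp add: ehk_duality mtx_distrib kron_linear tau_linear)

lemma ehk_scale: "\<Phi> (c *\<^sub>M X) = c *\<^sub>M \<Phi> X"
  by (rule tau_eqI) (simp add: ehk_duality mtx_scale kron_linear tau_linear)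

lemma tau_conj_\<Gamma>: "normalized_trace (\<Gamma> ** K ** dagger \<Gamma>) = normalized_trace K"
  using tau_commute[of "\<Gamma>" "K ** dagger \<Gamma>"] by (simp add: mtx_assoc \<Gamma>)

lemma ehk_trace: "normalized_trace (\<Phi> X) = normalized_trace X"
  using ehk_duality[of "mat 1" X]
  by (simp add: embA_simps tau_conj_\<Gamma> tau_kron is_gaussianD(2)[OF \<rho>T(1)])

lemma ehk_hermitian:
  assumes "dagger X = X"
  shows "dagger (\<Phi> X) = \<Phi> X"
proof (rule tau_eqI)
  fix V
  have "normalized_trace (V ** dagger (\<Phi> X)) = cnj (normalized_trace (dagger V ** \<Phi> X))"
    using tau_dagger[of "\<Phi> X ** dagger V"] tau_commute[of "\<Phi> X" "dagger V"] by (simp add: dagger_mult)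
  also have "\<dots> = normalized_trace (dagger (embA (dagger V) ** (\<Gamma> ** kron \<rho>T X ** dagger \<Gamma>)))"
    by (simp add: ehk_duality tau_dagger)
  also have "\<dots> = normalized_trace ((\<Gamma> ** kron \<rho>T X ** dagger \<Gamma>) ** embA V)"
    by (simp add: dagger_mult embA_simps kron_dagger assms is_gaussianD(1)[OF \<rho>T(1)] mtx_assoc)
  finally show "normalized_trace (V ** dagger (\<Phi> X)) = normalized_trace (V ** \<Phi> X)"
    unfolding ehk_duality by (simp only: tau_commute[of "embA V"])
qed

text \<open>One statement serves the gauge unitaries and parity. As \<open>u\<close> multiplies the
  field by a scalar and its adjoint by the inverse scalar, \<open>kron u u\<close> commutes with the
  quadratic expressions from which \<Gamma> is built, hence with \<Gamma>.\<close>

lemma ehk_covariant: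
  assumes u: "u ** u' = mat 1" "u' ** u = mat 1" and W: "u ** W = W ** u"
    and Z: "\<And>\<psi>. u ** Z \<psi> = c *\<^sub>M (Z \<psi> ** u)" "\<And>\<psi>. u ** Zd \<psi> = c' *\<^sub>M (Zd \<psi> ** u)" "c' * c = 1"
    and \<rho>: "u ** \<rho>T = \<rho>T ** u"
  shows "\<Phi> (u ** X ** u') = u ** \<Phi> X ** u'"
proof (rule tau_eqI)
  fix V
  let ?k = "kron u u" and ?k' = "kron u' u'"
  let ?G = "\<lambda>X. \<Gamma> ** kron \<rho>T X ** dagger \<Gamma>"
  have Wp: "u ** Wp = Wp ** u" "u ** Wm = Wm ** u" by (simp_all add: Wp_def Wm_def mtx_distrib mtx_scale W)
  have W': "W ** u' = u' ** W"
  proof -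
    have "u' ** (u ** W) ** u' = u' ** (W ** u) ** u'" by (simp add: W)
    moreover have "u' ** (u ** W) ** u' = (u' ** u) ** W ** u'" "u' ** (W ** u) ** u' = u' ** W ** (u ** u')"
      by (simp_all only: mtx_assoc)
    ultimately show ?thesis by (simp add: u)
  qed
  have Wp': "u' ** Wp = Wp ** u'" "u' ** Wm = Wm ** u'" by (simp_all add: Wp_def Wm_def mtx_distrib mtx_scale W')
  have pu: "u' ** Wp ** u = Wp" "u' ** Wm ** u = Wm"
    using Wp' by (simp_all add: mtx_assoc u)
  have kk: "?k ** ?k' = mat 1" "?k' ** ?k = mat 1" by (simp_all add: kron_mult u kron_one)
  have kA: "embA (u' ** V ** u) = ?k' ** embA V ** ?k"
  proof -
    have "W ** (u' ** V ** u) ** W = (W ** u') ** V ** (u ** W)" by (simp only: mtx_assoc)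
    then have "W ** (u' ** V ** u) ** W = u' ** (W ** V ** W) ** u" unfolding W W' by (simp only: mtx_assoc)
    then show ?thesis by (simp add: embA_def mtx_distrib kron_mult pu)
  qed
  have "?k ** (D.Zd \<xi> ** Z2 \<xi>) = D.Zd \<xi> ** Z2 \<xi> ** ?k" for \<xi>
  proof -
    obtain \<psi> \<eta> where \<xi>: "\<xi> = direct_sum \<psi> \<eta>" by (rule direct_sum_cases)
    have 1: "?k ** Z2 \<xi> = c *\<^sub>M (Z2 \<xi> ** ?k)"
      by (simp add: \<xi> Z2_direct_sum mtx_distrib kron_mult Z W kron_linear cscale_add_right)
    have 2: "?k ** D.Zd \<xi> = c' *\<^sub>M (D.Zd \<xi> ** ?k)"
      by (simp add: \<xi> Z2_direct_sum dagger_simps kron_dagger mtx_distrib kron_mult Z W kron_linear cscale_add_right)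
    have "?k ** (D.Zd \<xi> ** Z2 \<xi>) = c' *\<^sub>M (D.Zd \<xi> ** (?k ** Z2 \<xi>))"
      unfolding matrix_mul_assoc 2 by (simp add: mtx_scale mtx_assoc)
    also have "\<dots> = (c' * c) *\<^sub>M (D.Zd \<xi> ** Z2 \<xi> ** ?k)" unfolding 1 by (simp add: mtx_scale mtx_assoc)
    finally show ?thesis by (simp add: Z(3))
  qed
  then have k\<Gamma>: "?k ** \<Gamma> = \<Gamma> ** ?k" by (rule \<Gamma>(4))
  have k\<Gamma>': "dagger \<Gamma> ** ?k' = ?k' ** dagger \<Gamma>"
  proof -
    have "dagger \<Gamma> ** (\<Gamma> ** ?k) ** dagger \<Gamma> = dagger \<Gamma> ** (?k ** \<Gamma>) ** dagger \<Gamma>" by (simp add: k\<Gamma>)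
    moreover have "dagger \<Gamma> ** (\<Gamma> ** ?k) ** dagger \<Gamma> = (dagger \<Gamma> ** \<Gamma>) ** ?k ** dagger \<Gamma>"
      "dagger \<Gamma> ** (?k ** \<Gamma>) ** dagger \<Gamma> = dagger \<Gamma> ** ?k ** (\<Gamma> ** dagger \<Gamma>)" by (simp_all only: mtx_assoc)
    ultimately have "?k ** dagger \<Gamma> = dagger \<Gamma> ** ?k" by (simp add: \<Gamma>)
    then have "?k' ** (?k ** dagger \<Gamma>) ** ?k' = ?k' ** (dagger \<Gamma> ** ?k) ** ?k'" by simp
    moreover have "?k' ** (?k ** dagger \<Gamma>) ** ?k' = (?k' ** ?k) ** dagger \<Gamma> ** ?k'"
      "?k' ** (dagger \<Gamma> ** ?k) ** ?k' = ?k' ** dagger \<Gamma> ** (?k ** ?k')" by (simp_all only: mtx_assoc)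
    ultimately show ?thesis by (simp add: kk)
  qed
  have \<rho>u: "u ** \<rho>T ** u' = \<rho>T" unfolding \<rho> by (simp add: mtx_assoc u)
  have "normalized_trace (V ** (u ** \<Phi> X ** u')) = normalized_trace (u' ** V ** u ** \<Phi> X)"
    using tau_commute[of "V ** (u ** \<Phi> X)" u'] by (simp add: mtx_assoc)
  also have "\<dots> = normalized_trace (?k' ** (embA V ** (?k ** ?G X)))"
    unfolding ehk_duality kA by (simp add: mtx_assoc)
  also have "\<dots> = normalized_trace (embA V ** (?k ** ?G X ** ?k'))"
    by (subst tau_commute) (simp add: mtx_assoc)
  also have "?k ** ?G X ** ?k' = \<Gamma> ** (?k ** kron \<rho>T X ** ?k') ** dagger \<Gamma>"
  proof -
    have "?k ** ?G X ** ?k' = (?k ** \<Gamma>) ** kron \<rho>T X ** (dagger \<Gamma> ** ?k')" by (simp only: mtx_assoc)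
    then show ?thesis unfolding k\<Gamma> k\<Gamma>' by (simp only: mtx_assoc)
  qed
  also have "?k ** kron \<rho>T X ** ?k' = kron \<rho>T (u ** X ** u')"
    by (simp add: kron_mult \<rho>u)
  also have "normalized_trace (embA V ** (\<Gamma> ** kron \<rho>T (u ** X ** u') ** dagger \<Gamma>)) = normalized_trace (V ** \<Phi> (u ** X ** u'))"
    by (simp add: ehk_duality)
  finally show "normalized_trace (V ** \<Phi> (u ** X ** u')) = normalized_trace (V ** (u ** \<Phi> X ** u'))" by simp
qed

lemma N_W: "N ** W = W ** N"
proof -
  have "W ** N = N ** W"
    unfolding parity_op_def by (rule op_exp_intertwine) (simp add: mtx_scale)
  then show ?thesis by simp
qed

lemma ehk_gauge_covariant: "gauge_covariant Z \<Phi>"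
  unfolding gauge_covariant_def Let_def
proof (intro allI)
  fix t :: real and X
  let ?u = "op_exp ((- \<i> * t) *\<^sub>M N)" and ?u' = "op_exp ((\<i> * t) *\<^sub>M N)"
  show "\<Phi> (?u ** X ** ?u') = ?u ** \<Phi> X ** ?u'"
  proof (rule ehk_covariant)
    have "- ((\<i> * t) *\<^sub>M N) = (- \<i> * t) *\<^sub>M N" by (simp add: cscale_minus_left)
    then show "?u ** ?u' = mat 1" "?u' ** ?u = mat 1"
      using op_exp_minus[of "(\<i> * t) *\<^sub>M N"] by simp_all
    show "?u ** W = W ** ?u" by (rule op_exp_intertwine) (simp add: mtx_scale mtx_distrib N_W)
    have "N ** \<rho>T = \<rho>T ** N" using \<rho>T(2) by (simp add: gauge_alg_def)
    then show "?u ** \<rho>T = \<rho>T ** ?u" by (intro op_exp_intertwine) (simp add: mtx_scale mtx_distrib)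
    show "?u ** Z \<psi> = exp (- (- \<i> * t)) *\<^sub>M (Z \<psi> ** ?u)" "?u ** Zd \<psi> = exp (- \<i> * t) *\<^sub>M (Zd \<psi> ** ?u)" for \<psi>
      by (rule exp_N_Z exp_N_Zd)+
    show "exp (- \<i> * t) * exp (- (- \<i> * t)) = 1" by (simp add: exp_minus)
  qed
qed

lemma ehk_parity: "W ** \<Phi> X ** W = \<Phi> (W ** X ** W)"
proof -
  have "\<Phi> (W ** X ** W) = W ** \<Phi> X ** W"
    by (rule ehk_covariant[where c = "-1" and c' = "-1"])
      (simp_all add: W_Z W_Zd cscale_minus_left is_gaussianD(3)[OF \<rho>T(1)])
  then show ?thesis by simp
qed

text \<open>Evenness of \<rho> lets the tail \<open>W\<close> of the first component pass to the
  other side, so the product state obeys the Gaussian relation of the doubled field with the direct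
  sum of the symbols.\<close>

lemma Z2_product_state:
  assumes \<rho>: "is_gaussian Q \<rho>"
  shows "Z2 (direct_sum \<psi> \<eta>) ** kron \<rho>T \<rho> =
    Z2 (direct_sum (ehk_T S R *v \<psi>) (Q *v \<eta>)) ** kron \<rho>T \<rho> + kron \<rho>T \<rho> ** Z2 (direct_sum (ehk_T S R *v \<psi>) (Q *v \<eta>))"
proof -
  have 1: "kron (Z \<psi>) W ** kron \<rho>T \<rho> =
      kron (Z (ehk_T S R *v \<psi>)) W ** kron \<rho>T \<rho> + kron \<rho>T \<rho> ** kron (Z (ehk_T S R *v \<psi>)) W"
    unfolding kron_mult is_gaussianD(4)[OF \<rho>T(1), of \<psi>] is_gaussianD(3)[OF \<rho>] by (simp add: kron_linear)
  have 2: "kron (mat 1) (Z \<eta>) ** kron \<rho>T \<rho> =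
      kron (mat 1) (Z (Q *v \<eta>)) ** kron \<rho>T \<rho> + kron \<rho>T \<rho> ** kron (mat 1) (Z (Q *v \<eta>))"
    unfolding kron_mult is_gaussianD(4)[OF \<rho>, of \<eta>] by (simp add: kron_linear)
  show ?thesis
    unfolding Z2_direct_sum matrix_add_ldistrib matrix_add_rdistrib' 1 2 by (simp add: algebra_simps)
qed

text \<open>
  The second component of the Bogoliubov-transformed symbol is lost under the conditional
  expectation: an odd element of the second algebra anticommutes with the odd part of the first one,
  while its product with the even part is odd and has mean zero in an even state.
\<close>

lemma ehk_gaussian:
  assumes \<rho>: "is_gaussian Q \<rho>"
  shows "is_gaussian (S ** Q ** dagger S + R) (\<Phi> \<rho>)"
  unfolding is_gaussian_def
proof (intro conjI allI)
  show "dagger (\<Phi> \<rho>) = \<Phi> \<rho>" by (rule ehk_hermitian[OF is_gaussianD(1)[OF \<rho>]])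
  show "normalized_trace (\<Phi> \<rho>) = 1" by (simp add: ehk_trace is_gaussianD(2)[OF \<rho>])
  have W\<rho>: "W ** \<rho> ** W = \<rho>" unfolding is_gaussianD(3)[OF \<rho>] by (simp add: mtx_assoc)
  have "W ** (W ** \<Phi> \<rho> ** W) = W ** \<Phi> \<rho>" by (simp only: ehk_parity W\<rho>)
  then show "W ** \<Phi> \<rho> = \<Phi> \<rho> ** W" by (simp add: matrix_mul_assoc)
  let ?Q = "S ** Q ** dagger S + R"
  fix \<psi>
  define K where "K = kron \<rho>T \<rho>"
  define \<sigma> where "\<sigma> = \<Gamma> ** K ** dagger \<Gamma>"
  have comp': "contraction S" using comp by (simp add: compatible_def)
  define \<psi>' where "\<psi>' = - (op_sqrt (mat 1 - S ** dagger S) *v \<psi>)"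
  define \<eta>' where "\<eta>' = dagger S *v \<psi>"
  define \<zeta> where "\<zeta> = direct_sum (ehk_T S R *v \<psi>') (Q *v \<eta>')"
  have U\<psi>: "ehk_U S *v direct_sum \<psi> 0 = direct_sum \<psi>' \<eta>'"
    by (simp add: ehk_U_def block_op_vec \<psi>'_def \<eta>'_def mtx_vec)
  obtain \<eta> where \<eta>: "ehk_U S *v \<zeta> = direct_sum (?Q *v \<psi>) \<eta>"
    using ehk_U_compress[OF comp, of \<psi> Q] by (auto simp: \<zeta>_def \<psi>'_def \<eta>'_def mtx_vec)
  \<comment> \<open>\<open>ehk_U S\<close> is an involution, so conjugation by \<Gamma> also carries
    the image vector back to \<open>direct_sum \<psi> 0\<close>.\<close>
  have "\<Gamma> ** Z2 (direct_sum \<psi>' \<eta>') ** dagger \<Gamma> = Z2 (direct_sum \<psi> 0)"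
    unfolding \<Gamma>(3) U\<psi>[symmetric] by (simp add: matrix_vector_mul_assoc ehk_U_unitary(2)[OF comp'])
  then have "Z2 (direct_sum \<psi> 0) ** \<sigma> = (\<Gamma> ** Z2 (direct_sum \<psi>' \<eta>') ** dagger \<Gamma>) ** (\<Gamma> ** K ** dagger \<Gamma>)"
    by (simp only: \<sigma>_def)
  also have "\<dots> = \<Gamma> ** Z2 (direct_sum \<psi>' \<eta>') ** (dagger \<Gamma> ** \<Gamma>) ** K ** dagger \<Gamma>"
    by (simp only: mtx_assoc)
  also have "\<dots> = \<Gamma> ** (Z2 (direct_sum \<psi>' \<eta>') ** K) ** dagger \<Gamma>" by (simp add: \<Gamma> mtx_assoc)
  also have "\<dots> = \<Gamma> ** (Z2 \<zeta> ** K + K ** Z2 \<zeta>) ** dagger \<Gamma>"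
    unfolding K_def Z2_product_state[OF \<rho>, of \<psi>' \<eta>'] \<zeta>_def ..
  also have "\<dots> = \<Gamma> ** Z2 \<zeta> ** dagger \<Gamma> ** \<sigma> + \<sigma> ** (\<Gamma> ** Z2 \<zeta> ** dagger \<Gamma>)"
  proof -
    have "\<Gamma> ** Z2 \<zeta> ** dagger \<Gamma> ** \<sigma> = \<Gamma> ** Z2 \<zeta> ** (dagger \<Gamma> ** \<Gamma>) ** K ** dagger \<Gamma>"
      "\<sigma> ** (\<Gamma> ** Z2 \<zeta> ** dagger \<Gamma>) = \<Gamma> ** K ** (dagger \<Gamma> ** \<Gamma>) ** Z2 \<zeta> ** dagger \<Gamma>"
      by (simp_all only: \<sigma>_def mtx_assoc)
    then show ?thesis by (simp add: \<Gamma> mtx_distrib mtx_assoc)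
  qed
  finally have rel: "Z2 (direct_sum \<psi> 0) ** \<sigma> =
      Z2 (direct_sum (?Q *v \<psi>) \<eta>) ** \<sigma> + \<sigma> ** Z2 (direct_sum (?Q *v \<psi>) \<eta>)"
    unfolding \<Gamma>(3) \<eta> .
  let ?z = "kron (mat 1) (Z \<eta>)"
  have split: "Z2 (direct_sum (?Q *v \<psi>) \<eta>) = embA (Z (?Q *v \<psi>)) + ?z"
    by (simp add: embA_Z Z2_direct_sum kron_linear)
  have rel': "embA (Z \<psi>) ** \<sigma> = embA (Z (?Q *v \<psi>)) ** \<sigma> + \<sigma> ** embA (Z (?Q *v \<psi>)) + (?z ** \<sigma> + \<sigma> ** ?z)"
    using rel unfolding split embA_Z[symmetric] by (simp add: mtx_distrib algebra_simps)
  \<comment> \<open>Total parity. It commutes with \<sigma>, so operators that are odd in the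
    doubled algebra have mean zero in \<sigma>.\<close>
  let ?w = "kron W W"
  have w2: "?w ** ?w = mat 1" by (simp add: kron_mult kron_one)
  have w\<sigma>: "?w ** \<sigma> = \<sigma> ** ?w"
  proof -
    have "?w ** (D.Zd \<xi> ** Z2 \<xi>) = D.Zd \<xi> ** Z2 \<xi> ** ?w" for \<xi>
    proof -
      obtain a b where \<xi>: "\<xi> = direct_sum a b" by (rule direct_sum_cases)
      have 1: "?w ** Z2 \<xi> = - (Z2 \<xi> ** ?w)" "?w ** D.Zd \<xi> = - (D.Zd \<xi> ** ?w)"
        by (simp_all add: \<xi> Z2_direct_sum dagger_simps kron_dagger mtx_distrib kron_mult W_Z W_Zd kron_linear)
      have "?w ** (D.Zd \<xi> ** Z2 \<xi>) = - (D.Zd \<xi> ** (?w ** Z2 \<xi>))"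
        unfolding matrix_mul_assoc 1(2) by (simp add: mtx_distrib mtx_assoc)
      then show ?thesis unfolding 1(1) by (simp add: mtx_distrib mtx_assoc)
    qed
    then have 1: "?w ** \<Gamma> = \<Gamma> ** ?w" by (rule \<Gamma>(4))
    have 2: "?w ** dagger \<Gamma> = dagger \<Gamma> ** ?w"
      using arg_cong[OF 1, of dagger] by (simp add: dagger_mult kron_dagger)
    have 3: "?w ** K = K ** ?w"
      by (simp add: K_def kron_mult is_gaussianD(3)[OF \<rho>] is_gaussianD(3)[OF \<rho>T(1)])
    have "?w ** \<sigma> = (?w ** \<Gamma>) ** K ** dagger \<Gamma>" by (simp only: \<sigma>_def mtx_assoc)
    also have "\<dots> = \<Gamma> ** (?w ** K) ** dagger \<Gamma>" unfolding 1 by (simp only: mtx_assoc)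
    also have "\<dots> = \<Gamma> ** K ** (?w ** dagger \<Gamma>)" unfolding 3 by (simp only: mtx_assoc)
    also have "\<dots> = \<sigma> ** ?w" unfolding 2 by (simp only: \<sigma>_def mtx_assoc)
    finally show ?thesis .
  qed
  have zero: "normalized_trace (embA V ** (?z ** \<sigma> + \<sigma> ** ?z)) = 0" for V
  proof -
    let ?A = "embA V ** ?z + ?z ** embA V"
    have "normalized_trace (embA V ** (?z ** \<sigma> + \<sigma> ** ?z)) = normalized_trace (\<sigma> ** ?A)"
      using tau_commute[of "embA V ** ?z" \<sigma>] tau_commute[of "embA V ** \<sigma>" ?z] tau_commute[of "?z ** embA V" \<sigma>]
      by (simp add: mtx_distrib tau_linear mtx_assoc)
    \<comment> \<open>\<open>Z \<eta>\<close> exchanges the projections \<open>Wp\<close> and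
      \<open>Wm\<close>, so adding both orders symmetrizes \<open>V\<close>: only its even part
      survives, multiplied by the odd operator \<open>Z \<eta>\<close>.\<close>
    moreover have A: "?A = kron (V + W ** V ** W) (Z \<eta>)"
    proof -
      have "?A = kron V (Z \<eta> ** (Wm + Wp)) + kron (W ** V ** W) (Z \<eta> ** (Wp + Wm))"
        by (simp add: embA_def mtx_distrib kron_mult kron_linear Wp_Z Wm_Z algebra_simps)
      then show ?thesis by (simp add: Wpm add.commute[of Wm] kron_linear)
    qed
    have "?w ** ?A ** ?w = - ?A"
    proof -
      have "W ** Z \<eta> ** W = - (Z \<eta> ** (W ** W))" unfolding W_Z by (simp only: mtx_distrib mtx_assoc)
      moreover have "W ** (V + W ** V ** W) ** W = V + W ** V ** W"
      proof -
        have "W ** (W ** V ** W) ** W = (W ** W) ** V ** (W ** W)" by (simp only: mtx_assoc)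
        then show ?thesis by (simp add: mtx_distrib add.commute)
      qed
      ultimately show ?thesis unfolding A kron_mult by (simp add: kron_linear)
    qed
    then have "normalized_trace (\<sigma> ** (?w ** ?A ** ?w)) = - normalized_trace (\<sigma> ** ?A)"
      by (simp add: mtx_distrib tau_linear)
    moreover have "normalized_trace (\<sigma> ** (?w ** ?A ** ?w)) = normalized_trace (\<sigma> ** ?A)"
    proof -
      have "normalized_trace (\<sigma> ** (?w ** ?A ** ?w)) = normalized_trace (?w ** (\<sigma> ** (?w ** ?A)))"
        using tau_commute[of "\<sigma> ** (?w ** ?A)" ?w] by (simp only: mtx_assoc)
      also have "?w ** (\<sigma> ** (?w ** ?A)) = (?w ** \<sigma>) ** ?w ** ?A" by (simp only: mtx_assoc)
      also have "\<dots> = \<sigma> ** (?w ** ?w) ** ?A" unfolding w\<sigma> by (simp only: mtx_assoc)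
      finally show ?thesis unfolding w2 by simp
    qed
    ultimately show ?thesis by simp
  qed
  have dual: "normalized_trace (V ** \<Phi> \<rho>) = normalized_trace (embA V ** \<sigma>)" for V
    unfolding ehk_duality \<sigma>_def K_def ..
  show "Z \<psi> ** \<Phi> \<rho> = Z (?Q *v \<psi>) ** \<Phi> \<rho> + \<Phi> \<rho> ** Z (?Q *v \<psi>)"
  proof (rule tau_eqI)
    fix V
    have "normalized_trace (V ** (Z \<psi> ** \<Phi> \<rho>)) = normalized_trace (embA V ** (embA (Z \<psi>) ** \<sigma>))"
      using dual[of "V ** Z \<psi>"] by (simp add: embA_simps mtx_assoc)
    also have "\<dots> = normalized_trace (embA V ** (embA (Z (?Q *v \<psi>)) ** \<sigma>)) + normalized_trace (embA V ** (\<sigma> ** embA (Z (?Q *v \<psi>))))"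
      unfolding rel' using zero[of V] by (simp add: mtx_distrib tau_linear)
    also have "normalized_trace (embA V ** (embA (Z (?Q *v \<psi>)) ** \<sigma>)) = normalized_trace (V ** (Z (?Q *v \<psi>) ** \<Phi> \<rho>))"
      using dual[of "V ** Z (?Q *v \<psi>)"] by (simp add: embA_simps mtx_assoc)
    also have "normalized_trace (embA V ** (\<sigma> ** embA (Z (?Q *v \<psi>)))) = normalized_trace (V ** (\<Phi> \<rho> ** Z (?Q *v \<psi>)))"
      using dual[of "Z (?Q *v \<psi>) ** V"] tau_commute[of "V ** \<Phi> \<rho>" "Z (?Q *v \<psi>)"]
        tau_commute[of "embA V ** \<sigma>" "embA (Z (?Q *v \<psi>))"]
      by (simp add: embA_simps mtx_assoc)
    finally show "normalized_trace (V ** (Z \<psi> ** \<Phi> \<rho>)) =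
        normalized_trace (V ** (Z (?Q *v \<psi>) ** \<Phi> \<rho> + \<Phi> \<rho> ** Z (?Q *v \<psi>)))"
      by (simp add: mtx_distrib tau_linear)
  qed
qed

lemma ehk_gig: "Q \<in> symbols \<Longrightarrow> \<Phi> (gig_density Z Q) = gig_density Z (S ** Q ** dagger S + R)"
  using gig_density_unique[OF ehk_symbol[OF comp] ehk_gaussian[OF gig_density_gaussian]] by simp

text \<open>Splitting \<rho>T into \<open>r ** r\<close>, and each rank one test operator into two
  ketbras through an auxiliary unit vector \<open>e\<close>, exhibits the matrix coefficients as
  traces of \<open>dagger (B i) ** kron (mat 1) (X i j) ** B j\<close>. Expanded over columns and
  over the first tensor index, their sum consists of values of the block form of
  \<open>X\<close>.\<close>

lemma ehk_completely_positive: "completely_positive_on UNIV \<Phi>"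
  unfolding completely_positive_on_def
proof (intro allI impI)
  fix m and X :: "nat \<Rightarrow> nat \<Rightarrow> 'k cop"
  assume X: "block_psd m X"
  obtain r where r: "dagger r = r" "r ** r = \<rho>T" using \<rho>T(3) by blast
  define e :: "complex ^ 'k" where "e = axis undefined 1"
  have e: "cinner e e = 1" by (simp add: e_def cinner_axis_axis)
  show "block_psd m (\<lambda>i j. \<Phi> (X i j))"
    unfolding block_psd_def
  proof
    fix v :: "nat \<Rightarrow> complex ^ 'k"
    define B where "B i = kron r (mat 1) ** dagger \<Gamma> ** embA (ketbra (v i) e)" for i
    have vB: "cinner (v i) (\<Phi> (X i j) *v v j) = of_nat CARD('k) * normalized_trace (dagger (B i) ** kron (mat 1) (X i j) ** B j)" for i j
    proof -
      have "ketbra (v j) (v i) = ketbra (v j) e ** dagger (ketbra (v i) e)"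
        by (simp add: dagger_ketbra ketbra_mult_ketbra e)
      then have k: "embA (ketbra (v j) (v i)) = embA (ketbra (v j) e) ** dagger (embA (ketbra (v i) e))"
        by (simp add: embA_simps)
      have c: "kron \<rho>T (X i j) = kron r (mat 1) ** kron (mat 1) (X i j) ** kron r (mat 1)"
        by (simp add: kron_mult r)
      have "cinner (v i) (\<Phi> (X i j) *v v j) = trace (\<Phi> (X i j) ** ketbra (v j) (v i))"
        by (simp add: trace_mult_ketbra)
      also have "\<dots> = of_nat CARD('k) * normalized_trace (ketbra (v j) (v i) ** \<Phi> (X i j))"
        using tau_commute[of "\<Phi> (X i j)" "ketbra (v j) (v i)"] by (simp add: normalized_trace_def)
      also have "normalized_trace (ketbra (v j) (v i) ** \<Phi> (X i j)) =
          normalized_trace (embA (ketbra (v j) e) ** (dagger (embA (ketbra (v i) e)) ** (\<Gamma> ** kron \<rho>T (X i j) ** dagger \<Gamma>)))"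
        unfolding ehk_duality k by (simp add: mtx_assoc)
      also have "\<dots> = normalized_trace ((dagger (embA (ketbra (v i) e)) ** (\<Gamma> ** kron \<rho>T (X i j) ** dagger \<Gamma>)) ** embA (ketbra (v j) e))"
        by (rule tau_commute)
      also have "\<dots> = normalized_trace (dagger (B i) ** kron (mat 1) (X i j) ** B j)"
        by (simp only: c B_def dagger_mult dagger_dagger kron_dagger r dagger_one mtx_assoc)
      finally show ?thesis .
    qed
    have tr: "normalized_trace (dagger (B i) ** kron (mat 1) (X i j) ** B j) =
        (\<Sum>p\<in>UNIV. \<Sum>a\<in>UNIV. cinner (\<chi> b. (B i *v axis p 1) $ (a, b)) (X i j *v (\<chi> b. (B j *v axis p 1) $ (a, b)))) / of_nat CARD('k \<times> 'k)" for i j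
    proof -
      have "trace (dagger (B i) ** kron (mat 1) (X i j) ** B j) =
          (\<Sum>p\<in>UNIV. cinner (B i *v axis p 1) (kron (mat 1) (X i j) *v (B j *v axis p 1)))"
        unfolding trace_def
        by (intro sum.cong refl) (simp add: matrix_axis_nth[of "_ ** _"] matrix_vector_mult_mult cinner_dagger[of _ "dagger _"])
      then show ?thesis by (simp only: normalized_trace_def cinner_kron_one)
    qed
    define f where "f i j p a = cinner (\<chi> b. (B i *v axis p 1) $ (a, b)) (X i j *v (\<chi> b. (B j *v axis p 1) $ (a, b)))" for i j p a
    have nn: "(\<Sum>i<m. \<Sum>j<m. f i j p a) \<in> \<real>\<^sub>\<ge>\<^sub>0" for p a
      using X[unfolded block_psd_def, rule_format, of "\<lambda>i. \<chi> b. (B i *v axis p 1) $ (a, b)"]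
      by (simp add: f_def)
    define c :: complex where "c = of_nat CARD('k) / of_nat CARD('k \<times> 'k)"
    have "cinner (v i) (\<Phi> (X i j) *v v j) = c * (\<Sum>p\<in>UNIV. \<Sum>a\<in>UNIV. f i j p a)" for i j
      unfolding vB tr f_def c_def by (simp only: times_divide_eq_left times_divide_eq_right)
    then have "(\<Sum>i<m. \<Sum>j<m. cinner (v i) (\<Phi> (X i j) *v v j)) = c * (\<Sum>i<m. \<Sum>j<m. \<Sum>p\<in>UNIV. \<Sum>a\<in>UNIV. f i j p a)"
      by (simp add: sum_distrib_left)
    also have "(\<Sum>i<m. \<Sum>j<m. \<Sum>p\<in>UNIV. \<Sum>a\<in>UNIV. f i j p a) = (\<Sum>p\<in>UNIV. \<Sum>a\<in>UNIV. \<Sum>i<m. \<Sum>j<m. f i j p a)"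
    proof -
      have e: "(\<Sum>p\<in>UNIV. \<Sum>a\<in>UNIV. g p a) = (\<Sum>y\<in>UNIV. g (fst y) (snd y))" for g :: "'k \<times> 'k \<Rightarrow> 'k \<Rightarrow> complex"
        by (simp add: sum_UNIV_prod)
      have "(\<Sum>i<m. \<Sum>j<m. \<Sum>y\<in>UNIV. f i j (fst y) (snd y)) = (\<Sum>i<m. \<Sum>y\<in>UNIV. \<Sum>j<m. f i j (fst y) (snd y))"
        by (intro sum.cong refl sum.swap)
      also have "\<dots> = (\<Sum>y\<in>UNIV. \<Sum>i<m. \<Sum>j<m. f i j (fst y) (snd y))" by (rule sum.swap)
      finally show ?thesis unfolding e .
    qed
    also have "c * (\<Sum>p\<in>UNIV. \<Sum>a\<in>UNIV. \<Sum>i<m. \<Sum>j<m. f i j p a) \<in> \<real>\<^sub>\<ge>\<^sub>0"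
    proof (intro nonneg_Reals_mult_I)
      show "c \<in> \<real>\<^sub>\<ge>\<^sub>0"
        unfolding c_def by (intro nonneg_Reals_divide_I) auto
      have "sum g S \<in> \<real>\<^sub>\<ge>\<^sub>0" if "\<And>s. g s \<in> \<real>\<^sub>\<ge>\<^sub>0" for g :: "'c \<Rightarrow> complex" and S
        using that by (induction S rule: infinite_finite_induct) (auto intro: nonneg_Reals_add_I)
      then show "(\<Sum>p\<in>UNIV. \<Sum>a\<in>UNIV. \<Sum>i<m. \<Sum>j<m. f i j p a) \<in> \<real>\<^sub>\<ge>\<^sub>0"
        using nn by (simp add: complex_nonneg_Reals_iff sum_nonneg)
    qed
    finally show "(\<Sum>i<m. \<Sum>j<m. cinner (v i) (\<Phi> (X i j) *v v j)) \<in> \<real>\<^sub>\<ge>\<^sub>0" .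
  qed
qed

lemma ehk_gig_quantum_operation: "gig_quantum_operation Z \<Phi>"
  unfolding gig_quantum_operation_def quantum_operation_on_def
proof (intro conjI)
  show "\<Phi> ` gig_densities Z \<subseteq> gig_densities Z"
    unfolding gig_densities_def using ehk_gig ehk_symbol[OF comp] by auto
qed (simp_all add: ehk_additive ehk_scale ehk_trace ehk_completely_positive ehk_gauge_covariant)

end

end

section \<open>The semigroup of a generating pair\<close>

lemma at_within_Icc_Suc: "0 \<le> (t::real) \<Longrightarrow> at t within {0..t + 1} = at t within {0..}"
  by (rule at_within_nhd[of t "{..<t + 1}"]) auto

lemma zero_derivative_const:
  fixes F :: "real \<Rightarrow> 'a::real_normed_vector"
  assumes "\<And>t. 0 \<le> t \<Longrightarrow> (F has_vector_derivative 0) (at t within {0..})" "0 \<le> t"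
  shows "F t = F 0"
proof -
  obtain K where "\<And>t. 0 \<le> t \<Longrightarrow> F t = K"
    using has_vector_derivative_zero_constant[of "{0..}" F] assms(1) by auto
  then show ?thesis using assms(2) by simp
qed

definition flow_conj :: "'n::finite cop \<Rightarrow> 'n cop \<Rightarrow> real \<Rightarrow> 'n cop" where
  "flow_conj G A t = op_exp (t *\<^sub>R G) ** A ** dagger (op_exp (t *\<^sub>R G))"

lemma op_exp_dagger_scaleR: "op_exp (t *\<^sub>R dagger G) = dagger (op_exp (t *\<^sub>R G))" for G :: "'n::finite cop"
  by (simp add: op_exp_dagger dagger_scaleR)

lemma covariance_integral_eq: "covariance_integral G A t = integral {0..t} (flow_conj G A)"
  unfolding covariance_integral_def flow_conj_def op_exp_dagger_scaleR ..

lemma flow_conj_zero [simp]: "flow_conj G A 0 = A"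
  by (simp add: flow_conj_def)

lemma flow_conj_derivative:
  "(flow_conj G A has_vector_derivative G ** flow_conj G A t + flow_conj G A t ** dagger G) (at t within S)"
proof -
  have "((\<lambda>t. dagger (op_exp (t *\<^sub>R G))) has_vector_derivative dagger (op_exp (t *\<^sub>R G)) ** dagger G) (at t within S)"
    using bounded_linear.has_vector_derivative[OF bounded_linear_dagger op_exp_derivative, of G t S]
    by (simp add: dagger_mult)
  from has_vector_derivative_mtx_mult[OF has_vector_derivative_mtx_mult[OF op_exp_derivative has_vector_derivative_const] this, of G A]
  show ?thesis unfolding flow_conj_def by (simp add: mtx_assoc add.commute)
qed

text \<open>In contrast to the preceding form, the derivative is again a \<open>flow_conj\<close>,
  so it can be compared with the integrand of a covariance integral.\<close>

lemma flow_conj_derivative':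
  "(flow_conj G A has_vector_derivative flow_conj G (G ** A + A ** dagger G) t) (at t within S)"
proof -
  have "((\<lambda>t. dagger (op_exp (t *\<^sub>R G))) has_vector_derivative dagger G ** dagger (op_exp (t *\<^sub>R G))) (at t within S)"
    using bounded_linear.has_vector_derivative[OF bounded_linear_dagger op_exp_derivative_right, of G t S]
    by (simp add: dagger_mult)
  from has_vector_derivative_mtx_mult[OF has_vector_derivative_mtx_mult[OF op_exp_derivative_right has_vector_derivative_const] this, of G A]
  show ?thesis unfolding flow_conj_def by (simp add: mtx_assoc mtx_distrib add.commute)
qed

lemma continuous_on_flow_conj: "continuous_on S (flow_conj G A)"
  by (rule continuous_on_vector_derivative[OF flow_conj_derivative])

lemma flow_conj_linear: "flow_conj G (A + B) t = flow_conj G A t + flow_conj G B t"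
  "flow_conj G (A - B) t = flow_conj G A t - flow_conj G B t" "flow_conj G (- A) t = - flow_conj G A t"
  by (simp_all add: flow_conj_def mtx_distrib)

lemma flow_conj_flow_conj: "flow_conj G (flow_conj G A t) s = flow_conj G A (s + t)"
  by (simp add: flow_conj_def op_exp_add dagger_mult mtx_assoc)

lemma covariance_derivative:
  assumes "0 \<le> t"
  shows "(covariance_integral G A has_vector_derivative flow_conj G A t) (at t within {0..})"
proof -
  have "((\<lambda>u. integral {0..u} (flow_conj G A)) has_vector_derivative flow_conj G A t) (at t within {0..t + 1})"
    by (rule integral_has_vector_derivative[OF continuous_on_flow_conj]) (use assms in auto)
  then show ?thesis
    unfolding at_within_Icc_Suc[OF assms] covariance_integral_eq[abs_def] .
qed

lemma covariance_zero [simp]: "covariance_integral G A 0 = 0"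
  by (simp add: covariance_integral_eq)

text \<open>Both sides have the same derivative and agree at zero. This turns the derivative of the
  integral into an autonomous linear equation for the integral itself.\<close>

lemma covariance_ode:
  assumes "0 \<le> t"
  shows "flow_conj G A t = G ** covariance_integral G A t + covariance_integral G A t ** dagger G + A"
proof -
  define F where "F t = flow_conj G A t - (G ** covariance_integral G A t + covariance_integral G A t ** dagger G)" for t
  have "(F has_vector_derivative 0) (at t within {0..})" if t: "0 \<le> t" for t
  proof -
    have 1: "((\<lambda>t. G ** covariance_integral G A t) has_vector_derivative G ** flow_conj G A t) (at t within {0..})"
      by (rule bounded_linear.has_vector_derivative[OF bounded_linear_mult_right covariance_derivative[OF t]])
    have 2: "((\<lambda>t. covariance_integral G A t ** dagger G) has_vector_derivative flow_conj G A t ** dagger G) (at t within {0..})"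
      by (rule bounded_linear.has_vector_derivative[OF bounded_linear_mult_left covariance_derivative[OF t]])
    show ?thesis
      unfolding F_def
      using has_vector_derivative_diff[OF flow_conj_derivative[of G A t] has_vector_derivative_add[OF 1 2]] by simp
  qed
  from zero_derivative_const[of F, OF this assms] have "F t = A" by (simp add: F_def)
  then show ?thesis by (simp add: F_def algebra_simps)
qed

text \<open>The cocycle identity by which composing the affine symbol maps at times \<open>t\<close>
  and \<open>s\<close> gives the one at time \<open>s + t\<close>.\<close>

lemma covariance_add:
  assumes "0 \<le> s" "0 \<le> t"
  shows "covariance_integral G A (s + t) =
    covariance_integral G A s + op_exp (s *\<^sub>R G) ** covariance_integral G A t ** dagger (op_exp (s *\<^sub>R G))"
proof -
  define F where "F t = covariance_integral G A (s + t) - flow_conj G (covariance_integral G A t) s" for t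
  have "(F has_vector_derivative 0) (at t within {0..})" if t: "0 \<le> t" for t
  proof -
    have "(covariance_integral G A has_vector_derivative flow_conj G A (s + t)) (at (s + t) within (\<lambda>t. s + t) ` {0..})"
      by (rule has_vector_derivative_within_subset[OF covariance_derivative]) (use assms t in auto)
    from vector_diff_chain_within[OF has_vector_derivative_add[OF has_vector_derivative_const has_vector_derivative_id] this[unfolded]]
    have 1: "((\<lambda>t. covariance_integral G A (s + t)) has_vector_derivative flow_conj G A (s + t)) (at t within {0..})"
      by (simp add: o_def)
    have "((\<lambda>t. flow_conj G (covariance_integral G A t) s) has_vector_derivative flow_conj G (flow_conj G A t) s) (at t within {0..})"
      unfolding flow_conj_def[of _ _ s]
      by (intro bounded_linear.has_vector_derivative[OF bounded_linear_mult_left]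
          bounded_linear.has_vector_derivative[OF bounded_linear_mult_right] covariance_derivative t)
    from has_vector_derivative_diff[OF 1 this] show ?thesis
      unfolding F_def flow_conj_flow_conj by simp
  qed
  from zero_derivative_const[of F, OF this assms(2)]
  show ?thesis by (simp add: F_def flow_conj_def algebra_simps)
qed

lemma covariance_solution:
  fixes X :: "real \<Rightarrow> 'n::finite cop"
  assumes X: "\<And>t. 0 \<le> t \<Longrightarrow> (X has_vector_derivative A + (G ** X t + X t ** dagger G)) (at t within {0..})"
    and t: "0 \<le> t"
  shows "X t = op_exp (t *\<^sub>R G) ** X 0 ** dagger (op_exp (t *\<^sub>R G)) + covariance_integral G A t"
proof -
  define Y where "Y t = X t - covariance_integral G A t" for t
  have "(Y has_vector_derivative G ** Y t + Y t ** dagger G) (at t within {0..})" if t: "0 \<le> t" for t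
    using has_vector_derivative_diff[OF X[OF t] covariance_derivative[OF t, of G A]]
    unfolding Y_def covariance_ode[OF t] by (simp add: mtx_distrib algebra_simps)
  from linear_ode_unique[of Y G "dagger G", OF this t]
  show ?thesis by (simp add: Y_def op_exp_dagger_scaleR algebra_simps)
qed

lemma covariance_psd:
  fixes A :: "'n::finite cop"
  assumes A: "psd A" and t: "0 \<le> t"
  shows "psd (covariance_integral G A t)"
proof -
  have p: "psd (flow_conj G A s)" for s unfolding flow_conj_def by (rule psd_conj'[OF A])
  have i: "flow_conj G A integrable_on {0..t}" by (rule integrable_continuous_real[OF continuous_on_flow_conj])
  show ?thesis
    unfolding psd_iff covariance_integral_eq
  proof (intro conjI allI)
    have "dagger (integral {0..t} (flow_conj G A)) = integral {0..t} (dagger \<circ> flow_conj G A)"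
      by (rule integral_linear[OF i bounded_linear_dagger, symmetric])
    also have "dagger \<circ> flow_conj G A = flow_conj G A" using psd_hermitian[OF p] by (simp add: fun_eq_iff)
    finally show "dagger (integral {0..t} (flow_conj G A)) = integral {0..t} (flow_conj G A)" .
    fix v :: "complex ^ 'n"
    have b: "bounded_linear (\<lambda>M. Re (cinner v (M *v v)))"
      by (rule bounded_linear_compose[OF bounded_linear_Re bounded_linear_form])
    have "Re (cinner v (integral {0..t} (flow_conj G A) *v v)) = integral {0..t} ((\<lambda>M. Re (cinner v (M *v v))) \<circ> flow_conj G A)"
      by (rule integral_linear[OF i b, symmetric])
    also have "\<dots> \<ge> 0"
      using p by (intro integral_nonneg integrable_linear[OF i b]) (simp add: psd_iff)
    finally show "0 \<le> Re (cinner v (integral {0..t} (flow_conj G A) *v v))" .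
  qed
qed

text \<open>The derivative of \<open>flow_conj G (mat 1)\<close> is the flow of
  \<open>G + dagger G\<close>, so the integrals for \<open>A\<close> and for
  \<open>- G - dagger G - A\<close> together fill the defect of the contraction. The upper bound in
  compatibility thus becomes positivity of a second covariance integral.\<close>

lemma covariance_complement:
  assumes "0 \<le> t"
  shows "mat 1 - op_exp (t *\<^sub>R G) ** dagger (op_exp (t *\<^sub>R G)) - covariance_integral G A t =
    covariance_integral G (- G - dagger G - A) t"
proof -
  define F where "F t = flow_conj G (mat 1) t + covariance_integral G A t + covariance_integral G (- G - dagger G - A) t" for t
  have "(F has_vector_derivative 0) (at t within {0..})" if t: "0 \<le> t" for t
    unfolding F_def
    using has_vector_derivative_add[OF has_vector_derivative_add[OF flow_conj_derivative'[of G "mat 1" t] covariance_derivative[OF t, of G A]]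
        covariance_derivative[OF t, of G "- G - dagger G - A"]]
    by (simp add: flow_conj_linear)
  from zero_derivative_const[of F, OF this assms] have "F t = mat 1" by (simp add: F_def)
  then show ?thesis by (simp add: F_def flow_conj_def algebra_simps)
qed

lemma psd_imp_contraction:
  fixes S :: "'n::finite cop"
  assumes "psd (mat 1 - dagger S ** S)"
  shows "contraction S"
  unfolding contraction_iff
proof
  fix v
  have "0 \<le> Re (cinner v ((mat 1 - dagger S ** S) *v v))" using assms by (simp add: psd_iff)
  then have "(norm (S *v v))\<^sup>2 \<le> (norm v)\<^sup>2"
    by (simp add: mtx_vec cinner_simps cinner_dagger[of _ "dagger S"] cinner_same)
  then show "norm (S *v v) \<le> norm v" by (rule power2_le_imp_le) simp
qed

text \<open>The complement formula for \<open>dagger G\<close> with \<open>A = 0\<close> writes the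
  defect operator as an integral of positive operators.\<close>

lemma dissipative_contraction_generator:
  fixes G :: "'n::finite cop"
  assumes "psd (- G - dagger G)"
  shows "contraction_semigroup_generator G"
  unfolding contraction_semigroup_generator_def
proof (intro allI impI)
  fix t :: real assume t: "0 \<le> t"
  have "covariance_integral (dagger G) 0 t = 0"
    by (simp add: covariance_integral_eq flow_conj_def[abs_def])
  moreover have "- dagger G - dagger (dagger G) - 0 = - G - dagger G" by simp
  ultimately have "mat 1 - dagger (op_exp (t *\<^sub>R G)) ** op_exp (t *\<^sub>R G) = covariance_integral (dagger G) (- G - dagger G) t"
    using covariance_complement[OF t, of "dagger G" 0] by (simp only: op_exp_dagger_scaleR dagger_dagger diff_0_right)
  then show "contraction (op_exp (t *\<^sub>R G))"
    using covariance_psd[OF assms t] by (intro psd_imp_contraction) simp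
qed

lemma generating_pairs_iff: "(G, A) \<in> generating_pairs \<longleftrightarrow> psd A \<and> psd (- G - dagger G - A)"
proof -
  have "psd A \<Longrightarrow> psd (- G - dagger G - A) \<Longrightarrow> contraction_semigroup_generator G"
    using psd_add[of A "- G - dagger G - A"] by (intro dissipative_contraction_generator) simp
  then show ?thesis by (auto simp: generating_pairs_def op_le_def)
qed

lemma generating_compatible:
  assumes "(G, A) \<in> generating_pairs" "0 \<le> t"
  shows "compatible (op_exp (t *\<^sub>R G)) (covariance_integral G A t)"
proof -
  have A: "psd A" "psd (- G - dagger G - A)" using assms(1) by (auto simp: generating_pairs_iff)
  have "contraction (op_exp (t *\<^sub>R G))"
    using assms by (auto simp: generating_pairs_def contraction_semigroup_generator_def)
  then show ?thesis
    using covariance_psd[OF A(1) assms(2)] covariance_psd[OF A(2) assms(2)]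
    by (simp add: compatible_def op_le_def covariance_complement[OF assms(2)])
qed

lemma projection_ketbra: "cinner x x = 1 \<Longrightarrow> ketbra x x \<in> symbols"
  by (rule projection_symbol) (simp_all add: dagger_ketbra ketbra_mult_ketbra)

lemma symbols_zero: "0 \<in> symbols" and symbols_one: "mat 1 \<in> symbols"
  by (simp_all add: symbols_iff)

text \<open>The symbol 1 makes \<open>H\<close> skew-Hermitian, so it commutes with rank one
  projections, by polarization with all rank one operators, and is therefore a scalar, which
  skewness makes imaginary.\<close>

lemma anticommutator_zero_imp_scalar:
  fixes H :: "'n::finite cop"
  assumes H: "\<And>Q. Q \<in> symbols \<Longrightarrow> H ** Q + Q ** dagger H = 0"
  shows "\<exists>\<theta>::real. H = (\<i> * \<theta>) *\<^sub>M mat 1"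
proof -
  have H1: "dagger H = - H" using H[OF symbols_one] by (simp add: eq_neg_iff_add_eq_0 add.commute)
  have unit: "H ** ketbra x x = ketbra x x ** H" if "cinner x x = 1" for x
    using H[OF projection_ketbra[OF that]] by (simp add: H1 mtx_distrib)
  have comm: "H ** ketbra x x = ketbra x x ** H" for x
  proof (cases "x = 0")
    case False
    define e where "e = (1 / norm x) *\<^sub>R x"
    have "cinner e e = 1" using False by (simp add: e_def cinner_simps cinner_same power2_eq_square)
    moreover have "x = of_real (norm x) *s e"
      using False by (simp add: e_def vec_eq_iff scaleR_conv_of_real[where 'a=complex])
    then have "ketbra x x = (of_real (norm x) * of_real (norm x)) *\<^sub>M ketbra e e"
      by (metis complex_cnj_complex_of_real cscale_cscale ketbra_linear(3,4))
    ultimately show ?thesis using unit by (simp add: mtx_scale)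
  qed (simp add: ketbra_linear)
  have comm2: "H ** ketbra x y = ketbra x y ** H" for x y
  proof -
    let ?k = "\<lambda>c. ketbra (x + c *s y) (x + c *s y)"
    have "4 *\<^sub>M ketbra x y = ?k 1 + \<i> *\<^sub>M ?k \<i> + (- 1) *\<^sub>M ?k (- 1) + (- \<i>) *\<^sub>M ?k (- \<i>)"
      by (rule mat_eqI) (simp add: algebra_simps)
    then have "H ** (4 *\<^sub>M ketbra x y) = 4 *\<^sub>M ketbra x y ** H"
      by (simp only: mtx_distrib mtx_scale comm)
    then have "(1 / 4) *\<^sub>M 4 *\<^sub>M (H ** ketbra x y) = (1 / 4) *\<^sub>M 4 *\<^sub>M (ketbra x y ** H)"
      by (simp add: mtx_scale)
    then show ?thesis by simp
  qed
  define e :: "complex ^ 'n" where "e = axis undefined 1"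
  have e: "cinner e e = 1" by (simp add: e_def cinner_axis_axis)
  define c where "c = cinner e (H *v e)"
  have Hc: "H = c *\<^sub>M mat 1"
  proof (rule matrix_eqI_vec)
    fix x
    have "(H ** ketbra x e) *v e = (ketbra x e ** H) *v e" by (simp add: comm2)
    then show "H *v x = (c *\<^sub>M mat 1) *v x" by (simp add: mtx_vec ketbra_vec e vec_scale_simps c_def)
  qed
  have "cnj c *\<^sub>M mat 1 = (- c) *\<^sub>M (mat 1 :: 'n cop)"
    using H1 unfolding Hc by (simp add: dagger_cscale cscale_minus_left)
  then have "(cnj c *\<^sub>M mat 1) *v e = ((- c) *\<^sub>M mat 1) *v e" by simp
  then have "cinner e (cnj c *s e) = cinner e ((- c) *s e)" by (simp add: mtx_vec)
  then have "cnj c = - c" by (simp add: cinner_simps e)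
  then have "c = \<i> * of_real (Im c)" by (simp add: complex_eq_iff)
  then show ?thesis using Hc by metis
qed

section \<open>Transfer of the symbol flow to the gauge invariant algebra\<close>

context irreducible_car
begin

lemma gauge_alg_closed:
  "X \<in> gauge_alg Z \<Longrightarrow> Y \<in> gauge_alg Z \<Longrightarrow> X + Y \<in> gauge_alg Z"
  "X \<in> gauge_alg Z \<Longrightarrow> c *\<^sub>M X \<in> gauge_alg Z"
  by (simp_all add: gauge_alg_def mtx_distrib mtx_scale)

abbreviation "ehk_flow G A t \<equiv> ehk_map Z (op_exp (t *\<^sub>R G)) (covariance_integral G A t)"
abbreviation "symbol_flow G A t Q \<equiv> op_exp (t *\<^sub>R G) ** Q ** dagger (op_exp (t *\<^sub>R G)) + covariance_integral G A t"

lemma ehk_gauge_alg: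
  assumes "compatible S R" "X \<in> gauge_alg Z"
  shows "ehk_map Z S R X \<in> gauge_alg Z"
proof -
  have "X \<in> {X. ehk_map Z S R X \<in> gauge_alg Z}"
    by (rule gauge_alg_induct[OF _ _ _ assms(2)])
      (simp_all add: ehk_additive[OF assms(1)] ehk_scale[OF assms(1)] ehk_gig[OF assms(1)] gauge_alg_closed
        gig_density_in_gauge_alg ehk_symbol[OF assms(1)])
  then show ?thesis by simp
qed

lemma ehk_gauge_eqI:
  assumes "compatible S R" and "\<And>X Y. F (X + Y) = F X + F Y" "\<And>c X. F (c *\<^sub>M X) = c *\<^sub>M F X"
    and "\<And>Q. Q \<in> symbols \<Longrightarrow> F (gig_density Z Q) = gig_density Z (S ** Q ** dagger S + R)"
    and "X \<in> gauge_alg Z"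
  shows "F X = ehk_map Z S R X"
proof -
  have "X \<in> {X. F X = ehk_map Z S R X}"
    by (rule gauge_alg_induct[OF _ _ _ assms(5)])
      (simp_all add: ehk_additive[OF assms(1)] ehk_scale[OF assms(1)] ehk_gig[OF assms(1)] assms(2-4))
  then show ?thesis by simp
qed

lemma continuous_on_gig_flow:
  assumes "continuous_on T q" "\<And>t. t \<in> T \<Longrightarrow> q t \<in> symbols"
  shows "continuous_on T (\<lambda>t. gig_density Z (q t))"
  by (rule continuous_on_compose2[OF continuous_on_gig_density assms(1)]) (use assms(2) in auto)

lemma continuous_on_symbol_flow: "continuous_on {0..} (\<lambda>t. symbol_flow G A t Q)"
proof (rule continuous_on_add)
  show "continuous_on {0..} (\<lambda>t. op_exp (t *\<^sub>R G) ** Q ** dagger (op_exp (t *\<^sub>R G)))"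
    using continuous_on_flow_conj[of "{0..}" G Q] unfolding flow_conj_def .
  show "continuous_on {0..} (covariance_integral G A)"
    by (rule continuous_on_vector_derivative) (rule covariance_derivative, simp)
qed

lemma ehk_flow_semigroup:
  assumes GA: "(G, A) \<in> generating_pairs"
  shows "(\<lambda>t\<in>{0..}. restrict (ehk_flow G A t) (gauge_alg Z)) \<in> gig_semigroups Z"
proof -
  have c: "compatible (op_exp (t *\<^sub>R G)) (covariance_integral G A t)" if "0 \<le> t" for t
    by (rule generating_compatible[OF GA that])
  note add = ehk_additive[OF c] and scale = ehk_scale[OF c] and gig = ehk_gig[OF c] and sym = ehk_symbol[OF c]
  have gigs: "gig_density Z Q \<in> gauge_alg Z" if "Q \<in> symbols" for Q by (rule gig_density_in_gauge_alg[OF that])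
  show ?thesis
    unfolding gig_semigroups_def
  proof (intro CollectI conjI allI impI ballI)
    show "(\<lambda>t\<in>{0..}. restrict (ehk_flow G A t) (gauge_alg Z)) \<in> extensional {0..}" by simp
    show "(\<lambda>t\<in>{0..}. restrict (ehk_flow G A t) (gauge_alg Z)) t \<in> extensional (gauge_alg Z)" if "0 \<le> t" for t
      using that by simp
    show "quantum_operation_on (gauge_alg Z) ((\<lambda>t\<in>{0..}. restrict (ehk_flow G A t) (gauge_alg Z)) t)" if t: "0 \<le> t" for t
    proof -
      have "block_psd m (\<lambda>i j. restrict (ehk_flow G A t) (gauge_alg Z) (X i j))"
        if X: "\<forall>i<m. \<forall>j<m. X i j \<in> gauge_alg Z" "block_psd m X" for m X
      proof -
        have "block_psd m (\<lambda>i j. ehk_flow G A t (X i j))"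
          using ehk_completely_positive[OF c[OF t]] X(2) by (simp add: completely_positive_on_def)
        then show ?thesis using X(1) by (simp add: block_psd_def)
      qed
      then show ?thesis
        using t unfolding quantum_operation_on_def completely_positive_on_def
        by (auto simp: gauge_alg_closed add scale ehk_gauge_alg[OF c] ehk_trace[OF c])
    qed
    show "(\<lambda>t\<in>{0..}. restrict (ehk_flow G A t) (gauge_alg Z)) 0 X = X" if X: "X \<in> gauge_alg Z" for X
      using ehk_gauge_eqI[OF c[of 0], of "\<lambda>X. X" X] X by simp
    show "(\<lambda>t\<in>{0..}. restrict (ehk_flow G A t) (gauge_alg Z)) s ((\<lambda>t\<in>{0..}. restrict (ehk_flow G A t) (gauge_alg Z)) t X)
        = (\<lambda>t\<in>{0..}. restrict (ehk_flow G A t) (gauge_alg Z)) (s + t) X"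
      if st: "0 \<le> s" "0 \<le> t" and X: "X \<in> gauge_alg Z" for s t X
    proof -
      have "ehk_flow G A s (ehk_flow G A t X) = ehk_flow G A (s + t) X"
      proof (rule ehk_gauge_eqI[OF c _ _ _ X])
        fix Q :: "'n cop" assume Q: "Q \<in> symbols"
        have "symbol_flow G A s (symbol_flow G A t Q) = symbol_flow G A (s + t) Q"
          unfolding op_exp_add covariance_add[OF st] by (simp add: dagger_mult mtx_distrib mtx_assoc add.commute add.left_commute)
        then show "ehk_flow G A s (ehk_flow G A t (gig_density Z Q)) = gig_density Z (symbol_flow G A (s + t) Q)"
          using st Q by (simp add: gig sym)
      qed (use st in \<open>simp_all add: add scale\<close>)
      then show ?thesis using st X by (simp add: ehk_gauge_alg[OF c])
    qed
    show "continuous_on {0..} (\<lambda>t. (\<lambda>t\<in>{0..}. restrict (ehk_flow G A t) (gauge_alg Z)) t X)" if X: "X \<in> gauge_alg Z" for X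
    proof -
      have "X \<in> {X. continuous_on {0..} (\<lambda>t. ehk_flow G A t X)}"
      proof (rule gauge_alg_induct[OF _ _ _ X])
        fix X Y assume "X \<in> {X. continuous_on {0..} (\<lambda>t. ehk_flow G A t X)}" "Y \<in> {X. continuous_on {0..} (\<lambda>t. ehk_flow G A t X)}"
        then have "continuous_on {0..} (\<lambda>t. ehk_flow G A t X + ehk_flow G A t Y)" by (auto intro: continuous_on_add)
        then show "X + Y \<in> {X. continuous_on {0..} (\<lambda>t. ehk_flow G A t X)}"
          using continuous_on_cong[of "{0..}" "{0..}" "\<lambda>t. ehk_flow G A t (X + Y)" "\<lambda>t. ehk_flow G A t X + ehk_flow G A t Y"]
          by (simp add: add)
      next
        fix r X assume "X \<in> {X. continuous_on {0..} (\<lambda>t. ehk_flow G A t X)}"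
        then have "continuous_on {0..} (\<lambda>t. r *\<^sub>M ehk_flow G A t X)"
          by (auto intro: bounded_linear.continuous_on[OF bounded_linear_cscale])
        then show "r *\<^sub>M X \<in> {X. continuous_on {0..} (\<lambda>t. ehk_flow G A t X)}"
          using continuous_on_cong[of "{0..}" "{0..}" "\<lambda>t. ehk_flow G A t (r *\<^sub>M X)" "\<lambda>t. r *\<^sub>M ehk_flow G A t X"]
          by (simp add: scale)
      next
        fix Q :: "'n cop" assume Q: "Q \<in> symbols"
        have "continuous_on {0..} (\<lambda>t. gig_density Z (symbol_flow G A t Q))"
          by (rule continuous_on_gig_flow[OF continuous_on_symbol_flow]) (simp add: sym Q)
        then show "gig_density Z Q \<in> {X. continuous_on {0..} (\<lambda>t. ehk_flow G A t X)}"
          using continuous_on_cong[of "{0..}" "{0..}" "\<lambda>t. ehk_flow G A t (gig_density Z Q)" "\<lambda>t. gig_density Z (symbol_flow G A t Q)"]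
          by (simp add: gig Q)
      qed
      then show ?thesis
        using X continuous_on_cong[of "{0..}" "{0..}" "\<lambda>t. (\<lambda>t\<in>{0..}. restrict (ehk_flow G A t) (gauge_alg Z)) t X" "\<lambda>t. ehk_flow G A t X"]
        by simp
    qed
    show "(\<lambda>t\<in>{0..}. restrict (ehk_flow G A t) (gauge_alg Z)) t ` gig_densities Z \<subseteq> gig_densities Z" if t: "0 \<le> t" for t
      using t by (auto simp: gig_densities_def gigs gig sym)
  qed
qed

text \<open>Densities determine symbols, so the symbol paths coincide and may be differentiated at
  zero: the symbol 0 isolates \<open>A\<close>, and the difference of the generators satisfies
  \<open>H ** Q + Q ** dagger H = 0\<close>. Conversely, an imaginary scalar contributes a phase
  that cancels against its conjugate.\<close>

lemma ehk_flow_unique: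
  assumes GA: "(G, A) \<in> generating_pairs" and GA': "(G', A') \<in> generating_pairs"
  shows "(\<forall>t\<ge>0. restrict (ehk_flow G A t) (gauge_alg Z) = restrict (ehk_flow G' A' t) (gauge_alg Z))
    \<longleftrightarrow> A = A' \<and> (\<exists>\<theta>::real. G' = G + (\<i> * \<theta>) *\<^sub>M mat 1)" (is "?L \<longleftrightarrow> ?R")
proof
  note c = generating_compatible[OF GA] and c' = generating_compatible[OF GA']
  assume L: ?L
  have flow: "symbol_flow G A t Q = symbol_flow G' A' t Q" if t: "0 \<le> t" and Q: "Q \<in> symbols" for t Q
  proof -
    have "restrict (ehk_flow G A t) (gauge_alg Z) (gig_density Z Q) = restrict (ehk_flow G' A' t) (gauge_alg Z) (gig_density Z Q)"
      using L t by simp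
    then have "gig_density Z (symbol_flow G A t Q) = gig_density Z (symbol_flow G' A' t Q)"
      using Q by (simp add: gig_density_in_gauge_alg ehk_gig[OF c[OF t]] ehk_gig[OF c'[OF t]])
    then show ?thesis
      by (rule gig_density_inj[OF ehk_symbol[OF c[OF t] Q] ehk_symbol[OF c'[OF t] Q]])
  qed
  have deriv: "((\<lambda>t. symbol_flow G A t Q) has_vector_derivative G ** Q + Q ** dagger G + A) (at 0 within {0..})" for G A Q :: "'n cop"
    using has_vector_derivative_add[OF flow_conj_derivative[of G Q 0 "{0..}"] covariance_derivative[of 0 G A]]
    by (simp add: flow_conj_def)
  have eq: "G ** Q + Q ** dagger G + A = G' ** Q + Q ** dagger G' + A'" if Q: "Q \<in> symbols" for Q
  proof -
    have "((\<lambda>t. symbol_flow G A t Q) has_vector_derivative G' ** Q + Q ** dagger G' + A') (at 0 within {0..})"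
      by (rule has_vector_derivative_transform[OF _ _ deriv[of G' Q A']]) (simp_all add: flow Q)
    then show ?thesis
      by (intro vector_derivative_unique_within[OF _ deriv]) (simp_all add: at_within_Ici_at_right)
  qed
  have A: "A = A'" using eq[OF symbols_zero] by simp
  have "(G' - G) ** Q + Q ** dagger (G' - G) = 0" if "Q \<in> symbols" for Q
    using eq[OF that] A by (simp add: mtx_distrib dagger_simps algebra_simps)
  from anticommutator_zero_imp_scalar[OF this]
  show ?R using A by (metis add.commute diff_add_cancel)
next
  assume ?R
  then obtain \<theta> :: real where A: "A' = A" and G': "G' = G + (\<i> * \<theta>) *\<^sub>M mat 1" by blast
  have E: "op_exp (t *\<^sub>R G') = exp (\<i> * (t * \<theta>)) *\<^sub>M op_exp (t *\<^sub>R G)" for t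
  proof -
    have "t *\<^sub>R G' = t *\<^sub>R G + (\<i> * (t * \<theta>)) *\<^sub>M mat 1"
      by (rule mat_eqI) (simp add: G' scaleR_conv_of_real[where 'a=complex] algebra_simps)
    then show ?thesis by (simp add: op_exp_scalar_shift)
  qed
  have phase: "exp (\<i> * (t * \<theta>)) * cnj (exp (\<i> * (t * \<theta>))) = 1" for t :: real
    by (simp add: exp_cnj flip: exp_add)
  have flow: "flow_conj G' B t = flow_conj G B t" for B t
    using phase[of t] by (simp add: flow_conj_def E dagger_cscale mtx_scale mult.commute)
  then have cov: "covariance_integral G' A' t = covariance_integral G A t" for t
    unfolding covariance_integral_eq A by (simp add: flow[abs_def])
  show ?L
  proof (intro allI impI)
    fix t :: real assume t: "0 \<le> t"
    have "ehk_flow G A t X = ehk_flow G' A' t X" if X: "X \<in> gauge_alg Z" for X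
    proof (rule ehk_gauge_eqI[OF generating_compatible[OF GA' t] _ _ _ X])
      note c = generating_compatible[OF GA t]
      show "ehk_flow G A t (gig_density Z Q) = gig_density Z (symbol_flow G' A' t Q)" if "Q \<in> symbols" for Q
        using that flow[of Q t] unfolding flow_conj_def by (simp add: ehk_gig[OF c] cov)
    qed (simp_all add: ehk_additive[OF generating_compatible[OF GA t]] ehk_scale[OF generating_compatible[OF GA t]])
    then show "restrict (ehk_flow G A t) (gauge_alg Z) = restrict (ehk_flow G' A' t) (gauge_alg Z)"
      by (intro restrict_ext)
  qed
qed

end

section \<open>Infinitesimal symbol maps\<close>

text \<open>A real polynomial of degree three in the real and imaginary parts of \<open>s\<close> is
  sampled at enough points. Points on the axes determine everything except \<open>Im b\<close>, for
  which \<open>1 + \<i>\<close> is added.\<close>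

lemma cubic_identity:
  fixes a b d :: complex and c0 c :: real
  assumes "\<And>s. c0 + 2 * Re (cnj s * a) + (2 * Re ((cnj s)\<^sup>2 * b) + (cmod s)\<^sup>2 * c) + (cmod s)\<^sup>2 * (2 * Re (cnj s * d)) = 0"
  shows "c0 = 0 \<and> a = 0 \<and> b = 0 \<and> c = 0 \<and> d = 0"
proof -
  have e0: "c0 = 0" using assms[of 0] by simp
  have e1: "2 * Re a + (2 * Re b + c) + 2 * Re d = 0" using assms[of 1] e0 by simp
  have e2: "- 2 * Re a + (2 * Re b + c) - 2 * Re d = 0" using assms[of "- 1"] e0 by simp
  have e3: "4 * Re a + 4 * (2 * Re b + c) + 16 * Re d = 0" using assms[of 2] e0 by simp
  have f1: "2 * Im a + (- 2 * Re b + c) + 2 * Im d = 0" using assms[of \<i>] e0 by simp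
  have f2: "- 2 * Im a + (- 2 * Re b + c) - 2 * Im d = 0" using assms[of "- \<i>"] e0 by simp
  have f3: "4 * Im a + 4 * (- 2 * Re b + c) + 16 * Im d = 0" using assms[of "2 * \<i>"] e0
    by (simp add: norm_mult power_mult_distrib)
  have g: "2 * (Re a + Im a) + (4 * Im b + 2 * c) + 2 * (2 * (Re d + Im d)) = 0"
  proof -
    have n: "(cmod (1 + \<i>))\<^sup>2 = 2" by (simp add: cmod_power2)
    show ?thesis using assms[of "1 + \<i>", unfolded n] e0 by (simp add: power2_eq_square)
  qed
  have B: "2 * Re b + c = 0" "- 2 * Re b + c = 0" using e1 e2 f1 f2 by linarith+
  have "Re a + Re d = 0" "Im a + Im d = 0" using e1 f1 B by linarith+
  moreover have "4 * Re a + 16 * Re d = 0" "4 * Im a + 16 * Im d = 0" using e3 f3 unfolding B by linarith+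
  ultimately have "Re a = 0" "Re d = 0" "Im a = 0" "Im d = 0" by linarith+
  then show ?thesis using g e0 B by (simp add: complex_eq_iff)
qed

text \<open>Collects the value of the form at the test vectors by powers of \<open>s\<close>, in the
  shape required by \<open>cubic_identity\<close>; the parameters stand for matrix entries.\<close>

lemma test_vector_expansion:
  fixes s a1 a2 a3 a4 a5 b1 b2 b3 b4 :: complex
  shows "2 * Re (cnj s * (- (cnj s * a1) - a2 + s * cnj s * a3 + s * a4 + cnj s * a5)) +
      Re (s * cnj s * b1 - cnj s * b2 - s * cnj b2 - b3 - cnj b3 + s * b4 + cnj s * cnj b4) =
    - (2 * Re b3) + 2 * Re (cnj s * (cnj b4 - a2 - b2))
      + (2 * Re ((cnj s)\<^sup>2 * (a5 - a1)) + (cmod s)\<^sup>2 * (2 * Re a4 + Re b1)) + (cmod s)\<^sup>2 * (2 * Re (cnj s * a3))"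
  unfolding cmod_power2 by (simp add: power2_eq_square algebra_simps)

text \<open>
  A Hermitian map whose values on rank one projections \<open>|\<psi>\<rangle>\<langle>\<psi>|\<close> vanish as quadratic forms on the
  orthogonal complement of \<open>\<psi>\<close>, normalized by \<open>\<mu>(|x\<rangle>\<langle>e|) e = 0\<close>, vanishes: test with the
  orthogonal vectors \<open>s e + x\<close> and \<open>- e + cnj s x + \<zeta>\<close>, and compare coefficients in \<open>s\<close>.
\<close>

lemma normalized_tangent_map_zero:
  fixes \<mu> :: "'n::finite cop \<Rightarrow> 'n cop"
  assumes add: "\<And>X Y. \<mu> (X + Y) = \<mu> X + \<mu> Y" and scale: "\<And>c X. \<mu> (c *\<^sub>M X) = c *\<^sub>M \<mu> X"
    and herm: "\<And>X. dagger (\<mu> X) = \<mu> (dagger X)"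
    and tang: "\<And>\<psi> \<eta>. cinner \<psi> \<eta> = 0 \<Longrightarrow> cinner \<eta> (\<mu> (ketbra \<psi> \<psi>) *v \<eta>) = 0"
    and e: "cinner e e = 1" and norm: "\<And>x. \<mu> (ketbra x e) *v e = 0"
  shows "\<mu> X = 0"
proof -
  define H where "H x y = \<mu> (ketbra x y)" for x y
  have Hl: "H (x + y) z = H x z + H y z" "H z (x + y) = H z x + H z y"
    "H (c *s x) z = c *\<^sub>M H x z" "H z (c *s x) = cnj c *\<^sub>M H z x" for x y z c
    by (simp_all add: H_def ketbra_linear add scale)
  have Hd: "dagger (H x y) = H y x" for x y by (simp add: H_def herm dagger_ketbra)
  have tang': "cinner \<eta> (H \<psi> \<psi> *v \<eta>) = 0" if "cinner \<psi> \<eta> = 0" for \<psi> \<eta>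
    using tang[OF that] by (simp add: H_def)
  have He: "H x e *v e = 0" for x using norm by (simp add: H_def)
  have flip: "cinner x (H y y *v z) = cnj (cinner z (H y y *v x))" for x y z
    by (simp add: cinner_dagger_left Hd)
  have hee: "H e e = 0"
  proof (rule matrix_eqI_quadratic)
    fix v
    define \<eta> where "\<eta> = v - cinner e v *s e"
    have \<eta>: "cinner e \<eta> = 0" by (simp add: \<eta>_def cinner_simps e)
    have v: "v = cinner e v *s e + \<eta>" by (simp add: \<eta>_def)
    have 1: "cinner e (H e e *v \<eta>) = 0" using flip[of e e \<eta>] He[of e] by simp
    show "cinner v (H e e *v v) = cinner v (0 *v v)"
      by (subst (1 2) v) (simp add: mtx_vec cinner_simps He 1 tang'[OF \<eta>] vec_scale_simps)
  qed
  have unit: "H x e = 0 \<and> H x x = 0" if x: "cinner x x = 1" "cinner e x = 0" for x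
  proof -
    define M where "M = H x e"
    define h where "h = H x x"
    have Md: "H e x = dagger M" by (simp add: M_def Hd)
    have Me: "M *v e = 0" by (simp add: M_def He)
    have xe: "cinner x e = 0" using x(2) cinner_eq_0_commute by blast
    have M': "cinner y (dagger M *v z) = cnj (cinner z (M *v y))" for y z
      by (simp add: cinner_dagger_left)
    have h': "cinner y (h *v z) = cnj (cinner z (h *v y))" for y z
      unfolding h_def by (rule flip)
    have Hs: "H (s *s e + x) (s *s e + x) = s *\<^sub>M dagger M + cnj s *\<^sub>M M + h" for s
      by (simp add: Hl hee Md M_def[symmetric] h_def)
    have q: "cinner \<eta> (H (s *s e + x) (s *s e + x) *v \<eta>) = 2 * Re (cnj s * cinner \<eta> (M *v \<eta>)) + Re (cinner \<eta> (h *v \<eta>))" for s \<eta>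
    proof -
      have "cinner \<eta> (h *v \<eta>) = of_real (Re (cinner \<eta> (h *v \<eta>)))"
        by (rule hermitian_cinner_real) (simp add: h_def Hd)
      moreover have "s * cnj z + cnj s * z = 2 * Re (cnj s * z)" for z
        by (simp add: complex_eq_iff)
      then have "s * cnj (cinner \<eta> (M *v \<eta>)) + cnj s * cinner \<eta> (M *v \<eta>) = 2 * Re (cnj s * cinner \<eta> (M *v \<eta>))" .
      ultimately show ?thesis unfolding Hs by (simp add: mtx_vec cinner_simps M' add.assoc[symmetric])
    qed
    have all: "cinner \<zeta> (M *v \<zeta>) = 0 \<and> cinner \<zeta> (h *v \<zeta>) = 0 \<and> cinner e (h *v x) = 0 \<and> cinner e (M *v x) = 0 \<and>
      cinner x (h *v x) = 0 \<and> cinner x (M *v x) = 0 \<and> cinner x (M *v \<zeta>) = 0 \<and> cinner e (M *v \<zeta>) = 0 \<and>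
      cinner x (h *v \<zeta>) = 0 \<and> cinner e (h *v \<zeta>) = 0 \<and> cinner \<zeta> (M *v x) = 0"
      if \<zeta>: "cinner e \<zeta> = 0" "cinner x \<zeta> = 0" for \<zeta>
    proof -
      have h\<zeta>: "cinner \<zeta> (h *v \<zeta>) = 0" unfolding h_def by (rule tang'[OF \<zeta>(2)])
      have he: "cinner e (h *v e) = 0" unfolding h_def by (rule tang'[OF xe])
      have "cinner (s *s e + x) \<zeta> = 0" for s using \<zeta> by (simp add: cinner_simps)
      from tang'[OF this] have "2 * Re (cnj s * cinner \<zeta> (M *v \<zeta>)) = 0" for s
        unfolding q h\<zeta> by (simp add: complex_eq_iff)
      from this[of 1] this[of \<i>] have M\<zeta>: "cinner \<zeta> (M *v \<zeta>) = 0" by (simp add: complex_eq_iff)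
      \<comment> \<open>The form vanishes on the orthogonal test vectors for every \<open>s\<close>,
        so each coefficient vanishes; the coefficients are entries of \<open>M\<close> and
        \<open>h\<close> among \<open>e\<close>, \<open>x\<close> and \<xi>.\<close>
      have poly: "- (2 * Re (cinner e (h *v \<xi>))) = 0 \<and> cnj (cinner x (h *v \<xi>)) - cinner e (M *v \<xi>) - cinner e (h *v x) = 0 \<and>
          cinner \<xi> (M *v x) - cinner e (M *v x) = 0 \<and> 2 * Re (cinner x (M *v \<xi>)) + Re (cinner x (h *v x)) = 0 \<and> cinner x (M *v x) = 0"
        if \<xi>: "cinner e \<xi> = 0" "cinner x \<xi> = 0" "cinner \<xi> (M *v \<xi>) = 0" "cinner \<xi> (h *v \<xi>) = 0" for \<xi>
      proof (rule cubic_identity)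
        fix s
        define \<eta> where "\<eta> = - e + cnj s *s x + \<xi>"
        have "cinner (s *s e + x) \<eta> = 0"
          using \<xi> by (simp add: \<eta>_def cinner_simps e x xe)
        from tang'[OF this] have "2 * Re (cnj s * cinner \<eta> (M *v \<eta>)) + Re (cinner \<eta> (h *v \<eta>)) = 0"
          unfolding q by (simp add: complex_eq_iff)
        moreover have "cinner \<eta> (M *v \<eta>) = - (cnj s * cinner e (M *v x)) - cinner e (M *v \<xi>) + s * cnj s * cinner x (M *v x)
            + s * cinner x (M *v \<xi>) + cnj s * cinner \<xi> (M *v x)"
          using \<xi> by (simp add: \<eta>_def mtx_vec cinner_simps Me algebra_simps)
        moreover have "cinner \<eta> (h *v \<eta>) = s * cnj s * cinner x (h *v x) - cnj s * cinner e (h *v x) - s * cnj (cinner e (h *v x))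
            - cinner e (h *v \<xi>) - cnj (cinner e (h *v \<xi>)) + s * cinner x (h *v \<xi>) + cnj s * cnj (cinner x (h *v \<xi>))"
          using \<xi> he h'[of x e] h'[of \<xi> e] h'[of \<xi> x] by (simp add: \<eta>_def mtx_vec cinner_simps algebra_simps)
        ultimately show "- (2 * Re (cinner e (h *v \<xi>))) + 2 * Re (cnj s * (cnj (cinner x (h *v \<xi>)) - cinner e (M *v \<xi>) - cinner e (h *v x)))
          + (2 * Re ((cnj s)\<^sup>2 * (cinner \<xi> (M *v x) - cinner e (M *v x))) + (cmod s)\<^sup>2 * (2 * Re (cinner x (M *v \<xi>)) + Re (cinner x (h *v x))))
          + (cmod s)\<^sup>2 * (2 * Re (cnj s * cinner x (M *v x))) = 0"
          unfolding test_vector_expansion[symmetric] by (simp only:)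
      qed
      \<comment> \<open>Three choices of the free vector: zero gives the entries on the plane of
        \<open>e\<close> and \<open>x\<close>, while \<zeta> and \<open>\<i> *s \<zeta>\<close>
        together separate the real and imaginary parts of the mixed entries.\<close>
      have p0: "cinner e (h *v x) = 0" "cinner e (M *v x) = 0" "Re (cinner x (h *v x)) = 0" "cinner x (M *v x) = 0"
        using poly[of 0] by auto
      have p1: "Re (cinner e (h *v \<zeta>)) = 0" "cnj (cinner x (h *v \<zeta>)) = cinner e (M *v \<zeta>)" "cinner \<zeta> (M *v x) = 0" "Re (cinner x (M *v \<zeta>)) = 0"
        using poly[OF \<zeta> M\<zeta> h\<zeta>] p0 by auto
      have p2: "Re (cinner e (h *v (\<i> *s \<zeta>))) = 0" "cnj (cinner x (h *v (\<i> *s \<zeta>))) = cinner e (M *v (\<i> *s \<zeta>))" "Re (cinner x (M *v (\<i> *s \<zeta>))) = 0"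
        using poly[of "\<i> *s \<zeta>"] \<zeta> M\<zeta> h\<zeta> p0 by (auto simp: cinner_simps mtx_vec)
      have "- (\<i> * cnj (cinner x (h *v \<zeta>))) = \<i> * cinner e (M *v \<zeta>)" using p2(2) by (simp add: mtx_vec cinner_simps del: cnj_cinner)
      then have "cnj (cinner x (h *v \<zeta>)) = - cinner e (M *v \<zeta>)" by (simp add: complex_eq_iff del: cnj_cinner)
      then have z1: "cinner e (M *v \<zeta>) = 0" using p1(2) by simp
      then have z2: "cinner x (h *v \<zeta>) = 0" using p1(2) by (metis complex_cnj_zero_iff)
      have z3: "cinner e (h *v \<zeta>) = 0" "cinner x (M *v \<zeta>) = 0"
        using p1(1,4) p2(1,3) by (simp_all add: mtx_vec cinner_simps complex_eq_iff)
      have "cinner x (h *v x) = 0"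
        using hermitian_cinner_real[of h x] p0(3) by (simp add: h_def Hd)
      then show ?thesis using z1 z2 z3 p0 p1 M\<zeta> h\<zeta> by simp
    qed
    have dec: "\<exists>a b \<zeta>. v = a *s e + b *s x + \<zeta> \<and> cinner e \<zeta> = 0 \<and> cinner x \<zeta> = 0" for v
      by (intro exI[of _ "cinner e v"] exI[of _ "cinner x v"] exI[of _ "v - cinner e v *s e - cinner x v *s x"])
        (simp add: cinner_simps e x xe)
    have "cinner v (M *v v) = 0 \<and> cinner v (h *v v) = 0" for v
    proof -
      obtain a b \<zeta> where v: "v = a *s e + b *s x + \<zeta>" and \<zeta>: "cinner e \<zeta> = 0" "cinner x \<zeta> = 0" using dec by blast
      note z = all[OF \<zeta>]
      have "cinner x (h *v e) = 0" "cinner \<zeta> (h *v e) = 0" "cinner \<zeta> (h *v x) = 0"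
        using h'[of x e] h'[of \<zeta> e] h'[of \<zeta> x] z by simp_all
      moreover have "cinner e (h *v e) = 0" unfolding h_def by (rule tang'[OF xe])
      ultimately show ?thesis using z by (simp add: v mtx_vec cinner_simps Me)
    qed
    then have "M = 0" "h = 0" by (auto intro!: matrix_eqI_quadratic)
    then show ?thesis by (simp add: M_def h_def)
  qed
  have diag: "H \<psi> \<psi> = 0" for \<psi>
  proof -
    define \<eta> where "\<eta> = \<psi> - cinner e \<psi> *s e"
    have \<eta>: "cinner e \<eta> = 0" by (simp add: \<eta>_def cinner_simps e)
    have \<psi>: "\<psi> = cinner e \<psi> *s e + \<eta>" by (simp add: \<eta>_def)
    show ?thesis
    proof (cases "\<eta> = 0")
      case True
      then show ?thesis using \<psi> by (metis Hl(3) add.right_neutral cscale_zero_right hee Hl(4))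
    next
      case False
      define x where "x = (1 / norm \<eta>) *\<^sub>R \<eta>"
      have x: "cinner x x = 1" "cinner e x = 0"
        using False \<eta> by (simp_all add: x_def cinner_simps cinner_same power2_eq_square)
      have "\<eta> = of_real (norm \<eta>) *s x"
        using False by (simp add: x_def vec_eq_iff scaleR_conv_of_real[where 'a=complex])
      then obtain b where b: "\<psi> = cinner e \<psi> *s e + b *s x" using \<psi> by metis
      have "H e x = 0" using unit[OF x] Hd[of x e] by (metis dagger_zero)
      then have "H (a *s e + b *s x) (a *s e + b *s x) = 0" for a
        using unit[OF x] hee by (simp add: Hl)
      then show ?thesis using b by metis
    qed
  qed
  have off: "H x y = 0" for x y
  proof -
    let ?k = "\<lambda>c. ketbra (x + c *s y) (x + c *s y)"
    have "4 *\<^sub>M ketbra x y = ?k 1 + \<i> *\<^sub>M ?k \<i> + (- 1) *\<^sub>M ?k (- 1) + (- \<i>) *\<^sub>M ?k (- \<i>)"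
      by (rule mat_eqI) (simp add: algebra_simps)
    then have "\<mu> (4 *\<^sub>M ketbra x y) = 0"
      using diag by (simp add: add scale H_def)
    then show ?thesis by (simp add: scale cscale_eq_0_iff H_def)
  qed
  have "\<mu> 0 = 0" using scale[of 0 0] by simp
  then have "\<mu> (sum f S) = (\<Sum>i\<in>S. \<mu> (f i))" for f and S :: "'n set"
    by (induction S rule: infinite_finite_induct) (simp_all add: add)
  then show ?thesis by (subst matrix_ketbra_sum) (simp add: off[unfolded H_def])
qed

theorem tangent_map_form:
  fixes \<mu> :: "'n::finite cop \<Rightarrow> 'n cop"
  assumes add: "\<And>X Y. \<mu> (X + Y) = \<mu> X + \<mu> Y" and scale: "\<And>c X. \<mu> (c *\<^sub>M X) = c *\<^sub>M \<mu> X"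
    and herm: "\<And>X. dagger (\<mu> X) = \<mu> (dagger X)"
    and tang: "\<And>\<psi> \<eta>. cinner \<psi> \<eta> = 0 \<Longrightarrow> cinner \<eta> (\<mu> (ketbra \<psi> \<psi>) *v \<eta>) = 0"
  shows "\<exists>G. \<forall>X. \<mu> X = G ** X + X ** dagger G"
proof -
  define e :: "complex ^ 'n" where "e = axis undefined 1"
  have e: "cinner e e = 1" by (simp add: e_def cinner_axis_axis)
  \<comment> \<open>At \<open>ketbra x e\<close> and \<open>e\<close> the form to be subtracted
    takes the value \<open>G *v x + cinner (G *v e) e *s x\<close>. Half of the diagonal entry is
    the value of \<kappa> for which \<open>cinner (G *v e) e = \<kappa>\<close>, so that this equals
    the value of \<mu>.\<close>
  define \<kappa> where "\<kappa> = cinner e (\<mu> (ketbra e e) *v e) / 2"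
  have \<kappa>: "cnj \<kappa> = \<kappa>" by (simp add: \<kappa>_def cinner_dagger_left herm dagger_ketbra)
  have "\<mu> 0 = 0" using scale[of 0 0] by simp
  then have msum: "\<mu> (sum f S) = (\<Sum>i\<in>S. \<mu> (f i))" for f and S :: "'n set"
    by (induction S rule: infinite_finite_induct) (simp_all add: add)
  define G :: "'n cop" where "G = (\<chi> i j. (\<mu> (ketbra (axis j 1) e) *v e) $ i) - \<kappa> *\<^sub>M mat 1"
  have G: "G *v x = \<mu> (ketbra x e) *v e - \<kappa> *s x" for x
  proof -
    have ks: "ketbra (\<Sum>j\<in>S. x $ j *s axis j 1) e = (\<Sum>j\<in>S. x $ j *\<^sub>M ketbra (axis j 1) e)" for S :: "'n set"
      by (induction S rule: infinite_finite_induct) (simp_all add: ketbra_linear)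
    have xs: "x = (\<Sum>j\<in>UNIV. x $ j *s axis j 1)"
      using orthonormal_basis_expand[OF orthonormal_basis_axis, of x] by (simp add: cinner_axis_left)
    have "\<mu> (ketbra x e) *v e = (\<Sum>j\<in>UNIV. x $ j *s (\<mu> (ketbra (axis j 1) e) *v e))"
      by (subst xs) (simp add: ks msum scale mtx_vec)
    also have "\<dots> = (\<chi> i j. (\<mu> (ketbra (axis j 1) e) *v e) $ i) *v x"
      by (simp add: vec_eq_iff matrix_vector_mult_def mult.commute)
    finally show ?thesis by (simp add: G_def mtx_vec)
  qed
  have "\<mu> X - (G ** X + X ** dagger G) = 0" for X
  proof (rule normalized_tangent_map_zero[where \<mu> = "\<lambda>X. \<mu> X - (G ** X + X ** dagger G)"])
    show "cinner e e = 1" by (rule e)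
    show "dagger (\<mu> X - (G ** X + X ** dagger G)) = \<mu> (dagger X) - (G ** dagger X + dagger X ** dagger G)" for X
      by (simp add: dagger_simps herm add.commute)
    show "cinner \<eta> ((\<mu> (ketbra \<psi> \<psi>) - (G ** ketbra \<psi> \<psi> + ketbra \<psi> \<psi> ** dagger G)) *v \<eta>) = 0"
      if "cinner \<psi> \<eta> = 0" for \<psi> \<eta>
      using that tang[OF that] cinner_eq_0_commute[of \<psi> \<eta>]
      by (simp add: mtx_vec cinner_simps mult_ketbra ketbra_mult ketbra_vec vec_scale_simps)
    fix x
    have "cinner (G *v e) e = cnj (cinner e (G *v e))" by simp
    also have "\<dots> = \<kappa>" using \<kappa> by (simp add: G cinner_simps e \<kappa>_def del: cnj_cinner)
    finally show "(\<mu> (ketbra x e) - (G ** ketbra x e + ketbra x e ** dagger G)) *v e = 0"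
      by (simp add: matrix_vector_mult_diff_rdistrib matrix_vector_mult_add_rdistrib mult_ketbra ketbra_mult ketbra_vec e vec_scale_simps G)
  qed (simp_all add: add scale mtx_distrib mtx_scale)
  then show ?thesis by (metis eq_iff_diff_eq_0)
qed

text \<open>A semigroup is linear on the gauge algebra only; extended to the whole space it becomes
  a bounded linear map, which can be exchanged with integrals.\<close>

lemma subspace_linear_extension:
  fixes f :: "'a::euclidean_space \<Rightarrow> 'b::euclidean_space"
  assumes S: "subspace S" and add: "\<And>x y. x \<in> S \<Longrightarrow> y \<in> S \<Longrightarrow> f (x + y) = f x + f y"
    and scale: "\<And>r x. x \<in> S \<Longrightarrow> f (r *\<^sub>R x) = r *\<^sub>R f x"
  shows "\<exists>g. bounded_linear g \<and> (\<forall>x\<in>S. g x = f x)"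
proof -
  obtain B where B: "B \<subseteq> S" "independent B" "S \<subseteq> span B" using basis_exists[of S] by metis
  obtain g where g: "linear g" "\<forall>x\<in>B. g x = f x" using linear_independent_extend[OF B(2), of f] by blast
  have "span B \<subseteq> {x \<in> S. g x = f x}"
  proof (rule span_minimal)
    show "B \<subseteq> {x \<in> S. g x = f x}" using B g by auto
    show "subspace {x \<in> S. g x = f x}"
      using S add scale scale[of 0 0] linear_add[OF g(1)] linear_scale[OF g(1)] linear_0[OF g(1)]
      by (auto simp: subspace_def)
  qed
  then show ?thesis using B(3) g(1) by (auto simp: linear_conv_bounded_linear)
qed

text \<open>The difference quotients at zero are positive operators, and positivity of a form
  survives the limit.\<close>

lemma derivative_psd:
  fixes X :: "real \<Rightarrow> 'n::finite cop"
  assumes X: "(X has_vector_derivative D) (at 0 within {0..})" and X0: "X 0 = 0" and psd: "\<And>t. 0 \<le> t \<Longrightarrow> psd (X t)"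
  shows "psd D"
  unfolding psd_iff
proof (intro conjI allI)
  have "((\<lambda>t. dagger (X t)) has_vector_derivative dagger D) (at 0 within {0..})"
    by (rule bounded_linear.has_vector_derivative[OF bounded_linear_dagger X])
  moreover have "((\<lambda>t. dagger (X t)) has_vector_derivative D) (at 0 within {0..})"
    by (rule has_vector_derivative_transform[OF _ _ X]) (simp_all add: psd_hermitian[OF psd])
  ultimately show "dagger D = D"
    by (intro vector_derivative_unique_within[of 0 "{0..}"]) (simp_all add: at_within_Ici_at_right)
  fix v
  let ?f = "\<lambda>t. Re (cinner v (X t *v v))"
  have "(?f has_vector_derivative Re (cinner v (D *v v))) (at 0 within {0..})"
    by (rule bounded_linear.has_vector_derivative[OF bounded_linear_compose[OF bounded_linear_Re bounded_linear_form] X])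
  then have "(?f has_real_derivative Re (cinner v (D *v v))) (at 0 within {0..})"
    by (simp add: has_real_derivative_iff_has_vector_derivative)
  then have lim: "((\<lambda>t. (?f t - ?f 0) / (t - 0)) \<longlongrightarrow> Re (cinner v (D *v v))) (at 0 within {0..})"
    by (simp add: has_field_derivative_iff)
  show "0 \<le> Re (cinner v (D *v v))"
  proof (rule tendsto_lowerbound[OF lim])
    show "\<forall>\<^sub>F t in at 0 within {0..}. 0 \<le> (?f t - ?f 0) / (t - 0)"
      using psd by (auto simp: eventually_at_filter X0 psd_iff)
    show "at 0 within {0..} \<noteq> (bot :: real filter)" by (simp add: at_within_Ici_at_right)
  qed
qed

section \<open>Classification of the semigroups\<close>

lemma integral_derivative_Ici:
  fixes f :: "real \<Rightarrow> 'a::banach"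
  assumes f: "continuous_on {0..} f" and t: "0 \<le> t"
  shows "((\<lambda>u. integral {0..u} f) has_vector_derivative f t) (at t within {0..})"
proof -
  have "((\<lambda>u. integral {0..u} f) has_vector_derivative f t) (at t within {0..t + 1})"
    by (rule integral_has_vector_derivative[OF continuous_on_subset[OF f]]) (use t in auto)
  then show ?thesis unfolding at_within_Icc_Suc[OF t] .
qed

lemma has_vector_derivative_shift_Ici:
  fixes f :: "real \<Rightarrow> 'a::real_normed_vector"
  assumes "(f has_vector_derivative D) (at (s + t) within {0..})" "0 \<le> s"
  shows "((\<lambda>t. f (s + t)) has_vector_derivative D) (at t within {0..})"
proof -
  have "(f has_vector_derivative D) (at (s + t) within (\<lambda>t. s + t) ` {0..})"
    by (rule has_vector_derivative_within_subset[OF assms(1)]) (use assms(2) in auto)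
  from vector_diff_chain_within[OF has_vector_derivative_add[OF has_vector_derivative_const has_vector_derivative_id] this]
  show ?thesis by (simp add: o_def)
qed

lemma integral_shift_Ici:
  fixes f :: "real \<Rightarrow> 'a::banach"
  assumes f: "continuous_on {0..} f" and st: "0 \<le> s" "0 \<le> t"
  shows "integral {0..t} (\<lambda>u. f (s + u)) = integral {0..s + t} f - integral {0..s} f"
proof -
  define F where "F t = integral {0..t} (\<lambda>u. f (s + u)) - (integral {0..s + t} f - integral {0..s} f)" for t
  have c: "continuous_on {0..} (\<lambda>u. f (s + u))"
    by (rule continuous_on_compose2[OF f]) (use st in \<open>auto intro!: continuous_intros\<close>)
  have "(F has_vector_derivative 0) (at t within {0..})" if t: "0 \<le> t" for t
    unfolding F_def
    using has_vector_derivative_diff[OF integral_derivative_Ici[OF c t]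
        has_vector_derivative_diff[OF has_vector_derivative_shift_Ici[OF integral_derivative_Ici[OF f], of s t] has_vector_derivative_const]]
      st t by simp
  from zero_derivative_const[of F, OF this st(2)] show ?thesis by (simp add: F_def)
qed

text \<open>For a quadratic form, the average of two values minus the value at the midpoint is a
  quarter of the value at the difference. Here the form is the two by two determinant.\<close>

lemma bilinear_midpoint:
  fixes a0 a1 b0 b1 c0 c1 d0 d1 :: complex
  assumes "(a0 + a1) / 2 * ((b0 + b1) / 2) - (c0 + c1) / 2 * ((d0 + d1) / 2) = (a0 * b0 - c0 * d0 + (a1 * b1 - c1 * d1)) / 2"
  shows "(a1 - a0) * (b1 - b0) - (c1 - c0) * (d1 - d0) = 0"
proof -
  have e: "(a1 - a0) * (b1 - b0) - (c1 - c0) * (d1 - d0) = 4 * ((a0 * b0 - c0 * d0 + (a1 * b1 - c1 * d1)) / 2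
      - ((a0 + a1) / 2 * ((b0 + b1) / 2) - (c0 + c1) / 2 * ((d0 + d1) / 2)))"
    by (simp add: field_simps)
  show ?thesis unfolding e assms by simp
qed

lemma derivative_Ici_unique:
  fixes f :: "real \<Rightarrow> 'a::real_normed_vector"
  assumes "(f has_vector_derivative D) (at 0 within {0..})" "(f has_vector_derivative D') (at 0 within {0..})"
  shows "D = D'"
  using assms by (intro vector_derivative_unique_within[of 0 "{0..}"]) (simp_all add: at_within_Ici_at_right)

section \<open>Orbits of a semigroup and their derivatives\<close>

context irreducible_car
begin

lemma subspace_gauge_alg: "subspace (gauge_alg Z)"
  by (auto simp: subspace_def gauge_alg_closed scaleR_cscale) (simp add: gauge_alg_def)

lemma gauge_alg_integral:
  assumes f: "f integrable_on S" and "\<And>s. s \<in> S \<Longrightarrow> f s \<in> gauge_alg Z"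
  shows "integral S f \<in> gauge_alg Z"
proof -
  have b: "bounded_linear (\<lambda>X. N ** X - X ** N)"
    by (intro bounded_linear_sub bounded_linear_mult_left bounded_linear_mult_right)
  have "N ** integral S f - integral S f ** N = integral S ((\<lambda>X. N ** X - X ** N) \<circ> f)"
    using integral_linear[OF f b] by simp
  also have "\<dots> = integral S (\<lambda>_. 0)"
    by (rule integral_cong) (use assms(2) in \<open>simp add: gauge_alg_def\<close>)
  finally show ?thesis by (simp add: gauge_alg_def)
qed

lemma gig_prod_gauge: "orthonormal_basis \<psi> \<Longrightarrow> gig_prod \<psi> \<mu> \<in> gauge_alg Z"
  by (simp add: gauge_alg_def gig_prod_def N_mode_prod)

context
  fixes P assumes P: "P \<in> gig_semigroups Z"
begin

lemma P_quantum_operation: "0 \<le> t \<Longrightarrow> quantum_operation_on (gauge_alg Z) (P t)"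
  using P by (simp add: gig_semigroups_def)

lemma P_gauge: "0 \<le> t \<Longrightarrow> X \<in> gauge_alg Z \<Longrightarrow> P t X \<in> gauge_alg Z"
  and P_add: "0 \<le> t \<Longrightarrow> X \<in> gauge_alg Z \<Longrightarrow> Y \<in> gauge_alg Z \<Longrightarrow> P t (X + Y) = P t X + P t Y"
  and P_scale: "0 \<le> t \<Longrightarrow> X \<in> gauge_alg Z \<Longrightarrow> P t (c *\<^sub>M X) = c *\<^sub>M P t X"
  using P_quantum_operation[of t] by (auto simp: quantum_operation_on_def)

lemma P_zero: "X \<in> gauge_alg Z \<Longrightarrow> P 0 X = X"
  and P_semigroup: "0 \<le> s \<Longrightarrow> 0 \<le> t \<Longrightarrow> X \<in> gauge_alg Z \<Longrightarrow> P s (P t X) = P (s + t) X"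
  and P_continuous: "X \<in> gauge_alg Z \<Longrightarrow> continuous_on {0..} (\<lambda>t. P t X)"
  and P_extensional: "0 \<le> t \<Longrightarrow> P t \<in> extensional (gauge_alg Z)"
  and P_gig_subset: "0 \<le> t \<Longrightarrow> P t ` gig_densities Z \<subseteq> gig_densities Z"
  using P by (simp_all add: gig_semigroups_def)

definition "symbol_map t Q = symbol_of (P t (gig_density Z Q))"

lemma P_gig:
  assumes "0 \<le> t" "Q \<in> symbols"
  shows "symbol_map t Q \<in> symbols" "P t (gig_density Z Q) = gig_density Z (symbol_map t Q)"
proof -
  obtain Q' where Q': "Q' \<in> symbols" "P t (gig_density Z Q) = gig_density Z Q'"
    using P_gig_subset[OF assms(1)] assms(2) by (force simp: gig_densities_def)
  then show "symbol_map t Q \<in> symbols" "P t (gig_density Z Q) = gig_density Z (symbol_map t Q)"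
    by (simp_all add: symbol_map_def symbol_of_gig)
qed

lemma P_integral:
  assumes X: "X \<in> gauge_alg Z" and tr: "0 \<le> t" "0 \<le> r"
  shows "integral {0..r} (\<lambda>s. P s X) \<in> gauge_alg Z"
    "P t (integral {0..r} (\<lambda>s. P s X)) = integral {0..t + r} (\<lambda>s. P s X) - integral {0..t} (\<lambda>s. P s X)"
proof -
  have c: "continuous_on {0..r} (\<lambda>s. P s X)"
    by (rule continuous_on_subset[OF P_continuous[OF X]]) auto
  have i: "(\<lambda>s. P s X) integrable_on {0..r}" by (rule integrable_continuous_real[OF c])
  show g: "integral {0..r} (\<lambda>s. P s X) \<in> gauge_alg Z"
    by (rule gauge_alg_integral[OF i]) (simp add: P_gauge X)
  obtain L where L: "bounded_linear L" "\<And>Y. Y \<in> gauge_alg Z \<Longrightarrow> L Y = P t Y"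
    using subspace_linear_extension[OF subspace_gauge_alg, of "P t"] P_add[OF tr(1)] P_scale[OF tr(1)]
    by (auto simp: scaleR_cscale)
  have "P t (integral {0..r} (\<lambda>s. P s X)) = integral {0..r} (L \<circ> (\<lambda>s. P s X))"
    using integral_linear[OF i L(1)] L(2)[OF g] by simp
  also have "\<dots> = integral {0..r} (\<lambda>s. P (t + s) X)"
    by (rule integral_cong) (simp add: L P_gauge P_semigroup X tr)
  also have "\<dots> = integral {0..t + r} (\<lambda>s. P s X) - integral {0..t} (\<lambda>s. P s X)"
    by (rule integral_shift_Ici[OF P_continuous[OF X] tr])
  finally show "P t (integral {0..r} (\<lambda>s. P s X)) = integral {0..t + r} (\<lambda>s. P s X) - integral {0..t} (\<lambda>s. P s X)" .
qed

text \<open>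
  The averages of an orbit are differentiable vectors. They converge to the given vector, and the
  subspace of differentiable vectors is closed because the dimension is finite.
\<close>

lemma P_differentiable:
  assumes X: "X \<in> gauge_alg Z" and t: "0 \<le> t"
  shows "\<exists>Y. ((\<lambda>t. P t X) has_vector_derivative Y) (at t within {0..})"
proof -
  define D where "D = {X \<in> gauge_alg Z. \<forall>t\<ge>0. \<exists>Y. ((\<lambda>t. P t X) has_vector_derivative Y) (at t within {0..})}"
  have "subspace D"
    unfolding subspace_def
  proof (intro conjI ballI allI)
    have P0: "P t 0 = 0" if "0 \<le> t" for t using P_scale[OF that, of 0 0] subspace_0[OF subspace_gauge_alg] by simp
    have "((\<lambda>t. P t 0) has_vector_derivative 0) (at t within {0..})" if "0 \<le> t" for t
      by (rule has_vector_derivative_transform[of _ _ _ "\<lambda>_. 0"]) (use that in \<open>simp_all add: P0\<close>)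
    then show "0 \<in> D" using subspace_0[OF subspace_gauge_alg] by (auto simp: D_def)
    fix X Y assume XY: "X \<in> D" "Y \<in> D"
    show "X + Y \<in> D"
      unfolding D_def
    proof (intro CollectI conjI allI impI)
      show "X + Y \<in> gauge_alg Z" using XY by (simp add: D_def gauge_alg_closed)
      fix t :: real assume t: "0 \<le> t"
      obtain A where A: "((\<lambda>t. P t X) has_vector_derivative A) (at t within {0..})"
        using XY(1) t unfolding D_def by blast
      obtain B where "((\<lambda>t. P t Y) has_vector_derivative B) (at t within {0..})"
        using XY(2) t unfolding D_def by blast
      with A have "((\<lambda>t. P t X + P t Y) has_vector_derivative A + B) (at t within {0..})" by (rule has_vector_derivative_add)
      then have "((\<lambda>t. P t (X + Y)) has_vector_derivative A + B) (at t within {0..})"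
        using XY t by (intro has_vector_derivative_transform[of _ _ "\<lambda>t. P t (X + Y)" "\<lambda>t. P t X + P t Y"]) (auto simp: D_def P_add)
      then show "\<exists>A. ((\<lambda>t. P t (X + Y)) has_vector_derivative A) (at t within {0..})" by blast
    qed
  next
    fix c X assume X: "X \<in> D"
    show "c *\<^sub>R X \<in> D"
      unfolding D_def
    proof (intro CollectI conjI allI impI)
      show "c *\<^sub>R X \<in> gauge_alg Z" using X by (simp add: D_def gauge_alg_closed scaleR_cscale)
      fix t :: real assume t: "0 \<le> t"
      obtain A where "((\<lambda>t. P t X) has_vector_derivative A) (at t within {0..})" using X t by (auto simp: D_def)
      then have "((\<lambda>t. c *\<^sub>R P t X) has_vector_derivative c *\<^sub>R A) (at t within {0..})"
        by (rule bounded_linear.has_vector_derivative[OF bounded_linear_scaleR_right])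
      then have "((\<lambda>t. P t (c *\<^sub>R X)) has_vector_derivative c *\<^sub>R A) (at t within {0..})"
        using X t by (intro has_vector_derivative_transform[of _ _ "\<lambda>t. P t (c *\<^sub>R X)" "\<lambda>t. c *\<^sub>R P t X"]) (auto simp: D_def P_scale scaleR_cscale)
      then show "\<exists>A. ((\<lambda>t. P t (c *\<^sub>R X)) has_vector_derivative A) (at t within {0..})" by blast
    qed
  qed
  then have closed: "closed D" by (rule closed_subspace)
  define I where "I r = integral {0..r} (\<lambda>s. P s X)" for r
  have I': "(I has_vector_derivative P t X) (at t within {0..})" if "0 \<le> t" for t
    unfolding I_def by (rule integral_derivative_Ici[OF P_continuous[OF X] that])
  have ID: "I r \<in> D" if r: "0 \<le> r" for r
    unfolding D_def
  proof (intro CollectI conjI allI impI)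
    show "I r \<in> gauge_alg Z" unfolding I_def by (rule P_integral(1)[OF X order_refl r])
    fix t :: real assume t: "0 \<le> t"
    have "((\<lambda>t. I (r + t) - I t) has_vector_derivative P (r + t) X - P t X) (at t within {0..})"
      by (intro has_vector_derivative_diff has_vector_derivative_shift_Ici I') (use r t in auto)
    then have "((\<lambda>t. P t (I r)) has_vector_derivative P (r + t) X - P t X) (at t within {0..})"
      using t r by (intro has_vector_derivative_transform[of _ _ "\<lambda>t. P t (I r)" "\<lambda>t. I (r + t) - I t"])
        (auto simp: I_def P_integral(2)[OF X] add.commute)
    then show "\<exists>Y. ((\<lambda>t. P t (I r)) has_vector_derivative Y) (at t within {0..})" by blast
  qed
  have "((\<lambda>y. (I y - I 0 - (y - 0) *\<^sub>R X) /\<^sub>R norm (y - 0)) \<longlongrightarrow> 0) (at 0 within {0..})"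
    using I'[of 0] by (simp add: has_vector_derivative_def has_derivative_within P_zero X divide_inverse_commute diff_diff_eq)
  moreover have "\<forall>\<^sub>F y in at 0 within {0..}. (I y - I 0 - (y - 0) *\<^sub>R X) /\<^sub>R norm (y - 0) = (1 / y) *\<^sub>R I y - X"
    by (auto simp: eventually_at_filter I_def algebra_simps divide_inverse)
  ultimately have "((\<lambda>y. (1 / y) *\<^sub>R I y - X) \<longlongrightarrow> 0) (at 0 within {0..})"
    by (rule Lim_transform_eventually)
  then have "((\<lambda>y. (1 / y) *\<^sub>R I y) \<longlongrightarrow> X) (at 0 within {0..})" by (simp add: LIM_zero_iff)
  moreover have "\<forall>\<^sub>F y in at 0 within {0..}. (1 / y) *\<^sub>R I y \<in> D"
    unfolding eventually_at_filter
    by (rule always_eventually) (use ID \<open>subspace D\<close> in \<open>auto intro!: subspace_scale\<close>)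
  ultimately have "X \<in> D"
    by (intro Lim_in_closed_set[OF closed]) (auto simp: at_within_Ici_at_right)
  then show ?thesis using t by (simp add: D_def)
qed

definition "gen X = (SOME Y. ((\<lambda>t. P t X) has_vector_derivative Y) (at 0 within {0..}))"

lemma gen: "X \<in> gauge_alg Z \<Longrightarrow> ((\<lambda>t. P t X) has_vector_derivative gen X) (at 0 within {0..})"
  unfolding gen_def by (rule someI_ex[OF P_differentiable]) simp_all

lemma gen_add:
  assumes X: "X \<in> gauge_alg Z" and Y: "Y \<in> gauge_alg Z"
  shows "gen (X + Y) = gen X + gen Y"
proof (rule derivative_Ici_unique)
  show "((\<lambda>t. P t (X + Y)) has_vector_derivative gen (X + Y)) (at 0 within {0..})"
    using assms by (intro gen gauge_alg_closed)
  show "((\<lambda>t. P t (X + Y)) has_vector_derivative gen X + gen Y) (at 0 within {0..})"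
    by (rule has_vector_derivative_transform[OF _ _ has_vector_derivative_add[OF gen[OF X] gen[OF Y]]])
      (simp_all add: P_add assms)
qed

lemma gen_scale:
  assumes X: "X \<in> gauge_alg Z"
  shows "gen (c *\<^sub>M X) = c *\<^sub>M gen X"
proof (rule derivative_Ici_unique)
  show "((\<lambda>t. P t (c *\<^sub>M X)) has_vector_derivative gen (c *\<^sub>M X)) (at 0 within {0..})"
    using assms by (intro gen gauge_alg_closed)
  show "((\<lambda>t. P t (c *\<^sub>M X)) has_vector_derivative c *\<^sub>M gen X) (at 0 within {0..})"
    by (rule has_vector_derivative_transform[OF _ _ bounded_linear.has_vector_derivative[OF bounded_linear_cscale gen[OF X]]])
      (simp_all add: P_scale assms)
qed

lemma P_derivative:
  assumes X: "X \<in> gauge_alg Z" and t: "0 \<le> t"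
  shows "((\<lambda>t. P t X) has_vector_derivative gen (P t X)) (at t within {0..})"
proof -
  obtain Y where Y: "((\<lambda>t. P t X) has_vector_derivative Y) (at t within {0..})"
    using P_differentiable[OF assms] by blast
  then have "((\<lambda>s. P (t + s) X) has_vector_derivative Y) (at 0 within {0..})"
    using has_vector_derivative_shift_Ici[of "\<lambda>t. P t X" Y t 0] t by simp
  then have "((\<lambda>s. P s (P t X)) has_vector_derivative Y) (at 0 within {0..})"
    by (rule has_vector_derivative_transform[rotated 2]) (simp_all add: P_semigroup X t add.commute)
  then have "Y = gen (P t X)" using gen[OF P_gauge[OF t X]] by (rule derivative_Ici_unique)
  then show ?thesis using Y by simp
qed

section \<open>The drift of the symbol\<close>

definition "drift Q = symbol_of (gen (gig_density Z Q))"

lemma symbol_map_zero: "Q \<in> symbols \<Longrightarrow> symbol_map 0 Q = Q"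
  by (simp add: symbol_map_def P_zero gig_density_in_gauge_alg symbol_of_gig)

lemma symbol_map_derivative:
  assumes "Q \<in> symbols" "0 \<le> t"
  shows "((\<lambda>t. symbol_map t Q) has_vector_derivative drift (symbol_map t Q)) (at t within {0..})"
  using bounded_linear.has_vector_derivative[OF bounded_linear_symbol_of P_derivative[OF gig_density_in_gauge_alg[OF assms(1)] assms(2)]]
  unfolding symbol_map_def[symmetric] P_gig(2)[OF assms(2,1)] drift_def[symmetric] .

lemma symbol_map_derivative_zero:
  assumes "Q \<in> symbols"
  shows "((\<lambda>t. symbol_map t Q) has_vector_derivative drift Q) (at 0 within {0..})"
  using symbol_map_derivative[OF assms order_refl] by (simp add: symbol_map_zero assms)

text \<open>The drift as a function of the eigenvalues in a prescribed basis.
  \<open>gig_prod\<close> makes sense for all real eigenvalues, so the dependence on each of them is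
  affine without restriction to the unit interval.\<close>

definition "diag_drift \<psi> \<mu> = symbol_of (gen (gig_prod \<psi> \<mu>))"

lemma diag_drift_eq:
  assumes "orthonormal_basis \<psi>" "Q = (\<Sum>j\<in>UNIV. \<mu> j *\<^sub>R ketbra (\<psi> j) (\<psi> j))"
  shows "drift Q = diag_drift \<psi> \<mu>"
  by (simp add: drift_def diag_drift_def gig_density_eq[OF assms])

lemma diag_drift_affine:
  assumes \<psi>: "orthonormal_basis \<psi>"
  shows "diag_drift \<psi> (\<mu>(i := x)) = (1 - x) *\<^sub>R diag_drift \<psi> (\<mu>(i := 0)) + x *\<^sub>R diag_drift \<psi> (\<mu>(i := 1))"
  unfolding diag_drift_def
  by (subst gig_prod_affine[OF \<psi>])
    (simp add: scaleR_cscale gen_add gen_scale gauge_alg_closed gig_prod_gauge[OF \<psi>] symbol_of_linear)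

text \<open>
  Along one eigenvalue \<open>\<mu>\<^sub>i\<close> the density is affine, hence so is its four point function, which is a
  \<open>2 \<times> 2\<close> minor of the symbol. So the increment of the symbol has rank at most one; differentiating
  at time zero, where the increment is \<open>|\<psi>\<^sub>i\<rangle>\<langle>\<psi>\<^sub>i|\<close>, gives the next fact.
\<close>

lemma diag_drift_independent:
  assumes \<psi>: "orthonormal_basis \<psi>" and \<mu>: "\<And>j. 0 \<le> \<mu> j" "\<And>j. \<mu> j \<le> 1" and \<eta>: "cinner (\<psi> i) \<eta> = 0"
  shows "cinner \<eta> (diag_drift \<psi> (\<mu>(i := 1)) *v \<eta>) = cinner \<eta> (diag_drift \<psi> (\<mu>(i := 0)) *v \<eta>)"
proof -
  define Q where "Q x = (\<Sum>j\<in>UNIV. (\<mu>(i := x)) j *\<^sub>R ketbra (\<psi> j) (\<psi> j))" for x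
  have Qs: "Q x \<in> symbols" if "0 \<le> x" "x \<le> 1" for x
    unfolding Q_def using \<mu> that by (intro spectral_symbols[OF \<psi>]) auto
  have gQ: "gig_density Z (Q x) = gig_prod \<psi> (\<mu>(i := x))" for x
    unfolding Q_def by (rule gig_density_eq[OF \<psi> refl])
  have Qdiff: "Q 1 - Q 0 = ketbra (\<psi> i) (\<psi> i)"
  proof -
    have "Q 1 - Q 0 = (\<Sum>j\<in>UNIV. if j = i then ketbra (\<psi> i) (\<psi> i) else 0)"
      unfolding Q_def sum_subtractf[symmetric] by (intro sum.cong) auto
    then show ?thesis by simp
  qed
  let ?x = "\<psi> i"
  define f where "f t M y z = cinner y (symbol_map t M *v z)" for t M y z
  \<comment> \<open>Comparing the midpoint of the segment with its end points is enough to isolate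
    the quadratic term of the minor, which is the minor of the increment.\<close>
  have half: "gig_density Z (Q (1/2)) = (1/2) *\<^sub>M gig_density Z (Q 0) + (1/2) *\<^sub>M gig_density Z (Q 1)"
    unfolding gQ using gig_prod_affine[OF \<psi>, of \<mu> i "1/2"] by (simp add: scaleR_cscale)
  define B where "B t = symbol_map t (Q 1) - symbol_map t (Q 0)" for t
  have minor: "cinner ?x (B t *v ?x) * cinner \<eta> (B t *v \<eta>) - cinner ?x (B t *v \<eta>) * cinner \<eta> (B t *v ?x) = 0"
    if t: "0 \<le> t" for t
  proof -
    have g: "gig_density Z (Q x) \<in> gauge_alg Z" for x unfolding gQ by (rule gig_prod_gauge[OF \<psi>])
    have Ph: "P t (gig_density Z (Q (1/2))) = (1/2) *\<^sub>M P t (gig_density Z (Q 0)) + (1/2) *\<^sub>M P t (gig_density Z (Q 1))"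
      unfolding half by (simp add: P_add P_scale t g gauge_alg_closed)
    have s: "symbol_map t (Q (1/2)) = (1/2) *\<^sub>M symbol_map t (Q 0) + (1/2) *\<^sub>M symbol_map t (Q 1)"
      unfolding symbol_map_def Ph by (simp add: symbol_of_linear)
    have fp: "normalized_trace (P t (gig_density Z M) ** (Zd ?x ** Zd \<eta> ** Z \<eta> ** Z ?x)) =
        f t M ?x ?x * f t M \<eta> \<eta> - f t M ?x \<eta> * f t M \<eta> ?x" if "M \<in> symbols" for M
      unfolding P_gig(2)[OF t that] f_def by (rule four_point[OF P_gig(1)[OF t that]])
    have h: "f t (Q (1/2)) y z = (f t (Q 0) y z + f t (Q 1) y z) / 2" for y z
      unfolding f_def s by (simp add: mtx_vec cinner_simps)
    have "f t (Q (1/2)) ?x ?x * f t (Q (1/2)) \<eta> \<eta> - f t (Q (1/2)) ?x \<eta> * f t (Q (1/2)) \<eta> ?x =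
        (f t (Q 0) ?x ?x * f t (Q 0) \<eta> \<eta> - f t (Q 0) ?x \<eta> * f t (Q 0) \<eta> ?x +
        (f t (Q 1) ?x ?x * f t (Q 1) \<eta> \<eta> - f t (Q 1) ?x \<eta> * f t (Q 1) \<eta> ?x)) / 2"
    proof -
      have "normalized_trace (P t (gig_density Z (Q (1/2))) ** M) =
          (normalized_trace (P t (gig_density Z (Q 0)) ** M) + normalized_trace (P t (gig_density Z (Q 1)) ** M)) / 2" for M
        unfolding Ph by (simp add: mtx_distrib mtx_scale tau_linear add_divide_distrib)
      from this[of "Zd ?x ** Zd \<eta> ** Z \<eta> ** Z ?x"] show ?thesis
        using fp[OF Qs[of "1/2"]] fp[OF Qs[of 0]] fp[OF Qs[of 1]] by simp
    qed
    then have "(f t (Q 1) ?x ?x - f t (Q 0) ?x ?x) * (f t (Q 1) \<eta> \<eta> - f t (Q 0) \<eta> \<eta>)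
        - (f t (Q 1) ?x \<eta> - f t (Q 0) ?x \<eta>) * (f t (Q 1) \<eta> ?x - f t (Q 0) \<eta> ?x) = 0"
      unfolding h by (rule bilinear_midpoint)
    then show ?thesis by (simp add: B_def f_def mtx_vec cinner_simps)
  qed
  have B0: "B 0 = ketbra ?x ?x" by (simp add: B_def symbol_map_zero Qs Qdiff)
  have "(B has_vector_derivative drift (Q 1) - drift (Q 0)) (at 0 within {0..})"
    unfolding B_def by (intro has_vector_derivative_diff symbol_map_derivative_zero Qs) auto
  then have D: "((\<lambda>t. cinner y (B t *v z)) has_vector_derivative cinner y ((drift (Q 1) - drift (Q 0)) *v z)) (at 0 within {0..})" for y z
    by (rule bounded_linear.has_vector_derivative[OF bounded_linear_form])
  have \<eta>': "cinner \<eta> ?x = 0" using \<eta> cinner_eq_0_commute by blast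
  have xx: "cinner ?x ?x = 1" by (simp add: orthonormal_basisD[OF \<psi>])
  \<comment> \<open>At time zero the increment is \<open>ketbra ?x ?x\<close> and \<eta> is
    orthogonal to \<open>?x\<close>; of the four terms of the product rule only the one
    differentiating the entry at \<eta> survives, with factor one.\<close>
  have "((\<lambda>t. cinner ?x (B t *v ?x) * cinner \<eta> (B t *v \<eta>) - cinner ?x (B t *v \<eta>) * cinner \<eta> (B t *v ?x))
      has_vector_derivative cinner \<eta> ((drift (Q 1) - drift (Q 0)) *v \<eta>)) (at 0 within {0..})"
    using has_vector_derivative_diff[OF has_vector_derivative_mult[OF D[of ?x ?x] D[of \<eta> \<eta>]] has_vector_derivative_mult[OF D[of ?x \<eta>] D[of \<eta> ?x]]]
    by (simp add: B0 ketbra_vec cinner_simps \<eta> \<eta>' xx)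
  moreover have "((\<lambda>t. cinner ?x (B t *v ?x) * cinner \<eta> (B t *v \<eta>) - cinner ?x (B t *v \<eta>) * cinner \<eta> (B t *v ?x))
      has_vector_derivative 0) (at 0 within {0..})"
    by (rule has_vector_derivative_transform[of _ _ _ "\<lambda>_. 0"]) (simp_all add: minor)
  ultimately have "cinner \<eta> ((drift (Q 1) - drift (Q 0)) *v \<eta>) = 0" by (rule derivative_Ici_unique)
  moreover have "drift (Q x) = diag_drift \<psi> (\<mu>(i := x))" for x by (rule diag_drift_eq[OF \<psi> Q_def])
  ultimately show ?thesis by (simp add: mtx_vec cinner_simps)
qed

lemma diag_drift_independent':
  assumes \<psi>: "orthonormal_basis \<psi>" and \<mu>: "\<And>j. 0 \<le> \<mu> j" "\<And>j. \<mu> j \<le> 1"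
    and "cinner (\<psi> i) u = 0" "cinner (\<psi> i) v = 0"
  shows "cinner u (diag_drift \<psi> (\<mu>(i := 1)) *v v) = cinner u (diag_drift \<psi> (\<mu>(i := 0)) *v v)"
proof -
  have "cinner (\<psi> i) (u + c *s v) = 0" for c using assms(4,5) by (simp add: cinner_simps)
  then have "4 * cinner u (diag_drift \<psi> (\<mu>(i := 1)) *v v) = 4 * cinner u (diag_drift \<psi> (\<mu>(i := 0)) *v v)"
    unfolding polarization_4 using diag_drift_independent[OF \<psi> \<mu>] by simp
  then show ?thesis by simp
qed

text \<open>
  On the plane spanned by \<open>\<psi>\<^sub>i\<close> and \<open>\<psi>\<^sub>k\<close> the symbol \<open>s (|\<psi>\<^sub>i\<rangle>\<langle>\<psi>\<^sub>i| + |\<psi>\<^sub>k\<rangle>\<langle>\<psi>\<^sub>k|)\<close> is diagonal in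
  every orthonormal basis, so that the independence of eigenvalues applies to all vectors of the plane.
\<close>

lemma diag_drift_plane:
  assumes \<psi>: "orthonormal_basis \<psi>" and ik: "i \<noteq> k"
  defines "F \<equiv> \<lambda>x y. diag_drift \<psi> ((\<lambda>_. 0)(i := x, k := y))"
  shows "cinner (\<psi> i) ((F 1 1 - F 1 0 - F 0 1 + F 0 0) *v \<psi> k) = 0"
proof -
  \<comment> \<open>The second difference along the diagonal of the square of eigenvalue pairs.
    Equal eigenvalues leave the basis of the plane free, which the mixed difference does not allow;
    as \<open>F\<close> is affine in each argument, the mixed difference is
    \<open>(- 4) *\<^sub>R Y\<close>.\<close>
  define Y where "Y = F (1/2) (1/2) - (1/2) *\<^sub>R F 0 0 - (1/2) *\<^sub>R F 1 1"
  have Yc: "cinner (\<psi> i + c *s \<psi> k) (Y *v (\<psi> i + c *s \<psi> k)) = 0" if c: "cnj c * c = 1" for c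
  proof -
    \<comment> \<open>Normalizes \<open>\<psi> i + c *s \<psi> k\<close> and its orthogonal partner,
      which form the rotated basis of the plane.\<close>
    define a :: complex where "a = of_real (1 / sqrt 2)"
    have a: "cnj a = a" "a * a = 1 / 2" by (simp_all add: a_def flip: of_real_mult)
    define u where "u = a *s (\<psi> i + c *s \<psi> k)"
    define v where "v = a *s (\<psi> i - c *s \<psi> k)"
    define \<phi> where "\<phi> = \<psi>(i := u, k := v)"
    have c': "c * cnj c = 1" using c by (simp add: mult.commute)
    have a3: "a * (a * z) = z / 2" for z by (simp add: mult.assoc[symmetric] a)
    have uv: "cinner u u = 1" "cinner v v = 1" "cinner u v = 0" "cinner v u = 0"
      using ik c c' by (simp_all add: u_def v_def cinner_simps orthonormal_basisD[OF \<psi>] a a3 mult_ac)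
    have uj: "cinner u (\<psi> j) = 0" "cinner v (\<psi> j) = 0" "cinner (\<psi> j) u = 0" "cinner (\<psi> j) v = 0" if "j \<noteq> i" "j \<noteq> k" for j
      using that by (simp_all add: u_def v_def cinner_simps orthonormal_basisD[OF \<psi>])
    have \<phi>: "orthonormal_basis \<phi>"
      using ik uv uj by (auto simp: orthonormal_basis_def \<phi>_def orthonormal_basisD[OF \<psi>])
    have plane: "ketbra u u + ketbra v v = ketbra (\<psi> i) (\<psi> i) + ketbra (\<psi> k) (\<psi> k)"
    proof -
      have c3: "c * (cnj c * z) = z" for z by (simp add: mult.assoc[symmetric] c')
      show ?thesis by (rule mat_eqI) (simp add: u_def v_def a algebra_simps a3 c3)
    qed
    have sum2: "(\<Sum>j\<in>UNIV. ((\<lambda>_. 0)(i := s, k := s)) j *\<^sub>R ketbra (\<beta> j) (\<beta> j)) = s *\<^sub>R (ketbra (\<beta> i) (\<beta> i) + ketbra (\<beta> k) (\<beta> k))"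
      for s and \<beta> :: "'n \<Rightarrow> complex ^ 'n"
    proof -
      have "(\<Sum>j\<in>UNIV. ((\<lambda>_. 0)(i := s, k := s)) j *\<^sub>R ketbra (\<beta> j) (\<beta> j)) =
          (\<Sum>j\<in>UNIV. if j = i then s *\<^sub>R ketbra (\<beta> i) (\<beta> i) else 0) + (\<Sum>j\<in>UNIV. if j = k then s *\<^sub>R ketbra (\<beta> k) (\<beta> k) else 0)"
        unfolding sum.distrib[symmetric] using ik by (intro sum.cong) auto
      then show ?thesis by (simp add: scaleR_add_right)
    qed
    have FF: "diag_drift \<phi> ((\<lambda>_. 0)(i := s, k := s)) = F s s" for s
    proof -
      have e: "(\<Sum>j\<in>UNIV. ((\<lambda>_. 0)(i := s, k := s)) j *\<^sub>R ketbra (\<phi> j) (\<phi> j)) = (\<Sum>j\<in>UNIV. ((\<lambda>_. 0)(i := s, k := s)) j *\<^sub>R ketbra (\<psi> j) (\<psi> j))"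
        unfolding sum2 using plane ik by (simp add: \<phi>_def)
      show ?thesis
        unfolding F_def diag_drift_eq[OF \<phi> refl, symmetric] diag_drift_eq[OF \<psi> refl, symmetric] e ..
    qed
    define p where "p x y = cinner u (diag_drift \<phi> ((\<lambda>_. 0)(i := x, k := y)) *v u)" for x y
    \<comment> \<open>The eigenvalue of \<open>v\<close> does not affect the entry at
      \<open>u\<close>; hence along the diagonal this entry depends on one eigenvalue only,
      affinely, and its second difference vanishes.\<close>
    have ind: "p x 1 = p x 0" if "0 \<le> x" "x \<le> 1" for x
      using diag_drift_independent[OF \<phi>, of "(\<lambda>_. 0)(i := x)" k u] that uv ik by (simp add: p_def \<phi>_def)
    have aff1: "p x y = (1 - of_real y) * p x 0 + of_real y * p x 1" for x y
      unfolding p_def by (subst diag_drift_affine[OF \<phi>]) (simp add: mtx_vec cinner_simps)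
    have aff2: "p x 0 = (1 - of_real x) * p 0 0 + of_real x * p 1 0" for x
    proof -
      have t: "(\<lambda>_. 0)(i := x, k := 0) = ((\<lambda>_. 0)(k := 0))(i := x)" for x :: real using ik by (auto simp: fun_eq_iff)
      show ?thesis unfolding p_def t by (subst diag_drift_affine[OF \<phi>]) (simp add: mtx_vec cinner_simps)
    qed
    have "p (1/2) (1/2) = p (1/2) 0" using aff1[of "1/2" "1/2"] ind[of "1/2"] by simp
    moreover have "p 1 1 = p 1 0" using ind[of 1] by simp
    ultimately have "p (1/2) (1/2) - p 0 0 / 2 - p 1 1 / 2 = 0" using aff2[of "1/2"] by simp
    then have "cinner u (Y *v u) = 0" by (simp add: p_def FF Y_def mtx_vec cinner_simps)
    moreover have "cinner u (Y *v u) = (cnj a * a) * cinner (\<psi> i + c *s \<psi> k) (Y *v (\<psi> i + c *s \<psi> k))"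
      unfolding u_def by (simp only: vec.scale cinner_scale_left cinner_scale_right mult_ac)
    ultimately show ?thesis using a by simp
  qed
  have "cnj (\<i> ^ m) * \<i> ^ m = 1" for m by (simp flip: power_mult_distrib)
  then have "4 * cinner (\<psi> i) (Y *v \<psi> k) = 0" unfolding polarization_4 using Yc by simp
  then have Yik: "cinner (\<psi> i) (Y *v \<psi> k) = 0" by simp
  have h1: "F x (1/2) = (1/2) *\<^sub>R F x 0 + (1/2) *\<^sub>R F x 1" for x
    unfolding F_def by (subst diag_drift_affine[OF \<psi>]) simp
  have h2: "F (1/2) y = (1/2) *\<^sub>R F 0 y + (1/2) *\<^sub>R F 1 y" for y
  proof -
    have t: "(\<lambda>_. 0)(i := x, k := y) = ((\<lambda>_. 0)(k := y))(i := x)" for x :: real using ik by (auto simp: fun_eq_iff)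
    show ?thesis unfolding F_def t by (subst diag_drift_affine[OF \<psi>]) simp
  qed
  have "F 1 1 - F 1 0 - F 0 1 + F 0 0 = (- 4) *\<^sub>R Y"
    unfolding Y_def h1 h2 by (rule mat_eqI) (simp add: scaleR_conv_of_real[where 'a=complex] algebra_simps)
  then show ?thesis by (simp only: scaleR_vec cinner_scaleR_right Yik mult_zero_right)
qed

text \<open>The matrix entries are treated separately. If one of \<open>i\<close>, \<open>k\<close>
  is not an index of the entry, its eigenvalue does not influence the entry. Otherwise the entry
  joins \<open>\<psi> i\<close> and \<open>\<psi> k\<close>, all other eigenvalues can be set to
  zero, and the computation in the plane applies.\<close>

lemma diag_drift_mixed_difference:
  assumes \<psi>: "orthonormal_basis \<psi>" and \<mu>: "\<And>j. 0 \<le> \<mu> j" "\<And>j. \<mu> j \<le> 1" and ik: "i \<noteq> k"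
  shows "diag_drift \<psi> (\<mu>(i := 1, k := 1)) - diag_drift \<psi> (\<mu>(i := 1, k := 0)) - diag_drift \<psi> (\<mu>(i := 0, k := 1)) + diag_drift \<psi> (\<mu>(i := 0, k := 0)) = 0"
    (is "?X \<mu> = 0")
proof -
  have expand: "cinner u (?X \<nu> *v v) =
      cinner u (diag_drift \<psi> (\<nu>(i := 1, k := 1)) *v v) - cinner u (diag_drift \<psi> (\<nu>(i := 1, k := 0)) *v v)
      - cinner u (diag_drift \<psi> (\<nu>(i := 0, k := 1)) *v v) + cinner u (diag_drift \<psi> (\<nu>(i := 0, k := 0)) *v v)" for \<nu> u v
    by (simp only: matrix_vector_mult_add_rdistrib matrix_vector_mult_diff_rdistrib cinner_add_right cinner_diff_right)
  have entry: "cinner (\<psi> a) (?X \<mu> *v \<psi> b) = 0" for a b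
  proof (cases "(i \<noteq> a \<and> i \<noteq> b) \<or> (k \<noteq> a \<and> k \<noteq> b)")
    case True
    have sw: "\<mu>(i := x, k := y) = (\<mu>(k := y))(i := x)" for x y using ik by (auto simp: fun_eq_iff)
    from True show ?thesis
    proof
      assume "i \<noteq> a \<and> i \<noteq> b"
      then have "cinner (\<psi> a) (diag_drift \<psi> (\<mu>(i := 1, k := y)) *v \<psi> b) = cinner (\<psi> a) (diag_drift \<psi> (\<mu>(i := 0, k := y)) *v \<psi> b)"
        if "0 \<le> y" "y \<le> 1" for y
        unfolding sw using \<mu> that by (intro diag_drift_independent'[OF \<psi>]) (auto simp: orthonormal_basisD[OF \<psi>])
      from this[of 0] this[of 1] show ?thesis unfolding expand by simp
    next
      assume "k \<noteq> a \<and> k \<noteq> b"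
      then have "cinner (\<psi> a) (diag_drift \<psi> (\<mu>(i := x, k := 1)) *v \<psi> b) = cinner (\<psi> a) (diag_drift \<psi> (\<mu>(i := x, k := 0)) *v \<psi> b)"
        if "0 \<le> x" "x \<le> 1" for x
        using \<mu> that by (intro diag_drift_independent'[OF \<psi>]) (auto simp: orthonormal_basisD[OF \<psi>])
      from this[of 0] this[of 1] show ?thesis unfolding expand by simp
    qed
  next
    case False
    then have ab: "(a = i \<and> b = k) \<or> (a = k \<and> b = i)" using ik by auto
    have red: "cinner (\<psi> a) (diag_drift \<psi> (\<nu>(i := x, k := y)) *v \<psi> b) = cinner (\<psi> a) (diag_drift \<psi> (\<nu>(j := 0, i := x, k := y)) *v \<psi> b)"
      if \<nu>: "\<And>j. 0 \<le> \<nu> j" "\<And>j. \<nu> j \<le> 1" and xy: "0 \<le> x" "x \<le> 1" "0 \<le> y" "y \<le> 1" for \<nu> x y j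
    proof (cases "j = i \<or> j = k")
      case True
      then have "\<nu>(j := 0, i := x, k := y) = \<nu>(i := x, k := y)" by (auto simp: fun_eq_iff)
      then show ?thesis by simp
    next
      case False
      let ?\<nu> = "\<nu>(i := x, k := y)"
      have e: "\<nu>(j := z, i := x, k := y) = ?\<nu>(j := z)" for z using False by (auto simp: fun_eq_iff)
      have 1: "cinner (\<psi> a) (diag_drift \<psi> (?\<nu>(j := 1)) *v \<psi> b) = cinner (\<psi> a) (diag_drift \<psi> (?\<nu>(j := 0)) *v \<psi> b)"
        using \<nu> xy False ab by (intro diag_drift_independent'[OF \<psi>]) (auto simp: orthonormal_basisD[OF \<psi>])
      have "diag_drift \<psi> ?\<nu> = diag_drift \<psi> (?\<nu>(j := ?\<nu> j))" by (simp only: fun_upd_triv)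
      also have "\<dots> = (1 - ?\<nu> j) *\<^sub>R diag_drift \<psi> (?\<nu>(j := 0)) + ?\<nu> j *\<^sub>R diag_drift \<psi> (?\<nu>(j := 1))"
        by (rule diag_drift_affine[OF \<psi>])
      finally have "cinner (\<psi> a) (diag_drift \<psi> ?\<nu> *v \<psi> b) =
          cinner (\<psi> a) (((1 - ?\<nu> j) *\<^sub>R diag_drift \<psi> (?\<nu>(j := 0)) + ?\<nu> j *\<^sub>R diag_drift \<psi> (?\<nu>(j := 1))) *v \<psi> b)"
        by (rule arg_cong)
      also have "\<dots> = (of_real (1 - ?\<nu> j) + of_real (?\<nu> j)) * cinner (\<psi> a) (diag_drift \<psi> (?\<nu>(j := 0)) *v \<psi> b)"
        by (simp only: matrix_vector_mult_add_rdistrib scaleR_vec cinner_add_right cinner_scaleR_right 1 distrib_right)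
      also have "of_real (1 - ?\<nu> j) + of_real (?\<nu> j) = (1 :: complex)" by (simp flip: of_real_add)
      finally have "cinner (\<psi> a) (diag_drift \<psi> ?\<nu> *v \<psi> b) = cinner (\<psi> a) (diag_drift \<psi> (?\<nu>(j := 0)) *v \<psi> b)"
        by (simp only: mult_1_left)
      then show ?thesis unfolding e .
    qed
    \<comment> \<open>Iterates \<open>red\<close> over the index set, until all eigenvalues except
      the two are zero.\<close>
    have "cinner (\<psi> a) (diag_drift \<psi> (\<mu>(i := x, k := y)) *v \<psi> b) =
        cinner (\<psi> a) (diag_drift \<psi> ((\<lambda>j. if j \<in> S then 0 else \<mu> j)(i := x, k := y)) *v \<psi> b)"
      if xy: "0 \<le> x" "x \<le> 1" "0 \<le> y" "y \<le> 1" for x y S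
      using finite[of S]
    proof (induction S rule: finite_induct)
      case (insert j S)
      let ?s = "\<lambda>l. if l \<in> S then 0 else \<mu> l"
      have u: "?s(j := 0) = (\<lambda>l. if l \<in> insert j S then 0 else \<mu> l)" by auto
      have "cinner (\<psi> a) (diag_drift \<psi> (?s(i := x, k := y)) *v \<psi> b) =
          cinner (\<psi> a) (diag_drift \<psi> (?s(j := 0, i := x, k := y)) *v \<psi> b)"
        by (rule red) (use \<mu> xy in auto)
      then show ?case unfolding u by (rule trans[OF insert.IH])
    qed simp
    from this[of _ _ UNIV]
    have z: "cinner (\<psi> a) (diag_drift \<psi> (\<mu>(i := x, k := y)) *v \<psi> b) = cinner (\<psi> a) (diag_drift \<psi> ((\<lambda>_. 0)(i := x, k := y)) *v \<psi> b)"
      if "0 \<le> x" "x \<le> 1" "0 \<le> y" "y \<le> 1" for x y using that by simp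
    have "cinner (\<psi> a) (?X (\<lambda>_. 0) *v \<psi> b) = 0"
      using ab
    proof
      assume "a = i \<and> b = k"
      then have "a = i" "b = k" by auto
      then show ?thesis by (simp only: diag_drift_plane[OF \<psi> ik])
    next
      assume ab: "a = k \<and> b = i"
      have tw: "(\<lambda>_. 0)(k := y, i := x) = (\<lambda>_. 0)(i := x, k := y)" for x y :: real using ik by (auto simp: fun_eq_iff)
      note pl = diag_drift_plane[OF \<psi> ik[symmetric], unfolded tw matrix_vector_mult_add_rdistrib
          matrix_vector_mult_diff_rdistrib cinner_add_right cinner_diff_right]
      have "a = k" "b = i" using ab by auto
      have "w - z - y + v = 0" if "w - y - z + v = 0" for w y z v :: complex
        using that by (simp add: algebra_simps)
      from this[OF pl] show ?thesis unfolding expand \<open>a = k\<close> \<open>b = i\<close> .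
    qed
    then show ?thesis unfolding expand z[of 0 0, simplified] z[of 1 0, simplified] z[of 0 1, simplified] z[of 1 1, simplified] .
  qed
  show ?thesis
  proof (rule orthonormal_matrix_eqI[OF \<psi>])
    fix b
    have "?X \<mu> *v \<psi> b = (\<Sum>a\<in>UNIV. cinner (\<psi> a) (?X \<mu> *v \<psi> b) *s \<psi> a)"
      by (rule orthonormal_basis_expand[OF \<psi>])
    also have "\<dots> = 0" unfolding entry by simp
    finally show "?X \<mu> *v \<psi> b = 0 *v \<psi> b" unfolding matrix_vector_mult_0 .
  qed
qed

text \<open>Vanishing mixed differences make the increment blind to the other eigenvalues, which are
  switched from zero to their values one by one.\<close>

lemma diag_drift_increment:
  assumes \<psi>: "orthonormal_basis \<psi>" and \<nu>: "\<And>j. 0 \<le> \<nu> j" "\<And>j. \<nu> j \<le> 1"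
  shows "diag_drift \<psi> (\<nu>(i := 1)) - diag_drift \<psi> (\<nu>(i := 0)) =
    diag_drift \<psi> ((\<lambda>_. 0)(i := 1)) - diag_drift \<psi> (\<lambda>_. 0)"
proof -
  let ?r = "\<lambda>S j. if j \<in> S then \<nu> j else 0"
  let ?\<Delta> = "\<lambda>\<mu>. diag_drift \<psi> (\<mu>(i := 1)) - diag_drift \<psi> (\<mu>(i := 0))"
  have "?\<Delta> (?r S) = ?\<Delta> (\<lambda>_. 0)" for S
    using finite[of S]
  proof (induction S rule: finite_induct)
    case (insert k S)
    let ?\<mu> = "?r S"
    have ins: "?r (insert k S) = ?\<mu>(k := \<nu> k)" by auto
    have "?\<Delta> (?\<mu>(k := \<nu> k)) = ?\<Delta> ?\<mu>"
    proof (cases "k = i")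
      case False
      have sw: "?\<mu>(k := y, i := x) = (?\<mu>(i := x))(k := y)" for x y using False by (auto simp: fun_eq_iff)
      have aff: "diag_drift \<psi> (?\<mu>(i := x, k := \<nu> k)) =
          (1 - \<nu> k) *\<^sub>R diag_drift \<psi> (?\<mu>(i := x, k := 0)) + \<nu> k *\<^sub>R diag_drift \<psi> (?\<mu>(i := x, k := 1))" for x
        by (rule diag_drift_affine[OF \<psi>])
      have mixed: "diag_drift \<psi> (?\<mu>(i := 1, k := 1)) - diag_drift \<psi> (?\<mu>(i := 1, k := 0))
          - diag_drift \<psi> (?\<mu>(i := 0, k := 1)) + diag_drift \<psi> (?\<mu>(i := 0, k := 0)) = 0"
        using \<nu> False by (intro diag_drift_mixed_difference[OF \<psi>]) auto
      have k0: "?\<mu>(i := x, k := 0) = ?\<mu>(i := x)" for x using insert.hyps(2) False by (auto simp: fun_eq_iff)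
      have "?\<Delta> (?\<mu>(k := \<nu> k)) = diag_drift \<psi> (?\<mu>(i := 1, k := 0)) - diag_drift \<psi> (?\<mu>(i := 0, k := 0)) +
          \<nu> k *\<^sub>R (diag_drift \<psi> (?\<mu>(i := 1, k := 1)) - diag_drift \<psi> (?\<mu>(i := 1, k := 0))
            - diag_drift \<psi> (?\<mu>(i := 0, k := 1)) + diag_drift \<psi> (?\<mu>(i := 0, k := 0)))"
        unfolding sw aff by (simp only: algebra_simps scaleR_one)
      then show ?thesis unfolding mixed unfolding k0 by simp
    qed simp
    then show ?case unfolding ins by (rule trans[OF _ insert.IH])
  qed simp
  from this[of UNIV] show ?thesis by (simp add: fun_upd_idem)
qed

text \<open>Telescoping over the eigenvalues: each contributes, proportionally to its size, the
  increment computed at zero.\<close>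

lemma diag_drift_sum:
  assumes \<psi>: "orthonormal_basis \<psi>" and \<mu>: "\<And>j. 0 \<le> \<mu> j" "\<And>j. \<mu> j \<le> 1"
  shows "diag_drift \<psi> \<mu> = diag_drift \<psi> (\<lambda>_. 0) +
    (\<Sum>i\<in>UNIV. \<mu> i *\<^sub>R (diag_drift \<psi> ((\<lambda>_. 0)(i := 1)) - diag_drift \<psi> (\<lambda>_. 0)))"
proof -
  let ?r = "\<lambda>S j. if j \<in> S then \<mu> j else 0"
  have "diag_drift \<psi> (?r S) = diag_drift \<psi> (\<lambda>_. 0) +
    (\<Sum>i\<in>S. \<mu> i *\<^sub>R (diag_drift \<psi> ((\<lambda>_. 0)(i := 1)) - diag_drift \<psi> (\<lambda>_. 0)))" for S
    using finite[of S]
  proof (induction S rule: finite_induct)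
    case (insert i S)
    have ins: "?r (insert i S) = (?r S)(i := \<mu> i)" "(?r S)(i := 0) = ?r S" using insert.hyps(2) by auto
    have "diag_drift \<psi> (?r (insert i S)) = diag_drift \<psi> ((?r S)(i := 0)) +
        \<mu> i *\<^sub>R (diag_drift \<psi> ((?r S)(i := 1)) - diag_drift \<psi> ((?r S)(i := 0)))"
      unfolding ins(1) by (subst diag_drift_affine[OF \<psi>]) (simp only: algebra_simps scaleR_one)
    also have "diag_drift \<psi> ((?r S)(i := 1)) - diag_drift \<psi> ((?r S)(i := 0)) =
        diag_drift \<psi> ((\<lambda>_. 0)(i := 1)) - diag_drift \<psi> (\<lambda>_. 0)"
      using \<mu> by (intro diag_drift_increment[OF \<psi>]) auto
    finally show ?case unfolding ins(2) insert.IH sum.insert[OF insert.hyps] by (simp only: add_ac)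
  qed simp
  from this[of UNIV] show ?thesis by simp
qed

text \<open>The density of a rank one projection is sesquilinear in the vector, hence so is the drift.\<close>

definition "pair_drift x y = of_nat CARD('k) *\<^sub>M symbol_of (gen (ketbra (fock [x]) (fock [y]))) - cinner y x *\<^sub>M drift 0"

lemma one_particle_gauge: "ketbra (fock [x]) (fock [y]) \<in> gauge_alg Z"
  unfolding gauge_alg_def mem_Collect_eq mult_ketbra ketbra_mult N_hermitian N_fock by simp

lemma pair_drift_linear:
  "pair_drift (x + y) z = pair_drift x z + pair_drift y z" "pair_drift z (x + y) = pair_drift z x + pair_drift z y"
  "pair_drift (c *s x) z = c *\<^sub>M pair_drift x z" "pair_drift z (c *s x) = cnj c *\<^sub>M pair_drift z x"
proof -
  have f: "fock [x + y] = fock [x] + fock [y]" "fock [c *s x] = c *s fock [x]" for x y c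
    by (simp_all add: Z_simps dagger_simps mtx_vec)
  note g = one_particle_gauge
  show "pair_drift (x + y) z = pair_drift x z + pair_drift y z" "pair_drift z (x + y) = pair_drift z x + pair_drift z y"
    "pair_drift (c *s x) z = c *\<^sub>M pair_drift x z" "pair_drift z (c *s x) = cnj c *\<^sub>M pair_drift z x"
    unfolding pair_drift_def f ketbra_linear gen_add[OF g g] gen_scale[OF g] symbol_of_linear cinner_simps
    by (simp_all add: mtx_scale cscale_add_left cscale_diff_right mult.commute)
qed

lemma drift_projection:
  assumes "cinner e e = 1"
  shows "drift (ketbra e e) = drift 0 + pair_drift e e"
proof -
  have "gig_density Z (ketbra e e) = of_nat CARD('k) *\<^sub>M ketbra (fock [e]) (fock [e])"
    using fock_gaussian[of "[e]"] assms by (intro gig_density_unique projection_ketbra) simp_all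
  then have "drift (ketbra e e) = of_nat CARD('k) *\<^sub>M symbol_of (gen (ketbra (fock [e]) (fock [e])))"
    by (simp only: drift_def gen_scale[OF one_particle_gauge] symbol_of_linear)
  then show ?thesis unfolding pair_drift_def assms by simp
qed

text \<open>The linear extension of \<open>pair_drift\<close> from rank one operators, through the
  columns of \<open>X\<close> in the standard basis; sesquilinearity makes it agree with
  \<open>pair_drift\<close> on every ketbra.\<close>

definition "drift_map X = (\<Sum>b\<in>UNIV. pair_drift (X *v axis b 1) (axis b 1))"

lemma drift_map_linear: "drift_map (X + Y) = drift_map X + drift_map Y" "drift_map (c *\<^sub>M X) = c *\<^sub>M drift_map X"
  by (simp_all add: drift_map_def mtx_vec pair_drift_linear sum.distrib cscale_sum)

lemma drift_map_ketbra: "drift_map (ketbra x y) = pair_drift x y"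
proof -
  have ps: "pair_drift x (\<Sum>b\<in>S. c b *s axis b 1) = (\<Sum>b\<in>S. cnj (c b) *\<^sub>M pair_drift x (axis b 1))" for S :: "'n set" and c
  proof (induction S rule: infinite_finite_induct)
    case (infinite S)
    then show ?case using pair_drift_linear(4)[of x 0 0] by (simp add: vec_scale_simps)
  next
    case empty
    show ?case using pair_drift_linear(4)[of x 0 0] by (simp add: vec_scale_simps)
  qed (simp add: pair_drift_linear)
  have "y = (\<Sum>b\<in>UNIV. y $ b *s axis b 1)"
    using orthonormal_basis_expand[OF orthonormal_basis_axis, of y] by (simp add: cinner_axis_left)
  then have "pair_drift x y = (\<Sum>b\<in>UNIV. cnj (y $ b) *\<^sub>M pair_drift x (axis b 1))" using ps[of "\<lambda>b. y $ b" UNIV] by simp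
  then show ?thesis
    by (simp add: drift_map_def ketbra_vec pair_drift_linear cinner_axis_right)
qed

lemma drift_map_zero: "drift_map 0 = 0"
  using drift_map_linear(2)[of 0 0] by simp

lemma drift_map_spectral: "drift_map (\<Sum>j\<in>S. \<mu> j *\<^sub>R ketbra (\<psi> j) (\<psi> j)) = (\<Sum>j\<in>S. \<mu> j *\<^sub>R pair_drift (\<psi> j) (\<psi> j))"
  for S :: "'n set"
  by (induction S rule: infinite_finite_induct)
    (simp_all add: drift_map_zero drift_map_linear drift_map_ketbra scaleR_cscale)

lemma diag_drift_unit:
  assumes \<psi>: "orthonormal_basis \<psi>"
  shows "diag_drift \<psi> ((\<lambda>_. 0)(i := 1)) = drift (ketbra (\<psi> i) (\<psi> i))" "diag_drift \<psi> (\<lambda>_. 0) = drift 0"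
proof -
  have "(\<Sum>j\<in>UNIV. ((\<lambda>_. 0)(i := 1)) j *\<^sub>R ketbra (\<psi> j) (\<psi> j)) = (\<Sum>j\<in>UNIV. if j = i then ketbra (\<psi> i) (\<psi> i) else 0)"
    by (intro sum.cong) auto
  then show "diag_drift \<psi> ((\<lambda>_. 0)(i := 1)) = drift (ketbra (\<psi> i) (\<psi> i))"
    by (intro diag_drift_eq[OF \<psi>, symmetric]) simp
  show "diag_drift \<psi> (\<lambda>_. 0) = drift 0" by (rule diag_drift_eq[OF \<psi>, symmetric]) simp
qed

text \<open>The two partial linearities meet here: the drift is additive over an eigenbasis of
  \<open>Q\<close>, and each rank one term is a value of a linear map that does not refer to the
  eigenbasis.\<close>

lemma drift_affine:
  assumes "Q \<in> symbols"
  shows "drift Q = drift 0 + drift_map Q"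
proof -
  obtain \<psi> \<mu> where s: "orthonormal_basis \<psi>" "\<And>j. 0 \<le> \<mu> j" "\<And>j. \<mu> j \<le> 1"
    "Q = (\<Sum>j\<in>UNIV. \<mu> j *\<^sub>R ketbra (\<psi> j) (\<psi> j))"
    using symbols_spectral[OF assms] by blast
  have "drift (ketbra (\<psi> j) (\<psi> j)) - drift 0 = pair_drift (\<psi> j) (\<psi> j)" for j
    using drift_projection[of "\<psi> j"] orthonormal_basisD[OF s(1), of j j] by simp
  then show ?thesis
    using diag_drift_sum[OF s(1-3)] diag_drift_eq[OF s(1,4)]
    by (simp add: diag_drift_unit[OF s(1)] s(4) drift_map_spectral)
qed

lemma drift_hermitian:
  assumes "Q \<in> symbols"
  shows "dagger (drift Q) = drift Q"
proof (rule derivative_Ici_unique)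
  show "((\<lambda>t. symbol_map t Q) has_vector_derivative drift Q) (at 0 within {0..})"
    by (rule symbol_map_derivative_zero[OF assms])
  show "((\<lambda>t. symbol_map t Q) has_vector_derivative dagger (drift Q)) (at 0 within {0..})"
    by (rule has_vector_derivative_transform[OF _ _ bounded_linear.has_vector_derivative[OF bounded_linear_dagger symbol_map_derivative_zero[OF assms]]])
      (simp_all add: symbols_hermitian P_gig assms)
qed

lemma pair_drift_hermitian_unit:
  assumes "cinner e e = 1"
  shows "dagger (pair_drift e e) = pair_drift e e"
proof -
  have "pair_drift e e = drift (ketbra e e) - drift 0" using drift_projection[OF assms] by simp
  then show ?thesis
    by (simp add: dagger_diff drift_hermitian projection_ketbra[OF assms] symbols_zero)
qed

lemma drift_map_hermitian: "dagger (drift_map X) = drift_map (dagger X)"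
proof -
  have h: "dagger (drift_map Y) = drift_map Y" if Y: "dagger Y = Y" for Y
  proof -
    obtain \<psi> \<mu> where s: "orthonormal_basis \<psi>" "Y = (\<Sum>j\<in>UNIV. \<mu> j *\<^sub>R ketbra (\<psi> j) (\<psi> j))"
      using spectral_theorem[OF Y] by metis
    have "dagger (pair_drift (\<psi> j) (\<psi> j)) = pair_drift (\<psi> j) (\<psi> j)" for j
      by (rule pair_drift_hermitian_unit) (simp add: orthonormal_basisD[OF s(1)])
    then show ?thesis unfolding s(2) drift_map_spectral by (simp add: dagger_simps)
  qed
  define A where "A = (1 / 2) *\<^sub>M (X + dagger X)"
  define B where "B = (- \<i> / 2) *\<^sub>M (X - dagger X)"
  have AB: "dagger A = A" "dagger B = B"
    by (auto simp: A_def B_def dagger_simps mtx_scale add.commute cscale_minus_left)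
  have X: "X = A + \<i> *\<^sub>M B" "dagger X = A + (- \<i>) *\<^sub>M B"
    by (rule mat_eqI, simp add: A_def B_def field_simps)+
  have "dagger (drift_map X) = drift_map A + (- \<i>) *\<^sub>M drift_map B"
    by (simp add: X(1) drift_map_linear dagger_simps h AB)
  also have "\<dots> = drift_map (dagger X)" unfolding X(2) by (simp only: drift_map_linear)
  finally show ?thesis .
qed

lemma drift_map_tangent:
  assumes \<eta>: "cinner \<psi> \<eta> = 0"
  shows "cinner \<eta> (drift_map (ketbra \<psi> \<psi>) *v \<eta>) = 0"
proof -
  have unit: "cinner \<eta> (pair_drift e e *v \<eta>) = 0" if e: "cinner e e = 1" "cinner e \<eta> = 0" for e
  proof -
    \<comment> \<open>An orthonormal basis containing \<open>e\<close> up to a phase is needed. An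
      eigenbasis of \<open>ketbra e e\<close> is one: some eigenvector overlaps \<open>e\<close>,
      and it must then be a multiple of \<open>e\<close>.\<close>
    obtain \<phi> \<mu> where s: "orthonormal_basis \<phi>" "\<And>j. ketbra e e *v \<phi> j = \<mu> j *\<^sub>R \<phi> j"
      using spectral_theorem[of "ketbra e e"] dagger_ketbra[of e e] by metis
    have "\<exists>j. cinner e (\<phi> j) \<noteq> 0"
    proof (rule ccontr)
      assume "\<not> ?thesis"
      then have "cinner (\<phi> j) e = 0" for j using cinner_eq_0_commute by blast
      then have "e = 0" using orthonormal_basis_expand[OF s(1), of e] by (simp add: vec_scale_simps)
      then show False using e by simp
    qed
    then obtain j where j: "cinner e (\<phi> j) \<noteq> 0" by blast
    have "cinner e (\<phi> j) *s e = \<mu> j *\<^sub>R \<phi> j" using s(2)[of j] by (simp add: ketbra_vec)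
    then have "cinner e (cinner e (\<phi> j) *s e) = cinner e (\<mu> j *\<^sub>R \<phi> j)" by simp
    then have "cinner e (\<phi> j) = of_real (\<mu> j) * cinner e (\<phi> j)" by (simp add: cinner_simps e)
    then have "\<mu> j = 1" using j by (metis mult_cancel_right1 of_real_eq_1_iff)
    then have \<phi>: "\<phi> j = cinner e (\<phi> j) *s e" using \<open>cinner e (\<phi> j) *s e = \<mu> j *\<^sub>R \<phi> j\<close> by simp
    have phase: "cinner e (\<phi> j) * cnj (cinner e (\<phi> j)) = 1"
    proof -
      have "cinner (\<phi> j) (\<phi> j) = 1" by (simp add: orthonormal_basisD[OF s(1)])
      then show ?thesis by (subst (asm) (1) \<phi>) (simp add: cinner_simps mult.commute)
    qed
    have k: "ketbra (\<phi> j) (\<phi> j) = ketbra e e"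
    proof -
      have "ketbra (\<phi> j) (\<phi> j) = (cinner e (\<phi> j) * cnj (cinner e (\<phi> j))) *\<^sub>M ketbra e e"
        by (subst (1 2) \<phi>) (simp only: ketbra_linear cscale_cscale mult.commute)
      then show ?thesis using phase by simp
    qed
    have "cinner (\<phi> j) \<eta> = 0" by (subst \<phi>) (simp add: cinner_simps e)
    from diag_drift_independent[OF s(1) _ _ this, of "\<lambda>_. 0"]
    have "cinner \<eta> (diag_drift \<phi> ((\<lambda>_. 0)(j := 1)) *v \<eta>) = cinner \<eta> (diag_drift \<phi> (\<lambda>_. 0) *v \<eta>)"
      by (simp add: fun_upd_idem)
    then show ?thesis
      unfolding diag_drift_unit[OF s(1)] k drift_projection[OF e(1)] by (simp add: mtx_vec cinner_simps)
  qed
  show ?thesis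
  proof (cases "\<psi> = 0")
    case True
    then show ?thesis by (simp add: ketbra_linear drift_map_zero)
  next
    case False
    define e where "e = (1 / norm \<psi>) *\<^sub>R \<psi>"
    have e: "cinner e e = 1" "cinner e \<eta> = 0"
      using False \<eta> by (simp_all add: e_def cinner_simps cinner_same power2_eq_square)
    have \<psi>: "\<psi> = of_real (norm \<psi>) *s e"
      using False by (simp add: e_def vec_eq_iff scaleR_conv_of_real[where 'a=complex])
    have "pair_drift \<psi> \<psi> = (of_real (norm \<psi>) * of_real (norm \<psi>)) *\<^sub>M pair_drift e e"
      by (subst (1 2) \<psi>) (simp add: pair_drift_linear)
    then show ?thesis using unit[OF e] by (simp add: drift_map_ketbra mtx_vec cinner_simps)
  qed
qed

text \<open>The affine drift makes every symbol path a solution of one inhomogeneous linear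
  equation, whose solution is \<open>symbol_flow\<close>; agreement on the densities extends to
  their span.\<close>

theorem gig_semigroup_generator:
  "\<exists>G A. (G, A) \<in> generating_pairs \<and> (\<forall>t\<ge>0. P t = restrict (ehk_flow G A t) (gauge_alg Z))"
proof -
  obtain G where G: "\<And>X. drift_map X = G ** X + X ** dagger G"
    using tangent_map_form[OF drift_map_linear drift_map_hermitian drift_map_tangent] by blast
  define A where "A = drift 0"
  have flow: "symbol_map t Q = symbol_flow G A t Q" if Q: "Q \<in> symbols" and t: "0 \<le> t" for t Q
  proof -
    have "((\<lambda>t. symbol_map t Q) has_vector_derivative A + (G ** symbol_map t Q + symbol_map t Q ** dagger G)) (at t within {0..})"
      if t: "0 \<le> t" for t
      using symbol_map_derivative[OF Q t] unfolding drift_affine[OF P_gig(1)[OF t Q]] G A_def .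
    from covariance_solution[of "\<lambda>t. symbol_map t Q", OF this t] show ?thesis
      by (simp add: symbol_map_zero Q)
  qed
  have "psd A"
  proof (rule derivative_psd)
    show "((\<lambda>t. symbol_map t 0) has_vector_derivative A) (at 0 within {0..})"
      unfolding A_def by (rule symbol_map_derivative_zero[OF symbols_zero])
    show "symbol_map 0 0 = 0" by (rule symbol_map_zero[OF symbols_zero])
    show "psd (symbol_map t 0)" if "0 \<le> t" for t using P_gig(1)[OF that symbols_zero] by (simp add: symbols_iff)
  qed
  moreover have "psd (- G - dagger G - A)"
  proof (rule derivative_psd)
    have "((\<lambda>t. mat 1 - symbol_map t (mat 1)) has_vector_derivative 0 - drift (mat 1)) (at 0 within {0..})"
      by (intro has_vector_derivative_diff has_vector_derivative_const symbol_map_derivative_zero[OF symbols_one])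
    then show "((\<lambda>t. mat 1 - symbol_map t (mat 1)) has_vector_derivative - G - dagger G - A) (at 0 within {0..})"
      by (simp add: drift_affine[OF symbols_one] G A_def algebra_simps)
    show "mat 1 - symbol_map 0 (mat 1) = 0" by (simp add: symbol_map_zero[OF symbols_one])
    show "psd (mat 1 - symbol_map t (mat 1))" if "0 \<le> t" for t using P_gig(1)[OF that symbols_one] by (simp add: symbols_iff)
  qed
  ultimately have GA: "(G, A) \<in> generating_pairs" by (simp add: generating_pairs_iff)
  have "P t = restrict (ehk_flow G A t) (gauge_alg Z)" if t: "0 \<le> t" for t
  proof (rule extensionalityI[OF P_extensional[OF t] restrict_extensional])
    note c = generating_compatible[OF GA t]
    fix X assume X: "X \<in> gauge_alg Z"
    have "X \<in> {X \<in> gauge_alg Z. P t X = ehk_flow G A t X}"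
    proof (rule gauge_alg_induct[OF _ _ _ X])
      show "gig_density Z Q \<in> {X \<in> gauge_alg Z. P t X = ehk_flow G A t X}" if Q: "Q \<in> symbols" for Q
        by (simp add: gig_density_in_gauge_alg Q P_gig(2)[OF t Q] flow[OF Q t] ehk_gig[OF c Q])
    qed (simp_all add: gauge_alg_closed P_add[OF t] P_scale[OF t] ehk_additive[OF c] ehk_scale[OF c])
    then show "P t X = restrict (ehk_flow G A t) (gauge_alg Z) X" using X by simp
  qed
  then show ?thesis using GA by blast
qed

end

end

section \<open>The correspondence\<close>

text \<open>A vector is coded by one set of naturals: the encoded pairs of a basis index and an
  element of the set that codes the coordinate.\<close>

lemma euclidean_lepoll_real: "(S :: 'a::euclidean_space set) \<lesssim> (UNIV :: real set)"
proof -
  obtain j :: "real \<Rightarrow> nat set" where j: "inj j"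
    using nat_sets_eqpoll_reals eqpoll_sym eqpoll_imp_lepoll unfolding lepoll_def by blast
  define \<phi> :: "'a \<Rightarrow> nat set" where
    "\<phi> x = {prod_encode (to_nat_on Basis b, m) | b m. b \<in> (Basis :: 'a set) \<and> m \<in> j (x \<bullet> b)}" for x
  have rec: "j (x \<bullet> b) = {m. prod_encode (to_nat_on Basis b, m) \<in> \<phi> x}" if "b \<in> Basis" for x b
  proof -
    have "inj_on (to_nat_on (Basis :: 'a set)) Basis" by (simp add: countable_finite inj_on_to_nat_on)
    then show ?thesis using that by (auto simp: \<phi>_def dest: inj_onD)
  qed
  have "inj \<phi>"
  proof (rule injI)
    fix x y assume "\<phi> x = \<phi> y"
    then have "j (x \<bullet> b) = j (y \<bullet> b)" if "b \<in> Basis" for b by (simp add: rec that)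
    from injD[OF j this] show "x = y" by (rule euclidean_eqI)
  qed
  then have "S \<lesssim> (UNIV :: nat set set)" unfolding lepoll_def by (meson inj_on_subset subset_UNIV)
  then show ?thesis using nat_sets_eqpoll_reals lepoll_trans1 lepoll_trans2 by blast
qed

context irreducible_car
begin

abbreviation "ehk_semigroup G A \<equiv> (\<lambda>t\<in>{0..}. restrict (ehk_flow G A t) (gauge_alg Z))"

lemma gig_semigroup_eq:
  assumes "P \<in> gig_semigroups Z"
  shows "\<exists>(G, A) \<in> generating_pairs. P = ehk_semigroup G A"
proof -
  obtain G A where GA: "(G, A) \<in> generating_pairs" "\<And>t. 0 \<le> t \<Longrightarrow> P t = restrict (ehk_flow G A t) (gauge_alg Z)"
    using gig_semigroup_generator[OF assms] by blast
  have "P \<in> extensional {0..}" using assms by (simp add: gig_semigroups_def)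
  then have "P = ehk_semigroup G A"
    by (rule extensionalityI[OF _ restrict_extensional]) (simp add: GA(2))
  then show ?thesis using GA(1) by blast
qed

lemma scalar_generating_pair: "0 \<le> r \<Longrightarrow> (- (r *\<^sub>R mat 1), 0) \<in> generating_pairs"
  using psd_scale[OF psd_one, of "2 * r"] by (simp add: generating_pairs_iff dagger_simps scaleR_2 flip: scaleR_left_distrib)

text \<open>
  A pair is determined by its semigroup only up to a phase in \<open>G\<close>, so the bijection is obtained by
  comparing cardinalities: both sets have the cardinality of the continuum.
\<close>

lemma gig_semigroups_eqpoll: "gig_semigroups Z \<approx> (generating_pairs :: ('n cop \<times> 'n cop) set)"
proof (rule lepoll_antisym)
  define c where "c P = (SOME GA. GA \<in> generating_pairs \<and> P = ehk_semigroup (fst GA) (snd GA))" for P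
  have c: "c P \<in> generating_pairs \<and> P = ehk_semigroup (fst (c P)) (snd (c P))" if "P \<in> gig_semigroups Z" for P
    unfolding c_def by (rule someI_ex) (use gig_semigroup_eq[OF that] in auto)
  have "inj_on c (gig_semigroups Z)"
  proof (rule inj_onI)
    fix P Q assume P: "P \<in> gig_semigroups Z" and Q: "Q \<in> gig_semigroups Z" and eq: "c P = c Q"
    have "P = ehk_semigroup (fst (c Q)) (snd (c Q))" by (rule conjunct2[OF c[OF P], unfolded eq])
    then show "P = Q" by (rule trans[OF _ conjunct2[OF c[OF Q], symmetric]])
  qed
  then show "gig_semigroups Z \<lesssim> (generating_pairs :: ('n cop \<times> 'n cop) set)"
    unfolding lepoll_def using c by blast
  \<comment> \<open>Real scalar generators of different strength never differ by an imaginary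
    scalar, so they provide a continuum of distinct semigroups.\<close>
  have pair: "(- (exp x *\<^sub>R mat 1), 0) \<in> (generating_pairs :: ('n cop \<times> 'n cop) set)" for x :: real
    by (rule scalar_generating_pair) simp
  define s where "s x = ehk_semigroup (- (exp x *\<^sub>R mat 1)) 0" for x :: real
  have s_apply: "s x t = restrict (ehk_flow (- (exp x *\<^sub>R mat 1)) 0 t) (gauge_alg Z)" if "0 \<le> t" for x t
    using that by (simp only: s_def restrict_apply atLeast_iff if_True)
  have "inj s"
  proof (rule injI)
    fix x y assume "s x = s y"
    have "restrict (ehk_flow (- (exp x *\<^sub>R mat 1)) 0 t) (gauge_alg Z) = restrict (ehk_flow (- (exp y *\<^sub>R mat 1)) 0 t) (gauge_alg Z)"
      if "0 \<le> t" for t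
      unfolding s_apply[OF that, symmetric] \<open>s x = s y\<close> ..
    then obtain \<theta> :: real where "- (exp y *\<^sub>R mat 1) = - (exp x *\<^sub>R mat 1) + (\<i> * \<theta>) *\<^sub>M (mat 1 :: 'n cop)"
      using ehk_flow_unique[OF pair pair, of x y] by blast
    then have "(- (exp y *\<^sub>R mat 1)) $ i $ i = (- (exp x *\<^sub>R mat 1) + (\<i> * \<theta>) *\<^sub>M (mat 1 :: 'n cop)) $ i $ i" for i by simp
    then have "exp y = exp x" by (simp add: mat_def complex_eq_iff)
    then show "x = y" by simp
  qed
  moreover have "range s \<subseteq> gig_semigroups Z" unfolding s_def using ehk_flow_semigroup[OF pair] by blast
  ultimately have "(UNIV :: real set) \<lesssim> gig_semigroups Z" unfolding lepoll_def by blast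
  then show "(generating_pairs :: ('n cop \<times> 'n cop) set) \<lesssim> gig_semigroups Z"
    using euclidean_lepoll_real lepoll_trans by blast
qed

end

text \<open>The explicit assignment of a semigroup to a pair forgets an imaginary scalar in
  \<open>G\<close>, and the last conjunct describes its fibres exactly; the bijection in the first
  conjunct comes from equality of cardinals instead.\<close>

theorem theorem4p3:
  fixes Z :: "complex ^ 'n::finite \<Rightarrow> complex ^ 'k::finite ^ 'k"
  assumes "CAR_field Z" and "acts_irreducibly Z"
  shows
    "(\<exists>F. bij_betw F (gig_semigroups Z) (generating_pairs :: ((complex ^ 'n ^ 'n) \<times> _) set)) \<and>
     (\<forall>P \<in> gig_semigroups Z. \<exists>(G, A) \<in> generating_pairs. \<forall>t\<ge>0.
        P t = restrict (ehk_map Z (op_exp (t *\<^sub>R G)) (covariance_integral G A t)) (gauge_alg Z)) \<and>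
     (\<forall>(G, A) \<in> generating_pairs.
        (\<forall>t\<ge>0. compatible (op_exp (t *\<^sub>R G)) (covariance_integral G A t) \<and>
           gig_quantum_operation Z (ehk_map Z (op_exp (t *\<^sub>R G)) (covariance_integral G A t))) \<and>
        (\<lambda>t\<in>{0..}. restrict (ehk_map Z (op_exp (t *\<^sub>R G)) (covariance_integral G A t)) (gauge_alg Z))
          \<in> gig_semigroups Z) \<and>
     (\<forall>(G, A) \<in> generating_pairs. \<forall>(G', A') \<in> generating_pairs.
        (\<forall>t\<ge>0. restrict (ehk_map Z (op_exp (t *\<^sub>R G)) (covariance_integral G A t)) (gauge_alg Z)
              = restrict (ehk_map Z (op_exp (t *\<^sub>R G')) (covariance_integral G' A' t)) (gauge_alg Z))
        \<longleftrightarrow> A = A' \<and> (\<exists>\<theta>::real. G' = G + (\<i> * \<theta>) *\<^sub>M mat 1))"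
proof -
  interpret irreducible_car Z
    by unfold_locales (rule assms)+
  show ?thesis
  proof (intro conjI)
    show "\<exists>F. bij_betw F (gig_semigroups Z) (generating_pairs :: ('n cop \<times> 'n cop) set)"
      using gig_semigroups_eqpoll by (simp add: eqpoll_def)
    show "\<forall>P \<in> gig_semigroups Z. \<exists>(G, A) \<in> generating_pairs. \<forall>t\<ge>0. P t = restrict (ehk_flow G A t) (gauge_alg Z)"
      using gig_semigroup_generator by fast
    show "\<forall>(G, A) \<in> generating_pairs.
        (\<forall>t\<ge>0. compatible (op_exp (t *\<^sub>R G)) (covariance_integral G A t) \<and> gig_quantum_operation Z (ehk_flow G A t)) \<and>
        ehk_semigroup G A \<in> gig_semigroups Z"
      using generating_compatible ehk_gig_quantum_operation ehk_flow_semigroup by blast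
    show "\<forall>(G, A) \<in> generating_pairs. \<forall>(G', A') \<in> generating_pairs.
        (\<forall>t\<ge>0. restrict (ehk_flow G A t) (gauge_alg Z) = restrict (ehk_flow G' A' t) (gauge_alg Z))
        \<longleftrightarrow> A = A' \<and> (\<exists>\<theta>::real. G' = G + (\<i> * \<theta>) *\<^sub>M mat 1)"
      using ehk_flow_unique by blast
  qed
qed

end
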